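(* Let $\mathcal M$ be a closed hyperbolic 3-manifold that fibers over a circle with fiber a closed orientable surface $S$. Let $\Gamma<\mathrm{PSL}_2(\mathbb R)$ be a torsion-free uniform lattice with a homeomorphism $\phi:\Gamma\backslash\mathbb H^2\to S$, let $\rho:\Gamma\to\mathrm{PSL}_2(\mathbb C)$ be the holonomy representation induced by $\phi:\Gamma\backslash\mathbb H^2\to S\subset\mathcal M$, and let $f:\mathbb S^1=\partial\mathbb H^2\to\partial\mathbb H^3$ be the associated Cannon-Thurston map. Let $G=\mathrm{PSL}_2(\mathbb R)\times\mathrm{PSL}_2(\mathbb C)$. Then for Lebesgue almost all $\xi\in\mathbb S^1$, the orbit $[g]NM$ with $gP=(\xi,f(\xi))$ is dense in the space $$\{[h]\in\Gamma_\rho\backslash G: hP\in\Lambda_\rho\}.$$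
   Context: The Cannon-Thurston map $f$ is the $\rho$-equivariant continuous map $\partial\mathbb H^2\to\partial\mathbb H^3$ that continuously extends a lift $F:\mathbb H^2\to\mathbb H^3$ of $\phi$; its existence (Cannon-Thurston) is known, and it is surjective but not injective. $\Gamma_\rho=\{(\gamma,\rho(\gamma)):\gamma\in\Gamma\}<G$, a discrete subgroup; $\Lambda_\rho=\{(\xi,f(\xi)):\xi\in\mathbb S^1\}\subset\partial\mathbb H^2\times\partial\mathbb H^3$. $P=P_1\times P_2$ is the product of the upper triangular subgroups of $\mathrm{PSL}_2(\mathbb R)$ and $\mathrm{PSL}_2(\mathbb C)$, so that $G/P=\partial\mathbb H^2\times\partial\mathbb H^3$. $N<G$ is the product of the strictly upper triangular (unipotent) subgroups, and $M=\{e\}\times\{\mathrm{diag}(e^{i\theta},e^{-i\theta}):\theta\in\mathbb R\}$. $[g]=\Gamma_\rho g\in\Gamma_\rho\backslash G$. *)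

theory Defs
  imports "HOL-Analysis.Analysis" "HOL-Algebra.Coset" "HOL-Algebra.Bij"
begin

section \<open>Quotient topologies\<close>

text \<open>The quotient topology on a partition \<open>\<C>\<close> of (the underlying set of) \<open>X\<close>.\<close>

definition quotient_topology :: "'a topology \<Rightarrow> 'a set set \<Rightarrow> 'a set topology" where
  "quotient_topology X \<C> = topology (\<lambda>\<U>. \<U> \<subseteq> \<C> \<and> openin X (\<Union>\<U>))"

lemma openin_quotient_topology:
  assumes "disjoint \<C>"
  shows "openin (quotient_topology X \<C>) \<U> \<longleftrightarrow> \<U> \<subseteq> \<C> \<and> openin X (\<Union>\<U>)"
proof -
  have eq: "\<Union>(\<U> \<inter> \<V>) = \<Union>\<U> \<inter> \<Union>\<V>" if "\<U> \<subseteq> \<C>" "\<V> \<subseteq> \<C>" for \<U> \<V>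
  proof
    show "\<Union>\<U> \<inter> \<Union>\<V> \<subseteq> \<Union>(\<U> \<inter> \<V>)"
    proof
      fix x assume "x \<in> \<Union>\<U> \<inter> \<Union>\<V>"
      then obtain U V where "U \<in> \<U>" "V \<in> \<V>" "x \<in> U" "x \<in> V" by auto
      moreover from this have "U = V"
        using assms that by (auto simp: disjoint_def)
      ultimately show "x \<in> \<Union>(\<U> \<inter> \<V>)" by auto
    qed
  qed auto
  have "istopology (\<lambda>\<U>. \<U> \<subseteq> \<C> \<and> openin X (\<Union>\<U>))"
    unfolding istopology_def
  proof (intro conjI allI impI)
    fix \<U> \<V> assume "\<U> \<subseteq> \<C> \<and> openin X (\<Union>\<U>)" "\<V> \<subseteq> \<C> \<and> openin X (\<Union>\<V>)"
    then show "\<U> \<inter> \<V> \<subseteq> \<C>" "openin X (\<Union>(\<U> \<inter> \<V>))" using eq by auto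
  next
    fix \<K> assume *: "\<forall>\<U>\<in>\<K>. \<U> \<subseteq> \<C> \<and> openin X (\<Union>\<U>)"
    have "openin X (\<Union>(Union ` \<K>))" using * by (intro openin_Union) auto
    moreover have "\<Union>(\<Union>\<K>) = \<Union>(Union ` \<K>)" by auto
    ultimately show "openin X (\<Union>(\<Union>\<K>))" by simp
    show "\<Union>\<K> \<subseteq> \<C>" using * by auto
  qed
  then show ?thesis by (simp add: quotient_topology_def)
qed

text \<open>Orbits and orbit space of a set \<open>T\<close> of transformations (a group, in all uses).\<close>

definition orbit_of :: "('a \<Rightarrow> 'a) set \<Rightarrow> 'a \<Rightarrow> 'a set" where
  "orbit_of T x = (\<lambda>t. t x) ` T"

definition orbit_space :: "'a topology \<Rightarrow> ('a \<Rightarrow> 'a) set \<Rightarrow> 'a set topology" where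
  "orbit_space X T = quotient_topology X (orbit_of T ` topspace X)"


section \<open>The groups \<open>PSL\<^sub>2(\<real>)\<close> and \<open>PSL\<^sub>2(\<complex>)\<close>\<close>

definition mat2 :: "'a \<Rightarrow> 'a \<Rightarrow> 'a \<Rightarrow> 'a \<Rightarrow> 'a::zero^2^2" where
  "mat2 a b c d = vector [vector [a, b], vector [c, d]]"

definition SL2 :: "('a::field^2^2) monoid" where
  "SL2 = \<lparr>carrier = {A. det A = 1}, mult = (**), one = mat 1\<rparr>"

definition pm1 :: "('a::field^2^2) set" where
  "pm1 = {mat 1, - mat 1}"

definition PSL2 :: "('a::field^2^2) set monoid" where
  "PSL2 = SL2 Mod pm1"

definition psl :: "'a::field^2^2 \<Rightarrow> ('a^2^2) set" where
  "psl A = pm1 #>\<^bsub>SL2\<^esub> A"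

lemma group_SL2: "group (SL2 :: ('a::field^2^2) monoid)"
proof (rule groupI)
  fix A :: "'a^2^2" assume "A \<in> carrier SL2"
  then have A: "det A = 1" by (simp add: SL2_def)
  then obtain B where "A ** B = mat 1" "B ** A = mat 1"
    using invertible_det_nz[of A] by (auto simp: invertible_def)
  moreover from this A have "det B = 1" by (metis det_I det_mul mult_1)
  ultimately show "\<exists>B\<in>carrier SL2. B \<otimes>\<^bsub>SL2\<^esub> A = \<one>\<^bsub>SL2\<^esub>"
    by (auto simp: SL2_def)
qed (auto simp: SL2_def det_mul matrix_mul_assoc)

lemma det_uminus_2: "det (- A) = det (A :: 'a::field^2^2)"
  by (simp add: det_2)

lemma matrix_mul_uminus_one:
  fixes A :: "'a::field^2^2"
  shows "(- mat 1) ** A = - A" "A ** (- mat 1) = - A"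
  by (simp_all add: vec_eq_iff matrix_matrix_mult_def mat_def sum_2 forall_2)

lemma psl_eq: "psl A = {A, - A}"
  by (auto simp: psl_def r_coset_def pm1_def SL2_def matrix_mul_uminus_one)

lemma normal_pm1: "pm1 \<lhd> (SL2 :: ('a::field^2^2) monoid)"
proof -
  interpret group "SL2 :: ('a^2^2) monoid" by (rule group_SL2)
  have *: "(- mat 1 :: 'a^2^2) ** (- mat 1) = mat 1"
    by (simp add: matrix_mul_uminus_one)
  have "subgroup pm1 (SL2 :: ('a^2^2) monoid)"
  proof (rule subgroupI)
    fix A :: "'a^2^2" assume A: "A \<in> pm1"
    have "inv\<^bsub>SL2\<^esub> A = A"
      by (rule inv_equality)
        (use A * in \<open>auto simp: pm1_def SL2_def det_uminus_2\<close>)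
    then show "inv\<^bsub>SL2\<^esub> A \<in> pm1" using A by simp
  qed (auto simp: pm1_def SL2_def det_uminus_2 *)
  then show ?thesis
    by (rule normalI) (auto simp: r_coset_def l_coset_def pm1_def SL2_def matrix_mul_uminus_one)
qed

lemma group_PSL2: "group (PSL2 :: ('a::field^2^2) set monoid)"
  unfolding PSL2_def by (rule normal.factorgroup_is_group[OF normal_pm1])

definition PSL2_top :: "('a::{field,topological_space}^2^2) set topology" where
  "PSL2_top = quotient_topology (top_of_set (carrier SL2)) (carrier PSL2)"

text \<open>Every action \<open>\<alpha>\<close> of \<open>SL2\<close> below is trivial on \<open>- mat 1\<close>; this is the induced action
  of \<open>PSL2\<close>, whose elements are the pairs \<open>{A, - A}\<close>.\<close>

definition psl_act :: "('a^2^2 \<Rightarrow> 'x \<Rightarrow> 'x) \<Rightarrow> ('a^2^2) set \<Rightarrow> 'x \<Rightarrow> 'x" where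
  "psl_act \<alpha> g x = the_elem ((\<lambda>A. \<alpha> A x) ` g)"


section \<open>Hyperbolic plane, hyperbolic space and their boundaries\<close>

text \<open>Upper half-space models: \<open>(z, t)\<close> with \<open>t > 0\<close> is the point of height \<open>t\<close> above \<open>z\<close>.\<close>

definition H2 :: "complex set" where
  "H2 = {z. Im z > 0}"

definition H3 :: "(complex \<times> real) set" where
  "H3 = {(z, t). t > 0}"

definition h3_dist :: "complex \<times> real \<Rightarrow> complex \<times> real \<Rightarrow> real" where
  "h3_dist = (\<lambda>(z, t) (w, s). arcosh (1 + ((cmod (z - w))\<^sup>2 + (t - s)\<^sup>2) / (2 * t * s)))"

definition mobius_H2 :: "real^2^2 \<Rightarrow> complex \<Rightarrow> complex" where
  "mobius_H2 A z =
     (of_real (A$1$1) * z + of_real (A$1$2)) / (of_real (A$2$1) * z + of_real (A$2$2))"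

text \<open>The Poincare extension of a Moebius transformation of the Riemann sphere.\<close>

definition mobius_H3 :: "complex^2^2 \<Rightarrow> complex \<times> real \<Rightarrow> complex \<times> real" where
  "mobius_H3 A = (\<lambda>(z, t).
     let a = A$1$1; b = A$1$2; c = A$2$1; d = A$2$2;
         q = (cmod (c * z + d))\<^sup>2 + (cmod c)\<^sup>2 * t\<^sup>2
     in (((a * z + b) * cnj (c * z + d) + a * cnj c * of_real (t\<^sup>2)) / of_real q, t / q))"

abbreviation act_H2 :: "(real^2^2) set \<Rightarrow> complex \<Rightarrow> complex" where
  "act_H2 \<equiv> psl_act mobius_H2"

abbreviation act_H3 :: "(complex^2^2) set \<Rightarrow> complex \<times> real \<Rightarrow> complex \<times> real" where
  "act_H3 \<equiv> psl_act mobius_H3"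

text \<open>The boundaries are \<open>\<partial>\<H>\<^sup>2 = \<real> \<union> {\<infinity>}\<close> and \<open>\<partial>\<H>\<^sup>3 = \<complex> \<union> {\<infinity>}\<close>, as one-point compactifications
  with \<open>None\<close> as \<open>\<infinity>\<close>.\<close>

definition bdry_top :: "'a::topological_space option topology" where
  "bdry_top = Alexandroff_compactification euclidean"

definition mobius_bdry :: "'a::field^2^2 \<Rightarrow> 'a option \<Rightarrow> 'a option" where
  "mobius_bdry A \<xi> =
     (case \<xi> of
        None \<Rightarrow> if A$2$1 = 0 then None else Some (A$1$1 / A$2$1)
      | Some x \<Rightarrow> if A$2$1 * x + A$2$2 = 0 then None
                  else Some ((A$1$1 * x + A$1$2) / (A$2$1 * x + A$2$2)))"

abbreviation act_bdry :: "('a::field^2^2) set \<Rightarrow> 'a option \<Rightarrow> 'a option" where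
  "act_bdry \<equiv> psl_act mobius_bdry"

text \<open>The closed balls \<open>\<H>\<^sup>2 \<union> \<partial>\<H>\<^sup>2\<close> and \<open>\<H>\<^sup>3 \<union> \<partial>\<H>\<^sup>3\<close>: closed half-space together with \<open>\<infinity>\<close>.\<close>

definition H2_bar :: "complex option topology" where
  "H2_bar = Alexandroff_compactification (top_of_set {z. Im z \<ge> 0})"

definition H3_bar :: "(complex \<times> real) option topology" where
  "H3_bar = Alexandroff_compactification (top_of_set {(z, t). t \<ge> 0})"

text \<open>The Cayley transform \<open>w \<mapsto> \<i>(1 + w) / (1 - w)\<close> from the disc to the half-plane,
  restricted to the unit circle: this is the identification of \<open>\<S>\<^sup>1\<close> with \<open>\<partial>\<H>\<^sup>2\<close>.\<close>

definition circle_to_bdry :: "complex \<Rightarrow> real option" where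
  "circle_to_bdry w = (if w = 1 then None else Some (Re (\<i> * (1 + w) / (1 - w))))"


section \<open>Lattices, closed hyperbolic 3-manifolds and fibrations\<close>

text \<open>A discrete cocompact subgroup automatically has finite covolume.\<close>

definition torsion_free_uniform_lattice :: "(real^2^2) set set \<Rightarrow> bool" where
  "torsion_free_uniform_lattice \<Gamma> \<longleftrightarrow>
     subgroup \<Gamma> PSL2 \<and>
     subtopology PSL2_top \<Gamma> = discrete_topology \<Gamma> \<and>
     compact_space (quotient_topology PSL2_top (rcosets\<^bsub>PSL2\<^esub> \<Gamma>)) \<and>
     (\<forall>\<gamma>\<in>\<Gamma>. \<forall>n::nat. n > 0 \<and> \<gamma> [^]\<^bsub>PSL2\<^esub> n = \<one>\<^bsub>PSL2\<^esub> \<longrightarrow> \<gamma> = \<one>\<^bsub>PSL2\<^esub>)"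

definition H2_quotient :: "(real^2^2) set set \<Rightarrow> complex set topology" where
  "H2_quotient \<Gamma> = orbit_space (top_of_set H2) (act_H2 ` \<Gamma>)"

definition H3_quotient :: "(complex \<times> real \<Rightarrow> complex \<times> real) set \<Rightarrow> (complex \<times> real) set topology" where
  "H3_quotient \<Delta> = orbit_space (top_of_set H3) \<Delta>"

text \<open>A closed hyperbolic 3-manifold is \<open>\<Delta>\<setminus>\<H>\<^sup>3\<close>, where \<open>\<Delta>\<close> is a group of isometries of \<open>\<H>\<^sup>3\<close>
  (possibly reversing orientation) acting freely, properly discontinuously and cocompactly.\<close>

definition closed_hyperbolic_3_manifold :: "(complex \<times> real \<Rightarrow> complex \<times> real) set \<Rightarrow> bool" where
  "closed_hyperbolic_3_manifold \<Delta> \<longleftrightarrow>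
     subgroup \<Delta> (BijGroup H3) \<and>
     (\<forall>\<delta>\<in>\<Delta>. \<forall>x\<in>H3. \<forall>y\<in>H3. h3_dist (\<delta> x) (\<delta> y) = h3_dist x y) \<and>
     (\<forall>\<delta>\<in>\<Delta>. \<forall>x\<in>H3. \<delta> x = x \<longrightarrow> \<delta> = \<one>\<^bsub>BijGroup H3\<^esub>) \<and>
     (\<forall>K. compact K \<and> K \<subseteq> H3 \<longrightarrow> finite {\<delta>\<in>\<Delta>. \<delta> ` K \<inter> K \<noteq> {}}) \<and>
     compact_space (H3_quotient \<Delta>)"

definition fibre_bundle ::
    "'e topology \<Rightarrow> 'b topology \<Rightarrow> ('e \<Rightarrow> 'b) \<Rightarrow> 'f topology \<Rightarrow> bool" where
  "fibre_bundle E B p Y \<longleftrightarrow>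
     continuous_map E B p \<and>
     (\<forall>b\<in>topspace B. \<exists>U h. openin B U \<and> b \<in> U \<and>
        homeomorphic_map (subtopology E {x\<in>topspace E. p x \<in> U})
                         (prod_topology (subtopology B U) Y) h \<and>
        (\<forall>x\<in>topspace E. p x \<in> U \<longrightarrow> fst (h x) = p x))"

text \<open>The manifold \<open>\<Delta>\<setminus>\<H>\<^sup>3\<close> fibers over the circle by \<open>p\<close>, and \<open>S\<close> is one of the fibers.\<close>

definition fibers_over_circle ::
    "(complex \<times> real \<Rightarrow> complex \<times> real) set \<Rightarrow> ((complex \<times> real) set \<Rightarrow> complex)
     \<Rightarrow> (complex \<times> real) set set \<Rightarrow> bool" where
  "fibers_over_circle \<Delta> p S \<longleftrightarrow>
     (\<exists>b\<in>sphere 0 1. S = {x\<in>topspace (H3_quotient \<Delta>). p x = b}) \<and>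
     fibre_bundle (H3_quotient \<Delta>) (top_of_set (sphere 0 1)) p (subtopology (H3_quotient \<Delta>) S)"


section \<open>Holonomy and the Cannon-Thurston map\<close>

definition is_lift ::
    "(real^2^2) set set \<Rightarrow> (complex \<times> real \<Rightarrow> complex \<times> real) set
     \<Rightarrow> (complex set \<Rightarrow> (complex \<times> real) set) \<Rightarrow> (complex \<Rightarrow> complex \<times> real) \<Rightarrow> bool" where
  "is_lift \<Gamma> \<Delta> \<phi> F \<longleftrightarrow>
     continuous_map (top_of_set H2) (top_of_set H3) F \<and>
     (\<forall>x\<in>H2. orbit_of \<Delta> (F x) = \<phi> (orbit_of (act_H2 ` \<Gamma>) x))"

text \<open>With \<open>\<Gamma>\<close> and \<open>\<Delta>\<close> viewed as the deck groups of \<open>\<H>\<^sup>2 \<rightarrow> \<Gamma>\<setminus>\<H>\<^sup>2\<close> and \<open>\<H>\<^sup>3 \<rightarrow> \<Delta>\<setminus>\<H>\<^sup>3\<close>, the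
  homomorphism \<open>\<rho>\<close> on fundamental groups induced by \<open>\<phi>\<close> sends \<open>\<gamma>\<close> to the unique element of \<open>\<Delta>\<close>
  that intertwines the lift \<open>F\<close>. The choice of \<open>F\<close> corresponds to the choice of base points;
  another choice conjugates \<open>\<rho>\<close> by an element of \<open>\<Delta>\<close>.\<close>

definition is_holonomy ::
    "(real^2^2) set set \<Rightarrow> (complex \<times> real \<Rightarrow> complex \<times> real) set
     \<Rightarrow> (complex \<Rightarrow> complex \<times> real) \<Rightarrow> ((real^2^2) set \<Rightarrow> (complex^2^2) set) \<Rightarrow> bool" where
  "is_holonomy \<Gamma> \<Delta> F \<rho> \<longleftrightarrow>
     \<rho> \<in> hom (PSL2\<lparr>carrier := \<Gamma>\<rparr>) PSL2 \<and>
     (\<forall>\<gamma>\<in>\<Gamma>. restrict (act_H3 (\<rho> \<gamma>)) H3 \<in> \<Delta> \<and>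
             (\<forall>x\<in>H2. F (act_H2 \<gamma> x) = act_H3 (\<rho> \<gamma>) (F x)))"

definition extend_by ::
    "(complex \<Rightarrow> complex \<times> real) \<Rightarrow> (real option \<Rightarrow> complex option)
     \<Rightarrow> complex option \<Rightarrow> (complex \<times> real) option" where
  "extend_by F f x =
     (let f' = (\<lambda>\<xi>. map_option (\<lambda>w. (w, 0)) (f \<xi>)) in
      case x of
        None \<Rightarrow> f' None
      | Some z \<Rightarrow> if Im z > 0 then Some (F z) else f' (Some (Re z)))"

definition is_Cannon_Thurston_map ::
    "(real^2^2) set set \<Rightarrow> ((real^2^2) set \<Rightarrow> (complex^2^2) set)
     \<Rightarrow> (complex \<Rightarrow> complex \<times> real) \<Rightarrow> (real option \<Rightarrow> complex option) \<Rightarrow> bool" where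
  "is_Cannon_Thurston_map \<Gamma> \<rho> F f \<longleftrightarrow>
     continuous_map bdry_top bdry_top f \<and>
     (\<forall>\<gamma>\<in>\<Gamma>. \<forall>\<xi>. f (act_bdry \<gamma> \<xi>) = act_bdry (\<rho> \<gamma>) (f \<xi>)) \<and>
     continuous_map H2_bar H3_bar (extend_by F f)"


section \<open>The homogeneous space \<open>\<Gamma>\<^sub>\<rho>\<setminus>G\<close>\<close>

type_synonym G = "(real^2^2) set \<times> (complex^2^2) set"

definition GG :: "G monoid" where
  "GG = PSL2 \<times>\<times> PSL2"

definition GG_top :: "G topology" where
  "GG_top = prod_topology PSL2_top PSL2_top"

definition upper_PSL2 :: "('a::field^2^2) set set" where
  "upper_PSL2 = {psl (mat2 a b 0 d) | a b d. a * d = 1}"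

definition unipotent_PSL2 :: "('a::field^2^2) set set" where
  "unipotent_PSL2 = {psl (mat2 1 b 0 1) | b. True}"

definition PP :: "G set" where
  "PP = upper_PSL2 \<times> upper_PSL2"

definition NN :: "G set" where
  "NN = unipotent_PSL2 \<times> unipotent_PSL2"

definition MM :: "G set" where
  "MM = {\<one>\<^bsub>PSL2\<^esub>} \<times> {psl (mat2 (cis \<theta>) 0 0 (cis (- \<theta>))) | \<theta>. True}"

text \<open>\<open>PP\<close> is the stabiliser of \<open>(\<infinity>, \<infinity>)\<close>, and \<open>G/P\<close> is identified with \<open>\<partial>\<H>\<^sup>2 \<times> \<partial>\<H>\<^sup>3\<close> by sending
  \<open>gP\<close> to \<open>g (\<infinity>, \<infinity>)\<close>, which is the same point for all elements of the coset.\<close>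

definition GP_point :: "G set \<Rightarrow> real option \<times> complex option" where
  "GP_point C = the_elem ((\<lambda>(g1, g2). (act_bdry g1 None, act_bdry g2 None)) ` C)"

definition Gamma_graph :: "(real^2^2) set set \<Rightarrow> ((real^2^2) set \<Rightarrow> (complex^2^2) set) \<Rightarrow> G set" where
  "Gamma_graph \<Gamma> \<rho> = {(\<gamma>, \<rho> \<gamma>) | \<gamma>. \<gamma> \<in> \<Gamma>}"

definition Lambda_graph ::
    "(real option \<Rightarrow> complex option) \<Rightarrow> (real option \<times> complex option) set" where
  "Lambda_graph f = {(\<xi>, f \<xi>) | \<xi>. True}"

definition GG_quotient ::
    "(real^2^2) set set \<Rightarrow> ((real^2^2) set \<Rightarrow> (complex^2^2) set) \<Rightarrow> G set topology" where
  "GG_quotient \<Gamma> \<rho> = quotient_topology GG_top (rcosets\<^bsub>GG\<^esub> (Gamma_graph \<Gamma> \<rho>))"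

definition E_space ::
    "(real^2^2) set set \<Rightarrow> ((real^2^2) set \<Rightarrow> (complex^2^2) set)
     \<Rightarrow> (real option \<Rightarrow> complex option) \<Rightarrow> G set set" where
  "E_space \<Gamma> \<rho> f =
     {Gamma_graph \<Gamma> \<rho> #>\<^bsub>GG\<^esub> h | h. h \<in> carrier GG \<and> GP_point (h <#\<^bsub>GG\<^esub> PP) \<in> Lambda_graph f}"

definition NM_orbit ::
    "(real^2^2) set set \<Rightarrow> ((real^2^2) set \<Rightarrow> (complex^2^2) set) \<Rightarrow> G \<Rightarrow> G set set" where
  "NM_orbit \<Gamma> \<rho> g =
     {Gamma_graph \<Gamma> \<rho> #>\<^bsub>GG\<^esub> (g \<otimes>\<^bsub>GG\<^esub> n \<otimes>\<^bsub>GG\<^esub> m) | n m. n \<in> NN \<and> m \<in> MM}"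

definition dense_in :: "'a topology \<Rightarrow> 'a set \<Rightarrow> bool" where
  "dense_in X D \<longleftrightarrow> D \<subseteq> topspace X \<and> X closure_of D = topspace X"


section \<open>The actions are well defined, and \<open>G/P = \<partial>\<H>\<^sup>2 \<times> \<partial>\<H>\<^sup>3\<close>\<close>

lemma psl_act_psl:
  assumes "\<alpha> (- A) x = \<alpha> A x"
  shows "psl_act \<alpha> (psl A) x = \<alpha> A x"
  using assms by (simp add: psl_act_def psl_eq)

lemma mobius_uminus:
  "mobius_H2 (- A) z = mobius_H2 A z"
  "mobius_H3 (- B) w = mobius_H3 B w"
  "mobius_bdry (- C) \<xi> = mobius_bdry C \<xi>"
proof -
  have neg: "- (c * x) - d = - (c * x + d)" for c d x :: "'b::field" by simp
  show "mobius_H2 (- A) z = mobius_H2 A z"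
    by (simp add: mobius_H2_def neg del: minus_add_distrib)
  show "mobius_H3 (- B) w = mobius_H3 B w"
    by (cases w) (simp add: mobius_H3_def Let_def neg del: minus_add_distrib)
  have "- x = 0 \<longleftrightarrow> x = 0" for x :: "'b::field" by simp
  then show "mobius_bdry (- C) \<xi> = mobius_bdry C \<xi>"
    by (auto simp: mobius_bdry_def neg simp del: minus_add_distrib split: option.splits)
qed

lemma carrier_PSL2: "carrier PSL2 = {psl A | A. det A = 1}"
  by (auto simp: PSL2_def FactGroup_def RCOSETS_def psl_def SL2_def)

lemma mult_psl: "det A = 1 \<Longrightarrow> det B = 1 \<Longrightarrow> psl A \<otimes>\<^bsub>PSL2\<^esub> psl B = psl (A ** B)"
  using normal.rcos_sum[OF normal_pm1, of A B]
  by (simp add: PSL2_def FactGroup_def psl_def SL2_def)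

lemma mat2_nth [simp]:
  "mat2 a b c d $ 1 $ 1 = a" "mat2 a b c d $ 1 $ 2 = b"
  "mat2 a b c d $ 2 $ 1 = c" "mat2 a b c d $ 2 $ 2 = d"
  by (simp_all add: mat2_def)

lemma act_bdry_upper:
  assumes "g \<in> carrier PSL2" "h \<in> upper_PSL2"
  shows "act_bdry (g \<otimes>\<^bsub>PSL2\<^esub> h) None = act_bdry g None"
proof -
  obtain A where A: "g = psl A" "det A = 1" using assms(1) by (auto simp: carrier_PSL2)
  obtain a b d where h: "h = psl (mat2 a b 0 d)" "a * d = 1"
    using assms(2) by (auto simp: upper_PSL2_def)
  have "mobius_bdry (A ** mat2 a b 0 d) None = mobius_bdry A None"
    using h(2) by (auto simp: mobius_bdry_def matrix_matrix_mult_def sum_2)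
  then show ?thesis
    using A h by (simp add: mult_psl det_2 psl_act_psl mobius_uminus)
qed

lemma GP_point_coset:
  assumes "g1 \<in> carrier PSL2" "g2 \<in> carrier PSL2"
  shows "GP_point ((g1, g2) <#\<^bsub>GG\<^esub> PP) = (act_bdry g1 None, act_bdry g2 None)"
proof -
  have "upper_PSL2 \<noteq> ({} :: (real^2^2) set set)" "upper_PSL2 \<noteq> ({} :: (complex^2^2) set set)"
    by (auto simp: upper_PSL2_def intro: exI[of _ 1])
  then have "(\<lambda>(g1, g2). (act_bdry g1 None, act_bdry g2 None)) ` ((g1, g2) <#\<^bsub>GG\<^esub> PP)
       = {(act_bdry g1 None, act_bdry g2 None)}"
    using assms by (force simp: l_coset_def GG_def PP_def act_bdry_upper image_UN)
  then show ?thesis by (simp add: GP_point_def)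
qed

lemma upper_PSL2_stabiliser:
  "(upper_PSL2 :: ('a::field^2^2) set set) = {g \<in> carrier PSL2. act_bdry g None = None}"
proof (intro Set.set_eqI iffI)
  fix g :: "('a^2^2) set" assume "g \<in> upper_PSL2"
  then show "g \<in> {g \<in> carrier PSL2. act_bdry g None = None}"
    by (force simp: upper_PSL2_def carrier_PSL2 det_2 psl_act_psl mobius_uminus mobius_bdry_def)
next
  fix g :: "('a^2^2) set" assume "g \<in> {g \<in> carrier PSL2. act_bdry g None = None}"
  then obtain A where A: "g = psl A" "det A = 1" "act_bdry (psl A) None = None"
    by (auto simp: carrier_PSL2)
  then have "A$2$1 = 0"
    by (simp add: psl_act_psl mobius_uminus mobius_bdry_def split: if_splits)
  moreover from this have "A = mat2 (A$1$1) (A$1$2) 0 (A$2$2)"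
    by (simp add: vec_eq_iff forall_2)
  ultimately show "g \<in> upper_PSL2"
    using A unfolding upper_PSL2_def mem_Collect_eq
    by (intro exI[of _ "A$1$1"] exI[of _ "A$1$2"] exI[of _ "A$2$2"]) (simp add: det_2)
qed

end

theory Submission
  imports Defs
begin

text \<open>Comparing first columns of matrices, \<open>[g]NM\<close> accumulates at \<open>[h]\<close> as soon as there are
  \<open>\<gamma>\<^sub>n\<close> in \<open>\<Gamma>\<close> such that \<open>\<gamma>\<^sub>n \<xi>\<close> tends to the base point of \<open>h\<close> and the conformal factors \<open>\<sigma>\<^sub>1\<close>
  of \<open>\<gamma>\<^sub>n\<close> at \<open>\<xi>\<close> and \<open>\<sigma>\<^sub>2\<close> of \<open>\<rho> \<gamma>\<^sub>n\<close> at \<open>f \<xi>\<close> tend to prescribed positive numbers; \<open>N\<close> and \<open>M\<close> absorb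
  everything else. So it suffices that, for almost all \<open>\<xi>\<close>, every pair of positive numbers is such a limit.

  For generic \<open>\<xi>\<close> and all real \<open>\<eta> \<noteq> \<zeta>\<close> there are \<open>g\<^sub>n\<close> in \<open>\<Gamma>\<close> with \<open>g\<^sub>n \<xi> \<rightarrow> \<eta>\<close> and \<open>g\<^sub>n \<i> \<rightarrow> \<zeta>\<close>.
  The conjugates of a fixed \<open>h\<close> in \<open>\<Gamma>\<close> by \<open>g\<^sub>n\<close> move \<open>\<xi>\<close> back to itself, with limiting conformal factors
  \<open>\<sigma>\<^sub>i(h, \<eta>) Q\<^sub>i(h \<eta>, \<zeta>) / Q\<^sub>i(\<eta>, \<zeta>)\<close>, where \<open>Q\<^sub>1\<close> and \<open>Q\<^sub>2\<close> are the squared chordal distances on the circle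
  and of the images under \<open>f\<close>. Varying \<open>\<zeta>\<close> and \<open>h\<close> yields the pairs of cross ratios of
  four points and of their images. If \<open>f \<alpha> = f e\<close> with \<open>\<alpha> \<noteq> e\<close> and one of the points tends to \<open>e\<close>, then
  the second cross ratio degenerates while the first one stays bounded, and this gives all pairs.

  Such \<open>\<alpha>\<close> and \<open>e\<close> exist because \<open>f\<close> maps the circle onto the sphere: the group \<open>\<rho>(\<Gamma>)\<close> of the fibre is normalised by
  \<open>\<Delta>\<close>, so that its limit set is that of the cocompact group \<open>\<Delta>\<close>.\<close>

section \<open>The projective ball model and Moebius cocycles\<close>

text \<open>The set of full measure has to be found from \<open>\<Gamma>\<close> alone, since
  nothing is known about how \<open>f\<close> distorts measure. So \<open>generic\<close> is a
  condition on the action on the hyperbolic plane only; it holds almost everywhere by porosity of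
  the exceptional sets at all small scales. Everything about \<open>\<rho>\<close> then follows from
  continuity of the extension of \<open>F\<close> by \<open>f\<close>. Conjugates are used because
  the conformal factors of \<open>g n\<close> itself degenerate: they tend to 0 when
  \<open>g n \<xi>\<close> and \<open>g n \<i>\<close> tend to different boundary points. In a
  conjugate of \<open>h\<close> the factor of \<open>g n\<close> meets that of its inverse, and a
  ratio of Poisson terms at the common point \<open>g n \<i>\<close> survives. The danger is that
  the two factors are dependent: if \<open>f\<close> were a Moebius embedding, both cross ratios
  would always agree. Two points identified by \<open>f\<close> destroy any such relation, which is
  why non-injectivity is the decisive input. The ball model puts interior and boundary points into
  one inner product space, so a single formula yields distances, horospheres and chords, and the
  hyperbolic plane is treated as a slice of hyperbolic space.\<close>

definition hdenom :: "complex \<times> real \<Rightarrow> real" where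
  "hdenom x = 1 + (cmod (fst x))\<^sup>2 + (snd x)\<^sup>2"

text \<open>The isometry from the half-space onto the projective (Klein) model in the unit ball, where
  \<open>1 - \<bar>ballmap x\<bar>\<^sup>2 = 4 (hgt x)\<^sup>2\<close>.\<close>

definition ballmap :: "complex \<times> real \<Rightarrow> complex \<times> real" where
  "ballmap x = ((2 / hdenom x) *\<^sub>R fst x, ((cmod (fst x))\<^sup>2 + (snd x)\<^sup>2 - 1) / hdenom x)"

definition hgt :: "complex \<times> real \<Rightarrow> real" where
  "hgt x = snd x / hdenom x"

definition ballmap_opt :: "(complex \<times> real) option \<Rightarrow> complex \<times> real" where
  "ballmap_opt x = (case x of None \<Rightarrow> (0, 1) | Some y \<Rightarrow> ballmap y)"

definition bdpt :: "complex option \<Rightarrow> complex \<times> real" where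
  "bdpt \<xi> = ballmap_opt (map_option (\<lambda>w. (w, 0)) \<xi>)"

text \<open>Homogeneous coordinates of a boundary point.\<close>

definition hx :: "'a::zero_neq_one option \<Rightarrow> 'a" where
  "hx \<xi> = (case \<xi> of None \<Rightarrow> 1 | Some z \<Rightarrow> z)"

definition hy :: "'a::zero_neq_one option \<Rightarrow> 'a" where
  "hy \<xi> = (case \<xi> of None \<Rightarrow> 0 | Some z \<Rightarrow> 1)"

definition hn :: "complex option \<Rightarrow> real" where
  "hn \<xi> = (cmod (hx \<xi>))\<^sup>2 + (cmod (hy \<xi>))\<^sup>2"

text \<open>The hyperbolic cosine of the distance, minus 1.\<close>

definition chC :: "complex \<times> real \<Rightarrow> complex \<times> real \<Rightarrow> real" where
  "chC x y = ((cmod (fst x - fst y))\<^sup>2 + (snd x - snd y)\<^sup>2) / (2 * snd x * snd y)"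

text \<open>The factor \<open>\<bar>A v\<bar>\<^sup>2 / \<bar>v\<bar>\<^sup>2\<close> for a vector \<open>v\<close> over \<open>\<xi>\<close>: on the sphere, \<open>A\<close> scales infinitesimal
  lengths at \<open>\<xi>\<close> by its inverse. The function \<open>poisson x \<xi>\<close> is the exponential of the Busemann
  function at \<open>\<xi>\<close> normalised at the centre of the ball, and \<open>chord\<close> is a quarter of the squared chordal distance.\<close>

definition sg :: "complex^2^2 \<Rightarrow> complex option \<Rightarrow> real" where
  "sg A \<xi> = ((cmod (A$1$1 * hx \<xi> + A$1$2 * hy \<xi>))\<^sup>2 + (cmod (A$2$1 * hx \<xi> + A$2$2 * hy \<xi>))\<^sup>2) / hn \<xi>"

definition poisson :: "complex \<times> real \<Rightarrow> complex option \<Rightarrow> real" where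
  "poisson x \<xi> = (1 - ballmap x \<bullet> bdpt \<xi>) / (2 * hgt x)"

definition chord :: "complex option \<Rightarrow> complex option \<Rightarrow> real" where
  "chord \<xi> \<eta> = (1 - bdpt \<xi> \<bullet> bdpt \<eta>) / 2"

lemma hdenom_pos: "hdenom x > 0"
  unfolding hdenom_def by (smt (verit) zero_le_power2)

lemma hx_hy_simps [simp]: "hx None = 1" "hy None = 0" "hx (Some z) = z" "hy (Some z) = 1"
  by (auto simp: hx_def hy_def)

lemma hx_hy_nz: "hx \<xi> \<noteq> 0 \<or> hy \<xi> \<noteq> 0"
  by (cases \<xi>) auto

lemma hn_pos: "hn \<xi> > 0"
  by (cases \<xi>) (auto simp: hn_def add_nonneg_pos)

lemma cmod2: "(cmod z)\<^sup>2 = (Re z)\<^sup>2 + (Im z)\<^sup>2"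
  by (simp add: cmod_def)

lemma norm_ballmap: "(norm (ballmap x))\<^sup>2 = 1 - 4 * (hgt x)\<^sup>2"
proof -
  have *: "hdenom x \<noteq> 0" using hdenom_pos[of x] by simp
  define a where "a = (cmod (fst x))\<^sup>2 + (snd x)\<^sup>2"
  have h: "hdenom x = 1 + a" by (simp add: hdenom_def a_def)
  have c: "(cmod (fst x))\<^sup>2 = a - (snd x)\<^sup>2" by (simp add: a_def)
  have "(norm (ballmap x))\<^sup>2 = (2 / hdenom x)\<^sup>2 * (cmod (fst x))\<^sup>2 + ((a - 1) / hdenom x)\<^sup>2"
    by (simp add: ballmap_def norm_Pair a_def power_mult_distrib power_divide)
  also have "\<dots> = (4 * (a - (snd x)\<^sup>2) + (a - 1)\<^sup>2) / (hdenom x)\<^sup>2"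
    using * by (simp add: c power_divide add_divide_distrib)
  also have "\<dots> = ((1 + a)\<^sup>2 - 4 * (snd x)\<^sup>2) / (hdenom x)\<^sup>2"
    by (simp add: power2_eq_square algebra_simps)
  also have "\<dots> = 1 - 4 * (hgt x)\<^sup>2"
    using * by (simp add: hgt_def power_divide diff_divide_distrib h)
  finally show ?thesis .
qed

text \<open>Polarised form of \<open>norm_ballmap\<close>. Height 0 is included, so it also
  evaluates inner products with boundary points and makes \<open>poisson\<close> and
  \<open>chord\<close> explicit.\<close>

lemma inner_ballmap:
  "1 - ballmap x \<bullet> ballmap y = 2 * ((cmod (fst x - fst y))\<^sup>2 + (snd x)\<^sup>2 + (snd y)\<^sup>2) / (hdenom x * hdenom y)"
proof -
  have *: "hdenom x \<noteq> 0" "hdenom y \<noteq> 0" using hdenom_pos[of x] hdenom_pos[of y] by simp_all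
  show ?thesis
    using * unfolding ballmap_def inner_Pair inner_scaleR_left inner_scaleR_right
    apply (simp add: inner_complex_def cmod2 divide_simps)
    apply (simp add: hdenom_def cmod2)
    apply (simp add: algebra_simps power2_eq_square)
    done
qed

text \<open>In the projective model \<open>cosh d(x, y)\<close> is \<open>1 - X \<bullet> Y\<close>
  divided by the square roots of \<open>1 - |X|^2\<close> and \<open>1 - |Y|^2\<close>; by
  \<open>norm_ballmap\<close> these roots are \<open>2 * hgt x\<close> and
  \<open>2 * hgt y\<close>.\<close>

lemma inner_ballmap_chC:
  assumes "snd x > 0" "snd y > 0"
  shows "1 - ballmap x \<bullet> ballmap y = 4 * hgt x * hgt y * (1 + chC x y)"
proof -
  have "1 + chC x y = ((cmod (fst x - fst y))\<^sup>2 + (snd x)\<^sup>2 + (snd y)\<^sup>2) / (2 * snd x * snd y)"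
    using assms by (simp add: chC_def divide_simps power2_eq_square algebra_simps)
  then show ?thesis
    using assms hdenom_pos[of x] hdenom_pos[of y]
    unfolding inner_ballmap hgt_def by (simp add: divide_simps) (simp add: algebra_simps)
qed

lemma bdpt_Some: "bdpt (Some z) = ballmap (z, 0)"
  by (simp add: bdpt_def ballmap_opt_def)

lemma bdpt_None: "bdpt None = (0, 1)"
  by (simp add: bdpt_def ballmap_opt_def)

lemma norm_bdpt: "norm (bdpt \<xi>) = 1"
proof (cases \<xi>)
  case None
  then show ?thesis by (simp add: bdpt_None norm_Pair)
next
  case (Some z)
  have "(norm (bdpt \<xi>))\<^sup>2 = 1" by (simp add: Some bdpt_Some norm_ballmap hgt_def)
  then show ?thesis by (simp add: power2_eq_1_iff) (smt (verit) norm_ge_zero)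
qed

text \<open>The inverse of the usual half-space Poisson kernel
  \<open>t / (|\<xi> - z|^2 + t^2)\<close>, normalised by \<open>hn\<close> so that it also makes
  sense at infinity.\<close>

lemma poisson_eq:
  assumes "t > 0"
  shows "poisson (z, t) \<xi> = ((cmod (hx \<xi> - z * hy \<xi>))\<^sup>2 + t\<^sup>2 * (cmod (hy \<xi>))\<^sup>2) / (t * hn \<xi>)"
proof (cases \<xi>)
  case None
  have "hdenom (z,t) \<noteq> 0" using hdenom_pos[of "(z,t)"] by simp
  then show ?thesis using assms None
    by (simp add: poisson_def bdpt_None hn_def ballmap_def hgt_def divide_simps)
       (simp add: hdenom_def)
next
  case (Some w)
  have *: "hdenom (z,t) \<noteq> 0" "hdenom (w,0) \<noteq> 0"
    using hdenom_pos[of "(z,t)"] hdenom_pos[of "(w,0)"] by simp_all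
  have h: "hn (Some w) = hdenom (w, 0)" by (simp add: hn_def hdenom_def)
  show ?thesis using assms *
    unfolding Some poisson_def bdpt_Some inner_ballmap h
    by (simp add: hgt_def divide_simps norm_minus_commute)
qed

lemma chord_eq:
  "chord \<xi> \<eta> = (cmod (hx \<xi> * hy \<eta> - hx \<eta> * hy \<xi>))\<^sup>2 / (hn \<xi> * hn \<eta>)"
proof -
  have h: "hn (Some w) = hdenom (w, 0)" for w by (simp add: hn_def hdenom_def)
  have *: "hdenom (w,0) \<noteq> 0" for w using hdenom_pos[of "(w,0)"] by simp
  have 1: "1 - (0, 1) \<bullet> ballmap (w,0) = 2 / hdenom (w, 0)" for w
    using *[of w] by (simp add: ballmap_def divide_simps) (simp add: hdenom_def)
  have 2: "1 - ballmap (w,0) \<bullet> (0,1) = 2 / hdenom (w, 0)" for w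
    using 1[of w] by (simp add: inner_commute)
  have n: "hn None = 1" by (simp add: hn_def)
  show ?thesis
  proof (cases \<xi>; cases \<eta>)
    fix z w assume s: "\<xi> = Some z" "\<eta> = Some w"
    show ?thesis using *[of z] *[of w]
      by (simp add: s chord_def bdpt_Some inner_ballmap h)
  next
    fix z assume s: "\<xi> = Some z" "\<eta> = None"
    show ?thesis unfolding s chord_def bdpt_Some bdpt_None h n 2 by simp
  next
    fix z assume s: "\<eta> = Some z" "\<xi> = None"
    show ?thesis unfolding s chord_def bdpt_Some bdpt_None h n 1 by simp
  next
    assume s: "\<eta> = None" "\<xi> = None"
    show ?thesis unfolding s chord_def bdpt_Some bdpt_None h n by simp
  qed
qed

lemma homog_eq_iff: "hx \<xi> * hy \<eta> = hx \<eta> * hy \<xi> \<longleftrightarrow> \<xi> = (\<eta> :: 'a::field option)"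
  by (cases \<xi>; cases \<eta>) auto

lemma chord_nonneg: "chord \<xi> \<eta> \<ge> 0"
  using hn_pos[of \<xi>] hn_pos[of \<eta>] by (simp add: chord_eq)

lemma chord_eq_0: "chord \<xi> \<eta> = 0 \<longleftrightarrow> \<xi> = \<eta>"
  using hn_pos[of \<xi>] hn_pos[of \<eta>] by (simp add: chord_eq homog_eq_iff)

lemma chord_pos: "chord \<xi> \<eta> > 0 \<longleftrightarrow> \<xi> \<noteq> \<eta>"
  using chord_nonneg[of \<xi> \<eta>] chord_eq_0[of \<xi> \<eta>] by linarith

lemma chord_le_1: "chord \<xi> \<eta> \<le> 1"
proof -
  have "\<bar>bdpt \<xi> \<bullet> bdpt \<eta>\<bar> \<le> 1"
    using Cauchy_Schwarz_ineq2[of "bdpt \<xi>" "bdpt \<eta>"] by (simp add: norm_bdpt)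
  then show ?thesis by (simp add: chord_def)
qed

lemma chord_commute: "chord \<xi> \<eta> = chord \<eta> \<xi>"
  by (simp add: chord_def inner_commute)

lemma dist_bdpt: "(dist (bdpt \<xi>) (bdpt \<eta>))\<^sup>2 = 4 * chord \<xi> \<eta>"
  by (simp add: chord_def dist_norm power2_norm_eq_inner inner_diff inner_commute)
     (simp add: norm_bdpt flip: power2_norm_eq_inner)

lemma bdpt_inj: "bdpt \<xi> = bdpt \<eta> \<longleftrightarrow> \<xi> = \<eta>"
  using dist_bdpt[of \<xi> \<eta>] chord_eq_0[of \<xi> \<eta>] by auto

text \<open>The Moebius action is the projectivised linear action. The scalar \<open>l\<close> is
  all that \<open>sg\<close> and \<open>chord\<close> see of it, so computing with \<open>l\<close>
  avoids splitting into finite and infinite points.\<close>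

lemma mobius_homog:
  fixes A :: "'a::field^2^2"
  assumes "det A = 1"
  obtains l where "l \<noteq> 0" "A$1$1 * hx \<xi> + A$1$2 * hy \<xi> = l * hx (mobius_bdry A \<xi>)"
    "A$2$1 * hx \<xi> + A$2$2 * hy \<xi> = l * hy (mobius_bdry A \<xi>)"
proof -
  define u v where "u = A$1$1 * hx \<xi> + A$1$2 * hy \<xi>" and "v = A$2$1 * hx \<xi> + A$2$2 * hy \<xi>"
  have d: "A$1$1 * A$2$2 - A$1$2 * A$2$1 = 1" using assms by (simp add: det_2)
  have m: "mobius_bdry A \<xi> = (if v = 0 then None else Some (u / v))"
    by (cases \<xi>) (auto simp: mobius_bdry_def u_def v_def)
  have e1: "A$2$2 * u - A$1$2 * v = (A$1$1 * A$2$2 - A$1$2 * A$2$1) * hx \<xi>"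
    and e2: "A$1$1 * v - A$2$1 * u = (A$1$1 * A$2$2 - A$1$2 * A$2$1) * hy \<xi>"
    by (simp_all add: u_def v_def algebra_simps)
  have "u \<noteq> 0 \<or> v \<noteq> 0" using e1 e2 d hx_hy_nz[of \<xi>] by auto
  then show ?thesis
    using that[of "if v = 0 then u else v"] unfolding u_def[symmetric] v_def[symmetric] m
    by (auto split: if_splits)
qed

lemma homog_unique:
  fixes \<eta> :: "'a::field option"
  assumes "l \<noteq> 0" "u = l * hx \<eta>" "v = l * hy \<eta>" "m \<noteq> 0" "u = m * hx \<zeta>" "v = m * hy \<zeta>"
  shows "\<eta> = \<zeta>"
  using assms by (cases \<eta>; cases \<zeta>) auto

lemma mobius_bdry_mult:
  fixes A B :: "'a::field^2^2"
  assumes "det A = 1" "det B = 1"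
  shows "mobius_bdry (A ** B) \<xi> = mobius_bdry A (mobius_bdry B \<xi>)"
proof -
  obtain l where l: "l \<noteq> 0" "B$1$1 * hx \<xi> + B$1$2 * hy \<xi> = l * hx (mobius_bdry B \<xi>)"
    "B$2$1 * hx \<xi> + B$2$2 * hy \<xi> = l * hy (mobius_bdry B \<xi>)" using mobius_homog assms(2) by blast
  let ?\<eta> = "mobius_bdry B \<xi>"
  obtain m where m: "m \<noteq> 0" "A$1$1 * hx ?\<eta> + A$1$2 * hy ?\<eta> = m * hx (mobius_bdry A ?\<eta>)"
    "A$2$1 * hx ?\<eta> + A$2$2 * hy ?\<eta> = m * hy (mobius_bdry A ?\<eta>)" using mobius_homog assms(1) by blast
  have d: "det (A ** B) = 1" using assms by (simp add: det_mul)
  obtain n where n: "n \<noteq> 0" "(A**B)$1$1 * hx \<xi> + (A**B)$1$2 * hy \<xi> = n * hx (mobius_bdry (A**B) \<xi>)"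
    "(A**B)$2$1 * hx \<xi> + (A**B)$2$2 * hy \<xi> = n * hy (mobius_bdry (A**B) \<xi>)" using mobius_homog d by blast
  have "(A**B)$1$1 * hx \<xi> + (A**B)$1$2 * hy \<xi> = A$1$1 * (B$1$1 * hx \<xi> + B$1$2 * hy \<xi>) + A$1$2 * (B$2$1 * hx \<xi> + B$2$2 * hy \<xi>)"
    by (simp add: matrix_matrix_mult_def sum_2 algebra_simps)
  also have "\<dots> = l * (A$1$1 * hx ?\<eta> + A$1$2 * hy ?\<eta>)" unfolding l by (simp add: algebra_simps)
  finally have 1: "n * hx (mobius_bdry (A**B) \<xi>) = (l * m) * hx (mobius_bdry A ?\<eta>)" using n m by simp
  have "(A**B)$2$1 * hx \<xi> + (A**B)$2$2 * hy \<xi> = A$2$1 * (B$1$1 * hx \<xi> + B$1$2 * hy \<xi>) + A$2$2 * (B$2$1 * hx \<xi> + B$2$2 * hy \<xi>)"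
    by (simp add: matrix_matrix_mult_def sum_2 algebra_simps)
  also have "\<dots> = l * (A$2$1 * hx ?\<eta> + A$2$2 * hy ?\<eta>)" unfolding l by (simp add: algebra_simps)
  finally have 2: "n * hy (mobius_bdry (A**B) \<xi>) = (l * m) * hy (mobius_bdry A ?\<eta>)" using n m by simp
  show ?thesis
    by (rule homog_unique[where l = n and m = "l * m"]) (use n m l 1 2 in auto)
qed

lemma mobius_bdry_one: "mobius_bdry (mat 1) \<xi> = \<xi>"
  by (cases \<xi>) (auto simp: mobius_bdry_def mat_def)

lemma sg_pos: "det A = 1 \<Longrightarrow> sg A \<xi> > 0"
  by (rule mobius_homog[of A \<xi>])
     (use hn_pos[of \<xi>] hx_hy_nz[of "mobius_bdry A \<xi>"] in \<open>auto simp: sg_def add_pos_nonneg add_nonneg_pos\<close>)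

lemma sg_uminus: "sg (- A) \<xi> = sg A \<xi>"
proof -
  have "cmod (- (x * y) - z * w) = cmod (x * y + z * w)" for x y z w :: complex
  proof -
    have "- (x * y) - z * w = - (x * y + z * w)" by simp
    then show ?thesis by (simp only: norm_minus_cancel)
  qed
  then show ?thesis by (simp add: sg_def)
qed

lemma sg_homog:
  assumes "A$1$1 * hx \<xi> + A$1$2 * hy \<xi> = l * hx \<eta>"
    "A$2$1 * hx \<xi> + A$2$2 * hy \<xi> = l * hy \<eta>"
  shows "sg A \<xi> = (cmod l)\<^sup>2 * hn \<eta> / hn \<xi>"
  unfolding sg_def assms by (simp add: hn_def norm_mult power_mult_distrib algebra_simps)

lemma sg_mult:
  assumes "det A = 1" "det B = 1"
  shows "sg (A ** B) \<xi> = sg A (mobius_bdry B \<xi>) * sg B \<xi>"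
proof -
  obtain l where l: "l \<noteq> 0" "B$1$1 * hx \<xi> + B$1$2 * hy \<xi> = l * hx (mobius_bdry B \<xi>)"
    "B$2$1 * hx \<xi> + B$2$2 * hy \<xi> = l * hy (mobius_bdry B \<xi>)" using mobius_homog assms(2) by blast
  let ?\<eta> = "mobius_bdry B \<xi>"
  have "(A**B)$1$1 * hx \<xi> + (A**B)$1$2 * hy \<xi> = A$1$1 * (B$1$1 * hx \<xi> + B$1$2 * hy \<xi>) + A$1$2 * (B$2$1 * hx \<xi> + B$2$2 * hy \<xi>)"
    by (simp add: matrix_matrix_mult_def sum_2 algebra_simps)
  also have "\<dots> = l * (A$1$1 * hx ?\<eta> + A$1$2 * hy ?\<eta>)" unfolding l by (simp add: algebra_simps)
  finally have 1: "(A**B)$1$1 * hx \<xi> + (A**B)$1$2 * hy \<xi> = \<dots>" .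
  have "(A**B)$2$1 * hx \<xi> + (A**B)$2$2 * hy \<xi> = A$2$1 * (B$1$1 * hx \<xi> + B$1$2 * hy \<xi>) + A$2$2 * (B$2$1 * hx \<xi> + B$2$2 * hy \<xi>)"
    by (simp add: matrix_matrix_mult_def sum_2 algebra_simps)
  also have "\<dots> = l * (A$2$1 * hx ?\<eta> + A$2$2 * hy ?\<eta>)" unfolding l by (simp add: algebra_simps)
  finally have 2: "(A**B)$2$1 * hx \<xi> + (A**B)$2$2 * hy \<xi> = \<dots>" .
  show ?thesis
    unfolding sg_homog[OF l(2,3)] using hn_pos[of ?\<eta>]
    by (simp add: sg_def[of "A ** B"] 1 2 sg_def[of A] norm_mult power_mult_distrib)
       (simp add: algebra_simps flip: add_divide_distrib)
qed

text \<open>\<open>chord\<close> is the squared modulus of the determinant of two homogeneous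
  vectors over the product of their squared lengths. A matrix of determinant 1 preserves the
  determinant; the lengths contribute the factors \<open>sg\<close>.\<close>

lemma chord_mobius:
  assumes "det A = 1"
  shows "chord (mobius_bdry A \<xi>) (mobius_bdry A \<eta>) * sg A \<xi> * sg A \<eta> = chord \<xi> \<eta>"
proof -
  obtain l where l: "l \<noteq> 0" "A$1$1 * hx \<xi> + A$1$2 * hy \<xi> = l * hx (mobius_bdry A \<xi>)"
    "A$2$1 * hx \<xi> + A$2$2 * hy \<xi> = l * hy (mobius_bdry A \<xi>)" using mobius_homog assms by blast
  obtain m where m: "m \<noteq> 0" "A$1$1 * hx \<eta> + A$1$2 * hy \<eta> = m * hx (mobius_bdry A \<eta>)"
    "A$2$1 * hx \<eta> + A$2$2 * hy \<eta> = m * hy (mobius_bdry A \<eta>)" using mobius_homog assms by blast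
  let ?a = "mobius_bdry A \<xi>" and ?b = "mobius_bdry A \<eta>"
  have "l * m * (hx ?a * hy ?b - hx ?b * hy ?a) = (l * hx ?a) * (m * hy ?b) - (m * hx ?b) * (l * hy ?a)"
    by (simp add: algebra_simps)
  also have "\<dots> = (A$1$1 * A$2$2 - A$1$2 * A$2$1) * (hx \<xi> * hy \<eta> - hx \<eta> * hy \<xi>)"
    unfolding l(2,3)[symmetric] m(2,3)[symmetric] by (simp add: algebra_simps)
  finally have "l * m * (hx ?a * hy ?b - hx ?b * hy ?a) = hx \<xi> * hy \<eta> - hx \<eta> * hy \<xi>"
    using assms by (simp add: det_2)
  then have "(cmod l)\<^sup>2 * (cmod m)\<^sup>2 * (cmod (hx ?a * hy ?b - hx ?b * hy ?a))\<^sup>2 = (cmod (hx \<xi> * hy \<eta> - hx \<eta> * hy \<xi>))\<^sup>2"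
    by (metis norm_mult power_mult_distrib)
  then show ?thesis
    unfolding sg_homog[OF l(2,3)] sg_homog[OF m(2,3)] chord_eq
    using hn_pos[of \<xi>] hn_pos[of \<eta>] hn_pos[of ?a] hn_pos[of ?b] by (simp add: divide_simps mult_ac)
qed

lemma poisson_pos: "snd x > 0 \<Longrightarrow> poisson x \<xi> > 0"
proof -
  assume "snd x > 0"
  moreover obtain z t where x: "x = (z, t)" by (cases x)
  moreover have "(cmod (hx \<xi> - z * hy \<xi>))\<^sup>2 + t\<^sup>2 * (cmod (hy \<xi>))\<^sup>2 > 0" if "t > 0"
    using that by (cases \<xi>) (auto simp: add_nonneg_pos)
  ultimately show ?thesis using hn_pos[of \<xi>] by (simp add: poisson_eq)
qed

lemma mobius_H3_pos:
  assumes "det A = 1" "t > 0"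
  shows "(cmod (A$2$1 * z + A$2$2))\<^sup>2 + (cmod (A$2$1))\<^sup>2 * t\<^sup>2 > 0" "snd (mobius_H3 A (z, t)) > 0"
proof -
  have "A$2$1 \<noteq> 0 \<or> A$2$1 * z + A$2$2 \<noteq> 0" using assms(1) by (auto simp: det_2)
  then show 1: "(cmod (A$2$1 * z + A$2$2))\<^sup>2 + (cmod (A$2$1))\<^sup>2 * t\<^sup>2 > 0"
    using assms(2) by (cases "A$2$1 = 0") (auto simp: add_nonneg_pos)
  then show "snd (mobius_H3 A (z, t)) > 0" using assms(2) by (simp add: mobius_H3_def Let_def)
qed

text \<open>The matrix with rows \<open>cnj w\<close>, \<open>- t * cnj c\<close> and
  \<open>t * c\<close>, \<open>w\<close> is a unitary matrix times the square root of
  \<open>(cmod w)^2 + (cmod c)^2 * t^2\<close>. The identity is its effect on the length of the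
  vector \<open>(u, t * y)\<close>.\<close>

lemma poisson_mobius_aux:
  fixes u w c y :: complex and t :: real
  shows "(cmod (cnj w * u - cnj c * of_real (t\<^sup>2) * y))\<^sup>2 + t\<^sup>2 * (cmod (c * u + w * y))\<^sup>2
    = ((cmod w)\<^sup>2 + (cmod c)\<^sup>2 * t\<^sup>2) * ((cmod u)\<^sup>2 + t\<^sup>2 * (cmod y)\<^sup>2)"
proof -
  have "of_real ((cmod (cnj w * u - cnj c * of_real (t\<^sup>2) * y))\<^sup>2 + t\<^sup>2 * (cmod (c * u + w * y))\<^sup>2)
    = (of_real (((cmod w)\<^sup>2 + (cmod c)\<^sup>2 * t\<^sup>2) * ((cmod u)\<^sup>2 + t\<^sup>2 * (cmod y)\<^sup>2)) :: complex)"
    unfolding of_real_add of_real_mult complex_norm_square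
    by (simp add: algebra_simps power2_eq_square)
  then show ?thesis by (simp only: of_real_eq_iff)
qed

lemma poisson_mobius_aux2:
  fixes q :: real
  assumes "q > 0" "q\<^sup>2 * L * E + t\<^sup>2 * L * H = q * U"
  shows "(E + (t/q)\<^sup>2 * H) * L * q = U"
proof -
  have "(t/q)\<^sup>2 * q\<^sup>2 = t\<^sup>2" using assms(1) by (simp add: power_divide)
  moreover have "q * ((E + (t/q)\<^sup>2 * H) * L * q) = q\<^sup>2 * L * E + ((t/q)\<^sup>2 * q\<^sup>2) * L * H"
    by (simp add: power2_eq_square distrib_left distrib_right mult_ac)
  ultimately have "q * ((E + (t/q)\<^sup>2 * H) * L * q) = q * U" using assms(2) by simp
  then show ?thesis using assms(1) by simp
qed

lemma poisson_mobius:
  assumes "det A = 1" "snd x > 0"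
  shows "poisson (mobius_H3 A x) (mobius_bdry A \<xi>) * sg A \<xi> = poisson x \<xi>"
proof -
  obtain z t where x: "x = (z, t)" by (cases x)
  have t: "t > 0" using assms x by simp
  define a b c d where abcd: "a = A$1$1" "b = A$1$2" "c = A$2$1" "d = A$2$2"
  have D: "a * d - b * c = 1" using assms(1) by (simp add: det_2 abcd)
  define w q where "w = c * z + d" and "q = (cmod w)\<^sup>2 + (cmod c)\<^sup>2 * t\<^sup>2"
  have q: "q > 0" using mobius_H3_pos(1)[OF assms(1) t, of z] by (simp add: q_def w_def abcd)
  have M: "mobius_H3 A x = (((a * z + b) * cnj w + a * cnj c * of_real (t\<^sup>2)) / of_real q, t / q)"
    by (simp add: mobius_H3_def x Let_def abcd w_def q_def)
  define X Y where "X = hx \<xi>" and "Y = hy \<xi>"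
  let ?\<eta> = "mobius_bdry A \<xi>"
  obtain l where l: "l \<noteq> 0" "a * X + b * Y = l * hx ?\<eta>" "c * X + d * Y = l * hy ?\<eta>"
    using mobius_homog[OF assms(1)] unfolding abcd X_def Y_def by metis
  define z' where "z' = ((a * z + b) * cnj w + a * cnj c * of_real (t\<^sup>2)) / of_real q"
  define u where "u = X - z * Y"
  have qq: "of_real q = w * cnj w + c * cnj c * of_real (t\<^sup>2)"
    unfolding q_def of_real_add of_real_mult complex_norm_square ..
  have qz: "of_real q * z' = (a * z + b) * cnj w + a * cnj c * of_real (t\<^sup>2)"
    using q by (simp add: z'_def)
  have cy: "c * X + d * Y = c * u + w * Y" by (simp add: u_def w_def algebra_simps)
  \<comment> \<open>Multiplying by \<open>q\<close> clears the denominator of \<open>z'\<close>; the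
    determinant of \<open>A\<close> then factors out.\<close>
  have "complex_of_real q * ((a * X + b * Y) - z' * (c * X + d * Y))
     = of_real q * (a * X + b * Y) - (of_real q * z') * (c * X + d * Y)" by (simp add: algebra_simps)
  also have "\<dots> = (a * d - b * c) * (cnj w * u - cnj c * of_real (t\<^sup>2) * Y)"
    unfolding qz unfolding qq by (simp add: u_def w_def algebra_simps)
  finally have e: "complex_of_real q * ((a * X + b * Y) - z' * (c * X + d * Y)) = cnj w * u - cnj c * of_real (t\<^sup>2) * Y"
    using D by simp
  have s1: "q\<^sup>2 * (cmod ((a * X + b * Y) - z' * (c * X + d * Y)))\<^sup>2 = (cmod (complex_of_real q * ((a * X + b * Y) - z' * (c * X + d * Y))))\<^sup>2"
    by (simp only: norm_mult power_mult_distrib norm_of_real power2_abs)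
  have key: "q\<^sup>2 * (cmod ((a * X + b * Y) - z' * (c * X + d * Y)))\<^sup>2 + t\<^sup>2 * (cmod (c * X + d * Y))\<^sup>2
      = q * ((cmod u)\<^sup>2 + t\<^sup>2 * (cmod Y)\<^sup>2)"
    unfolding s1[unfolded e] unfolding cy poisson_mobius_aux by (simp add: q_def)
  have "(a * X + b * Y) - z' * (c * X + d * Y) = l * (hx ?\<eta> - z' * hy ?\<eta>)"
    unfolding l(2,3) by (simp add: algebra_simps)
  then have "cmod ((a * X + b * Y) - z' * (c * X + d * Y)) = cmod l * cmod (hx ?\<eta> - z' * hy ?\<eta>)"
    by (simp only: norm_mult)
  moreover have "cmod (c * X + d * Y) = cmod l * cmod (hy ?\<eta>)" unfolding l(2,3) by (rule norm_mult)
  ultimately have key': "q\<^sup>2 * (cmod l)\<^sup>2 * (cmod (hx ?\<eta> - z' * hy ?\<eta>))\<^sup>2 + t\<^sup>2 * (cmod l)\<^sup>2 * (cmod (hy ?\<eta>))\<^sup>2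
      = q * ((cmod u)\<^sup>2 + t\<^sup>2 * (cmod Y)\<^sup>2)" using key by (simp add: power_mult_distrib mult.assoc)
  have sgA: "sg A \<xi> = (cmod l)\<^sup>2 * hn ?\<eta> / hn \<xi>"
    by (rule sg_homog) (use l in \<open>simp_all add: abcd X_def Y_def\<close>)
  have "poisson (mobius_H3 A x) ?\<eta> = ((cmod (hx ?\<eta> - z' * hy ?\<eta>))\<^sup>2 + (t/q)\<^sup>2 * (cmod (hy ?\<eta>))\<^sup>2) / ((t/q) * hn ?\<eta>)"
    unfolding M z'_def[symmetric] by (rule poisson_eq) (use t q in simp)
  moreover have "poisson x \<xi> = ((cmod u)\<^sup>2 + t\<^sup>2 * (cmod Y)\<^sup>2) / (t * hn \<xi>)"
    unfolding x u_def X_def Y_def by (rule poisson_eq[OF t])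
  moreover have "((cmod (hx ?\<eta> - z' * hy ?\<eta>))\<^sup>2 + (t/q)\<^sup>2 * (cmod (hy ?\<eta>))\<^sup>2) * (cmod l)\<^sup>2 * q = (cmod u)\<^sup>2 + t\<^sup>2 * (cmod Y)\<^sup>2"
    by (rule poisson_mobius_aux2[OF q key'])
  moreover have "(N / ((t/q) * hn ?\<eta>)) * ((cmod l)\<^sup>2 * hn ?\<eta> / hn \<xi>) = (N * (cmod l)\<^sup>2 * q) / (t * hn \<xi>)" for N
    using t q hn_pos[of \<xi>] hn_pos[of ?\<eta>] by (simp add: divide_simps)
  ultimately show ?thesis unfolding sgA by (simp only:)
qed

text \<open>Because \<open>2 * hgt x \<le> 1\<close>. It turns decay of \<open>poisson\<close> into
  convergence to \<open>\<xi>\<close> in the ball.\<close>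

lemma poisson_tendsto_bound: "snd x > 0 \<Longrightarrow> poisson x \<xi> \<ge> 1 - ballmap x \<bullet> bdpt \<xi>"
proof -
  assume x: "snd x > 0"
  have "hgt x > 0" using x hdenom_pos[of x] by (simp add: hgt_def)
  moreover have "2 * hgt x \<le> 1"
  proof -
    have "2 * snd x \<le> 1 + (snd x)\<^sup>2" using sum_squares_bound[of 1 "snd x"] by simp
    then have "2 * snd x \<le> hdenom x" unfolding hdenom_def by (smt (verit) zero_le_power2)
    then show ?thesis using hdenom_pos[of x] by (simp add: hgt_def divide_simps)
  qed
  moreover have "1 - ballmap x \<bullet> bdpt \<xi> \<ge> 0"
    using poisson_pos[OF x, of \<xi>] \<open>hgt x > 0\<close> unfolding poisson_def by (smt (verit) divide_nonpos_pos)
  ultimately show ?thesis unfolding poisson_def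
    by (simp add: pos_le_divide_eq mult_left_le)
qed

section \<open>The real group and the hyperbolic plane inside the complex picture\<close>

definition cmat :: "real^2^2 \<Rightarrow> complex^2^2" where
  "cmat A = (\<chi> i j. of_real (A$i$j))"

text \<open>The vertical half-plane over the real axis, a totally geodesic copy of the hyperbolic
  plane.\<close>

definition inc_H2 :: "complex \<Rightarrow> complex \<times> real" where
  "inc_H2 z = (of_real (Re z), Im z)"

abbreviation inc_bd :: "real option \<Rightarrow> complex option" where
  "inc_bd \<equiv> map_option of_real"

lemma cmat_nth [simp]: "cmat A $ i $ j = of_real (A$i$j)"
  by (simp add: cmat_def)

lemma det_cmat: "det (cmat A) = of_real (det A)"
  by (simp add: det_2)

lemma cmat_mult: "cmat (A ** B) = cmat A ** cmat B"
  by (simp add: vec_eq_iff matrix_matrix_mult_def)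

lemma cmat_uminus: "cmat (- A) = - cmat A"
  by (simp add: vec_eq_iff)

lemma mobius_bdry_cmat: "mobius_bdry (cmat A) (inc_bd \<xi>) = inc_bd (mobius_bdry A \<xi>)"
proof -
  have "of_real a * of_real x + of_real b = (0::complex) \<longleftrightarrow> a * x + b = 0" for a b x :: real
    by (metis of_real_add of_real_eq_0_iff of_real_mult)
  then show ?thesis by (cases \<xi>) (auto simp: mobius_bdry_def)
qed

lemma mobius_H3_cmat:
  assumes "det A = 1" "Im z > 0"
  shows "mobius_H3 (cmat A) (inc_H2 z) = inc_H2 (mobius_H2 A z)"
proof -
  obtain x y where z: "z = Complex x y" by (cases z)
  define a b c d where abcd: "a = A$1$1" "b = A$1$2" "c = A$2$1" "d = A$2$2"
  have D: "a * d - b * c = 1" using assms(1) by (simp add: det_2 abcd)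
  define q where "q = (c * x + d)\<^sup>2 + c\<^sup>2 * y\<^sup>2"
  have y: "y > 0" using assms z by simp
  have "cmod (of_real c * of_real x + of_real d) = \<bar>c * x + d\<bar>"
    by (metis norm_of_real of_real_add of_real_mult)
  then have q': "(cmod (of_real c * of_real x + of_real d))\<^sup>2 + (cmod (of_real c))\<^sup>2 * y\<^sup>2 = q"
    by (simp add: q_def)
  have Mz: "mobius_H2 A z = (of_real a * z + of_real b) / (of_real c * z + of_real d)"
    by (simp add: mobius_H2_def abcd)
  have R: "Re (mobius_H2 A z) = ((a * x + b) * (c * x + d) + a * c * y\<^sup>2) / q"
    unfolding Mz by (simp add: Re_divide z q_def power_mult_distrib) (simp add: power2_eq_square mult_ac)
  have "Im (mobius_H2 A z) = (a * y * (c * x + d) - (a * x + b) * (c * y)) / q"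
    unfolding Mz by (simp add: Im_divide z q_def power_mult_distrib)
  also have "a * y * (c * x + d) - (a * x + b) * (c * y) = (a * d - b * c) * y" by (simp add: algebra_simps)
  finally have I: "Im (mobius_H2 A z) = y / q" using D by simp
  have q2: "cmod (of_real c * of_real x + of_real d) ^ 2 + c\<^sup>2 * y\<^sup>2 = q"
    "(complex_of_real (cmod (of_real c * of_real x + of_real d)))\<^sup>2 + (of_real \<bar>c\<bar>)\<^sup>2 * (of_real y)\<^sup>2 = of_real q"
    using q' by (simp_all flip: of_real_power of_real_mult of_real_add)
  show ?thesis
    unfolding inc_H2_def R I by (simp add: mobius_H3_def inc_H2_def Let_def z q2 flip: abcd)
qed

lemma mobius_H2_pos:
  assumes "det A = 1" "Im z > 0"
  shows "Im (mobius_H2 A z) > 0"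
proof -
  have "snd (mobius_H3 (cmat A) (inc_H2 z)) > 0"
    unfolding inc_H2_def by (rule mobius_H3_pos(2)) (use assms in \<open>auto simp: det_cmat\<close>)
  then show ?thesis unfolding mobius_H3_cmat[OF assms] by (simp add: inc_H2_def)
qed

lemma mobius_H2_denom:
  fixes A :: "real^2^2"
  assumes "det A = 1" "Im z > 0"
  shows "of_real (A$2$1) * z + of_real (A$2$2) \<noteq> (0::complex)"
proof
  assume "of_real (A$2$1) * z + of_real (A$2$2) = (0::complex)"
  then have "A$2$1 * Im z = 0" "A$2$1 * Re z + A$2$2 = (0::real)" by (simp_all add: complex_eq_iff)
  then show False using assms by (simp add: det_2)
qed

lemma mobius_H2_mult:
  assumes "det A = 1" "det B = 1" "Im z > 0"
  shows "mobius_H2 (A ** B) z = mobius_H2 A (mobius_H2 B z)"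
proof -
  have B: "of_real (B$2$1) * z + of_real (B$2$2) \<noteq> (0::complex)" by (rule mobius_H2_denom) fact+
  have AB: "of_real ((A**B)$2$1) * z + of_real ((A**B)$2$2) \<noteq> (0::complex)"
    by (rule mobius_H2_denom) (use assms in \<open>auto simp: det_mul\<close>)
  have A: "of_real (A$2$1) * mobius_H2 B z + of_real (A$2$2) \<noteq> (0::complex)"
    by (rule mobius_H2_denom) (use assms mobius_H2_pos in auto)
  define w where "w = of_real (B$2$1) * z + of_real (B$2$2)"
  have "mobius_H2 B z * w = of_real (B$1$1) * z + of_real (B$1$2)"
    using B by (simp add: mobius_H2_def w_def)
  then have 1: "of_real ((A**B)$i$1) * z + of_real ((A**B)$i$2) = (of_real (A$i$1) * mobius_H2 B z + of_real (A$i$2)) * w" for i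
    by (simp add: matrix_matrix_mult_def sum_2 distrib_right mult.assoc) (simp add: w_def algebra_simps)
  show ?thesis
    unfolding mobius_H2_def[of "A ** B"] mobius_H2_def[of A] 1 using B by (simp add: w_def)
qed

section \<open>The groups acting on the compactifications\<close>

text \<open>The sign of the representative is arbitrary, which is harmless because the actions and
  \<open>sg\<close> do not distinguish \<open>A\<close> from \<open>- A\<close>.\<close>

definition rep :: "('a::field^2^2) set \<Rightarrow> 'a^2^2" where
  "rep g = (SOME A. det A = 1 \<and> g = psl A)"

lemma rep_spec:
  assumes "g \<in> carrier PSL2"
  shows "det (rep g) = 1" "psl (rep g) = g"
proof -
  have "\<exists>A. det A = 1 \<and> g = psl A" using assms by (auto simp: carrier_PSL2)
  then have "det (rep g) = 1 \<and> g = psl (rep g)" unfolding rep_def by (rule someI_ex)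
  then show "det (rep g) = 1" "psl (rep g) = g" by auto
qed

lemma psl_in_carrier [simp]: "det A = 1 \<Longrightarrow> psl A \<in> carrier PSL2"
  by (auto simp: carrier_PSL2)

lemma psl_eq_iff: "psl A = psl B \<longleftrightarrow> A = B \<or> A = - B"
  by (auto simp: psl_eq doubleton_eq_iff)

interpretation PSL2: group "PSL2 :: ('a::field^2^2) set monoid"
  by (rule group_PSL2)

lemma act_bdry_rep: "g \<in> carrier PSL2 \<Longrightarrow> act_bdry g \<xi> = mobius_bdry (rep g) \<xi>"
  by (metis psl_act_psl mobius_uminus(3) rep_spec(2))

lemma act_H2_rep: "g \<in> carrier PSL2 \<Longrightarrow> act_H2 g z = mobius_H2 (rep g) z"
  by (metis psl_act_psl mobius_uminus(1) rep_spec(2))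

lemma act_H3_rep: "g \<in> carrier PSL2 \<Longrightarrow> act_H3 g z = mobius_H3 (rep g) z"
  by (metis psl_act_psl mobius_uminus(2) rep_spec(2))

lemma act_psl:
  "act_bdry (psl A) \<xi> = mobius_bdry A \<xi>" "act_H2 (psl B) z = mobius_H2 B z" "act_H3 (psl C) w = mobius_H3 C w"
  by (simp_all add: psl_act_psl mobius_uminus)

lemma act_bdry_mult:
  fixes g h :: "('a::field^2^2) set"
  assumes "g \<in> carrier PSL2" "h \<in> carrier PSL2"
  shows "act_bdry (g \<otimes>\<^bsub>PSL2\<^esub> h) \<xi> = act_bdry g (act_bdry h \<xi>)"
proof -
  have "g \<otimes>\<^bsub>PSL2\<^esub> h = psl (rep g ** rep h)"
    using mult_psl[of "rep g" "rep h"] assms by (simp add: rep_spec)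
  then show ?thesis using assms
    by (simp add: act_psl mobius_bdry_mult rep_spec act_bdry_rep)
qed

lemma act_H2_mult:
  assumes "g \<in> carrier PSL2" "h \<in> carrier PSL2" "Im z > 0"
  shows "act_H2 (g \<otimes>\<^bsub>PSL2\<^esub> h) z = act_H2 g (act_H2 h z)"
proof -
  have "g \<otimes>\<^bsub>PSL2\<^esub> h = psl (rep g ** rep h)"
    using mult_psl[of "rep g" "rep h"] assms by (simp add: rep_spec)
  then show ?thesis using assms
    by (simp add: act_psl mobius_H2_mult rep_spec act_H2_rep)
qed

lemma act_H2_pos: "g \<in> carrier PSL2 \<Longrightarrow> Im z > 0 \<Longrightarrow> Im (act_H2 g z) > 0"
  by (simp add: act_H2_rep mobius_H2_pos rep_spec)

lemma PSL2_one: "\<one>\<^bsub>PSL2\<^esub> = psl (mat 1 :: 'a::field^2^2)"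
proof -
  have "psl (mat 1 :: 'a^2^2) \<otimes>\<^bsub>PSL2\<^esub> psl (mat 1) = psl (mat 1)" by (subst mult_psl) auto
  then show ?thesis by (metis PSL2.l_cancel_one psl_in_carrier det_I)
qed

lemma act_one: "act_bdry \<one>\<^bsub>PSL2\<^esub> \<xi> = (\<xi> :: 'a::field option)" "act_H2 \<one>\<^bsub>PSL2\<^esub> z = z"
  by (simp_all add: PSL2_one act_psl mobius_bdry_one) (simp add: mobius_H2_def mat_def)

lemma act_bdry_inv [simp]:
  fixes g :: "('a::field^2^2) set"
  assumes "g \<in> carrier PSL2"
  shows "act_bdry (inv\<^bsub>PSL2\<^esub> g) (act_bdry g \<xi>) = \<xi>" "act_bdry g (act_bdry (inv\<^bsub>PSL2\<^esub> g) \<xi>) = \<xi>"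
  using assms by (simp_all add: act_one PSL2.l_inv PSL2.r_inv flip: act_bdry_mult)

lemma act_H2_inv:
  assumes "g \<in> carrier PSL2" "Im z > 0"
  shows "act_H2 (inv\<^bsub>PSL2\<^esub> g) (act_H2 g z) = z" "act_H2 g (act_H2 (inv\<^bsub>PSL2\<^esub> g) z) = z"
  using assms by (simp_all add: act_one PSL2.l_inv PSL2.r_inv flip: act_H2_mult)

definition sgp :: "(complex^2^2) set \<Rightarrow> complex option \<Rightarrow> real" where
  "sgp g \<xi> = sg (rep g) \<xi>"

lemma sgp_psl: "det A = 1 \<Longrightarrow> sgp (psl A) \<xi> = sg A \<xi>"
proof -
  assume "det A = 1"
  then have "rep (psl A) = A \<or> rep (psl A) = - A"
    using rep_spec(2)[of "psl A"] by (simp add: psl_eq_iff)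
  then show ?thesis by (auto simp: sgp_def sg_uminus)
qed

lemma sgp_pos: "g \<in> carrier PSL2 \<Longrightarrow> sgp g \<xi> > 0"
  by (simp add: sgp_def sg_pos rep_spec)

lemma sgp_mult:
  assumes "g \<in> carrier PSL2" "h \<in> carrier PSL2"
  shows "sgp (g \<otimes>\<^bsub>PSL2\<^esub> h) \<xi> = sgp g (act_bdry h \<xi>) * sgp h \<xi>"
proof -
  have "g \<otimes>\<^bsub>PSL2\<^esub> h = psl (rep g ** rep h)"
    using mult_psl[of "rep g" "rep h"] assms by (simp add: rep_spec)
  moreover have "sgp (psl (rep g ** rep h)) \<xi> = sg (rep g ** rep h) \<xi>"
    using assms by (simp add: sgp_psl det_mul rep_spec)
  ultimately show ?thesis using assms
    by (simp add: rep_spec sg_mult sgp_def act_bdry_rep)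
qed

lemma sg_one: "sg (mat 1) \<xi> = 1"
  using hn_pos[of \<xi>] by (simp add: sg_def mat_def) (simp add: hn_def)

lemma sgp_one: "sgp \<one>\<^bsub>PSL2\<^esub> \<xi> = 1"
  by (simp add: PSL2_one sgp_psl sg_one)

lemma chord_act:
  assumes "g \<in> carrier PSL2"
  shows "chord (act_bdry g \<xi>) (act_bdry g \<eta>) * sgp g \<xi> * sgp g \<eta> = chord \<xi> \<eta>"
  using assms by (simp add: act_bdry_rep sgp_def chord_mobius rep_spec)

lemma poisson_act:
  assumes "g \<in> carrier PSL2" "snd x > 0"
  shows "poisson (act_H3 g x) (act_bdry g \<xi>) * sgp g \<xi> = poisson x \<xi>"
  using assms by (simp add: act_bdry_rep act_H3_rep sgp_def poisson_mobius rep_spec)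

definition cpsl :: "(real^2^2) set \<Rightarrow> (complex^2^2) set" where
  "cpsl g = psl (cmat (rep g))"

lemma cpsl_psl: "det A = 1 \<Longrightarrow> cpsl (psl A) = psl (cmat A)"
proof -
  assume "det A = 1"
  then have "rep (psl A) = A \<or> rep (psl A) = - A"
    using rep_spec(2)[of "psl A"] by (simp add: psl_eq_iff)
  then show ?thesis by (auto simp: cpsl_def psl_eq_iff cmat_uminus)
qed

lemma cpsl_carrier: "g \<in> carrier PSL2 \<Longrightarrow> cpsl g \<in> carrier PSL2"
  by (simp add: cpsl_def det_cmat rep_spec)

lemma cpsl_mult:
  assumes "g \<in> carrier PSL2" "h \<in> carrier PSL2"
  shows "cpsl (g \<otimes>\<^bsub>PSL2\<^esub> h) = cpsl g \<otimes>\<^bsub>PSL2\<^esub> cpsl h"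
proof -
  have "g \<otimes>\<^bsub>PSL2\<^esub> h = psl (rep g ** rep h)"
    using mult_psl[of "rep g" "rep h"] assms by (simp add: rep_spec)
  then have "cpsl (g \<otimes>\<^bsub>PSL2\<^esub> h) = psl (cmat (rep g) ** cmat (rep h))"
    using assms by (simp add: cpsl_psl det_mul rep_spec cmat_mult)
  then show ?thesis using assms by (simp add: cpsl_def mult_psl det_cmat rep_spec)
qed

lemma act_bdry_cpsl:
  "g \<in> carrier PSL2 \<Longrightarrow> act_bdry (cpsl g) (inc_bd \<xi>) = inc_bd (act_bdry g \<xi>)"
  by (simp add: cpsl_def act_psl mobius_bdry_cmat act_bdry_rep)

lemma act_H3_cpsl:
  "g \<in> carrier PSL2 \<Longrightarrow> Im z > 0 \<Longrightarrow> act_H3 (cpsl g) (inc_H2 z) = inc_H2 (act_H2 g z)"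
  by (simp add: cpsl_def act_psl mobius_H3_cmat act_H2_rep rep_spec)

section \<open>Topology of the compactifications\<close>

text \<open>Closed bounded subsets of \<open>S\<close> are compact, so a limit of \<open>g\<close>
  at infinity is exactly continuity at the added point.\<close>

lemma continuous_map_Alexandroff:
  fixes S :: "'a::euclidean_space set" and g :: "'a \<Rightarrow> 'b::metric_space"
  assumes "closed S" "continuous_on S g"
    and lim: "\<And>e. e > 0 \<Longrightarrow> \<exists>B. \<forall>x\<in>S. norm x > B \<longrightarrow> dist (g x) L < e"
  shows "continuous_map (Alexandroff_compactification (top_of_set S)) euclidean
           (\<lambda>x. case x of None \<Rightarrow> L | Some y \<Rightarrow> g y)" (is "continuous_map ?X _ ?h")
  unfolding continuous_map
proof (intro conjI allI impI)
  fix V :: "'b set" assume "openin euclidean V"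
  then have V: "open V" by simp
  show "openin ?X {x \<in> topspace ?X. ?h x \<in> V}"
  proof (cases "L \<in> V")
    case False
    then have "{x \<in> topspace ?X. ?h x \<in> V} = Some ` {x \<in> S. g x \<in> V}" by (auto split: option.splits)
    moreover have "openin (top_of_set S) {x \<in> S. g x \<in> V}"
      using continuous_openin_preimage_gen[OF assms(2) V] by (simp add: vimage_def Int_def)
    ultimately show ?thesis by simp
  next
    case True
    let ?C = "{x \<in> S. g x \<notin> V}"
    have eq: "{x \<in> topspace ?X. ?h x \<in> V} = insert None (Some ` (topspace (top_of_set S) - ?C))"
    proof (rule Set.set_eqI)
      fix x show "x \<in> {x \<in> topspace ?X. ?h x \<in> V} \<longleftrightarrow> x \<in> insert None (Some ` (topspace (top_of_set S) - ?C))"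
        using True by (cases x) auto
    qed
    have "openin (top_of_set S) (S - ?C)"
    proof -
      have "S - ?C = S \<inter> g -` V" by auto
      then show ?thesis using continuous_openin_preimage_gen[OF assms(2) V] by simp
    qed
    then have cl: "closedin (top_of_set S) ?C" by (simp add: closedin_def Collect_mono)
    then have "closed ?C" using assms(1) closedin_closed_trans by blast
    moreover have "bounded ?C"
    proof -
      obtain e where e: "e > 0" "ball L e \<subseteq> V" using V True by (meson open_contains_ball)
      obtain B where B: "\<forall>x\<in>S. norm x > B \<longrightarrow> dist (g x) L < e" using lim[OF e(1)] by blast
      have "norm x \<le> B" if "x \<in> ?C" for x
        using B e(2) that by (force simp: dist_commute)
      then show ?thesis unfolding bounded_iff by blast
    qed
    ultimately have "compact ?C" by (simp add: compact_eq_bounded_closed)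
    then have "compactin (top_of_set S) ?C" by (simp add: compactin_subtopology)
    then show ?thesis unfolding eq openin_Alexandroff_compactification using cl by blast
  qed
qed auto

lemma ballmap_continuous: "continuous_on S ballmap"
proof -
  have *: "hdenom x \<noteq> 0" for x using hdenom_pos[of x] by simp
  have "continuous_on S hdenom" unfolding hdenom_def by (intro continuous_intros)
  then show ?thesis unfolding ballmap_def by (intro continuous_intros) (simp_all add: *)
qed

lemma hgt_continuous: "continuous_on S hgt"
proof -
  have *: "hdenom x \<noteq> 0" for x using hdenom_pos[of x] by simp
  have "continuous_on S hdenom" unfolding hdenom_def by (intro continuous_intros)
  then show ?thesis unfolding hgt_def by (intro continuous_intros) (simp_all add: *)
qed

lemma ballmap_dist_pole: "(dist (ballmap x) (0, 1))\<^sup>2 \<le> 4 / hdenom x"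
proof -
  have p: "hdenom x \<noteq> 0" using hdenom_pos[of x] by simp
  have 1: "1 - ballmap x \<bullet> (0, 1) = 2 / hdenom x"
    using p by (simp add: ballmap_def divide_simps) (simp add: hdenom_def)
  have "(dist (ballmap x) (0, 1))\<^sup>2 = (norm (ballmap x))\<^sup>2 + 1 - 2 * (ballmap x \<bullet> (0, 1))"
    by (simp add: dist_norm power2_norm_eq_inner inner_diff inner_commute norm_Pair)
  also have "\<dots> \<le> 2 * (1 - ballmap x \<bullet> (0, 1))" by (simp add: norm_ballmap)
  finally show ?thesis unfolding 1 by simp
qed

lemma ballmap_at_infinity:
  assumes "e > 0"
  shows "\<exists>B. \<forall>x. norm x > B \<longrightarrow> dist (ballmap x) (0, 1) < e"
proof (intro exI allI impI)
  fix x :: "complex \<times> real" assume x: "norm x > 2 / e"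
  have "(2 / e)\<^sup>2 < (norm x)\<^sup>2" using x assms by (intro power_strict_mono) auto
  also have "\<dots> \<le> hdenom x" by (cases x) (simp add: hdenom_def norm_Pair)
  finally have "4 / hdenom x < e\<^sup>2" using assms hdenom_pos[of x] by (simp add: power_divide field_simps)
  then have "(dist (ballmap x) (0, 1))\<^sup>2 < e\<^sup>2" using ballmap_dist_pole[of x] by linarith
  then show "dist (ballmap x) (0, 1) < e" using assms by (simp add: power2_less_imp_less)
qed

lemma continuous_ballmap_opt: "continuous_map H3_bar euclidean ballmap_opt"
proof -
  have "closed {(z::complex, t::real). t \<ge> 0}"
  proof -
    have "{(z::complex, t::real). t \<ge> 0} = {x. snd x \<ge> 0}" by auto
    then show ?thesis by (simp add: closed_Collect_le continuous_on_const continuous_on_snd continuous_on_id)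
  qed
  then show ?thesis
    unfolding H3_bar_def ballmap_opt_def[abs_def]
    by (rule continuous_map_Alexandroff[OF _ ballmap_continuous]) (use ballmap_at_infinity in blast)
qed

lemma bdry_top_eq: "bdry_top = Alexandroff_compactification (top_of_set UNIV)"
  by (simp add: bdry_top_def)

lemma topspace_bdry_top [simp]: "topspace bdry_top = UNIV"
  by (simp add: bdry_top_def UNIV_option_conv)

lemma compact_space_bdry_top: "compact_space bdry_top"
  by (simp add: bdry_top_def)

lemma continuous_bdpt: "continuous_map bdry_top euclidean bdpt"
proof -
  have eq: "bdpt = (\<lambda>x. case x of None \<Rightarrow> (0,1) | Some w \<Rightarrow> ballmap (w, 0))"
    by (auto simp: bdpt_None bdpt_Some fun_eq_iff split: option.splits)
  have c: "continuous_on UNIV (\<lambda>w. ballmap (w, 0))"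
    by (rule continuous_on_compose2[OF ballmap_continuous[of UNIV]]) (auto intro!: continuous_intros)
  have l: "\<exists>B. \<forall>w\<in>UNIV. norm w > B \<longrightarrow> dist (ballmap (w, 0)) (0, 1) < e" if e: "e > 0" for e
  proof -
    obtain B where "\<forall>x. norm x > B \<longrightarrow> dist (ballmap x) (0, 1) < e" using ballmap_at_infinity[OF e] by blast
    then show ?thesis by (intro exI[of _ B]) (simp add: norm_Pair)
  qed
  show ?thesis unfolding eq bdry_top_eq by (rule continuous_map_Alexandroff[OF closed_UNIV c l])
qed

lemma continuous_bdpt_inc: "continuous_map bdry_top euclidean (\<lambda>\<xi>. bdpt (inc_bd \<xi>))"
proof -
  have eq: "(\<lambda>\<xi>. bdpt (inc_bd \<xi>)) = (\<lambda>x. case x of None \<Rightarrow> (0,1) | Some w \<Rightarrow> ballmap (of_real w, 0))"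
    by (auto simp: bdpt_None bdpt_Some fun_eq_iff split: option.splits)
  have c: "continuous_on UNIV (\<lambda>w. ballmap (of_real w, 0))"
    by (rule continuous_on_compose2[OF ballmap_continuous[of UNIV]]) (auto intro!: continuous_intros)
  have l: "\<exists>B. \<forall>w\<in>UNIV. norm (w::real) > B \<longrightarrow> dist (ballmap (of_real w, 0)) (0, 1) < e" if e: "e > 0" for e
  proof -
    obtain B where "\<forall>x. norm x > B \<longrightarrow> dist (ballmap x) (0, 1) < e" using ballmap_at_infinity[OF e] by blast
    then show ?thesis by (intro exI[of _ B]) (simp add: norm_Pair)
  qed
  show ?thesis unfolding eq bdry_top_eq by (rule continuous_map_Alexandroff[OF closed_UNIV c l])
qed

text \<open>The complement of a neighbourhood of \<open>x\<close> is compact, and so is its image,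
  which misses \<open>g x\<close>; values close to \<open>g x\<close> therefore come from the
  neighbourhood. This reduces convergence on the boundaries to convergence in the ball.\<close>

lemma limitin_of_separating:
  fixes g :: "'a \<Rightarrow> 'b::metric_space"
  assumes "compact_space X" "continuous_map X euclidean g" "x \<in> topspace X"
    and inj: "\<And>y. y \<in> topspace X \<Longrightarrow> g y = g x \<Longrightarrow> y = x"
    and s: "\<And>n. s n \<in> topspace X" "((\<lambda>n. g (s n)) \<longlongrightarrow> g x) F"
  shows "limitin X s x F"
  unfolding limitin_def
proof (intro conjI allI impI assms(3))
  fix U assume U: "openin X U \<and> x \<in> U"
  have "compactin X (topspace X - U)"
    using assms(1) U by (simp add: closedin_compact_space closedin_diff)
  then have "compact (g ` (topspace X - U))"
    using image_compactin[OF _ assms(2)] by simp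
  then have "closed (g ` (topspace X - U))" by (rule compact_imp_closed)
  moreover have "g x \<notin> g ` (topspace X - U)" using inj U by force
  ultimately have "eventually (\<lambda>n. g (s n) \<in> - g ` (topspace X - U)) F"
    using s(2) by (intro topological_tendstoD) auto
  then show "\<forall>\<^sub>F n in F. s n \<in> U"
    by (rule eventually_mono) (use s(1) in blast)
qed

lemma limitin_bdry_complex:
  "limitin bdry_top s x F \<longleftrightarrow> ((\<lambda>n. bdpt (s n)) \<longlongrightarrow> bdpt x) F"
proof
  assume "limitin bdry_top s x F"
  from continuous_map_limit[OF continuous_bdpt this] show "((\<lambda>n. bdpt (s n)) \<longlongrightarrow> bdpt x) F"
    by (simp add: o_def)
qed (rule limitin_of_separating[OF compact_space_bdry_top continuous_bdpt], auto simp: bdpt_inj)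

lemma inc_bd_inj: "inc_bd x = inc_bd y \<longleftrightarrow> x = y"
  by (cases x; cases y) auto

lemma limitin_bdry_real:
  "limitin bdry_top s x F \<longleftrightarrow> ((\<lambda>n. bdpt (inc_bd (s n))) \<longlongrightarrow> bdpt (inc_bd x)) F"
proof
  assume "limitin bdry_top s x F"
  from continuous_map_limit[OF continuous_bdpt_inc this] show "((\<lambda>n. bdpt (inc_bd (s n))) \<longlongrightarrow> bdpt (inc_bd x)) F"
    by (simp add: o_def)
qed (rule limitin_of_separating[OF compact_space_bdry_top continuous_bdpt_inc], auto simp: bdpt_inj inc_bd_inj)

lemma tendsto_bdpt_iff_chord:
  "((\<lambda>n. bdpt (s n)) \<longlongrightarrow> bdpt x) F \<longleftrightarrow> ((\<lambda>n. chord (s n) x) \<longlongrightarrow> 0) F"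
proof -
  have "((\<lambda>n. bdpt (s n)) \<longlongrightarrow> bdpt x) F \<longleftrightarrow> ((\<lambda>n. dist (bdpt (s n)) (bdpt x)) \<longlongrightarrow> 0) F"
    by (rule tendsto_dist_iff)
  also have "(\<lambda>n. dist (bdpt (s n)) (bdpt x)) = (\<lambda>n. 2 * sqrt (chord (s n) x))"
  proof
    fix n
    have "dist (bdpt (s n)) (bdpt x) = sqrt ((dist (bdpt (s n)) (bdpt x))\<^sup>2)" by simp
    also have "\<dots> = 2 * sqrt (chord (s n) x)" unfolding dist_bdpt by (simp add: real_sqrt_mult)
    finally show "dist (bdpt (s n)) (bdpt x) = 2 * sqrt (chord (s n) x)" .
  qed
  also have "((\<lambda>n. 2 * sqrt (chord (s n) x)) \<longlongrightarrow> 0) F \<longleftrightarrow> ((\<lambda>n. chord (s n) x) \<longlongrightarrow> 0) F"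
  proof
    assume "((\<lambda>n. 2 * sqrt (chord (s n) x)) \<longlongrightarrow> 0) F"
    from tendsto_power[OF this, of 2] have "((\<lambda>n. (2 * sqrt (chord (s n) x))\<^sup>2 / 4) \<longlongrightarrow> 0) F"
      using tendsto_divide[of "\<lambda>n. (2 * sqrt (chord (s n) x))\<^sup>2" 0 F "\<lambda>_. 4" 4] by simp
    then show "((\<lambda>n. chord (s n) x) \<longlongrightarrow> 0) F" by (simp add: power_mult_distrib chord_nonneg)
  next
    assume "((\<lambda>n. chord (s n) x) \<longlongrightarrow> 0) F"
    from tendsto_mult_right[OF tendsto_real_sqrt[OF this], of 2]
    show "((\<lambda>n. 2 * sqrt (chord (s n) x)) \<longlongrightarrow> 0) F" by (simp add: mult.commute)
  qed
  finally show ?thesis .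
qed

lemma chord_tendsto:
  assumes "((\<lambda>n. bdpt (s n)) \<longlongrightarrow> bdpt x) F" "((\<lambda>n. bdpt (t n)) \<longlongrightarrow> bdpt y) F"
  shows "((\<lambda>n. chord (s n) (t n)) \<longlongrightarrow> chord x y) F"
  unfolding chord_def by (intro tendsto_intros assms)  simp_all

section \<open>Cocompactness\<close>

lemma openin_PSL2_top:
  "openin PSL2_top (U :: ('a::{field,topological_space}^2^2) set set) \<longleftrightarrow>
     U \<subseteq> carrier PSL2 \<and> openin (top_of_set {A. det A = 1}) (\<Union>U)"
proof -
  interpret S: group "SL2 :: ('a^2^2) monoid" by (rule group_SL2)
  have "disjoint (carrier PSL2 :: ('a^2^2) set set)"
    unfolding PSL2_def FactGroup_def
    using S.rcos_disjoint[OF normal_imp_subgroup[OF normal_pm1]] by simp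
  then show ?thesis unfolding PSL2_top_def by (simp add: openin_quotient_topology) (simp add: SL2_def)
qed

lemma det_continuous_2: "continuous_on S (det :: 'a::{real_normed_field}^2^2 \<Rightarrow> 'a)"
  unfolding det_2[abs_def] by (intro continuous_intros)

lemma topspace_PSL2_top: "topspace PSL2_top = (carrier PSL2 :: ('a::real_normed_field^2^2) set set)"
proof -
  have "\<Union>(carrier PSL2 :: ('a^2^2) set set) = {A. det A = 1}"
  proof -
    have "det (- A) = det A" for A :: "'a^2^2" by (rule det_uminus_2)
    then show ?thesis by (auto simp: carrier_PSL2 psl_eq intro!: exI[of _ "{A, - A}" for A])
  qed
  then have "openin PSL2_top (carrier PSL2 :: ('a^2^2) set set)"
    by (simp add: openin_PSL2_top)
  moreover have "U \<subseteq> carrier PSL2" if "openin PSL2_top (U :: ('a^2^2) set set)" for U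
    using that by (simp add: openin_PSL2_top)
  ultimately show ?thesis unfolding topspace_def by blast
qed

lemma Union_PSL2: "A \<in> \<Union>U \<Longrightarrow> U \<subseteq> carrier PSL2 \<Longrightarrow> det A = 1 \<and> psl A \<in> U"
  for U :: "('a::field^2^2) set set"
proof -
  assume "A \<in> \<Union>U" "U \<subseteq> carrier PSL2"
  then obtain B where "det B = 1" "psl B \<in> U" "A \<in> psl B" by (auto simp: carrier_PSL2)
  then show ?thesis by (auto simp: psl_eq det_uminus_2 insert_commute)
qed

text \<open>The cosets that contain a matrix with entries below \<open>n\<close> form an increasing
  open cover of the compact quotient, so a single \<open>n\<close> suffices.\<close>

lemma lattice_cocompact:
  assumes "torsion_free_uniform_lattice \<Gamma>"
  shows "\<exists>M. \<forall>A. det A = 1 \<longrightarrow> (\<exists>\<gamma>\<in>\<Gamma>. \<exists>k. det k = 1 \<and> (\<forall>i j. \<bar>k$i$j\<bar> < M) \<and> psl A = \<gamma> \<otimes>\<^bsub>PSL2\<^esub> psl k)"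
proof -
  have sub: "subgroup \<Gamma> PSL2" and cpt: "compact_space (quotient_topology PSL2_top (rcosets\<^bsub>PSL2\<^esub> \<Gamma>))"
    using assms by (auto simp: torsion_free_uniform_lattice_def)
  interpret subgroup \<Gamma> PSL2 by (rule sub)
  let ?Q = "quotient_topology PSL2_top (rcosets\<^bsub>PSL2\<^esub> \<Gamma>)"
  have openQ: "openin ?Q \<U> \<longleftrightarrow> \<U> \<subseteq> rcosets\<^bsub>PSL2\<^esub> \<Gamma> \<and> openin PSL2_top (\<Union>\<U>)" for \<U>
    by (rule openin_quotient_topology) (rule PSL2.rcos_disjoint[OF sub])
  define O' where "O' n = {psl A | A. det A = 1 \<and> (\<forall>i j. \<bar>A$i$j\<bar> < real n)}" for n
  define W where "W n = {C \<in> rcosets\<^bsub>PSL2\<^esub> \<Gamma>. C \<inter> O' n \<noteq> {}}" for n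
  have O'c: "O' n \<subseteq> carrier PSL2" for n by (auto simp: O'_def)
  have UW: "\<Union>(W n) = {\<gamma> \<otimes>\<^bsub>PSL2\<^esub> u | \<gamma> u. \<gamma> \<in> \<Gamma> \<and> u \<in> O' n}" for n
  proof (intro equalityI subsetI)
    fix x assume "x \<in> \<Union>(W n)"
    then obtain C u where C: "C \<in> rcosets\<^bsub>PSL2\<^esub> \<Gamma>" "x \<in> C" "u \<in> C" "u \<in> O' n" by (auto simp: W_def)
    then obtain g where g: "g \<in> carrier PSL2" "C = \<Gamma> #>\<^bsub>PSL2\<^esub> g" by (auto simp: RCOSETS_def)
    have "C = \<Gamma> #>\<^bsub>PSL2\<^esub> u" using PSL2.repr_independence[of u \<Gamma> g] C g sub by simp
    then show "x \<in> {\<gamma> \<otimes>\<^bsub>PSL2\<^esub> u | \<gamma> u. \<gamma> \<in> \<Gamma> \<and> u \<in> O' n}" using C by (auto simp: r_coset_def)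
  next
    fix x assume "x \<in> {\<gamma> \<otimes>\<^bsub>PSL2\<^esub> u | \<gamma> u. \<gamma> \<in> \<Gamma> \<and> u \<in> O' n}"
    then obtain \<gamma> u where x: "x = \<gamma> \<otimes>\<^bsub>PSL2\<^esub> u" "\<gamma> \<in> \<Gamma>" "u \<in> O' n" by auto
    have u: "u \<in> carrier PSL2" using x O'c by auto
    have "\<Gamma> #>\<^bsub>PSL2\<^esub> u \<in> W n"
      using x u PSL2.rcos_self[OF u sub] by (auto simp: W_def RCOSETS_def)
    moreover have "x \<in> \<Gamma> #>\<^bsub>PSL2\<^esub> u" using x by (auto simp: r_coset_def)
    ultimately show "x \<in> \<Union>(W n)" by blast
  qed
  \<comment> \<open>The preimage in the matrices is a union of translates of an open box,
    intersected with \<open>SL2\<close>; this gives openness in both quotient topologies.\<close>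
  have UUW: "\<Union>(\<Union>(W n)) = (\<Union>\<gamma>\<in>\<Gamma>. {A. det A = 1} \<inter> {A. \<forall>i j. \<bar>(rep (inv\<^bsub>PSL2\<^esub> \<gamma>) ** A)$i$j\<bar> < real n})" for n
  proof (intro equalityI subsetI)
    fix A assume A: "A \<in> \<Union>(\<Union>(W n))"
    have sc: "\<Union>(W n) \<subseteq> carrier PSL2" unfolding UW using O'c mem_carrier by (auto intro!: PSL2.m_closed)
    have d: "det A = 1" "psl A \<in> \<Union>(W n)" using Union_PSL2[OF A sc] by auto
    then obtain \<gamma> u where g: "psl A = \<gamma> \<otimes>\<^bsub>PSL2\<^esub> u" "\<gamma> \<in> \<Gamma>" "u \<in> O' n" by (auto simp: UW)
    then obtain B where B: "u = psl B" "det B = 1" "\<forall>i j. \<bar>B$i$j\<bar> < real n" by (auto simp: O'_def)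
    have gc: "\<gamma> \<in> carrier PSL2" using g by simp
    have ic: "inv\<^bsub>PSL2\<^esub> \<gamma> \<in> carrier PSL2" using gc by simp
    have "psl (rep (inv\<^bsub>PSL2\<^esub> \<gamma>) ** A) = inv\<^bsub>PSL2\<^esub> \<gamma> \<otimes>\<^bsub>PSL2\<^esub> psl A"
      using mult_psl[of "rep (inv\<^bsub>PSL2\<^esub> \<gamma>)" A] d ic by (simp add: rep_spec)
    also have "\<dots> = psl B" unfolding g(1) using gc B
      by (simp flip: PSL2.m_assoc)
    finally have "rep (inv\<^bsub>PSL2\<^esub> \<gamma>) ** A = B \<or> rep (inv\<^bsub>PSL2\<^esub> \<gamma>) ** A = - B" by (simp add: psl_eq_iff)
    then have "\<forall>i j. \<bar>(rep (inv\<^bsub>PSL2\<^esub> \<gamma>) ** A)$i$j\<bar> < real n" using B by auto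
    then show "A \<in> (\<Union>\<gamma>\<in>\<Gamma>. {A. det A = 1} \<inter> {A. \<forall>i j. \<bar>(rep (inv\<^bsub>PSL2\<^esub> \<gamma>) ** A)$i$j\<bar> < real n})"
      using g d by auto
  next
    fix A assume "A \<in> (\<Union>\<gamma>\<in>\<Gamma>. {A. det A = 1} \<inter> {A. \<forall>i j. \<bar>(rep (inv\<^bsub>PSL2\<^esub> \<gamma>) ** A)$i$j\<bar> < real n})"
    then obtain \<gamma> where g: "\<gamma> \<in> \<Gamma>" "det A = 1" "\<forall>i j. \<bar>(rep (inv\<^bsub>PSL2\<^esub> \<gamma>) ** A)$i$j\<bar> < real n" by auto
    have gc: "\<gamma> \<in> carrier PSL2" using g by simp
    have ic: "inv\<^bsub>PSL2\<^esub> \<gamma> \<in> carrier PSL2" using gc by simp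
    have "psl (rep (inv\<^bsub>PSL2\<^esub> \<gamma>) ** A) \<in> O' n"
      using g ic by (auto simp: O'_def det_mul rep_spec)
    moreover have "\<gamma> \<otimes>\<^bsub>PSL2\<^esub> psl (rep (inv\<^bsub>PSL2\<^esub> \<gamma>) ** A) = psl A"
    proof -
      have "psl (rep (inv\<^bsub>PSL2\<^esub> \<gamma>) ** A) = inv\<^bsub>PSL2\<^esub> \<gamma> \<otimes>\<^bsub>PSL2\<^esub> psl A"
        using mult_psl[of "rep (inv\<^bsub>PSL2\<^esub> \<gamma>)" A] g ic by (simp add: rep_spec)
      then show ?thesis using gc g by (simp flip: PSL2.m_assoc)
    qed
    ultimately have "psl A \<in> \<Union>(W n)" unfolding UW mem_Collect_eq using g(1) by metis
    moreover have "A \<in> psl A" by (simp add: psl_eq)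
    ultimately show "A \<in> \<Union>(\<Union>(W n))" by (rule UnionI)
  qed
  have ent: "open {A :: real^2^2. \<forall>i j. \<bar>(R ** A)$i$j\<bar> < r}" for R r
  proof -
    have "{A :: real^2^2. \<forall>i j. \<bar>(R ** A)$i$j\<bar> < r} = (\<Inter>i. \<Inter>j. {A. \<bar>(R ** A)$i$j\<bar> < r})" by auto
    moreover have "open {A :: real^2^2. \<bar>(R ** A)$i$j\<bar> < r}" for i j
      unfolding matrix_matrix_mult_def
      by (intro open_Collect_less continuous_intros)
    ultimately show ?thesis by (auto intro!: open_INT)
  qed
  have opW: "openin ?Q (W n)" for n
    unfolding openQ openin_PSL2_top
  proof (intro conjI)
    show "W n \<subseteq> rcosets\<^bsub>PSL2\<^esub> \<Gamma>" by (auto simp: W_def)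
    show "\<Union>(W n) \<subseteq> carrier PSL2" unfolding UW using O'c mem_carrier by (auto intro!: PSL2.m_closed)
    show "openin (top_of_set {A. det A = 1}) (\<Union>(\<Union>(W n)))"
      unfolding UUW by (intro openin_Union) (auto intro!: openin_open_Int ent)
  qed
  have "topspace ?Q \<subseteq> \<Union>(range W)"
  proof
    fix C assume "C \<in> topspace ?Q"
    then have C: "C \<in> rcosets\<^bsub>PSL2\<^esub> \<Gamma>" using openQ by (auto simp: topspace_def)
    then obtain g where g: "g \<in> carrier PSL2" "C = \<Gamma> #>\<^bsub>PSL2\<^esub> g" by (auto simp: RCOSETS_def)
    obtain n where n: "(\<Sum>i\<in>UNIV. \<Sum>j\<in>UNIV. \<bar>rep g$i$j\<bar>) < real n" using reals_Archimedean2 by blast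
    have "\<bar>rep g$i$j\<bar> < real n" for i j
    proof -
      have "\<bar>rep g$i$j\<bar> \<le> (\<Sum>j\<in>UNIV. \<bar>rep g$i$j\<bar>)" by (rule member_le_sum) auto
      also have "\<dots> \<le> (\<Sum>i\<in>UNIV. \<Sum>j\<in>UNIV. \<bar>rep g$i$j\<bar>)"
        by (rule member_le_sum[where f = "\<lambda>i. \<Sum>j\<in>UNIV. \<bar>rep g$i$j\<bar>"]) (auto intro: sum_nonneg)
      finally show ?thesis using n by simp
    qed
    then have "g \<in> O' n" using rep_spec[OF g(1)] by (auto simp: O'_def intro!: exI[of _ "rep g"])
    then have "C \<in> W n" using C g PSL2.rcos_self[OF g(1) sub] by (auto simp: W_def)
    then show "C \<in> \<Union>(range W)" by blast
  qed
  then obtain \<F> where \<F>: "finite \<F>" "\<F> \<subseteq> range W" "topspace ?Q \<subseteq> \<Union>\<F>"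
    using cpt[unfolded compact_space_alt, rule_format, of "range W"] opW by auto
  then obtain I where I: "finite I" "\<F> = W ` I" by (meson finite_subset_image)
  have mono: "W m \<subseteq> W n" if "m \<le> n" for m n
  proof -
    have "\<bar>a\<bar> < real n" if "\<bar>a\<bar> < real m" for a
      using that \<open>m \<le> n\<close> by (meson less_le_trans of_nat_mono)
    then have "O' m \<subseteq> O' n" unfolding O'_def by blast
    then show ?thesis by (auto simp: W_def)
  qed
  define N where "N = Max (insert 0 I)"
  have all: "topspace ?Q \<subseteq> W N"
  proof
    fix C assume "C \<in> topspace ?Q"
    then obtain i where "i \<in> I" "C \<in> W i" using \<F> I by auto
    then show "C \<in> W N" using mono[of i N] I by (auto simp: N_def)
  qed
  show ?thesis
  proof (intro exI[of _ "real N"] allI impI)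
    fix A :: "real^2^2" assume A: "det A = 1"
    have "openin ?Q (rcosets\<^bsub>PSL2\<^esub> \<Gamma>)"
      using PSL2.rcosets_part_G[OF sub] openQ topspace_PSL2_top
      by (metis openin_topspace subset_refl)
    then have "\<Gamma> #>\<^bsub>PSL2\<^esub> psl A \<in> topspace ?Q"
      using A openin_subset by (fastforce simp: RCOSETS_def)
    then have "\<Gamma> #>\<^bsub>PSL2\<^esub> psl A \<in> W N" using all by blast
    then have "psl A \<in> \<Union>(W N)" using PSL2.rcos_self[of "psl A", OF _ sub] A by auto
    then show "\<exists>\<gamma>\<in>\<Gamma>. \<exists>k. det k = 1 \<and> (\<forall>i j. \<bar>k$i$j\<bar> < real N) \<and> psl A = \<gamma> \<otimes>\<^bsub>PSL2\<^esub> psl k"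
      unfolding UW by (auto simp: O'_def)
  qed
qed

section \<open>Generic boundary points of a uniform lattice\<close>

lemma inc_H2_snd [simp]: "snd (inc_H2 z) = Im z" "fst (inc_H2 z) = of_real (Re z)"
  by (simp_all add: inc_H2_def)

text \<open>The eigenvalues are \<open>l\<close> and \<open>1 / l\<close>. They differ because
  \<open>l^2 \<noteq> 1\<close>, so there is a second eigenline.\<close>

lemma second_fixed_point:
  fixes A :: "'a::field^2^2"
  assumes "det A = 1" and e: "A$1$1 * hx b + A$1$2 * hy b = l * hx b" "A$2$1 * hx b + A$2$2 * hy b = l * hy b"
    and "l\<^sup>2 \<noteq> 1"
  shows "\<exists>b'. b' \<noteq> b \<and> mobius_bdry A b' = b'"
proof -
  define a \<beta> c d where abcd: "a = A$1$1" "\<beta> = A$1$2" "c = A$2$1" "d = A$2$2"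
  have D: "a * d - \<beta> * c = 1" using assms(1) by (simp add: det_2 abcd)
  define x y where "x = hx b" and "y = hy b"
  have e1: "(a - l) * x + \<beta> * y = 0" and e2: "c * x + (d - l) * y = 0"
    using e by (simp_all add: abcd x_def y_def algebra_simps)
  have nz: "x \<noteq> 0 \<or> y \<noteq> 0" using hx_hy_nz[of b] by (simp add: x_def y_def)
  have "((a - l) * (d - l) - \<beta> * c) * x = 0"
    using e1 e2 by algebra
  moreover have "((a - l) * (d - l) - \<beta> * c) * y = 0"
    using e1 e2 by algebra
  ultimately have ch: "(a - l) * (d - l) - \<beta> * c = 0" using nz by auto
  then have ch': "l * (a + d - l) = 1" using D by algebra
  define m where "m = a + d - l"
  have lm: "l * m = 1" using ch' by (simp add: m_def)
  then have m0: "m \<noteq> 0" by auto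
  have lm': "l \<noteq> m" using lm assms(4) by (auto simp: power2_eq_square)
  \<comment> \<open>By Cayley-Hamilton the columns of \<open>A - l\<close> are eigenvectors for the
    other eigenvalue \<open>m\<close>; if the first column vanishes, the second does not, since
    \<open>l \<noteq> m\<close>.\<close>
  obtain p q where pq: "p \<noteq> 0 \<or> q \<noteq> 0" "a * p + \<beta> * q = m * p" "c * p + d * q = m * q"
  proof (cases "a - l = 0 \<and> c = 0")
    case False
    show ?thesis
      by (rule that[of "a - l" c]) (use False ch in \<open>auto simp: m_def algebra_simps\<close>)
  next
    case True
    have "\<beta> \<noteq> 0 \<or> d - l \<noteq> 0" using True lm' by (auto simp: m_def)
    then show ?thesis
      by (intro that[of \<beta> "d - l"]) (use True ch in \<open>auto simp: m_def algebra_simps\<close>)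
  qed
  define b' where "b' = (if q = 0 then None else Some (p / q))"
  have "mobius_bdry A b' = b'"
  proof (cases "q = 0")
    case True
    then have "c = 0" using pq by auto
    then show ?thesis using True by (simp add: b'_def mobius_bdry_def abcd)
  next
    case False
    have 1: "c * (p / q) + d = m" using pq(3) False by (simp add: field_simps)
    have "a * (p / q) + \<beta> = m * (p / q)" using pq(2) False by (simp add: field_simps)
    then show ?thesis using False 1 m0 by (simp add: b'_def mobius_bdry_def abcd)
  qed
  moreover have "b' \<noteq> b"
  proof
    assume "b' = b"
    then have "\<exists>s. s \<noteq> 0 \<and> p = s * x \<and> q = s * y"
      using pq(1) by (auto simp: b'_def x_def y_def split: if_splits)
    then obtain s where s: "s \<noteq> 0" "p = s * x" "q = s * y" by auto
    have "(l - m) * p = 0" "(l - m) * q = 0"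
      using e1 e2 pq(2,3) s by algebra+
    then show False using pq(1) lm' by auto
  qed
  ultimately show ?thesis by blast
qed

lemma sg_le: "sg A \<xi> \<le> (cmod (A$1$1))\<^sup>2 + (cmod (A$1$2))\<^sup>2 + (cmod (A$2$1))\<^sup>2 + (cmod (A$2$2))\<^sup>2"
proof -
  have cs: "(cmod (a * x + b * y))\<^sup>2 \<le> ((cmod a)\<^sup>2 + (cmod b)\<^sup>2) * ((cmod x)\<^sup>2 + (cmod y)\<^sup>2)" for a b x y :: complex
  proof -
    have "cmod (a * x + b * y) \<le> cmod a * cmod x + cmod b * cmod y"
      using norm_triangle_ineq[of "a * x" "b * y"] by (simp add: norm_mult)
    then have "(cmod (a * x + b * y))\<^sup>2 \<le> (cmod a * cmod x + cmod b * cmod y)\<^sup>2"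
      by (intro power_mono) auto
    also have "\<dots> \<le> ((cmod a)\<^sup>2 + (cmod b)\<^sup>2) * ((cmod x)\<^sup>2 + (cmod y)\<^sup>2)"
    proof -
      have "((cmod a)\<^sup>2 + (cmod b)\<^sup>2) * ((cmod x)\<^sup>2 + (cmod y)\<^sup>2) - (cmod a * cmod x + cmod b * cmod y)\<^sup>2
        = (cmod a * cmod y - cmod b * cmod x)\<^sup>2" by (simp add: power2_eq_square algebra_simps)
      then show ?thesis by (smt (verit) zero_le_power2)
    qed
    finally show ?thesis .
  qed
  show ?thesis
    unfolding sg_def using cs[of "A$1$1" "hx \<xi>" "A$1$2" "hy \<xi>"] cs[of "A$2$1" "hx \<xi>" "A$2$2" "hy \<xi>"] hn_pos[of \<xi>]
    by (simp add: divide_le_eq hn_def distrib_right)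
qed

text \<open>A set with holes of definite proportion at every small scale has no density points.\<close>

lemma porous_negligible:
  fixes A :: "real set"
  assumes "closed A" "0 < C" "0 < c" "0 < r0"
    and hole: "\<And>x r. 0 < r \<Longrightarrow> r < r0 \<Longrightarrow> \<exists>p q. x - C * r \<le> p \<and> q \<le> x + C * r \<and> c * r \<le> q - p \<and> {p..q} \<inter> A = {}"
  shows "negligible A"
proof -
  \<comment> \<open>The proportion of an interval of length \<open>2 * C * r\<close> that the hole
    at scale \<open>r\<close> is guaranteed to fill.\<close>
  define \<theta> where "\<theta> = c / (2 * C)"
  have \<theta>: "\<theta> > 0" using assms by (simp add: \<theta>_def)
  have lm: "A \<inter> {a..b} \<in> lmeasurable" for a b
    by (intro lmeasurable_compact closed_Int_compact assms(1)) simp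
  have holeI: "\<exists>p q. a \<le> p \<and> p \<le> q \<and> q \<le> b \<and> \<theta> * (b - a) \<le> q - p \<and> {p..q} \<inter> A = {}"
    if ab: "a < b" "b - a < 2 * C * r0" for a b
  proof -
    define r where "r = (b - a) / (2 * C)"
    have r: "0 < r" "r < r0" using ab assms by (simp_all add: r_def field_simps)
    have Cr: "C * r = (b - a) / 2" using assms by (simp add: r_def field_simps)
    have cr: "c * r = \<theta> * (b - a)" by (simp add: r_def \<theta>_def)
    obtain p q where pq: "(a + b) / 2 - C * r \<le> p \<and> q \<le> (a + b) / 2 + C * r \<and> c * r \<le> q - p \<and> {p..q} \<inter> A = {}"
      using hole[OF r] by blast
    have "\<theta> * (b - a) > 0" using \<theta> ab by simp
    then have "a \<le> p" "p \<le> q" "q \<le> b" "\<theta> * (b - a) \<le> q - p" "{p..q} \<inter> A = {}"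
      using pq unfolding Cr cr by (auto simp: field_simps)
    then show ?thesis by blast
  qed
  have \<theta>1: "\<theta> \<le> 1"
  proof -
    have "0 < C * r0" "C * r0 < 2 * C * r0" using assms by simp_all
    then obtain p q where "0 \<le> p" "q \<le> C * r0" "\<theta> * (C * r0 - 0) \<le> q - p" using holeI[of 0 "C * r0"] by auto
    then have "\<theta> * (C * r0) \<le> 1 * (C * r0)" by simp
    then show ?thesis using \<open>0 < C * r0\<close> by (rule mult_right_le_imp_le)
  qed
  \<comment> \<open>Removing a hole and recursing into the two remaining pieces gains a factor
    \<open>1 - \<theta>\<close> per generation.\<close>
  have main: "measure lebesgue (A \<inter> {a..b}) \<le> (1 - \<theta>) ^ n * (b - a)" if "a \<le> b" "b - a < 2 * C * r0" for a b n
    using that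
  proof (induction n arbitrary: a b)
    case 0
    have "measure lebesgue (A \<inter> {a..b}) \<le> measure lebesgue {a..b}"
      using lm by (intro measure_mono_fmeasurable) (auto dest: fmeasurableD)
    then show ?case using 0 by simp
  next
    case (Suc n)
    show ?case
    proof (cases "a = b")
      case True
      have "negligible (A \<inter> {b})" by (rule negligible_subset[of "{b}"]) auto
      then have "measure lebesgue (A \<inter> {b}) = 0" by (rule negligible_imp_measure0)
      then show ?thesis using True by simp
    next
      case False
      then obtain p q where pq: "a \<le> p" "p \<le> q" "q \<le> b" "\<theta> * (b - a) \<le> q - p" "{p..q} \<inter> A = {}"
        using holeI[of a b] Suc.prems by auto
      have "A \<inter> {a..b} \<subseteq> (A \<inter> {a..p}) \<union> (A \<inter> {q..b})"
      proof
        fix x assume x: "x \<in> A \<inter> {a..b}"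
        then have "x \<notin> {p..q}" using pq(5) by blast
        then show "x \<in> (A \<inter> {a..p}) \<union> (A \<inter> {q..b})" using x by auto
      qed
      then have "measure lebesgue (A \<inter> {a..b}) \<le> measure lebesgue ((A \<inter> {a..p}) \<union> (A \<inter> {q..b}))"
        using lm by (intro measure_mono_fmeasurable) (auto dest: fmeasurableD)
      also have "\<dots> \<le> measure lebesgue (A \<inter> {a..p}) + measure lebesgue (A \<inter> {q..b})"
        using lm by (intro measure_Un_le) (auto dest: fmeasurableD)
      also have "\<dots> \<le> (1 - \<theta>) ^ n * (p - a) + (1 - \<theta>) ^ n * (b - q)"
        using Suc.IH[of a p] Suc.IH[of q b] pq Suc.prems by simp
      also have "\<dots> = (1 - \<theta>) ^ n * (p - a + (b - q))" by (simp add: algebra_simps)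
      also have "\<dots> \<le> (1 - \<theta>) ^ n * ((1 - \<theta>) * (b - a))"
        using pq \<theta>1 by (intro mult_left_mono) (auto simp: algebra_simps)
      finally show ?thesis by (simp add: mult_ac)
    qed
  qed
  have null: "negligible (A \<inter> {a..b})" if ab: "a \<le> b" "b - a < 2 * C * r0" for a b
  proof -
    have "(\<lambda>n. (1 - \<theta>) ^ n * (b - a)) \<longlonglongrightarrow> 0 * (b - a)"
      using \<theta> \<theta>1 by (intro tendsto_mult LIMSEQ_power_zero tendsto_const) auto
    then have "measure lebesgue (A \<inter> {a..b}) \<le> 0"
      using main[OF ab] by (intro LIMSEQ_le_const[of _ 0]) auto
    then have "measure lebesgue (A \<inter> {a..b}) = 0" by (simp add: antisym)
    then show ?thesis using lm negligible_iff_measure by blast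
  qed
  define s where "s = C * r0"
  have s: "s > 0" using assms by (simp add: s_def)
  have "A \<subseteq> (\<Union>n::int. A \<inter> {of_int n * s .. of_int n * s + s})"
  proof
    fix x assume x: "x \<in> A"
    have "of_int \<lfloor>x / s\<rfloor> \<le> x / s" "x / s \<le> of_int \<lfloor>x / s\<rfloor> + 1" by linarith+
    then have "of_int \<lfloor>x / s\<rfloor> * s \<le> x" "x \<le> of_int \<lfloor>x / s\<rfloor> * s + s"
      unfolding pos_le_divide_eq[OF s] pos_divide_le_eq[OF s] by (simp_all add: distrib_right)
    then show "x \<in> (\<Union>n::int. A \<inter> {of_int n * s .. of_int n * s + s})" using x by auto
  qed
  moreover have "negligible (\<Union>n::int. A \<inter> {of_int n * s .. of_int n * s + s})"
    by (intro negligible_countable_Union) (use null s in \<open>auto simp: s_def\<close>)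
  ultimately show ?thesis using negligible_subset by blast
qed

section \<open>Consequences of discreteness and cocompactness\<close>

locale lattice =
  fixes \<Gamma> :: "(real^2^2) set set"
  assumes lattice: "torsion_free_uniform_lattice \<Gamma>"
begin

lemma subgroup: "subgroup \<Gamma> PSL2"
  using lattice by (simp add: torsion_free_uniform_lattice_def)

lemma in_carrier [simp]: "\<gamma> \<in> \<Gamma> \<Longrightarrow> \<gamma> \<in> carrier PSL2"
  using subgroup.mem_carrier[OF subgroup] .

lemma mult_in [simp]: "\<gamma> \<in> \<Gamma> \<Longrightarrow> \<delta> \<in> \<Gamma> \<Longrightarrow> \<gamma> \<otimes>\<^bsub>PSL2\<^esub> \<delta> \<in> \<Gamma>"
  using subgroup.m_closed[OF subgroup] .

lemma inv_in [simp]: "\<gamma> \<in> \<Gamma> \<Longrightarrow> inv\<^bsub>PSL2\<^esub> \<gamma> \<in> \<Gamma>"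
  using subgroup.m_inv_closed[OF subgroup] .

lemma one_in [simp]: "\<one>\<^bsub>PSL2\<^esub> \<in> \<Gamma>"
  using subgroup.one_closed[OF subgroup] .

lemma discrete:
  assumes "A \<longlonglongrightarrow> mat 1" "\<And>n. det (A n) = 1" "\<And>n. psl (A n) \<in> \<Gamma>"
  shows "\<forall>\<^sub>F n in sequentially. psl (A n) = psl (mat 1)"
proof -
  have "subtopology PSL2_top \<Gamma> = discrete_topology \<Gamma>"
    using lattice by (simp add: torsion_free_uniform_lattice_def)
  then have "openin (subtopology PSL2_top \<Gamma>) {psl (mat 1)}"
    using one_in by (simp add: PSL2_one)
  then obtain T where T: "openin PSL2_top T" "{psl (mat 1)} = T \<inter> \<Gamma>" by (auto simp: openin_subtopology)
  then have "T \<subseteq> carrier PSL2" "openin (top_of_set {A. det A = 1}) (\<Union>T)" by (simp_all add: openin_PSL2_top)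
  then obtain W where W: "open W" "\<Union>T = {A. det A = 1} \<inter> W" by (auto simp: openin_open)
  have "mat 1 \<in> \<Union>T" using T(2) by (auto simp: psl_eq)
  then have "\<forall>\<^sub>F n in sequentially. A n \<in> W" using W assms(1) by (intro topological_tendstoD) auto
  then show ?thesis
  proof (rule eventually_mono)
    fix n assume "A n \<in> W"
    then have "A n \<in> \<Union>T" using W assms(2) by auto
    then have "psl (A n) \<in> T" using Union_PSL2 \<open>T \<subseteq> carrier PSL2\<close> by blast
    then show "psl (A n) = psl (mat 1)" using T(2) assms(3)[of n] by blast
  qed
qed

lemma compact_K: "compact {k :: real^2^2. det k = 1 \<and> (\<forall>i j. \<bar>k$i$j\<bar> \<le> M)}"
proof -
  have "closed {k :: real^2^2. det k = 1}"
    by (intro closed_Collect_eq det_continuous_2 continuous_on_const)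
  moreover have "closed {k :: real^2^2. \<bar>k$i$j\<bar> \<le> M}" for i j
    by (intro closed_Collect_le continuous_intros)
  moreover have "{k :: real^2^2. det k = 1 \<and> (\<forall>i j. \<bar>k$i$j\<bar> \<le> M)} = {k. det k = 1} \<inter> (\<Inter>i. \<Inter>j. {k. \<bar>k$i$j\<bar> \<le> M})" by auto
  ultimately have "closed {k :: real^2^2. det k = 1 \<and> (\<forall>i j. \<bar>k$i$j\<bar> \<le> M)}"
    by (auto intro!: closed_Int closed_INT)
  moreover have "bounded {k :: real^2^2. det k = 1 \<and> (\<forall>i j. \<bar>k$i$j\<bar> \<le> M)}"
  proof -
    have "norm k \<le> (\<Sum>i\<in>(UNIV::2 set). \<Sum>j\<in>(UNIV::2 set). M)" if "\<forall>i j. \<bar>k$i$j\<bar> \<le> M" for k :: "real^2^2"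
    proof -
      have "norm k \<le> (\<Sum>i\<in>UNIV. norm (k$i))" by (simp add: norm_vec_def L2_set_le_sum)
      also have "\<dots> \<le> (\<Sum>i\<in>UNIV. \<Sum>j\<in>UNIV. \<bar>k$i$j\<bar>)"
        by (intro sum_mono) (metis norm_le_l1_cart)
      also have "\<dots> \<le> (\<Sum>i\<in>(UNIV::2 set). \<Sum>j\<in>(UNIV::2 set). M)" using that by (intro sum_mono) auto
      finally show ?thesis .
    qed
    then show ?thesis unfolding bounded_iff by blast
  qed
  ultimately show ?thesis by (simp add: compact_eq_bounded_closed)
qed

lemma H2_cocompact: "\<exists>K. compact K \<and> K \<subseteq> H2 \<and> (\<forall>z\<in>H2. \<exists>\<gamma>\<in>\<Gamma>. \<exists>w\<in>K. z = act_H2 \<gamma> w)"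
proof -
  obtain M where M: "\<And>A. det A = 1 \<Longrightarrow> \<exists>\<gamma>\<in>\<Gamma>. \<exists>k. det k = 1 \<and> (\<forall>i j. \<bar>k$i$j\<bar> < M) \<and> psl A = \<gamma> \<otimes>\<^bsub>PSL2\<^esub> psl k"
    using lattice_cocompact[OF lattice] by blast
  let ?K = "{k :: real^2^2. det k = 1 \<and> (\<forall>i j. \<bar>k$i$j\<bar> \<le> M)}"
  have nz: "of_real (k$2$1) * \<i> + of_real (k$2$2) \<noteq> (0::complex)" if "det k = 1" for k :: "real^2^2"
    using mobius_H2_denom[OF that, of \<i>] by simp
  have "continuous_on ?K (\<lambda>k. mobius_H2 k \<i>)"
    unfolding mobius_H2_def by (intro continuous_intros) (use nz in auto)
  then have "compact ((\<lambda>k. mobius_H2 k \<i>) ` ?K)" by (rule compact_continuous_image[OF _ compact_K])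
  moreover have "(\<lambda>k. mobius_H2 k \<i>) ` ?K \<subseteq> H2" by (auto simp: H2_def intro!: mobius_H2_pos)
  moreover have "\<exists>\<gamma>\<in>\<Gamma>. \<exists>w\<in>(\<lambda>k. mobius_H2 k \<i>) ` ?K. z = act_H2 \<gamma> w" if z: "z \<in> H2" for z
  proof -
    have y: "Im z > 0" using z by (simp add: H2_def)
    \<comment> \<open>The upper triangular matrix that takes \<open>\<i>\<close> to
      \<open>z\<close>.\<close>
    define A :: "real^2^2" where "A = mat2 (sqrt (Im z)) (Re z / sqrt (Im z)) 0 (1 / sqrt (Im z))"
    have A: "det A = 1" using y by (simp add: A_def det_2)
    have s0: "complex_of_real (sqrt (Im z)) \<noteq> 0" using y by simp
    have "mobius_H2 A \<i> = of_real (sqrt (Im z)) * (of_real (sqrt (Im z)) * \<i> + of_real (Re z / sqrt (Im z)))"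
      using s0 by (simp add: A_def mobius_H2_def field_simps)
    also have "\<dots> = of_real (sqrt (Im z) * sqrt (Im z)) * \<i> + of_real (Re z)"
      unfolding of_real_mult of_real_divide using s0 by (simp add: algebra_simps)
    also have "\<dots> = z" using y by (simp add: complex_eq_iff)
    finally have Az: "mobius_H2 A \<i> = z" .
    obtain \<gamma> k where g: "\<gamma> \<in> \<Gamma>" "det k = 1" "\<forall>i j. \<bar>k$i$j\<bar> < M" "psl A = \<gamma> \<otimes>\<^bsub>PSL2\<^esub> psl k"
      using M[OF A] by blast
    have "z = act_H2 (psl A) \<i>" by (simp add: act_psl Az)
    also have "\<dots> = act_H2 \<gamma> (act_H2 (psl k) \<i>)" unfolding g(4) using g by (intro act_H2_mult) auto
    finally have "z = act_H2 \<gamma> (mobius_H2 k \<i>)" by (simp add: act_psl)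
    moreover have "k \<in> ?K" using g(2,3) by (auto intro: less_imp_le)
    ultimately show ?thesis using g(1) by blast
  qed
  ultimately show ?thesis by (intro exI[of _ "(\<lambda>k. mobius_H2 k \<i>) ` ?K"]) (intro conjI ballI)
qed

lemma invariant_bounded:
  assumes "continuous_on H2 h" "\<And>\<gamma> z. \<gamma> \<in> \<Gamma> \<Longrightarrow> z \<in> H2 \<Longrightarrow> h (act_H2 \<gamma> z) = (h z :: real)"
  shows "\<exists>B. \<forall>z\<in>H2. h z \<le> B"
proof -
  obtain K where K: "compact K" "K \<subseteq> H2" "\<forall>z\<in>H2. \<exists>\<gamma>\<in>\<Gamma>. \<exists>w\<in>K. z = act_H2 \<gamma> w"
    using H2_cocompact by (elim exE conjE)
  have "compact (h ` K)" using K assms(1) by (meson compact_continuous_image continuous_on_subset)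
  then obtain B where B: "\<And>w. w \<in> K \<Longrightarrow> h w \<le> B"
    by (meson bounded_imp_bdd_above bdd_above.E compact_imp_bounded imageI)
  have "h z \<le> B" if z: "z \<in> H2" for z
  proof -
    obtain \<gamma> w where "\<gamma> \<in> \<Gamma>" "w \<in> K" "z = act_H2 \<gamma> w" using K(3) z by blast
    then show ?thesis using assms(2) B K(2) by (simp add: subset_iff)
  qed
  then show ?thesis by blast
qed

section \<open>No boundary point is fixed by the whole lattice\<close>

lemma poisson_inc_continuous: "continuous_on H2 (\<lambda>z. poisson (inc_H2 z) \<xi>)"
proof -
  have "hgt (inc_H2 z) \<noteq> 0" if "z \<in> H2" for z
    using that hdenom_pos[of "inc_H2 z"] by (simp add: hgt_def H2_def)
  moreover have "continuous_on H2 inc_H2" unfolding inc_H2_def by (intro continuous_intros)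
  ultimately show ?thesis unfolding poisson_def
    by (intro continuous_intros continuous_on_compose2[OF ballmap_continuous[of UNIV]]
        continuous_on_compose2[OF hgt_continuous[of UNIV]]) auto
qed

lemma poisson_inc_act:
  assumes "\<gamma> \<in> \<Gamma>" "z \<in> H2" "act_bdry \<gamma> b = b"
  shows "poisson (inc_H2 (act_H2 \<gamma> z)) (inc_bd b) * sgp (cpsl \<gamma>) (inc_bd b) = poisson (inc_H2 z) (inc_bd b)"
proof -
  have "act_bdry (cpsl \<gamma>) (inc_bd b) = inc_bd b" using assms by (simp add: act_bdry_cpsl)
  then show ?thesis
    using poisson_act[of "cpsl \<gamma>" "inc_H2 z" "inc_bd b"] assms
    by (simp add: cpsl_carrier act_H3_cpsl H2_def)
qed

text \<open>A geodesic ending at \<open>y\<close> leaves every horoball based at a different point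
  \<open>b\<close>, and \<open>poisson\<close> then grows at least like the inverse of the height.
  This contradicts the bounds from \<open>invariant_bounded\<close>.\<close>

lemma poisson_inc_lower:
  assumes "Some y \<noteq> b"
  shows "\<exists>c>0. \<forall>t>0. c / t \<le> poisson (inc_H2 (Complex y t)) (inc_bd b)"
proof -
  let ?x = "inc_bd b"
  have "hx ?x - of_real y * hy ?x \<noteq> 0" using assms by (cases b) auto
  then have p: "(cmod (hx ?x - of_real y * hy ?x))\<^sup>2 / hn ?x > 0" using hn_pos[of ?x] by simp
  have "(cmod (hx ?x - of_real y * hy ?x))\<^sup>2 / hn ?x / t \<le> poisson (inc_H2 (Complex y t)) ?x" if "t > 0" for t
    using that hn_pos[of ?x] by (simp add: inc_H2_def poisson_eq divide_simps)
  then show ?thesis using p by blast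
qed

text \<open>Invariance of \<open>chord\<close>, applied to a pair of fixed points: expansion at one
  of them is contraction at the other.\<close>

lemma fixed_sgp:
  assumes "\<gamma> \<in> \<Gamma>" "act_bdry \<gamma> b = b" "act_bdry \<gamma> b' = b'" "b \<noteq> b'"
  shows "sgp (cpsl \<gamma>) (inc_bd b) * sgp (cpsl \<gamma>) (inc_bd b') = 1"
proof -
  have "chord (inc_bd b) (inc_bd b') > 0" using assms(4) by (simp add: chord_pos inc_bd_inj)
  moreover have "chord (inc_bd b) (inc_bd b') * sgp (cpsl \<gamma>) (inc_bd b) * sgp (cpsl \<gamma>) (inc_bd b') = chord (inc_bd b) (inc_bd b')"
    using chord_act[of "cpsl \<gamma>" "inc_bd b" "inc_bd b'"] assms by (simp add: cpsl_carrier act_bdry_cpsl)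
  ultimately show ?thesis by (simp add: mult.assoc)
qed

text \<open>The parabolic elements fixing \<open>b\<close>.\<close>

definition transv :: "real option \<Rightarrow> real \<Rightarrow> real^2^2" where
  "transv b r = mat2 (1 - r * hx b * hy b) (r * (hx b)\<^sup>2) (- r * (hy b)\<^sup>2) (1 + r * hx b * hy b)"

lemma transv_det: "det (transv b r) = 1"
  by (simp add: transv_def det_2 algebra_simps power2_eq_square)

text \<open>\<open>transv b r\<close> is the identity plus \<open>r\<close> times the rank-one
  matrix \<open>v * w^T\<close> with \<open>v = (hx b, hy b)\<close> and
  \<open>w = (- hy b, hx b)\<close>. If \<open>v\<close> is an eigenvector of \<open>A\<close> for
  \<open>l\<close>, conjugation multiplies the column and the row factor by \<open>l\<close>
  each.\<close>

lemma transv_conj: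
  assumes "det A = 1" "A$1$1 * hx b + A$1$2 * hy b = l * hx b" "A$2$1 * hx b + A$2$2 * hy b = l * hy b"
  shows "A ** transv b r = transv b (l\<^sup>2 * r) ** A"
proof -
  define a \<beta> c d x y where s: "a = A$1$1" "\<beta> = A$1$2" "c = A$2$1" "d = A$2$2" "x = hx b" "y = hy b"
  have D: "a * d - \<beta> * c = 1" using assms(1) by (simp add: det_2 s)
  have e: "a * x + \<beta> * y = l * x" "c * x + d * y = l * y" using assms by (simp_all add: s)
  have i: "l * (d * x - \<beta> * y) = x" "l * (a * y - c * x) = y"
    using D e by algebra+
  have "(A ** transv b r) $ 1 $ 1 = (transv b (l\<^sup>2 * r) ** A) $ 1 $ 1"
  proof -
    have "a * (r * x * y) + \<beta> * (r * y * y) = l * r * x * y" "l * l * r * x * (a * y - c * x) = l * r * x * y" using e i by algebra+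
    then show ?thesis
      unfolding matrix_matrix_mult_def transv_def vec_lambda_beta sum_2 mat2_nth s[symmetric]
      by algebra
  qed
  moreover have "(A ** transv b r) $ 1 $ 2 = (transv b (l\<^sup>2 * r) ** A) $ 1 $ 2"
  proof -
    have "a * (r * x * x) + \<beta> * (r * x * y) = l * r * x * x" "l * l * r * x * (d * x - \<beta> * y) = l * r * x * x" using e i by algebra+
    then show ?thesis
      unfolding matrix_matrix_mult_def transv_def vec_lambda_beta sum_2 mat2_nth s[symmetric]
      by algebra
  qed
  moreover have "(A ** transv b r) $ 2 $ 1 = (transv b (l\<^sup>2 * r) ** A) $ 2 $ 1"
  proof -
    have "c * (r * x * y) + d * (r * y * y) = l * r * y * y" "l * l * r * y * (a * y - c * x) = l * r * y * y" using e i by algebra+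
    then show ?thesis
      unfolding matrix_matrix_mult_def transv_def vec_lambda_beta sum_2 mat2_nth s[symmetric]
      by algebra
  qed
  moreover have "(A ** transv b r) $ 2 $ 2 = (transv b (l\<^sup>2 * r) ** A) $ 2 $ 2"
  proof -
    have "c * (r * x * x) + d * (r * x * y) = l * r * x * y" "l * l * r * y * (d * x - \<beta> * y) = l * r * x * y" using e i by algebra+
    then show ?thesis
      unfolding matrix_matrix_mult_def transv_def vec_lambda_beta sum_2 mat2_nth s[symmetric]
      by algebra
  qed
  ultimately show ?thesis by (simp add: vec_eq_iff forall_2)
qed

text \<open>Determinant 1 forces the second eigenvalue to be 1 as well, so \<open>U\<close> is
  unipotent with fixed vector over \<open>b\<close>.\<close>

lemma eigen_one_transv:
  assumes "det U = 1" "U$1$1 * hx b + U$1$2 * hy b = hx b" "U$2$1 * hx b + U$2$2 * hy b = hy b"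
  shows "\<exists>r. U = transv b r"
proof -
  define a \<beta> c d where s: "a = U$1$1" "\<beta> = U$1$2" "c = U$2$1" "d = U$2$2"
  have D: "a * d - \<beta> * c = 1" using assms(1) by (simp add: det_2 s)
  show ?thesis
  proof (cases b)
    case None
    then have "a = 1" "c = 0" using assms s by simp_all
    then have "U = transv b \<beta>" using D None by (simp add: vec_eq_iff forall_2 transv_def s)
    then show ?thesis ..
  next
    case (Some x)
    have e: "a * x + \<beta> = x" "c * x + d = 1" using assms s Some by simp_all
    have "a + d = 2"
    proof -
      have "a - c * x = 1" using D e by algebra
      then show ?thesis using e by algebra
    qed
    then have f: "a = 1 + c * x" "d = 1 - c * x" using e by linarith+
    then have "\<beta> = - c * x\<^sup>2" using e(1) by (simp add: algebra_simps power2_eq_square)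
    note f = f this
    then have "U = transv b (- c)" using Some f by (simp add: vec_eq_iff forall_2 transv_def flip: s)
    then show ?thesis ..
  qed
qed

lemma transv_psl_one:
  assumes "psl (transv b r) = psl (mat 1)"
  shows "r = 0"
proof -
  have tr: "transv b r $1$1 + transv b r $2$2 = 2" by (simp add: transv_def)
  have "transv b r \<noteq> - mat 1"
  proof
    assume "transv b r = - mat 1"
    then show False using tr by (simp add: mat_def)
  qed
  then have "transv b r = mat 1" using assms by (simp add: psl_eq_iff)
  then have "r * (hx b)\<^sup>2 = 0" "- r * (hy b)\<^sup>2 = 0"
    by (simp_all add: transv_def vec_eq_iff forall_2 mat_def)
  then show ?thesis using hx_hy_nz[of b] by auto
qed

lemma transv_0: "transv b 0 = mat 1"
  by (simp add: transv_def vec_eq_iff forall_2 mat_def)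

text \<open>Powers of \<open>\<gamma>\<close> or of its inverse conjugate a parabolic element fixing \<open>b\<close> into elements
  converging to 1, against discreteness.\<close>

lemma no_transv:
  assumes "\<gamma> \<in> \<Gamma>" "act_bdry \<gamma> b = b" "sgp (cpsl \<gamma>) (inc_bd b) \<noteq> 1" "psl (transv b r) \<in> \<Gamma>"
  shows "r = 0"
proof -
  have conj: "\<exists>l. l\<^sup>2 = sgp (cpsl \<gamma>) (inc_bd b) \<and> (\<forall>s. psl (transv b s) \<in> \<Gamma> \<longrightarrow> psl (transv b (l\<^sup>2 * s)) \<in> \<Gamma>)"
    if g: "\<gamma> \<in> \<Gamma>" "act_bdry \<gamma> b = b" for \<gamma>
  proof -
    let ?A = "rep \<gamma>"
    have A: "det ?A = 1" "psl ?A = \<gamma>" using rep_spec[OF in_carrier[OF g(1)]] by auto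
    have "mobius_bdry ?A b = b" using g by (simp add: act_bdry_rep)
    then obtain l where l: "l \<noteq> 0" "?A$1$1 * hx b + ?A$1$2 * hy b = l * hx b" "?A$2$1 * hx b + ?A$2$2 * hy b = l * hy b"
      using mobius_homog[OF A(1), of b] by metis
    have h: "hx (inc_bd b) = of_real (hx b)" "hy (inc_bd b) = of_real (hy b)" by (cases b; simp)+
    have "sgp (cpsl \<gamma>) (inc_bd b) = sg (cmat ?A) (inc_bd b)"
      using A by (simp add: cpsl_def sgp_psl det_cmat)
    also have "\<dots> = (cmod (of_real l))\<^sup>2 * hn (inc_bd b) / hn (inc_bd b)"
      by (rule sg_homog) (use l in \<open>simp_all add: h flip: of_real_mult of_real_add\<close>)
    finally have l2: "l\<^sup>2 = sgp (cpsl \<gamma>) (inc_bd b)" using hn_pos[of "inc_bd b"] by simp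
    have "psl (transv b (l\<^sup>2 * s)) \<in> \<Gamma>" if s: "psl (transv b s) \<in> \<Gamma>" for s
    proof -
      have "\<gamma> \<otimes>\<^bsub>PSL2\<^esub> psl (transv b s) = psl (transv b (l\<^sup>2 * s)) \<otimes>\<^bsub>PSL2\<^esub> \<gamma>"
        using transv_conj[OF A(1) l(2,3), of s] mult_psl[OF A(1) transv_det] mult_psl[OF transv_det A(1)]
        by (simp add: A(2))
      then have "psl (transv b (l\<^sup>2 * s)) = \<gamma> \<otimes>\<^bsub>PSL2\<^esub> psl (transv b s) \<otimes>\<^bsub>PSL2\<^esub> inv\<^bsub>PSL2\<^esub> \<gamma>"
        using g by (simp add: PSL2.m_assoc transv_det)
      then show ?thesis using g s by simp
    qed
    then show ?thesis using l2 by blast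
  qed
  have "\<exists>q. 0 < q \<and> q < 1 \<and> (\<forall>s. psl (transv b s) \<in> \<Gamma> \<longrightarrow> psl (transv b (q * s)) \<in> \<Gamma>)"
  proof (cases "sgp (cpsl \<gamma>) (inc_bd b) < 1")
    case True
    then show ?thesis using conj[OF assms(1,2)] sgp_pos[OF cpsl_carrier, of \<gamma> "inc_bd b"] assms(1) by fastforce
  next
    case False
    let ?i = "inv\<^bsub>PSL2\<^esub> \<gamma>"
    have i: "?i \<in> \<Gamma>" "act_bdry ?i b = b" using assms(1,2) act_bdry_inv(1)[of \<gamma> b] by auto
    have "sgp (cpsl (?i \<otimes>\<^bsub>PSL2\<^esub> \<gamma>)) (inc_bd b) = sgp (cpsl ?i) (inc_bd b) * sgp (cpsl \<gamma>) (inc_bd b)"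
      using assms(1,2) sgp_mult[of "cpsl ?i" "cpsl \<gamma>" "inc_bd b"] cpsl_mult[of ?i \<gamma>]
      by (simp add: cpsl_carrier act_bdry_cpsl del: PSL2.l_inv)
    moreover have "cpsl (?i \<otimes>\<^bsub>PSL2\<^esub> \<gamma>) = \<one>\<^bsub>PSL2\<^esub>"
    proof -
      have c1: "cmat (mat 1) = mat 1" by (simp add: vec_eq_iff mat_def)
      have "cpsl \<one>\<^bsub>PSL2\<^esub> = \<one>\<^bsub>PSL2\<^esub>" unfolding PSL2_one by (subst cpsl_psl) (simp_all add: c1)
      then show ?thesis using assms(1) by (simp add: PSL2.l_inv)
    qed
    ultimately have "sgp (cpsl ?i) (inc_bd b) * sgp (cpsl \<gamma>) (inc_bd b) = 1" by (simp add: sgp_one)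
    then have "sgp (cpsl ?i) (inc_bd b) < 1"
      using False assms(3) sgp_pos[OF cpsl_carrier, of ?i "inc_bd b"] i
      by (smt (verit, ccfv_SIG) in_carrier mult_le_cancel_left2 mult_left_le)
    then show ?thesis using conj[OF i] sgp_pos[OF cpsl_carrier, of ?i "inc_bd b"] i by fastforce
  qed
  then obtain q where q: "0 < q" "q < 1" "\<And>s. psl (transv b s) \<in> \<Gamma> \<Longrightarrow> psl (transv b (q * s)) \<in> \<Gamma>" by blast
  have in\<Gamma>: "psl (transv b (q ^ n * r)) \<in> \<Gamma>" for n
    by (induction n) (use assms(4) q(3) in \<open>auto simp: mult.assoc\<close>)
  have "(\<lambda>n. q ^ n * r) \<longlonglongrightarrow> 0 * r" using q by (intro tendsto_mult LIMSEQ_power_zero tendsto_const) auto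
  then have s0: "(\<lambda>n. q ^ n * r) \<longlonglongrightarrow> 0" by simp
  have "(\<lambda>n. transv b (q ^ n * r)) \<longlonglongrightarrow> mat 1"
  proof (intro vec_tendstoI)
    fix i j :: 2
    have "(\<lambda>n. transv b (q ^ n * r) $ i $ j) \<longlonglongrightarrow> transv b 0 $ i $ j"
      using s0 q(1,2) exhaust_2[of i] exhaust_2[of j] unfolding transv_def by (elim disjE) (auto intro!: tendsto_eq_intros)
    then show "(\<lambda>n. transv b (q ^ n * r) $ i $ j) \<longlonglongrightarrow> mat 1 $ i $ j" by (simp add: transv_0)
  qed
  then have "\<forall>\<^sub>F n in sequentially. psl (transv b (q ^ n * r)) = psl (mat 1)"
    by (rule discrete) (use in\<Gamma> transv_det in auto)
  then obtain n where "psl (transv b (q ^ n * r)) = psl (mat 1)" by (meson eventually_sequentially order_refl)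
  from transv_psl_one[OF this] show ?thesis using q by simp
qed

text \<open>If all conformal factors at \<open>b\<close> are 1, then \<open>poisson\<close> at \<open>b\<close> is invariant, hence bounded by
  cocompactness. Otherwise commutators are parabolic, so \<open>\<Gamma>\<close> is abelian; then there is a second fixed
  point \<open>b'\<close>, and the product of the two functions \<open>poisson\<close> is invariant.\<close>

lemma no_global_fixed_point: "\<exists>\<kappa>\<in>\<Gamma>. act_bdry \<kappa> b \<noteq> b"
proof (rule ccontr)
  assume "\<not> ?thesis"
  then have fixb: "\<And>\<kappa>. \<kappa> \<in> \<Gamma> \<Longrightarrow> act_bdry \<kappa> b = b" by blast
  let ?\<chi> = "\<lambda>\<gamma>. sgp (cpsl \<gamma>) (inc_bd b)"
  have inH2: "Complex y t \<in> H2" if "t > 0" for y t using that by (simp add: H2_def)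
  show False
  proof (cases "\<forall>\<gamma>\<in>\<Gamma>. ?\<chi> \<gamma> = 1")
    case True
    then have "poisson (inc_H2 (act_H2 \<gamma> z)) (inc_bd b) = poisson (inc_H2 z) (inc_bd b)" if "\<gamma> \<in> \<Gamma>" "z \<in> H2" for \<gamma> z
      using poisson_inc_act[OF that fixb] that by simp
    then obtain B where B: "\<And>z. z \<in> H2 \<Longrightarrow> poisson (inc_H2 z) (inc_bd b) \<le> B"
      using invariant_bounded[OF poisson_inc_continuous] by blast
    obtain y where "Some y \<noteq> b" by (metis option.inject zero_neq_one)
    then obtain c where c: "c > 0" "\<And>t. t > 0 \<Longrightarrow> c / t \<le> poisson (inc_H2 (Complex y t)) (inc_bd b)"
      using poisson_inc_lower by blast
    have "B > 0" using B[of \<i>] poisson_pos[of "inc_H2 \<i>" "inc_bd b"] by (simp add: H2_def)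
    \<comment> \<open>At height \<open>c / (2 * B)\<close> the lower bound on \<open>poisson\<close>
      is already \<open>2 * B\<close>.\<close>
    have "c / (c / (2 * B)) \<le> B"
      using B[OF inH2] c(2) c(1) \<open>B > 0\<close> by (meson divide_pos_pos mult_pos_pos order_trans zero_less_numeral)
    then show False using c \<open>B > 0\<close> by simp
  next
    case False
    then obtain \<gamma>0 where g0: "\<gamma>0 \<in> \<Gamma>" "?\<chi> \<gamma>0 \<noteq> 1" by blast
    let ?A = "rep \<gamma>0"
    have A: "det ?A = 1" "psl ?A = \<gamma>0" using rep_spec[OF in_carrier[OF g0(1)]] by auto
    have "mobius_bdry ?A b = b" using g0 fixb by (simp flip: act_bdry_rep)
    then obtain l where l: "l \<noteq> 0" "?A$1$1 * hx b + ?A$1$2 * hy b = l * hx b" "?A$2$1 * hx b + ?A$2$2 * hy b = l * hy b"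
      using mobius_homog[OF A(1), of b] by metis
    have h: "hx (inc_bd b) = of_real (hx b)" "hy (inc_bd b) = of_real (hy b)" by (cases b; simp)+
    have "?\<chi> \<gamma>0 = sg (cmat ?A) (inc_bd b)"
      using A by (simp add: cpsl_def sgp_psl det_cmat)
    also have "\<dots> = (cmod (of_real l))\<^sup>2 * hn (inc_bd b) / hn (inc_bd b)"
      by (rule sg_homog) (use l in \<open>simp_all add: h flip: of_real_mult of_real_add\<close>)
    finally have "l\<^sup>2 \<noteq> 1" using g0 hn_pos[of "inc_bd b"] by simp
    from second_fixed_point[OF A(1) l(2,3) this]
    obtain b' where b': "b' \<noteq> b" "act_bdry \<gamma>0 b' = b'" using g0 by (auto simp: act_bdry_rep)
    \<comment> \<open>With three fixed points the factors would be pairwise inverse to each other,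
      so the one at \<open>b\<close> would have square 1.\<close>
    have only: "x = b \<or> x = b'" if "act_bdry \<gamma>0 x = x" for x
    proof (rule ccontr)
      assume n: "\<not> (x = b \<or> x = b')"
      have "?\<chi> \<gamma>0 * sgp (cpsl \<gamma>0) (inc_bd b') = 1" "?\<chi> \<gamma>0 * sgp (cpsl \<gamma>0) (inc_bd x) = 1"
        "sgp (cpsl \<gamma>0) (inc_bd b') * sgp (cpsl \<gamma>0) (inc_bd x) = 1"
        using fixed_sgp g0 fixb b' that n by metis+
      then have "(?\<chi> \<gamma>0)\<^sup>2 = 1" by algebra
      then show False using g0 sgp_pos[OF cpsl_carrier, of \<gamma>0 "inc_bd b"] by (auto simp: power2_eq_1_iff)
    qed
    show False
    proof (cases "\<forall>\<gamma>\<in>\<Gamma>. act_bdry \<gamma> b' = b'")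
      case True
      let ?h = "\<lambda>z. poisson (inc_H2 z) (inc_bd b) * poisson (inc_H2 z) (inc_bd b')"
      have "?h (act_H2 \<gamma> z) = ?h z" if g: "\<gamma> \<in> \<Gamma>" "z \<in> H2" for \<gamma> z
      proof -
        have "?h z = ?h (act_H2 \<gamma> z) * (?\<chi> \<gamma> * sgp (cpsl \<gamma>) (inc_bd b'))"
          using poisson_inc_act[OF g fixb[OF g(1)]] poisson_inc_act[OF g True[rule_format, OF g(1)]]
          by (metis (no_types, lifting) mult.assoc mult.left_commute)
        also have "?\<chi> \<gamma> * sgp (cpsl \<gamma>) (inc_bd b') = 1"
          using fixed_sgp[OF g(1) fixb[OF g(1)] True[rule_format, OF g(1)]] b' by metis
        finally show ?thesis by simp
      qed
      then obtain B where B: "\<And>z. z \<in> H2 \<Longrightarrow> ?h z \<le> B"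
        using invariant_bounded[of ?h] continuous_on_mult[OF poisson_inc_continuous poisson_inc_continuous] by blast
      obtain y where y: "Some y \<noteq> b" "Some y \<noteq> b'"
      proof -
        have "infinite (range (Some :: real \<Rightarrow> _))"
          using finite_imageD infinite_UNIV_char_0 inj_Some by blast
        then have "\<exists>u. u \<in> range (Some :: real \<Rightarrow> _) - {b, b'}"
          by (metis Diff_infinite_finite finite.emptyI finite.insertI all_not_in_conv)
        then show ?thesis using that by blast
      qed
      obtain c c' where c: "c > 0" "\<And>t. t > 0 \<Longrightarrow> c / t \<le> poisson (inc_H2 (Complex y t)) (inc_bd b)"
        "c' > 0" "\<And>t. t > 0 \<Longrightarrow> c' / t \<le> poisson (inc_H2 (Complex y t)) (inc_bd b')"
        using poisson_inc_lower[OF y(1)] poisson_inc_lower[OF y(2)] by blast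
      have "(c / t) * (c' / t) \<le> B" if "t > 0" for t
        using mult_mono[OF c(2)[OF that] c(4)[OF that]] B[OF inH2[OF that, of y]] c that
        by (smt (verit) divide_nonneg_pos)
      then have 1: "c * c' \<le> B * t\<^sup>2" if "t > 0" for t
        using that by (simp add: divide_simps power2_eq_square)
      have "((\<lambda>t. B * t\<^sup>2) \<longlongrightarrow> B * 0\<^sup>2) (at_right 0)" by (intro tendsto_intros)
      moreover have "\<forall>\<^sub>F t in at_right 0. c * c' \<le> B * t\<^sup>2"
        using 1 by (auto simp: eventually_at_filter)
      ultimately have "c * c' \<le> B * 0\<^sup>2" by (rule tendsto_lowerbound) simp
      then have "c * c' \<le> 0" by simp
      moreover have "c * c' > 0" using c(1,3) by (rule mult_pos_pos)
      ultimately show False by linarith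
    next
      case False
      then obtain \<gamma>1 where g1: "\<gamma>1 \<in> \<Gamma>" "act_bdry \<gamma>1 b' \<noteq> b'" by blast
      let ?i0 = "inv\<^bsub>PSL2\<^esub> \<gamma>0" and ?i1 = "inv\<^bsub>PSL2\<^esub> \<gamma>1"
      have adj: "\<exists>B. det B = 1 \<and> psl B = inv\<^bsub>PSL2\<^esub> g \<and> (\<exists>m. m \<noteq> 0 \<and>
          B$1$1 * hx b + B$1$2 * hy b = (1/m) * hx b \<and> B$2$1 * hx b + B$2$2 * hy b = (1/m) * hy b \<and>
          (rep g)$1$1 * hx b + (rep g)$1$2 * hy b = m * hx b \<and> (rep g)$2$1 * hx b + (rep g)$2$2 * hy b = m * hy b)"
        if g: "g \<in> \<Gamma>" for g
      proof -
        let ?R = "rep g"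
        have R: "det ?R = 1" "psl ?R = g" using rep_spec[OF in_carrier[OF g]] by auto
        have "mobius_bdry ?R b = b" using g fixb by (simp flip: act_bdry_rep)
        then obtain m where m: "m \<noteq> 0" "?R$1$1 * hx b + ?R$1$2 * hy b = m * hx b" "?R$2$1 * hx b + ?R$2$2 * hy b = m * hy b"
          using mobius_homog[OF R(1), of b] by metis
        define B where "B = mat2 (?R$2$2) (- ?R$1$2) (- ?R$2$1) (?R$1$1)"
        have d: "?R$1$1 * ?R$2$2 - ?R$1$2 * ?R$2$1 = 1" using R by (simp add: det_2)
        have dB: "det B = 1" using d by (simp add: B_def det_2 mult.commute)
        have "B ** ?R = mat 1"
          using d by (simp add: vec_eq_iff forall_2 matrix_matrix_mult_def sum_2 mat_def B_def algebra_simps)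
        then have "psl B \<otimes>\<^bsub>PSL2\<^esub> g = \<one>\<^bsub>PSL2\<^esub>"
          using mult_psl[OF dB R(1)] R(2) by (simp add: PSL2_one)
        then have pB: "psl B = inv\<^bsub>PSL2\<^esub> g" using g dB by (metis PSL2.inv_equality in_carrier psl_in_carrier)
        have "m * (?R$2$2 * hx b - ?R$1$2 * hy b) = hx b" "m * (?R$1$1 * hy b - ?R$2$1 * hx b) = hy b"
          using d m(2,3) by algebra+
        then have "B$1$1 * hx b + B$1$2 * hy b = (1/m) * hx b" "B$2$1 * hx b + B$2$2 * hy b = (1/m) * hy b"
          using m(1) by (simp_all add: B_def field_simps)
        then show ?thesis using dB pB m by blast
      qed
      obtain B0 m0 where B0: "det B0 = 1" "psl B0 = ?i0" "m0 \<noteq> 0"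
          "B0$1$1 * hx b + B0$1$2 * hy b = (1/m0) * hx b" "B0$2$1 * hx b + B0$2$2 * hy b = (1/m0) * hy b"
          "(rep \<gamma>0)$1$1 * hx b + (rep \<gamma>0)$1$2 * hy b = m0 * hx b" "(rep \<gamma>0)$2$1 * hx b + (rep \<gamma>0)$2$2 * hy b = m0 * hy b"
        using adj[OF g0(1)] by blast
      obtain B1 m1 where B1: "det B1 = 1" "psl B1 = ?i1" "m1 \<noteq> 0"
          "B1$1$1 * hx b + B1$1$2 * hy b = (1/m1) * hx b" "B1$2$1 * hx b + B1$2$2 * hy b = (1/m1) * hy b"
          "(rep \<gamma>1)$1$1 * hx b + (rep \<gamma>1)$1$2 * hy b = m1 * hx b" "(rep \<gamma>1)$2$1 * hx b + (rep \<gamma>1)$2$2 * hy b = m1 * hy b"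
        using adj[OF g1(1)] by blast
      have eig: "(P ** Q)$1$1 * hx b + (P ** Q)$1$2 * hy b = (s * t) * hx b \<and> (P ** Q)$2$1 * hx b + (P ** Q)$2$2 * hy b = (s * t) * hy b"
        if "P$1$1 * hx b + P$1$2 * hy b = s * hx b" "P$2$1 * hx b + P$2$2 * hy b = s * hy b"
           "Q$1$1 * hx b + Q$1$2 * hy b = t * hx b" "Q$2$1 * hx b + Q$2$2 * hy b = t * hy b"
        for P Q :: "real^2^2" and s t
      proof -
        have "(P ** Q)$i$1 * hx b + (P ** Q)$i$2 * hy b = P$i$1 * (Q$1$1 * hx b + Q$1$2 * hy b) + P$i$2 * (Q$2$1 * hx b + Q$2$2 * hy b)" for i
          by (simp add: matrix_matrix_mult_def sum_2 algebra_simps)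
        then have "(P ** Q)$i$1 * hx b + (P ** Q)$i$2 * hy b = t * (P$i$1 * hx b + P$i$2 * hy b)" for i
          unfolding that by (simp add: algebra_simps)
        then show ?thesis using that(1,2) by simp
      qed
      \<comment> \<open>The commutator of \<open>\<gamma>1\<close> and \<open>\<gamma>0\<close>. The
        eigenvalues at \<open>b\<close> cancel, so it is a \<open>transv\<close>, and
        \<open>no_transv\<close> makes it trivial.\<close>
      define U where "U = (rep \<gamma>1 ** rep \<gamma>0) ** (B1 ** B0)"
      have dU: "det U = 1" using g0 g1 B0 B1 by (simp add: U_def det_mul rep_spec)
      have "psl U = (\<gamma>1 \<otimes>\<^bsub>PSL2\<^esub> \<gamma>0) \<otimes>\<^bsub>PSL2\<^esub> (?i1 \<otimes>\<^bsub>PSL2\<^esub> ?i0)"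
      proof -
        have "psl U = psl (rep \<gamma>1 ** rep \<gamma>0) \<otimes>\<^bsub>PSL2\<^esub> psl (B1 ** B0)"
          unfolding U_def by (rule mult_psl[symmetric]) (use g0 g1 B0 B1 in \<open>simp_all add: det_mul rep_spec\<close>)
        moreover have "psl (rep \<gamma>1 ** rep \<gamma>0) = \<gamma>1 \<otimes>\<^bsub>PSL2\<^esub> \<gamma>0"
          using mult_psl[of "rep \<gamma>1" "rep \<gamma>0"] g0 g1 by (simp add: rep_spec)
        moreover have "psl (B1 ** B0) = ?i1 \<otimes>\<^bsub>PSL2\<^esub> ?i0"
          using mult_psl[of B1 B0] B0 B1 by simp
        ultimately show ?thesis by simp
      qed
      note pU = this
      have "U$1$1 * hx b + U$1$2 * hy b = hx b" "U$2$1 * hx b + U$2$2 * hy b = hy b"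
        using eig[OF conjunct1[OF eig[OF B1(6,7) B0(6,7)]] conjunct2[OF eig[OF B1(6,7) B0(6,7)]]
            conjunct1[OF eig[OF B1(4,5) B0(4,5)]] conjunct2[OF eig[OF B1(4,5) B0(4,5)]]] B0(3) B1(3)
        by (simp_all add: U_def)
      then obtain r where r: "U = transv b r" using eigen_one_transv[OF dU] by blast
      have "r = 0" using no_transv[OF g0(1) fixb[OF g0(1)] g0(2), of r] pU g0 g1 r by simp
      then have one: "(\<gamma>1 \<otimes>\<^bsub>PSL2\<^esub> \<gamma>0) \<otimes>\<^bsub>PSL2\<^esub> (?i1 \<otimes>\<^bsub>PSL2\<^esub> ?i0) = \<one>\<^bsub>PSL2\<^esub>"
        using pU r by (simp add: transv_0 PSL2_one)
      have "\<gamma>1 \<otimes>\<^bsub>PSL2\<^esub> \<gamma>0 = \<gamma>0 \<otimes>\<^bsub>PSL2\<^esub> \<gamma>1"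
      proof -
        have "?i1 \<otimes>\<^bsub>PSL2\<^esub> ?i0 = inv\<^bsub>PSL2\<^esub> (\<gamma>0 \<otimes>\<^bsub>PSL2\<^esub> \<gamma>1)" using g0 g1 by (simp add: PSL2.inv_mult_group)
        then show ?thesis using one g0 g1
          by (metis PSL2.inv_equality PSL2.inv_inv PSL2.m_closed PSL2.inv_closed in_carrier)
      qed
      \<comment> \<open>Commuting with \<open>\<gamma>0\<close>, the element
        \<open>\<gamma>1\<close> permutes the fixed points \<open>b\<close> and \<open>b'\<close>.
        It moves \<open>b'\<close>, so it would send both of them to \<open>b\<close>.\<close>
      then have "act_bdry \<gamma>0 (act_bdry \<gamma>1 b') = act_bdry \<gamma>1 b'"
        using g0 g1 b' by (metis act_bdry_mult in_carrier)
      then have "act_bdry \<gamma>1 b' = b" using only g1 by blast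
      then have "act_bdry \<gamma>1 b' = act_bdry \<gamma>1 b" using fixb g1 by simp
      then show False using b' g1 by (metis act_bdry_inv(1) in_carrier)
    qed
  qed
qed

end

text \<open>Takes \<open>\<infinity>\<close> to \<open>x\<close> and sees the boundary near \<open>x\<close> at scale \<open>r\<^sup>2\<close>.\<close>

definition horo :: "real \<Rightarrow> real \<Rightarrow> real^2^2" where
  "horo x r = mat2 (x / r) (- r) (1 / r) 0"

lemma horo_det: "r \<noteq> 0 \<Longrightarrow> det (horo x r) = 1"
  by (simp add: horo_def det_2)

lemma horo_bdry:
  assumes "r \<noteq> 0"
  shows "mobius_bdry (horo x r) None = Some x" "y \<noteq> 0 \<Longrightarrow> mobius_bdry (horo x r) (Some y) = Some (x - r\<^sup>2 / y)"
  using assms by (simp_all add: horo_def mobius_bdry_def field_simps power2_eq_square)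

text \<open>The second condition prescribes the direction in which \<open>g\<close> escapes:
  \<open>\<zeta>\<close> is a boundary point, and \<open>g \<i>\<close> in a small ball around it
  has small height.\<close>

definition bad_set :: "(real^2^2) set set \<Rightarrow> real \<Rightarrow> real \<Rightarrow> real \<Rightarrow> real set" where
  "bad_set \<Gamma> \<eta> \<zeta> e = {x. \<forall>g\<in>\<Gamma>. \<not> (act_bdry g (Some x) \<in> Some ` ball \<eta> e \<and> act_H2 g \<i> \<in> ball (of_real \<zeta>) e)}"

definition generic :: "(real^2^2) set set \<Rightarrow> real \<Rightarrow> bool" where
  "generic \<Gamma> x \<longleftrightarrow> (\<forall>\<eta> \<zeta> e. \<eta> \<noteq> \<zeta> \<and> 0 < e \<longrightarrow> x \<notin> bad_set \<Gamma> \<eta> \<zeta> e)"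

section \<open>Dense boundary orbits and holes in the exceptional sets\<close>

context lattice
begin

text \<open>\<open>horo \<zeta> r\<close> carries everything outside a small neighbourhood of 0
  close to \<open>\<zeta>\<close>. Write it as \<open>\<gamma>\<close> times \<open>k\<close> with
  \<open>k\<close> bounded. The preimages under \<open>k\<close> of \<open>b\<close> and of a second
  orbit point \<open>act_bdry \<kappa>0 b\<close> are a definite distance apart, so one of them
  avoids that neighbourhood.\<close>

lemma orbit_dense:
  assumes "e > 0"
  shows "\<exists>\<kappa>\<in>\<Gamma>. act_bdry \<kappa> b \<in> Some ` ball \<zeta> e"
proof -
  obtain M where M: "\<And>A. det A = 1 \<Longrightarrow> \<exists>\<gamma>\<in>\<Gamma>. \<exists>k. det k = 1 \<and> (\<forall>i j. \<bar>k$i$j\<bar> < M) \<and> psl A = \<gamma> \<otimes>\<^bsub>PSL2\<^esub> psl k"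
    using lattice_cocompact[OF lattice] by blast
  obtain \<kappa>0 where k0: "\<kappa>0 \<in> \<Gamma>" "act_bdry \<kappa>0 b \<noteq> b" using no_global_fixed_point by blast
  define c where "c = chord (inc_bd b) (inc_bd (act_bdry \<kappa>0 b))"
  have c: "c > 0" using k0 by (simp add: c_def chord_pos inc_bd_inj)
  \<comment> \<open>\<open>c / (4 * M^2 + 1)^2\<close> will bound \<open>chord\<close> of the two
    preimages from below, whereas two points of modulus below \<open>m0\<close> have
    \<open>chord\<close> at most \<open>4 * m0^2\<close>.\<close>
  define m0 where "m0 = sqrt (c / (4 * M\<^sup>2 + 1)\<^sup>2) / 3"
  have Mp: "4 * M\<^sup>2 + 1 > 0" by (simp add: add_nonneg_pos)
  have m0: "m0 > 0" using c Mp by (simp add: m0_def)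
  have m0c: "4 * m0\<^sup>2 < c / (4 * M\<^sup>2 + 1)\<^sup>2"
  proof -
    define u where "u = c / (4 * M\<^sup>2 + 1)\<^sup>2"
    have "u > 0" using c Mp by (simp add: u_def)
    moreover from this have "m0\<^sup>2 = u / 9" unfolding m0_def power_divide u_def[symmetric] by simp
    ultimately show ?thesis unfolding u_def[symmetric] by linarith
  qed
  \<comment> \<open>With this choice \<open>r^2 / m0 = e / 2\<close>, which bounds the distance to
    \<open>\<zeta>\<close> of the image of any point of modulus at least \<open>m0\<close>.\<close>
  define r where "r = sqrt (m0 * e / 2)"
  have r: "r > 0" "r\<^sup>2 = m0 * e / 2" using m0 assms by (simp_all add: r_def)
  obtain \<gamma> k where g: "\<gamma> \<in> \<Gamma>" "det k = 1" "\<forall>i j. \<bar>k$i$j\<bar> < M" "psl (horo \<zeta> r) = \<gamma> \<otimes>\<^bsub>PSL2\<^esub> psl k"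
    using M[OF horo_det, of r \<zeta>] r by auto
  let ?ki = "inv\<^bsub>PSL2\<^esub> (psl k)"
  have kc: "psl k \<in> carrier PSL2" using g by simp
  define m1 m2 where "m1 = act_bdry ?ki b" and "m2 = act_bdry ?ki (act_bdry \<kappa>0 b)"
  have km: "mobius_bdry k m1 = b" "mobius_bdry k m2 = act_bdry \<kappa>0 b"
    using act_bdry_inv(2)[OF kc] by (simp_all add: m1_def m2_def act_psl)
  have sgk: "sg (cmat k) \<xi> \<le> 4 * M\<^sup>2 + 1" for \<xi>
  proof -
    have "(k$i$j)\<^sup>2 \<le> M\<^sup>2" for i j using g(3) by (metis abs_le_square_iff abs_of_nonneg abs_ge_zero less_imp_le order_trans)
    then have "(k$1$1)\<^sup>2 + (k$1$2)\<^sup>2 + (k$2$1)\<^sup>2 + (k$2$2)\<^sup>2 \<le> M\<^sup>2 + M\<^sup>2 + M\<^sup>2 + M\<^sup>2" by (intro add_mono)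
    then show ?thesis using sg_le[of "cmat k" \<xi>] by simp
  qed
  have "chord (inc_bd b) (inc_bd (act_bdry \<kappa>0 b)) * sg (cmat k) (inc_bd m1) * sg (cmat k) (inc_bd m2) = chord (inc_bd m1) (inc_bd m2)"
    using chord_mobius[of "cmat k" "inc_bd m1" "inc_bd m2"] g(2) by (simp add: det_cmat mobius_bdry_cmat km)
  note cm = this
  have \<open>chord (inc_bd m1) (inc_bd m2) \<ge> c / (4 * M\<^sup>2 + 1)\<^sup>2\<close>
  proof -
    let ?ik = "cmat (rep ?ki)"
    have dk: "det (cmat k) = 1" using g(2) by (simp add: det_cmat)
    have "chord (inc_bd m1) (inc_bd m2) \<noteq> 0" "chord (inc_bd m1) (inc_bd m2) \<ge> 0"
      using cm c sg_pos[OF dk] unfolding c_def by (auto simp: chord_nonneg less_imp_neq[THEN not_sym])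
    \<comment> \<open>The inverse of \<open>k\<close>. Its entries are those of \<open>k\<close> up
      to sign and position, so \<open>sg_le\<close> gives the same bound.\<close>
    define K' where "K' = mat2 (k$2$2) (- k$1$2) (- k$2$1) (k$1$1)"
    have d: "k$1$1 * k$2$2 - k$1$2 * k$2$1 = 1" using g by (simp add: det_2)
    have dK: "det K' = 1" using d by (simp add: K'_def det_2 mult.commute)
    have kK: "k ** K' = mat 1" "K' ** k = mat 1"
      using d by (simp_all add: vec_eq_iff forall_2 matrix_matrix_mult_def sum_2 mat_def K'_def algebra_simps)
    have mK: "m1 = mobius_bdry K' b" "m2 = mobius_bdry K' (act_bdry \<kappa>0 b)"
      using mobius_bdry_mult[OF dK g(2)] kK by (metis km mobius_bdry_one)+
    have "chord (inc_bd m1) (inc_bd m2) * sg (cmat K') (inc_bd b) * sg (cmat K') (inc_bd (act_bdry \<kappa>0 b)) = c"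
      using chord_mobius[of "cmat K'" "inc_bd b" "inc_bd (act_bdry \<kappa>0 b)"] dK by (simp add: det_cmat mobius_bdry_cmat mK c_def)
    moreover have sgK: "sg (cmat K') \<xi> \<le> 4 * M\<^sup>2 + 1" for \<xi>
    proof -
      have "(k$i$j)\<^sup>2 \<le> M\<^sup>2" for i j using g(3) by (metis abs_le_square_iff abs_of_nonneg abs_ge_zero less_imp_le order_trans)
      then have "(k$2$2)\<^sup>2 + (k$1$2)\<^sup>2 + (k$2$1)\<^sup>2 + (k$1$1)\<^sup>2 \<le> M\<^sup>2 + M\<^sup>2 + M\<^sup>2 + M\<^sup>2" by (intro add_mono)
      then show ?thesis using sg_le[of "cmat K'" \<xi>] by (simp add: K'_def)
    qed
    ultimately have "c \<le> chord (inc_bd m1) (inc_bd m2) * (4 * M\<^sup>2 + 1) * (4 * M\<^sup>2 + 1)"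
    proof -
      have dcK: "det (cmat K') = 1" using dK by (simp add: det_cmat)
      have "c = chord (inc_bd m1) (inc_bd m2) * (sg (cmat K') (inc_bd b) * sg (cmat K') (inc_bd (act_bdry \<kappa>0 b)))"
        using \<open>_ = c\<close> by simp
      also have "\<dots> \<le> chord (inc_bd m1) (inc_bd m2) * ((4 * M\<^sup>2 + 1) * (4 * M\<^sup>2 + 1))"
        by (intro mult_left_mono mult_mono sgK chord_nonneg) (use sg_pos[OF dcK] Mp in \<open>auto intro: less_imp_le\<close>)
      finally show ?thesis by simp
    qed
    then show ?thesis using Mp by (simp add: pos_divide_le_eq power2_eq_square mult.assoc)
  qed
  then have big: "4 * m0\<^sup>2 < chord (inc_bd m1) (inc_bd m2)" using m0c by linarith
  have good: "mobius_bdry (horo \<zeta> r) m \<in> Some ` ball \<zeta> e" if "\<forall>y. m = Some y \<longrightarrow> m0 \<le> \<bar>y\<bar>" for m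
  proof (cases m)
    case None
    then show ?thesis using r assms by (simp add: horo_bdry)
  next
    case (Some y)
    then have y: "m0 \<le> \<bar>y\<bar>" using that by simp
    then have "y \<noteq> 0" using m0 by auto
    have "\<bar>r\<^sup>2 / y\<bar> \<le> r\<^sup>2 / m0" using y m0 by (simp add: abs_divide frac_le)
    also have "r\<^sup>2 / m0 = e / 2" unfolding r(2) using m0 by simp
    also have "\<dots> < e" using assms by simp
    finally have "\<zeta> - r\<^sup>2 / y \<in> ball \<zeta> e" unfolding mem_ball dist_real_def by simp
    then show ?thesis unfolding Some using horo_bdry(2)[of r y \<zeta>] r(1) \<open>y \<noteq> 0\<close> by simp
  qed
  have "(\<forall>y. m1 = Some y \<longrightarrow> m0 \<le> \<bar>y\<bar>) \<or> (\<forall>y. m2 = Some y \<longrightarrow> m0 \<le> \<bar>y\<bar>)"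
  proof (rule ccontr)
    assume "\<not> ?thesis"
    then obtain y1 y2 where y: "m1 = Some y1" "\<bar>y1\<bar> < m0" "m2 = Some y2" "\<bar>y2\<bar> < m0" by force
    have "chord (inc_bd m1) (inc_bd m2) = (y1 - y2)\<^sup>2 / (hn (inc_bd m1) * hn (inc_bd m2))"
      unfolding chord_eq y by (simp flip: of_real_diff)
    also have "\<dots> \<le> (y1 - y2)\<^sup>2 / 1"
    proof (intro divide_left_mono)
      have "hn (inc_bd m1) \<ge> 1" "hn (inc_bd m2) \<ge> 1" by (simp_all add: y hn_def)
      then show "1 \<le> hn (inc_bd m1) * hn (inc_bd m2)" using mult_mono[of 1 "hn (inc_bd m1)" 1 "hn (inc_bd m2)"] by simp
    qed (use hn_pos in auto)
    also have "\<bar>y1 - y2\<bar> \<le> 2 * m0" using y by linarith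
    then have "(y1 - y2)\<^sup>2 \<le> (2 * m0)\<^sup>2" by (metis abs_ge_zero power2_abs power_mono)
    finally show False using big by (simp add: power_mult_distrib)
  qed
  then obtain m where m: "m = m1 \<or> m = m2" "\<forall>y. m = Some y \<longrightarrow> m0 \<le> \<bar>y\<bar>" by blast
  have hk: "mobius_bdry (horo \<zeta> r) \<xi> = act_bdry \<gamma> (mobius_bdry k \<xi>)" for \<xi>
  proof -
    have "mobius_bdry (horo \<zeta> r) \<xi> = act_bdry (psl (horo \<zeta> r)) \<xi>" by (simp add: act_psl)
    also have "\<dots> = act_bdry \<gamma> (act_bdry (psl k) \<xi>)" unfolding g(4) by (rule act_bdry_mult) (use g in auto)
    finally show ?thesis by (simp add: act_psl)
  qed
  show ?thesis
  proof (cases "m = m1")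
    case True
    then have "act_bdry \<gamma> b \<in> Some ` ball \<zeta> e" using good[OF m(2)] hk[of m1] km by simp
    then show ?thesis using g(1) by blast
  next
    case False
    then have "act_bdry \<gamma> (act_bdry \<kappa>0 b) \<in> Some ` ball \<zeta> e" using m(1) good[OF m(2)] hk[of m2] km by simp
    then have "act_bdry (\<gamma> \<otimes>\<^bsub>PSL2\<^esub> \<kappa>0) b \<in> Some ` ball \<zeta> e" using g(1) k0(1) by (simp add: act_bdry_mult)
    then show ?thesis using g(1) k0(1) mult_in by blast
  qed
qed

lemma mobius_bdry_Some_ball:
  fixes B :: "real^2^2"
  assumes "mobius_bdry B (Some y) \<in> Some ` ball \<eta> e"
  shows "B$2$1 * y + B$2$2 \<noteq> 0" "(B$1$1 * y + B$1$2) / (B$2$1 * y + B$2$2) \<in> ball \<eta> e"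
  using assms by (auto simp: mobius_bdry_def split: if_splits)

text \<open>Writing \<open>horo x r = \<gamma> k\<close> with \<open>\<gamma>\<close> in \<open>\<Gamma>\<close> and \<open>k\<close> in a compact set, the element \<open>\<kappa> inv \<gamma>\<close> witnesses that an
  interval of length comparable to \<open>r\<^sup>2\<close> near \<open>x\<close> misses the bad set, uniformly in \<open>k\<close>.\<close>

lemma hole_local:
  fixes k :: "real^2^2"
  assumes k: "det k = 1" and e: "0 < e" "2 * e < \<bar>\<eta> - \<zeta>\<bar>"
  shows "\<exists>\<kappa> d n1 n2 W. \<kappa> \<in> \<Gamma> \<and> 0 < d \<and> n1 < n2 \<and> open W \<and> k \<in> W \<and>
    (\<forall>k'\<in>W. det k' = 1 \<longrightarrow>
       (\<forall>w. Im w > 0 \<and> cmod w < d \<longrightarrow> act_H2 \<kappa> (mobius_H2 k' w) \<in> ball (of_real \<zeta>) e) \<and>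
       (\<forall>n\<in>{n1..n2}. n \<noteq> 0 \<and> act_bdry \<kappa> (mobius_bdry k' (Some (1/n))) \<in> Some ` ball \<eta> e))"
proof -
  \<comment> \<open>Small \<open>w\<close> lie near the boundary point 0, so the element must take
    the image of 0 under \<open>k\<close> close to \<open>\<zeta>\<close>.\<close>
  obtain \<kappa> where \<kappa>: "\<kappa> \<in> \<Gamma>" "act_bdry \<kappa> (mobius_bdry k (Some 0)) \<in> Some ` ball \<zeta> e"
    using orbit_dense[OF e(1)] by blast
  let ?R = "rep \<kappa>"
  have R: "det ?R = 1" using rep_spec \<kappa>(1) in_carrier by blast
  define B where "B k' = ?R ** k'" for k' :: "real^2^2"
  have actB: "act_bdry \<kappa> (mobius_bdry k' \<xi>) = mobius_bdry (B k') \<xi>" if "det k' = 1" for k' \<xi>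
    using \<kappa>(1) that R by (simp add: act_bdry_rep B_def mobius_bdry_mult)
  have actB2: "act_H2 \<kappa> (mobius_H2 k' w) = mobius_H2 (B k') w" if "det k' = 1" "Im w > 0" for k' w
    using \<kappa>(1) that R by (simp add: act_H2_rep B_def mobius_H2_mult)
  have fstc: "(fst \<longlongrightarrow> k) (nhds (k, w))" and sndc: "(snd \<longlongrightarrow> w) (nhds (k, w))" for w :: "'b::metric_space"
    using tendsto_fst[OF filterlim_ident, of "(k, w)"] tendsto_snd[OF filterlim_ident, of "(k, w)"] by simp_all
  have Bc: "((\<lambda>p. B (fst p) $ i $ j) \<longlongrightarrow> B k $ i $ j) (nhds (k, w))" for i j and w :: "'b::metric_space"
    unfolding B_def matrix_matrix_mult_def by (simp, intro tendsto_intros tendsto_vec_nth fstc)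
  have 0: "mobius_bdry (B k) (Some 0) \<in> Some ` ball \<zeta> e" using \<kappa>(2) actB[OF k] by simp
  note z = mobius_bdry_Some_ball[OF 0, simplified]
  have "((\<lambda>p. (of_real (B (fst p)$1$1) * snd p + of_real (B (fst p)$1$2)) / (of_real (B (fst p)$2$1) * snd p + of_real (B (fst p)$2$2)))
     \<longlongrightarrow> (of_real (B k$1$1) * 0 + of_real (B k$1$2)) / (of_real (B k$2$1) * 0 + of_real (B k$2$2))) (nhds (k, 0::complex))"
    by (intro tendsto_intros Bc sndc) (use z in simp)
  moreover have "(of_real (B k$1$1) * 0 + of_real (B k$1$2)) / (of_real (B k$2$1) * 0 + of_real (B k$2$2)) \<in> ball (complex_of_real \<zeta>) e"
    using z(2) by (simp add: dist_of_real flip: of_real_divide)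
  ultimately have "\<forall>\<^sub>F p in nhds (k, 0). (of_real (B (fst p)$1$1) * snd p + of_real (B (fst p)$1$2)) / (of_real (B (fst p)$2$1) * snd p + of_real (B (fst p)$2$2)) \<in> ball (complex_of_real \<zeta>) e"
    using open_ball topological_tendstoD by blast
  then have "\<forall>\<^sub>F p in nhds (k, 0). mobius_H2 (B (fst p)) (snd p) \<in> ball (of_real \<zeta>) e"
    by (simp only: mobius_H2_def)
  then obtain P Q where PQ: "eventually P (nhds k)" "eventually Q (nhds (0::complex))" "\<And>k' w. P k' \<Longrightarrow> Q w \<Longrightarrow> mobius_H2 (B k') w \<in> ball (of_real \<zeta>) e"
    unfolding nhds_prod eventually_prod_filter by auto
  obtain W1 where W1: "open W1" "k \<in> W1" "\<And>k'. k' \<in> W1 \<Longrightarrow> P k'" using PQ(1) unfolding eventually_nhds by blast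
  obtain d where d: "d > 0" "\<And>w. cmod w < d \<Longrightarrow> Q w" using PQ(2) unfolding eventually_nhds_metric by auto
  have dB: "det (B k) = 1" using R k by (simp add: B_def det_mul)
  define K' where "K' = mat2 (B k$2$2) (- B k$1$2) (- B k$2$1) (B k$1$1)"
  have dd: "B k$1$1 * B k$2$2 - B k$1$2 * B k$2$1 = 1" using dB by (simp add: det_2)
  have dK: "det K' = 1" using dd by (simp add: K'_def det_2 mult.commute)
  have BK: "B k ** K' = mat 1" "K' ** B k = mat 1"
    using dd by (simp_all add: vec_eq_iff forall_2 matrix_matrix_mult_def sum_2 mat_def K'_def algebra_simps)
  have BKx: "mobius_bdry (B k) (mobius_bdry K' \<xi>) = \<xi>" for \<xi>
    using mobius_bdry_mult[OF dB dK, of \<xi>] BK by (simp add: mobius_bdry_one)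
  \<comment> \<open>Moving \<open>\<eta>\<close> slightly if necessary keeps its preimage away from
    infinity, so that this has a real coordinate \<open>y\<close>.\<close>
  obtain \<eta>' where \<eta>': "\<eta>' \<in> ball \<eta> e" "mobius_bdry K' (Some \<eta>') \<noteq> None"
  proof (cases "mobius_bdry K' (Some \<eta>) = None")
    case False
    then show ?thesis using that[of \<eta>] e by simp
  next
    case True
    have "mobius_bdry K' (Some (\<eta> + e/2)) \<noteq> None"
    proof
      assume "mobius_bdry K' (Some (\<eta> + e/2)) = None"
      then have "Some \<eta> = Some (\<eta> + e/2)" using True BKx by metis
      then show False using e by simp
    qed
    then show ?thesis using that[of "\<eta> + e/2"] e by (simp add: dist_real_def)
  qed
  then obtain y where y: "mobius_bdry K' (Some \<eta>') = Some y" by auto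
  have By: "mobius_bdry (B k) (Some y) = Some \<eta>'" using BKx[of "Some \<eta>'"] y by simp
  have y0: "y \<noteq> 0"
  proof
    assume "y = 0"
    then have "\<eta>' \<in> ball \<zeta> e" using 0 By by auto
    then show False using \<eta>'(1) e by (auto simp: dist_real_def)
  qed
  have "mobius_bdry (B k) (Some y) \<in> Some ` ball \<eta> e" using By \<eta>' by auto
  note zy = mobius_bdry_Some_ball[OF this]
  \<comment> \<open>\<open>horo x r\<close> sends \<open>y\<close> to \<open>x - r^2 / y\<close>,
    which is affine in \<open>n = 1 / y\<close>. Intervals in \<open>n\<close> thus become intervals
    near \<open>x\<close>.\<close>
  define n0 where "n0 = 1 / y"
  have n0: "n0 \<noteq> 0" "1 / n0 = y" using y0 by (simp_all add: n0_def)
  let ?num = "\<lambda>p. B (fst p)$1$1 * (1 / snd p) + B (fst p)$1$2"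
  let ?den = "\<lambda>p. B (fst p)$2$1 * (1 / snd p) + B (fst p)$2$2"
  have den: "(?den \<longlongrightarrow> B k$2$1 * y + B k$2$2) (nhds (k, n0))" and num: "(?num \<longlongrightarrow> B k$1$1 * y + B k$1$2) (nhds (k, n0))"
    unfolding n0(2)[symmetric] by (intro tendsto_intros Bc sndc n0(1))+
  have "\<forall>\<^sub>F p in nhds (k, n0). ?den p \<noteq> 0" using den zy(1) by (rule tendsto_imp_eventually_ne)
  moreover have "\<forall>\<^sub>F p in nhds (k, n0). ?num p / ?den p \<in> ball \<eta> e"
    using topological_tendstoD[OF tendsto_divide[OF num den zy(1)] open_ball zy(2)] .
  moreover have "\<forall>\<^sub>F p in nhds (k, n0). snd p \<noteq> 0" using sndc n0(1) by (rule tendsto_imp_eventually_ne)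
  ultimately have "\<forall>\<^sub>F p in nhds (k, n0). snd p \<noteq> 0 \<and> mobius_bdry (B (fst p)) (Some (1 / snd p)) \<in> Some ` ball \<eta> e"
    by eventually_elim (auto simp: mobius_bdry_def)
  then obtain P' Q' where PQ': "eventually P' (nhds k)" "eventually Q' (nhds n0)" "\<And>k' n. P' k' \<Longrightarrow> Q' n \<Longrightarrow> n \<noteq> 0 \<and> mobius_bdry (B k') (Some (1 / n)) \<in> Some ` ball \<eta> e"
    unfolding nhds_prod eventually_prod_filter by auto
  obtain W2 where W2: "open W2" "k \<in> W2" "\<And>k'. k' \<in> W2 \<Longrightarrow> P' k'" using PQ'(1) unfolding eventually_nhds by blast
  obtain d' where d': "d' > 0" "\<And>n. dist n n0 < d' \<Longrightarrow> Q' n" using PQ'(2) unfolding eventually_nhds_metric by auto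
  have q: "Q' n" if "n \<in> {n0..n0 + d'/2}" for n using that d' by (auto simp: dist_real_def)
  show ?thesis
  proof (rule exI[of _ \<kappa>], rule exI[of _ d], rule exI[of _ n0], rule exI[of _ "n0 + d'/2"], rule exI[of _ "W1 \<inter> W2"],
      intro conjI ballI impI allI)
    fix k' w assume k': "k' \<in> W1 \<inter> W2" "det k' = 1" and "Im w > 0 \<and> cmod w < d"
    then show "act_H2 \<kappa> (mobius_H2 k' w) \<in> ball (of_real \<zeta>) e"
      using PQ(3) W1(3) d(2) actB2 by auto
  next
    fix k' n assume k': "k' \<in> W1 \<inter> W2" "det k' = 1" and "n \<in> {n0..n0 + d'/2}"
    then have "n \<noteq> 0 \<and> mobius_bdry (B k') (Some (1 / n)) \<in> Some ` ball \<eta> e"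
      using PQ'(3) W2(3) q by blast
    then show "n \<noteq> 0" "act_bdry \<kappa> (mobius_bdry k' (Some (1/n))) \<in> Some ` ball \<eta> e"
      using actB k' by auto
  qed (use \<kappa>(1) d d'(1) W1 W2 in auto)
qed

lemma bad_set_closed: "closed (bad_set \<Gamma> \<eta> \<zeta> e)"
proof -
  let ?G = "{g \<in> \<Gamma>. act_H2 g \<i> \<in> ball (of_real \<zeta>) e}"
  have op: "open {x. act_bdry g (Some x) \<in> Some ` ball \<eta> e}" if g: "g \<in> \<Gamma>" for g
  proof -
    let ?A = "rep g"
    let ?S = "{x. ?A$2$1 * x + ?A$2$2 \<noteq> 0}"
    have S: "open ?S" by (intro open_Collect_neq continuous_intros)
    have "continuous_on ?S (\<lambda>x. (?A$1$1 * x + ?A$1$2) / (?A$2$1 * x + ?A$2$2))" by (intro continuous_intros) auto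
    then have "open (?S \<inter> (\<lambda>x. (?A$1$1 * x + ?A$1$2) / (?A$2$1 * x + ?A$2$2)) -` ball \<eta> e)"
      using S by (intro continuous_open_preimage) auto
    moreover have "{x. act_bdry g (Some x) \<in> Some ` ball \<eta> e} = ?S \<inter> (\<lambda>x. (?A$1$1 * x + ?A$1$2) / (?A$2$1 * x + ?A$2$2)) -` ball \<eta> e"
      using g by (auto simp: act_bdry_rep mobius_bdry_def)
    ultimately show ?thesis by simp
  qed
  have eq: "bad_set \<Gamma> \<eta> \<zeta> e = - (\<Union>g\<in>?G. {x. act_bdry g (Some x) \<in> Some ` ball \<eta> e})"
    by (auto simp: bad_set_def)
  have "open (\<Union>g\<in>?G. {x. act_bdry g (Some x) \<in> Some ` ball \<eta> e})" using op by (intro open_UN) auto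
  then show ?thesis unfolding eq by (rule closed_Compl)
qed

text \<open>Compactness of the set of possible \<open>k\<close> makes the data of
  \<open>hole_local\<close> uniform, which is the hypothesis of
  \<open>porous_negligible\<close>.\<close>

lemma bad_set_negligible:
  assumes e: "0 < e" "2 * e < \<bar>\<eta> - \<zeta>\<bar>"
  shows "negligible (bad_set \<Gamma> \<eta> \<zeta> e)"
proof -
  obtain M where M: "\<And>A. det A = 1 \<Longrightarrow> \<exists>\<gamma>\<in>\<Gamma>. \<exists>k. det k = 1 \<and> (\<forall>i j. \<bar>k$i$j\<bar> < M) \<and> psl A = \<gamma> \<otimes>\<^bsub>PSL2\<^esub> psl k"
    using lattice_cocompact[OF lattice] by blast
  let ?K = "{k :: real^2^2. det k = 1 \<and> (\<forall>i j. \<bar>k$i$j\<bar> \<le> M)}"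
  define good where "good k \<kappa> d n1 n2 W \<longleftrightarrow> \<kappa> \<in> \<Gamma> \<and> 0 < d \<and> n1 < n2 \<and> open W \<and> k \<in> W \<and>
    (\<forall>k'\<in>W. det k' = 1 \<longrightarrow>
       (\<forall>w. Im w > 0 \<and> cmod w < d \<longrightarrow> act_H2 \<kappa> (mobius_H2 k' w) \<in> ball (of_real \<zeta>) e) \<and>
       (\<forall>n\<in>{n1..n2}. n \<noteq> 0 \<and> act_bdry \<kappa> (mobius_bdry k' (Some (1/n))) \<in> Some ` ball \<eta> e))" for k \<kappa> d n1 n2 W
  have "\<exists>p. det k = 1 \<longrightarrow> good k (fst p) (fst (snd p)) (fst (snd (snd p))) (fst (snd (snd (snd p)))) (snd (snd (snd (snd p))))" for k
  proof (cases "det k = 1")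
    case True
    obtain \<kappa> d n1 n2 W where "good k \<kappa> d n1 n2 W" using hole_local[OF True e] unfolding good_def by (elim exE)
    then show ?thesis by (intro exI[of _ "(\<kappa>, d, n1, n2, W)"]) simp
  qed simp
  then have "\<exists>p. \<forall>k. det k = 1 \<longrightarrow> good k (fst (p k)) (fst (snd (p k))) (fst (snd (snd (p k)))) (fst (snd (snd (snd (p k))))) (snd (snd (snd (snd (p k)))))"
    by (intro choice) blast
  then obtain p where p: "\<forall>k. det k = 1 \<longrightarrow> good k (fst (p k)) (fst (snd (p k))) (fst (snd (snd (p k)))) (fst (snd (snd (snd (p k))))) (snd (snd (snd (snd (p k)))))" ..
  define \<kappa> d n1 n2 W where pk: "\<kappa> k = fst (p k)" "d k = fst (snd (p k))" "n1 k = fst (snd (snd (p k)))"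
    "n2 k = fst (snd (snd (snd (p k))))" "W k = snd (snd (snd (snd (p k))))" for k
  have good: "\<And>k. det k = 1 \<Longrightarrow> good k (\<kappa> k) (d k) (n1 k) (n2 k) (W k)" using p unfolding pk by blast
  have selfW: "k \<in> W k" "open (W k)" if "det k = 1" for k using good[OF that] by (simp_all add: good_def)
  have cov: "?K \<subseteq> \<Union>(W ` ?K)"
  proof
    fix k assume "k \<in> ?K"
    moreover from this have "k \<in> W k" using selfW(1) by simp
    ultimately show "k \<in> \<Union>(W ` ?K)" by (rule UN_I)
  qed
  have opW: "open V" if "V \<in> W ` ?K" for V using that selfW(2) by auto
  obtain \<D> where D: "\<D> \<subseteq> W ` ?K" "finite \<D>" "?K \<subseteq> \<Union>\<D>"
    by (rule compactE[OF compact_K cov opW])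
  obtain F where F': "F \<subseteq> ?K" "finite F" "\<D> = W ` F" using finite_subset_image[OF D(2,1)] by blast
  then have F: "finite F" "F \<subseteq> ?K" "?K \<subseteq> \<Union>(W ` F)" using D(3) by (simp_all only:)
  define C where "C = 1 + (\<Sum>k\<in>F. \<bar>n1 k\<bar> + \<bar>n2 k\<bar>)"
  define c where "c = Min (insert 1 ((\<lambda>k. n2 k - n1 k) ` F))"
  define r0 where "r0 = Min (insert 1 (d ` F))"
  have gF: "good k (\<kappa> k) (d k) (n1 k) (n2 k) (W k)" if "k \<in> F" for k using that F(2) good by blast
  have C: "C > 0" "\<And>k. k \<in> F \<Longrightarrow> \<bar>n1 k\<bar> \<le> C" "\<And>k. k \<in> F \<Longrightarrow> \<bar>n2 k\<bar> \<le> C"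
  proof -
    have *: "\<bar>n1 k\<bar> + \<bar>n2 k\<bar> \<le> (\<Sum>k\<in>F. \<bar>n1 k\<bar> + \<bar>n2 k\<bar>)" if "k \<in> F" for k
      using F(1) that by (intro member_le_sum[where f = "\<lambda>k. \<bar>n1 k\<bar> + \<bar>n2 k\<bar>"]) auto
    show "C > 0" unfolding C_def by (intro add_pos_nonneg sum_nonneg) auto
    show "\<bar>n1 k\<bar> \<le> C" "\<bar>n2 k\<bar> \<le> C" if "k \<in> F" for k using *[OF that] by (auto simp: C_def)
  qed
  have c: "c > 0" "\<And>k. k \<in> F \<Longrightarrow> c \<le> n2 k - n1 k"
    using F(1) gF unfolding c_def good_def by auto
  have r0: "r0 > 0" "\<And>k. k \<in> F \<Longrightarrow> r0 \<le> d k"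
    using F(1) gF unfolding r0_def good_def by auto
  show ?thesis
  proof (rule porous_negligible[OF bad_set_closed C(1) c(1) r0(1)])
    fix x r :: real assume r: "0 < r" "r < r0"
    \<comment> \<open>\<open>horo x s\<close> works at scale \<open>s^2\<close>, which is to be
      \<open>r\<close>.\<close>
    define s where "s = sqrt r"
    have s: "s > 0" "s\<^sup>2 = r" using r by (simp_all add: s_def)
    obtain \<gamma> k where g: "\<gamma> \<in> \<Gamma>" "det k = 1" "\<forall>i j. \<bar>k$i$j\<bar> < M" "psl (horo x s) = \<gamma> \<otimes>\<^bsub>PSL2\<^esub> psl k"
      using M[OF horo_det, of s x] s by auto
    have "k \<in> ?K" using g(2,3) by (auto intro: less_imp_le)
    then obtain k0 where k0: "k0 \<in> F" "k \<in> W k0" using F(3) by blast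
    note gk = gF[OF k0(1), unfolded good_def]
    let ?g = "\<kappa> k0 \<otimes>\<^bsub>PSL2\<^esub> inv\<^bsub>PSL2\<^esub> \<gamma>"
    have gG: "?g \<in> \<Gamma>" using gk g(1) by simp
    have hk: "mobius_bdry (horo x s) \<xi> = act_bdry \<gamma> (mobius_bdry k \<xi>)" for \<xi>
    proof -
      have "mobius_bdry (horo x s) \<xi> = act_bdry (psl (horo x s)) \<xi>" by (simp add: act_psl)
      also have "\<dots> = act_bdry \<gamma> (act_bdry (psl k) \<xi>)" unfolding g(4) by (rule act_bdry_mult) (use g in auto)
      finally show ?thesis by (simp add: act_psl)
    qed
    have hk2: "mobius_H2 (horo x s) z = act_H2 \<gamma> (mobius_H2 k z)" if "Im z > 0" for z
    proof -
      have "mobius_H2 (horo x s) z = act_H2 (psl (horo x s)) z" by (simp add: act_psl)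
      also have "\<dots> = act_H2 \<gamma> (act_H2 (psl k) z)" unfolding g(4) by (rule act_H2_mult) (use g that in auto)
      finally show ?thesis by (simp add: act_psl)
    qed
    \<comment> \<open>The preimage of \<open>\<i>\<close> under \<open>horo x s\<close>. Its modulus
      is at most \<open>r\<close>, hence below the threshold \<open>d k0\<close>.\<close>
    define w where "w = of_real r / (of_real x - \<i>)"
    have nz: "of_real x - \<i> \<noteq> 0" by (auto simp: complex_eq_iff)
    have Imw: "Im w > 0" using r by (simp add: w_def Im_divide) (simp add: power2_eq_square add_nonneg_pos)
    have w0: "w \<noteq> 0" using Imw by auto
    have "1 \<le> cmod (of_real x - \<i>)" using abs_Im_le_cmod[of "of_real x - \<i>"] by simp
    then have "cmod w \<le> r" using r by (simp add: w_def norm_divide divide_le_eq mult_le_cancel_left1)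
    then have wd: "cmod w < d k0" using r r0(2)[OF k0(1)] by linarith
    have "mobius_H2 (horo x s) w = (of_real x * w - of_real (s * s)) / w"
      using s w0 by (simp add: mobius_H2_def horo_def field_simps)
    also have "\<dots> = of_real x - of_real r / w" using s w0 by (simp add: diff_divide_distrib power2_eq_square)
    also have "\<dots> = \<i>" using r nz by (simp add: w_def)
    finally have hw: "mobius_H2 (horo x s) w = \<i>" .
    have "act_H2 ?g \<i> = act_H2 (\<kappa> k0) (act_H2 (inv\<^bsub>PSL2\<^esub> \<gamma>) (act_H2 \<gamma> (mobius_H2 k w)))"
      using hk2[OF Imw] hw gk g(1) by (simp add: act_H2_mult)
    also have "\<dots> = act_H2 (\<kappa> k0) (mobius_H2 k w)"
      using act_H2_inv(1)[of \<gamma> "mobius_H2 k w"] mobius_H2_pos[OF g(2) Imw] g(1) by simp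
    finally have gi: "act_H2 ?g \<i> \<in> ball (of_real \<zeta>) e" using gk k0(2) g(2) Imw wd by simp
    have hole: "x - r * n \<notin> bad_set \<Gamma> \<eta> \<zeta> e" if n: "n \<in> {n1 k0..n2 k0}" for n
    proof -
      have nn: "n \<noteq> 0" "act_bdry (\<kappa> k0) (mobius_bdry k (Some (1/n))) \<in> Some ` ball \<eta> e"
        using gk k0(2) g(2) n by blast+
      have "act_bdry \<gamma> (mobius_bdry k (Some (1/n))) = Some (x - r * n)"
        using hk[of "Some (1/n)"] horo_bdry(2)[of s "1/n" x] s nn(1) by simp
      then have "act_bdry ?g (Some (x - r * n)) = act_bdry (\<kappa> k0) (act_bdry (inv\<^bsub>PSL2\<^esub> \<gamma>) (act_bdry \<gamma> (mobius_bdry k (Some (1/n)))))"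
        using gk g(1) by (simp add: act_bdry_mult)
      also have "\<dots> = act_bdry (\<kappa> k0) (mobius_bdry k (Some (1/n)))" using g(1) by simp
      finally have "act_bdry ?g (Some (x - r * n)) \<in> Some ` ball \<eta> e" using nn(2) by simp
      then show ?thesis using gi gG unfolding bad_set_def by blast
    qed
    show "\<exists>p q. x - C * r \<le> p \<and> q \<le> x + C * r \<and> c * r \<le> q - p \<and> {p..q} \<inter> bad_set \<Gamma> \<eta> \<zeta> e = {}"
    proof (intro exI conjI)
      have "r * n2 k0 \<le> r * C" using C(3)[OF k0(1)] r by (intro mult_left_mono) auto
      then show "x - C * r \<le> x - r * n2 k0" by (simp add: mult.commute)
      have "r * (- C) \<le> r * n1 k0" using C(2)[OF k0(1)] r by (intro mult_left_mono) auto
      then show "x - r * n1 k0 \<le> x + C * r" by (simp add: mult.commute)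
      have "r * c \<le> r * (n2 k0 - n1 k0)" using c(2)[OF k0(1)] r by (intro mult_left_mono) auto
      then show "c * r \<le> (x - r * n1 k0) - (x - r * n2 k0)" by (simp add: algebra_simps)
      show "{x - r * n2 k0..x - r * n1 k0} \<inter> bad_set \<Gamma> \<eta> \<zeta> e = {}"
      proof (rule ccontr)
        assume "\<not> ?thesis"
        then obtain y where y: "x - r * n2 k0 \<le> y" "y \<le> x - r * n1 k0" "y \<in> bad_set \<Gamma> \<eta> \<zeta> e" by auto
        define n where "n = (x - y) / r"
        have "n \<in> {n1 k0..n2 k0}" using y r by (simp add: n_def pos_le_divide_eq pos_divide_le_eq algebra_simps)
        moreover have "y = x - r * n" using r by (simp add: n_def)
        ultimately show False using hole y(3) by metis
      qed
    qed
  qed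
qed

lemma bad_set_mono:
  assumes "ball \<eta> e \<subseteq> ball \<eta>' e'" "ball (complex_of_real \<zeta>) e \<subseteq> ball (of_real \<zeta>') e'"
  shows "bad_set \<Gamma> \<eta>' \<zeta>' e' \<subseteq> bad_set \<Gamma> \<eta> \<zeta> e"
  using assms unfolding bad_set_def by blast

lemma ex_rat_close: "0 < e \<Longrightarrow> \<exists>q\<in>\<rat>. \<bar>q - x\<bar> < (e::real)"
  using Rats_dense_in_real[of "x - e" "x + e"] by (auto simp: abs_less_iff) (metis abs_diff_less_iff abs_minus_commute add_diff_cancel)

text \<open>By \<open>bad_set_mono\<close> a bad set lies in one with smaller radius and nearby
  centres, so countably many rational parameters suffice; they can be chosen to satisfy
  \<open>2 * e < |\<eta> - \<zeta>|\<close>.\<close>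

lemma not_generic_negligible: "negligible {x. \<not> generic \<Gamma> x}"
proof -
  let ?I = "{(\<eta>, \<zeta>, e). \<eta> \<in> \<rat> \<and> \<zeta> \<in> \<rat> \<and> e \<in> \<rat> \<and> 0 < e \<and> 2 * e < \<bar>\<eta> - \<zeta>\<bar>}"
  have "?I \<subseteq> \<rat> \<times> \<rat> \<times> \<rat>" by auto
  then have cI: "countable ?I" by (rule countable_subset) (intro countable_SIGMA countable_rat)
  have "{x. \<not> generic \<Gamma> x} \<subseteq> (\<Union>(\<eta>, \<zeta>, e)\<in>?I. bad_set \<Gamma> \<eta> \<zeta> e)"
  proof
    fix x assume "x \<in> {x. \<not> generic \<Gamma> x}"
    then obtain \<eta> \<zeta> e where b: "\<eta> \<noteq> \<zeta>" "0 < e" "x \<in> bad_set \<Gamma> \<eta> \<zeta> e" by (auto simp: generic_def)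
    define m where "m = min e \<bar>\<eta> - \<zeta>\<bar>"
    have m: "m > 0" "m \<le> e" "m \<le> \<bar>\<eta> - \<zeta>\<bar>" using b by (auto simp: m_def)
    obtain \<eta>' where h1: "\<eta>' \<in> \<rat>" "\<bar>\<eta>' - \<eta>\<bar> < m / 8" using ex_rat_close[of "m/8" \<eta>] m by auto
    obtain \<zeta>' where h2: "\<zeta>' \<in> \<rat>" "\<bar>\<zeta>' - \<zeta>\<bar> < m / 8" using ex_rat_close[of "m/8" \<zeta>] m by auto
    obtain e' where h3: "e' \<in> \<rat>" "0 < e'" "e' < m / 8" using Rats_dense_in_real[of 0 "m/8"] m by auto
    have "dist \<eta>' \<eta> + e' \<le> e" using h1(2) h3 m unfolding dist_real_def by linarith
    then have 1: "ball \<eta>' e' \<subseteq> ball \<eta> e" by (simp add: ball_subset_ball_iff)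
    have 2: "ball (complex_of_real \<zeta>') e' \<subseteq> ball (of_real \<zeta>) e"
    proof -
      have "dist (complex_of_real \<zeta>') (of_real \<zeta>) = \<bar>\<zeta>' - \<zeta>\<bar>" by (simp add: dist_of_real dist_real_def)
      then have "dist (complex_of_real \<zeta>') (of_real \<zeta>) + e' \<le> e" using h2 h3 m by linarith
      then show ?thesis by (simp add: ball_subset_ball_iff)
    qed
    have "x \<in> bad_set \<Gamma> \<eta>' \<zeta>' e'" using bad_set_mono[OF 1 2] b(3) by blast
    moreover have "2 * e' < \<bar>\<eta>' - \<zeta>'\<bar>" using h1(2) h2(2) h3 m by linarith
    then have "(\<eta>', \<zeta>', e') \<in> ?I" using h1 h2 h3 by auto
    ultimately show "x \<in> (\<Union>(\<eta>, \<zeta>, e)\<in>?I. bad_set \<Gamma> \<eta> \<zeta> e)" by blast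
  qed
  moreover have "negligible (\<Union>(\<eta>, \<zeta>, e)\<in>?I. bad_set \<Gamma> \<eta> \<zeta> e)"
    using cI bad_set_negligible by (intro negligible_countable_Union countable_image) auto
  ultimately show ?thesis using negligible_subset by blast
qed

lemma ex_generic:
  assumes "a < (b::real)"
  shows "\<exists>x\<in>{a<..<b}. generic \<Gamma> x"
proof (rule ccontr)
  assume "\<not> ?thesis"
  then have "{a<..<b} \<subseteq> {x. \<not> generic \<Gamma> x}" by blast
  then have "negligible {a<..<b}" using not_generic_negligible negligible_subset by blast
  then show False using assms negligible_interval(2)[of a b] by (simp add: box_real)
qed

text \<open>The Cayley transform turns the angle \<open>\<theta>\<close> into
  \<open>tan ((\<theta> - pi) / 2)\<close>. The inverse \<open>2 * arctan x + pi\<close> is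
  differentiable, so it maps null sets to null sets.\<close>

lemma AE_generic:
  "AE \<theta> in lebesgue_on {0..2 * pi}. \<exists>x. circle_to_bdry (cis \<theta>) = Some x \<and> generic \<Gamma> x"
proof -
  let ?N = "{x. \<not> generic \<Gamma> x}"
  let ?h = "\<lambda>x. 2 * arctan x + pi"
  have "(?h has_real_derivative 2 * inverse (1 + x\<^sup>2)) (at x)" for x
    by (auto intro!: derivative_eq_intros)
  then have "?h differentiable (at x)" for x
    unfolding real_differentiable_def by blast
  then have "?h differentiable_on ?N" by (intro differentiable_at_imp_differentiable_on)
  then have neg: "negligible (?h ` ?N)"
    using not_generic_negligible by (intro negligible_differentiable_image_negligible) auto
  have "negligible (?h ` ?N \<union> {0, 2 * pi})" using neg by (simp add: negligible_insert)
  then have null: "?h ` ?N \<union> {0, 2 * pi} \<in> null_sets lebesgue" by (simp add: negligible_iff_null_sets)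
  have key: "\<exists>x. circle_to_bdry (cis \<theta>) = Some x \<and> generic \<Gamma> x" if th: "\<theta> \<in> {0..2*pi}" "\<theta> \<notin> ?h ` ?N \<union> {0, 2 * pi}" for \<theta>
  proof -
    define a where "a = (\<theta> - pi) / 2"
    have a: "- (pi/2) < a" "a < pi / 2" using th by (auto simp: a_def)
    have th2: "\<theta> = 2 * a + pi" unfolding a_def by (simp add: field_simps)
    have ca: "cos a \<noteq> 0" using cos_gt_zero_pi[OF a] by simp
    have cs: "cos \<theta> = - (2 * (cos a)\<^sup>2 - 1)" "sin \<theta> = - (2 * sin a * cos a)"
      unfolding th2 by (simp_all add: cos_double_cos sin_double)
    have n1: "cis \<theta> \<noteq> 1"
    proof
      assume "cis \<theta> = 1"
      then have "cos \<theta> = 1" by (simp add: complex_eq_iff)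
      then show False using ca cs by simp
    qed
    have "\<i> * (1 + cis \<theta>) = of_real (tan a) * (1 - cis \<theta>)"
    proof (rule complex_eqI)
      have "- sin \<theta> = tan a * (1 - cos \<theta>)" using ca by (simp add: cs tan_def power2_eq_square)
      then show "Re (\<i> * (1 + cis \<theta>)) = Re (of_real (tan a) * (1 - cis \<theta>))" by simp
      have "1 + cos \<theta> = 2 * (sin a)\<^sup>2" unfolding cs by (simp add: sin_squared_eq algebra_simps)
      also have "\<dots> = tan a * (- sin \<theta>)" using ca by (simp add: cs tan_def power2_eq_square)
      finally show "Im (\<i> * (1 + cis \<theta>)) = Im (of_real (tan a) * (1 - cis \<theta>))" by simp
    qed
    then have "\<i> * (1 + cis \<theta>) / (1 - cis \<theta>) = of_real (tan a)" using n1 by (simp add: field_simps)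
    then have "circle_to_bdry (cis \<theta>) = Some (tan a)" using n1 by (simp add: circle_to_bdry_def)
    moreover have "generic \<Gamma> (tan a)"
    proof (rule ccontr)
      assume "\<not> generic \<Gamma> (tan a)"
      then have "?h (tan a) \<in> ?h ` ?N" by blast
      moreover have "?h (tan a) = \<theta>" using a by (simp add: arctan_tan th2)
      ultimately show False using th by simp
    qed
    ultimately show ?thesis by blast
  qed
  have "AE \<theta> in lebesgue. \<theta> \<notin> ?h ` ?N \<union> {0, 2 * pi}" using null by (rule AE_not_in)
  then have "AE \<theta> in lebesgue. \<theta> \<in> {0..2*pi} \<longrightarrow> (\<exists>x. circle_to_bdry (cis \<theta>) = Some x \<and> generic \<Gamma> x)"
    by eventually_elim (use key in blast)
  then show ?thesis by (simp add: AE_restrict_space_iff)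
qed

end

section \<open>Pushing connected sets to a level set\<close>

text \<open>The infimum of the levels down to which \<open>C\<close> can be pushed is \<open>c\<close>, since a local retraction pushes past any
  other level.\<close>

lemma push_down:
  fixes u :: "'a::topological_space \<Rightarrow> real"
  assumes u: "continuous_on H u"
    and loc: "\<And>c. \<exists>\<eta>>0. \<forall>s. \<bar>s - c\<bar> < \<eta> \<longrightarrow> (\<exists>r. continuous_on {x\<in>H. \<bar>u x - c\<bar> < \<eta>} r \<and>
        (\<forall>x\<in>H. \<bar>u x - c\<bar> < \<eta> \<longrightarrow> r x \<in> H \<and> u (r x) = s \<and> (u x = s \<longrightarrow> r x = x)))"
    and C: "connected C" "C \<subseteq> H" "\<And>x. x \<in> C \<Longrightarrow> u x \<le> b"
  shows "\<exists>C'. connected C' \<and> C' \<subseteq> H \<and> C \<inter> {x. u x \<le> c} \<subseteq> C' \<and> (\<forall>x\<in>C'. u x \<le> c \<and> (x \<in> C \<or> u x = c))"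
proof -
  define P where "P b' C' \<longleftrightarrow> connected C' \<and> C' \<subseteq> H \<and> C \<inter> {x. u x \<le> c} \<subseteq> C' \<and> (\<forall>x\<in>C'. u x \<le> b' \<and> (x \<in> C \<or> u x \<ge> c))" for b' C'
  define B where "B = {b'. b' \<ge> c \<and> (\<exists>C'. P b' C')}"
  have "max b c \<in> B"
    unfolding B_def P_def using C by (auto intro!: exI[of _ C] simp: le_max_iff_disj)
  then have ne: "B \<noteq> {}" by blast
  have bb: "bdd_below B" unfolding B_def by (intro bdd_belowI[of _ c]) simp
  define t where "t = Inf B"
  have tc: "c \<le> t" unfolding t_def using ne by (intro cInf_greatest) (auto simp: B_def)
  obtain \<eta> where \<eta>: "\<eta> > 0" "\<And>s. \<bar>s - t\<bar> < \<eta> \<Longrightarrow> (\<exists>r. continuous_on {x\<in>H. \<bar>u x - t\<bar> < \<eta>} r \<and>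
        (\<forall>x\<in>H. \<bar>u x - t\<bar> < \<eta> \<longrightarrow> r x \<in> H \<and> u (r x) = s \<and> (u x = s \<longrightarrow> r x = x)))"
    using loc[of t] by blast
  have "t < t + \<eta>" using \<eta> by simp
  then obtain b' where b': "b' \<in> B" "b' < t + \<eta>" using cInf_lessD[OF ne] unfolding t_def by blast
  obtain C' where C': "P b' C'" using b' by (auto simp: B_def)
  \<comment> \<open>Half a step below the infimum, but stopped at \<open>c\<close>. Reaching a level
    below \<open>t\<close> would contradict the infimum, so the stop must have occurred.\<close>
  define s where "s = max c (t - \<eta>/2)"
  have st: "s \<le> t" "\<bar>s - t\<bar> < \<eta>" "s \<ge> c" using tc \<eta> by (auto simp: s_def)
  obtain r where r: "continuous_on {x\<in>H. \<bar>u x - t\<bar> < \<eta>} r"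
    "\<And>x. x \<in> H \<Longrightarrow> \<bar>u x - t\<bar> < \<eta> \<Longrightarrow> r x \<in> H \<and> u (r x) = s \<and> (u x = s \<longrightarrow> r x = x)"
    using \<eta>(2)[OF st(2)] by blast
  have near: "\<bar>u x - t\<bar> < \<eta>" if "x \<in> C'" "s \<le> u x" for x
    using that C' b' st \<eta> unfolding P_def s_def by (smt (verit) field_sum_of_halves)
  define m where "m x = (if u x \<le> s then x else r x)" for x
  have "continuous_on C' m"
    unfolding m_def
  proof (rule continuous_on_cases_le)
    show "continuous_on {t \<in> C'. u t \<le> s} (\<lambda>x. x)" by (rule continuous_on_id)
    show "continuous_on {t \<in> C'. s \<le> u t} r"
      by (rule continuous_on_subset[OF r(1)]) (use near C' in \<open>auto simp: P_def\<close>)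
    show "continuous_on C' u" using u C' unfolding P_def by (meson continuous_on_subset)
    show "x = r x" if "x \<in> C'" "u x = s" for x
      using r(2)[of x] near[of x] that C' by (auto simp: P_def)
  qed
  then have con: "connected (m ` C')" using C' connected_continuous_image unfolding P_def by blast
  have mprop: "m x \<in> H \<and> u (m x) \<le> s \<and> (m x \<in> C \<or> u (m x) \<ge> c)" if "x \<in> C'" for x
    using that r(2)[of x] near[of x] C' st unfolding m_def P_def by auto
  have "C \<inter> {x. u x \<le> c} \<subseteq> m ` C'"
  proof
    fix x assume x: "x \<in> C \<inter> {x. u x \<le> c}"
    then have "x \<in> C'" using C' by (auto simp: P_def)
    moreover have "m x = x" using x st by (simp add: m_def)
    ultimately show "x \<in> m ` C'" by (metis imageI)
  qed
  then have Ps: "P s (m ` C')" using con mprop by (auto simp: P_def)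
  then have "s \<in> B" using st by (auto simp: B_def)
  then have "t \<le> s" unfolding t_def using bb by (simp add: cInf_lower)
  then have "s = c" using \<eta> by (auto simp: s_def max_def split: if_splits)
  then have "P c (m ` C')" using Ps by simp
  then show ?thesis unfolding P_def by (intro exI[of _ "m ` C'"]) force
qed

section \<open>Hyperbolic space and its discrete groups of isometries\<close>

lemma H3_snd: "x \<in> H3 \<longleftrightarrow> snd x > 0"
  by (cases x) (simp add: H3_def)

lemma H3_Times: "H3 = UNIV \<times> {0<..}"
  by (auto simp: H3_def)

lemma open_H3: "open H3"
  unfolding H3_Times by (intro open_Times) auto

lemma convex_H3: "convex H3"
  unfolding H3_Times by (intro convex_Times) auto

lemma chC_nonneg: "x \<in> H3 \<Longrightarrow> y \<in> H3 \<Longrightarrow> chC x y \<ge> 0"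
  by (simp add: chC_def H3_snd)

lemma chC_self: "chC x x = 0"
  by (simp add: chC_def)

lemma h3_dist_chC: "h3_dist x y = arcosh (1 + chC x y)"
  by (cases x; cases y) (simp add: h3_dist_def chC_def)

lemma arcosh_inj: "a \<ge> 1 \<Longrightarrow> b \<ge> 1 \<Longrightarrow> arcosh a = arcosh b \<Longrightarrow> a = (b::real)"
proof -
  assume ab: "a \<ge> 1" "b \<ge> 1" "arcosh a = arcosh b"
  have *: "a < b \<Longrightarrow> arcosh a < arcosh b" if "a \<ge> 1" for a b :: real
  proof -
    assume lt: "a < b"
    then have "a\<^sup>2 \<le> b\<^sup>2" using that by (intro power_mono) auto
    then have "a + sqrt (a\<^sup>2 - 1) < b + sqrt (b\<^sup>2 - 1)" using lt by (intro add_less_le_mono) auto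
    moreover have "0 < a + sqrt (a\<^sup>2 - 1)" using that by (intro add_pos_nonneg) auto
    ultimately show ?thesis using that lt by (simp add: arcosh_real_def)
  qed
  show "a = b" using *[of a b] *[of b a] ab by linarith
qed

lemma chC_continuous: "x \<in> H3 \<Longrightarrow> y \<in> H3 \<Longrightarrow> ((\<lambda>p. chC (fst p) (snd p)) \<longlongrightarrow> chC x y) (nhds (x, y))"
proof -
  assume "x \<in> H3" "y \<in> H3"
  then have nz: "2 * snd x * snd y \<noteq> 0" by (simp add: H3_snd)
  have f: "(fst \<longlongrightarrow> x) (nhds (x, y))" and s: "(snd \<longlongrightarrow> y) (nhds (x, y))"
    using tendsto_fst[OF filterlim_ident, of "(x, y)"] tendsto_snd[OF filterlim_ident, of "(x, y)"] by simp_all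
  show ?thesis unfolding chC_def by (intro tendsto_intros f s nz)
qed

lemma chC_nbhd:
  assumes "x \<in> H3" "y \<in> H3" "chC x y < e"
  shows "\<exists>U V. open U \<and> open V \<and> x \<in> U \<and> y \<in> V \<and> (\<forall>x'\<in>U. \<forall>y'\<in>V. chC x' y' < e)"
proof -
  have "\<forall>\<^sub>F p in nhds (x, y). chC (fst p) (snd p) < e"
    using order_tendstoD(2)[OF chC_continuous[OF assms(1,2)] assms(3)] .
  then obtain P Q where PQ: "eventually P (nhds x)" "eventually Q (nhds y)" "\<And>x' y'. P x' \<Longrightarrow> Q y' \<Longrightarrow> chC x' y' < e"
    unfolding nhds_prod eventually_prod_filter by auto
  obtain U where "open U" "x \<in> U" "\<And>x'. x' \<in> U \<Longrightarrow> P x'" using PQ(1) unfolding eventually_nhds by blast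
  moreover obtain V where "open V" "y \<in> V" "\<And>x'. x' \<in> V \<Longrightarrow> Q x'" using PQ(2) unfolding eventually_nhds by blast
  ultimately show ?thesis using PQ(3) by (intro exI[of _ U] exI[of _ V]) simp
qed

text \<open>Small hyperbolic balls are comparable to Euclidean balls of radius proportional to the
  height; \<open>e \<le> 1\<close> keeps the height of \<open>y\<close> below four times that of
  \<open>x\<close>.\<close>

lemma chC_dist_bound:
  assumes "x \<in> H3" "y \<in> H3" "chC x y < e" "e \<le> 1"
  shows "(dist x y)\<^sup>2 < 16 * e * (snd x)\<^sup>2"
proof -
  obtain z t w s where xy: "x = (z, t)" "y = (w, s)" by (cases x; cases y)
  have ts: "t > 0" "s > 0" using assms xy by (simp_all add: H3_snd)
  have lt: "(cmod (z - w))\<^sup>2 + (t - s)\<^sup>2 < e * (2 * t * s)"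
    using assms(3) ts by (simp add: chC_def xy divide_less_eq)
  have "e * (2 * t * s) \<le> 1 * (2 * t * s)" using assms(4) ts by (intro mult_right_mono) auto
  then have "(t - s)\<^sup>2 < 2 * t * s" using lt by (smt (verit) zero_le_power2)
  then have "t\<^sup>2 + s * s < 4 * t * s" by (simp add: power2_eq_square algebra_simps)
  then have "s * s < 4 * t * s" using zero_le_power2[of t] by linarith
  then have s4: "s < 4 * t" using ts by simp
  have e0: "e > 0" using assms chC_nonneg[OF assms(1,2)] by linarith
  have "e * (2 * t * s) \<le> e * (2 * t * (4 * t))" using s4 ts e0 by (intro mult_left_mono) auto
  moreover have "e * (2 * t * (4 * t)) = 8 * e * t\<^sup>2" by (simp add: power2_eq_square)
  ultimately have "(cmod (z - w))\<^sup>2 + (t - s)\<^sup>2 < 8 * e * t\<^sup>2" using lt by linarith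
  moreover have "8 * e * t\<^sup>2 \<le> 16 * e * t\<^sup>2" using e0 by simp
  ultimately show ?thesis by (simp add: xy dist_norm norm_Pair)
qed

text \<open>One radius \<open>e\<close> serves all centres near \<open>x\<close>; the local
  hypothesis of \<open>uniformize\<close> asks for this form.\<close>

lemma chC_local_ball:
  assumes "open W" "x \<in> W" "x \<in> H3"
  shows "\<exists>e>0. \<exists>U. open U \<and> x \<in> U \<and> (\<forall>x'\<in>U \<inter> H3. \<forall>y\<in>H3. chC x' y < e \<longrightarrow> y \<in> W)"
proof -
  obtain r where r: "r > 0" "ball x r \<subseteq> W" using assms by (meson open_contains_ball)
  define T where "T = snd x"
  have T: "T > 0" using assms by (simp add: H3_snd T_def)
  define e where "e = min 1 (r\<^sup>2 / (256 * T\<^sup>2))"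
  have e: "e > 0" "e \<le> 1" using r T by (simp_all add: e_def)
  have eT: "64 * e * T\<^sup>2 \<le> (r/2)\<^sup>2"
  proof -
    have "e * T\<^sup>2 \<le> (r\<^sup>2 / (256 * T\<^sup>2)) * T\<^sup>2" unfolding e_def by (intro mult_right_mono) auto
    also have "\<dots> = r\<^sup>2 / 256" using T by simp
    finally show ?thesis by (simp add: power_divide)
  qed
  show ?thesis
  proof (intro exI[of _ e] conjI e(1) exI[of _ "ball x (min (r/2) T)"] ballI impI)
    fix x' y assume x': "x' \<in> ball x (min (r/2) T) \<inter> H3" and y: "y \<in> H3" "chC x' y < e"
    have "\<bar>snd x' - snd x\<bar> \<le> dist x' x" using dist_snd_le[of x' x] by (simp add: dist_real_def)
    then have "snd x' < 2 * T" using x' by (auto simp: T_def dist_commute)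
    moreover have "snd x' > 0" using x' by (simp add: H3_snd)
    ultimately have "(snd x')\<^sup>2 \<le> (2 * T)\<^sup>2" by (intro power_mono) auto
    then have "16 * e * (snd x')\<^sup>2 \<le> 16 * e * (2 * T)\<^sup>2" using e by (intro mult_left_mono) auto
    moreover have "16 * e * (2 * T)\<^sup>2 = 64 * e * T\<^sup>2" by (simp add: power_mult_distrib)
    moreover have "(dist x' y)\<^sup>2 < 16 * e * (snd x')\<^sup>2" using chC_dist_bound[of x' y e] x' y e by simp
    ultimately have "(dist x' y)\<^sup>2 < (r/2)\<^sup>2" using eT by linarith
    then have "dist x' y < r / 2" by (rule power2_less_imp_less) (use r in simp)
    then have "dist x y < r" using x' dist_triangle[of x y x'] by simp
    then show "y \<in> W" using r by auto
  qed (use r T in auto)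
qed

section \<open>Discrete cocompact groups of isometries\<close>

locale hyp3 =
  fixes \<Delta> :: "(complex \<times> real \<Rightarrow> complex \<times> real) set"
  assumes hyp3: "closed_hyperbolic_3_manifold \<Delta>"
begin

lemma sub: "subgroup \<Delta> (BijGroup H3)"
  using hyp3 by (simp add: closed_hyperbolic_3_manifold_def)

lemma Bij: "\<delta> \<in> \<Delta> \<Longrightarrow> \<delta> \<in> Bij H3"
  using subgroup.mem_carrier[OF sub] by (simp add: BijGroup_def)

lemma bij: "\<delta> \<in> \<Delta> \<Longrightarrow> bij_betw \<delta> H3 H3"
  using Bij by (simp add: Bij_def)

lemma maps [simp]: "\<delta> \<in> \<Delta> \<Longrightarrow> x \<in> H3 \<Longrightarrow> \<delta> x \<in> H3"
  using bij by (auto simp: bij_betw_def)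

lemma comp: "\<delta> \<in> \<Delta> \<Longrightarrow> \<epsilon> \<in> \<Delta> \<Longrightarrow> \<exists>\<kappa>\<in>\<Delta>. \<forall>x\<in>H3. \<kappa> x = \<delta> (\<epsilon> x)"
  using subgroup.m_closed[OF sub, of \<delta> \<epsilon>] Bij[of \<delta>] Bij[of \<epsilon>]
  by (auto simp: BijGroup_def compose_def intro!: bexI[of _ "compose H3 \<delta> \<epsilon>"])

lemma idD: "\<exists>\<iota>\<in>\<Delta>. \<forall>x\<in>H3. \<iota> x = x"
  using subgroup.one_closed[OF sub] by (auto simp: BijGroup_def intro!: bexI[of _ "\<lambda>x\<in>H3. x"])

lemma invD:
  assumes "\<delta> \<in> \<Delta>"
  shows "\<exists>\<kappa>\<in>\<Delta>. \<forall>x\<in>H3. \<kappa> (\<delta> x) = x \<and> \<delta> (\<kappa> x) = x"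
proof -
  let ?k = "inv\<^bsub>BijGroup H3\<^esub> \<delta>"
  have "?k \<in> \<Delta>" using subgroup.m_inv_closed[OF sub assms] .
  moreover have "?k = (\<lambda>x\<in>H3. inv_into H3 \<delta> x)" using inv_BijGroup[OF Bij[OF assms]] .
  moreover have "inv_into H3 \<delta> (\<delta> x) = x" "\<delta> (inv_into H3 \<delta> x) = x" if "x \<in> H3" for x
    using bij[OF assms] that by (simp_all add: bij_betw_def inv_into_f_f f_inv_into_f)
  ultimately show ?thesis using assms by (intro bexI[of _ ?k]) auto
qed

lemma chC_inv [simp]:
  assumes "\<delta> \<in> \<Delta>" "x \<in> H3" "y \<in> H3"
  shows "chC (\<delta> x) (\<delta> y) = chC x y"
proof -
  have "h3_dist (\<delta> x) (\<delta> y) = h3_dist x y" using hyp3 assms by (simp add: closed_hyperbolic_3_manifold_def)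
  then have a: "arcosh (1 + chC (\<delta> x) (\<delta> y)) = arcosh (1 + chC x y)" unfolding h3_dist_chC .
  have "chC (\<delta> x) (\<delta> y) \<ge> 0" "chC x y \<ge> 0" using assms by (simp_all add: chC_nonneg)
  then have "1 + chC (\<delta> x) (\<delta> y) = 1 + chC x y" by (intro arcosh_inj[OF _ _ a]) simp_all
  then show ?thesis by simp
qed

lemma free:
  assumes "\<delta> \<in> \<Delta>" "x \<in> H3" "\<delta> x = x" "y \<in> H3"
  shows "\<delta> y = y"
proof -
  have "\<delta> = \<one>\<^bsub>BijGroup H3\<^esub>" using hyp3 assms by (auto simp: closed_hyperbolic_3_manifold_def)
  then show ?thesis using assms by (simp add: BijGroup_def)
qed

lemma free2:
  assumes "\<delta> \<in> \<Delta>" "\<epsilon> \<in> \<Delta>" "x \<in> H3" "\<delta> x = \<epsilon> x" "y \<in> H3"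
  shows "\<delta> y = \<epsilon> y"
proof -
  obtain \<kappa> where k: "\<kappa> \<in> \<Delta>" "\<And>x. x \<in> H3 \<Longrightarrow> \<kappa> (\<epsilon> x) = x \<and> \<epsilon> (\<kappa> x) = x" using invD[OF assms(2)] by blast
  obtain \<mu> where m: "\<mu> \<in> \<Delta>" "\<And>x. x \<in> H3 \<Longrightarrow> \<mu> x = \<kappa> (\<delta> x)" using comp[OF k(1) assms(1)] by blast
  have "\<mu> x = x" using m k assms by simp
  then have "\<mu> y = y" using free m(1) assms by blast
  then have "\<kappa> (\<delta> y) = y" using m assms by simp
  then show ?thesis using k(2)[of "\<delta> y"] assms by simp
qed

lemma properly_discontinuous:
  "compact K \<Longrightarrow> K \<subseteq> H3 \<Longrightarrow> finite {\<delta>\<in>\<Delta>. \<delta> ` K \<inter> K \<noteq> {}}"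
  using hyp3 by (simp add: closed_hyperbolic_3_manifold_def)

lemma cont: "\<delta> \<in> \<Delta> \<Longrightarrow> continuous_on H3 \<delta>"
  unfolding continuous_on_topological
proof (intro ballI allI impI)
  fix x B assume d: "\<delta> \<in> \<Delta>" and x: "x \<in> H3" and B: "open B" "\<delta> x \<in> B"
  obtain e U where e: "e > 0" "\<delta> x \<in> U" "\<forall>x'\<in>U \<inter> H3. \<forall>y\<in>H3. chC x' y < e \<longrightarrow> y \<in> B"
    using chC_local_ball[OF B] d x by auto
  obtain V V' where V: "open V" "open V'" "x \<in> V" "x \<in> V'" "\<forall>x'\<in>V. \<forall>y'\<in>V'. chC x' y' < e"
    using chC_nbhd[OF x x, of e] e(1) by (auto simp: chC_self)
  have "\<delta> y \<in> B" if "y \<in> H3" "y \<in> V'" for y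
  proof -
    have "chC (\<delta> x) (\<delta> y) < e" using V that d x by simp
    then show ?thesis using e(2) e(3)[rule_format, of "\<delta> x" "\<delta> y"] d x that by simp
  qed
  then show "\<exists>A. open A \<and> x \<in> A \<and> (\<forall>y\<in>H3. y \<in> A \<longrightarrow> \<delta> y \<in> B)" using V by blast
qed

lemma open_image: "\<delta> \<in> \<Delta> \<Longrightarrow> open V \<Longrightarrow> V \<subseteq> H3 \<Longrightarrow> open (\<delta> ` V)"
proof -
  assume a: "\<delta> \<in> \<Delta>" "open V" "V \<subseteq> H3"
  obtain \<kappa> where k: "\<kappa> \<in> \<Delta>" "\<And>x. x \<in> H3 \<Longrightarrow> \<kappa> (\<delta> x) = x \<and> \<delta> (\<kappa> x) = x" using invD[OF a(1)] by blast
  have "\<delta> ` V = H3 \<inter> \<kappa> -` V"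
  proof (intro equalityI subsetI)
    fix y assume "y \<in> H3 \<inter> \<kappa> -` V"
    then show "y \<in> \<delta> ` V" using k(2)[of y] by (metis IntE imageI vimageD)
  qed (use a k in auto)
  then show ?thesis using continuous_open_preimage[OF cont[OF k(1)] open_H3 a(2)] by simp
qed

abbreviation pr :: "complex \<times> real \<Rightarrow> (complex \<times> real) set" where
  "pr \<equiv> orbit_of \<Delta>"

lemma pr_self: "x \<in> H3 \<Longrightarrow> x \<in> pr x"
  using idD by (auto simp: orbit_of_def image_iff) metis

lemma pr_eq_iff:
  assumes "x \<in> H3" "y \<in> H3"
  shows "pr x = pr y \<longleftrightarrow> (\<exists>\<delta>\<in>\<Delta>. y = \<delta> x)"
proof
  assume "pr x = pr y"
  then have "y \<in> pr x" using pr_self assms by blast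
  then show "\<exists>\<delta>\<in>\<Delta>. y = \<delta> x" by (auto simp: orbit_of_def)
next
  assume "\<exists>\<delta>\<in>\<Delta>. y = \<delta> x"
  then obtain \<delta> where d: "\<delta> \<in> \<Delta>" "y = \<delta> x" by blast
  obtain \<kappa> where k: "\<kappa> \<in> \<Delta>" "\<And>x. x \<in> H3 \<Longrightarrow> \<kappa> (\<delta> x) = x \<and> \<delta> (\<kappa> x) = x" using invD[OF d(1)] by blast
  have "\<epsilon> y \<in> pr x" if ep: "\<epsilon> \<in> \<Delta>" for \<epsilon>
  proof -
    obtain \<mu> where "\<mu> \<in> \<Delta>" "\<And>x. x \<in> H3 \<Longrightarrow> \<mu> x = \<epsilon> (\<delta> x)" using comp[OF ep d(1)] by blast
    then have "\<epsilon> y = \<mu> x" "\<mu> \<in> \<Delta>" using d assms by simp_all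
    then show ?thesis unfolding orbit_of_def by (simp add: image_iff) metis
  qed
  moreover have "\<epsilon> x \<in> pr y" if ep: "\<epsilon> \<in> \<Delta>" for \<epsilon>
  proof -
    obtain \<mu> where "\<mu> \<in> \<Delta>" "\<And>x. x \<in> H3 \<Longrightarrow> \<mu> x = \<epsilon> (\<kappa> x)" using comp[OF ep k(1)] by blast
    then have "\<epsilon> x = \<mu> y" "\<mu> \<in> \<Delta>" using d assms k by simp_all
    then show ?thesis unfolding orbit_of_def by (simp add: image_iff) metis
  qed
  ultimately show "pr x = pr y" unfolding orbit_of_def by blast
qed

lemma pr_inv: "\<delta> \<in> \<Delta> \<Longrightarrow> x \<in> H3 \<Longrightarrow> pr (\<delta> x) = pr x"
  using pr_eq_iff[of x "\<delta> x"] by auto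

lemma openin_M: "openin (H3_quotient \<Delta>) \<U> \<longleftrightarrow> \<U> \<subseteq> pr ` H3 \<and> open (\<Union>\<U>)"
proof -
  have dis: "disjoint (pr ` H3)"
  proof (rule pairwiseI)
    fix A B assume AB: "A \<in> pr ` H3" "B \<in> pr ` H3" "A \<noteq> B"
    then obtain x y where xy: "x \<in> H3" "y \<in> H3" "A = pr x" "B = pr y" by auto
    have "z \<notin> B" if z: "z \<in> A" for z
    proof
      assume "z \<in> B"
      then obtain \<delta> \<epsilon> where "\<delta> \<in> \<Delta>" "\<epsilon> \<in> \<Delta>" "z = \<delta> x" "z = \<epsilon> y" using z xy by (auto simp: orbit_of_def)
      then have "pr x = pr y" using pr_inv xy by metis
      then show False using AB xy by simp
    qed
    then show "disjnt A B" by (auto simp: disjnt_def)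
  qed
  have sub: "\<Union>\<U> \<subseteq> H3" if "\<U> \<subseteq> pr ` H3" using that by (auto simp: orbit_of_def)
  have "openin (top_of_set H3) W \<longleftrightarrow> open W" if "W \<subseteq> H3" for W
    using open_H3 that by (simp add: openin_open_eq)
  then show ?thesis unfolding H3_quotient_def orbit_space_def using openin_quotient_topology[OF dis] sub by auto
qed

lemma open_pr_image: "open V \<Longrightarrow> V \<subseteq> H3 \<Longrightarrow> openin (H3_quotient \<Delta>) (pr ` V)"
proof -
  assume V: "open V" "V \<subseteq> H3"
  have "\<Union>(pr ` V) = (\<Union>\<delta>\<in>\<Delta>. \<delta> ` V)" by (auto simp: orbit_of_def)
  then show ?thesis unfolding openin_M using V open_image by auto
qed

lemma topspace_M: "topspace (H3_quotient \<Delta>) = pr ` H3"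
proof
  show "topspace (H3_quotient \<Delta>) \<subseteq> pr ` H3" using openin_M openin_topspace by blast
  show "pr ` H3 \<subseteq> topspace (H3_quotient \<Delta>)" using open_pr_image[OF open_H3] openin_subset by blast
qed

lemma continuous_pr: "continuous_map (top_of_set H3) (H3_quotient \<Delta>) pr"
  unfolding continuous_map
proof (intro conjI allI impI)
  show "pr ` topspace (top_of_set H3) \<subseteq> topspace (H3_quotient \<Delta>)" by (simp add: topspace_M)
  fix U assume U: "openin (H3_quotient \<Delta>) U"
  have "{x \<in> topspace (top_of_set H3). pr x \<in> U} = \<Union>U"
  proof (intro equalityI subsetI)
    fix x assume x: "x \<in> \<Union>U"
    then obtain y where y: "y \<in> H3" "pr y \<in> U" "x \<in> pr y" using U by (auto simp: openin_M)
    then obtain \<delta> where "\<delta> \<in> \<Delta>" "x = \<delta> y" by (auto simp: orbit_of_def)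
    then show "x \<in> {x \<in> topspace (top_of_set H3). pr x \<in> U}" using y pr_inv by simp
  qed (use pr_self in auto)
  moreover have "\<Union>U \<subseteq> H3" using U by (auto simp: openin_M orbit_of_def)
  ultimately show "openin (top_of_set H3) {x \<in> topspace (top_of_set H3). pr x \<in> U}"
    using U open_H3 by (simp add: openin_M openin_open_eq)
qed

lemma H3_cocompact: "\<exists>K. compact K \<and> K \<subseteq> H3 \<and> (\<forall>x\<in>H3. \<exists>\<delta>\<in>\<Delta>. \<exists>k\<in>K. x = \<delta> k)"
proof -
  define B where "B n = {x :: complex \<times> real. cmod (fst x) < real (Suc n) \<and> 1 / real (Suc n) < snd x \<and> snd x < real (Suc n)}" for n
  have opB: "open (B n)" for n
  proof -
    have "B n = {x. cmod (fst x) < real (Suc n)} \<inter> {x. 1 / real (Suc n) < snd x} \<inter> {x. snd x < real (Suc n)}"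
      by (auto simp: B_def)
    then show ?thesis by (simp only:) (intro open_Int open_Collect_less continuous_intros)
  qed
  have BH: "B n \<subseteq> H3" for n
  proof
    fix x assume "x \<in> B n"
    then have "1 / real (Suc n) < snd x" by (simp add: B_def)
    moreover have "0 < 1 / real (Suc n)" by simp
    ultimately show "x \<in> H3" unfolding H3_snd by (rule less_trans[rotated])
  qed
  have cov: "\<exists>n. x \<in> B n" if "x \<in> H3" for x
  proof -
    have p: "snd x > 0" using that by (simp add: H3_snd)
    obtain n where n: "max (cmod (fst x)) (max (1 / snd x) (snd x)) < real n" using reals_Archimedean2 by blast
    then have "max (cmod (fst x)) (max (1 / snd x) (snd x)) < real (Suc n)" by simp
    then have "cmod (fst x) < real (Suc n)" "1 / snd x < real (Suc n)" "snd x < real (Suc n)" by (simp_all del: of_nat_Suc)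
    moreover from this(2) have "1 / real (Suc n) < snd x" using p by (simp add: divide_less_eq mult.commute del: of_nat_Suc)
    ultimately show ?thesis by (auto simp: B_def)
  qed
  have mono: "B m \<subseteq> B n" if "m \<le> n" for m n
  proof
    fix x assume x: "x \<in> B m"
    have "real (Suc m) \<le> real (Suc n)" using that by simp
    moreover have "1 / real (Suc n) \<le> 1 / real (Suc m)" using that by (simp add: frac_le)
    ultimately show "x \<in> B n" using x by (simp add: B_def del: of_nat_Suc)
  qed
  have cs: "compact_space (H3_quotient \<Delta>)" using hyp3 by (simp add: closed_hyperbolic_3_manifold_def)
  have cv: "pr ` H3 \<subseteq> \<Union>(range (\<lambda>n. pr ` B n))"
  proof
    fix m assume "m \<in> pr ` H3"
    then obtain x where x: "x \<in> H3" "m = pr x" by auto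
    obtain n where "x \<in> B n" using cov[OF x(1)] ..
    then show "m \<in> \<Union>(range (\<lambda>n. pr ` B n))" using x by auto
  qed
  have "\<exists>\<F>. finite \<F> \<and> \<F> \<subseteq> range (\<lambda>n. pr ` B n) \<and> pr ` H3 \<subseteq> \<Union>\<F>"
    by (rule cs[unfolded compact_space_alt topspace_M, rule_format]) (use cv open_pr_image[OF opB BH] in \<open>simp add: image_iff; force\<close>)
  then obtain \<F> where F: "finite \<F>" "\<F> \<subseteq> range (\<lambda>n. pr ` B n)" "pr ` H3 \<subseteq> \<Union>\<F>" by (elim exE conjE)
  obtain I where I: "finite I" "\<F> = (\<lambda>n. pr ` B n) ` I" using finite_subset_image[OF F(1,2)] by blast
  define N where "N = Max (insert 0 I)"
  define K where "K = {x :: complex \<times> real. cmod (fst x) \<le> real (Suc N) \<and> 1 / real (Suc N) \<le> snd x \<and> snd x \<le> real (Suc N)}"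
  have "K = cball 0 (real (Suc N)) \<times> {1 / real (Suc N)..real (Suc N)}" by (auto simp: K_def)
  then have "compact K" by (simp only:) (intro compact_Times compact_cball compact_Icc)
  moreover have "K \<subseteq> H3"
  proof
    fix x assume "x \<in> K"
    then have "1 / real (Suc N) \<le> snd x" by (simp add: K_def)
    moreover have "0 < 1 / real (Suc N)" by simp
    ultimately show "x \<in> H3" unfolding H3_snd by linarith
  qed
  moreover have "\<exists>\<delta>\<in>\<Delta>. \<exists>k\<in>K. x = \<delta> k" if x: "x \<in> H3" for x
  proof -
    obtain i where i: "i \<in> I" "pr x \<in> pr ` B i" using F(3) I x by auto
    then obtain k where k: "k \<in> B i" "pr x = pr k" by auto
    have "k \<in> B N" using mono[of i N] i I k by (auto simp: N_def)
    then have "k \<in> K" by (auto simp: B_def K_def)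
    moreover have "\<exists>\<delta>\<in>\<Delta>. x = \<delta> k" using pr_eq_iff[of k x] k BH x by auto
    ultimately show ?thesis by blast
  qed
  ultimately show ?thesis by blast
qed

text \<open>Cover a compact fundamental set by finitely many of the local neighbourhoods and take
  the least \<open>e\<close>; invariance carries the bound to all of \<open>H3\<close>.\<close>

lemma uniformize:
  assumes mono: "\<And>x e e'. x \<in> H3 \<Longrightarrow> Good x e \<Longrightarrow> 0 < e' \<Longrightarrow> e' \<le> e \<Longrightarrow> Good x e'"
    and invt: "\<And>x \<delta> e. x \<in> H3 \<Longrightarrow> \<delta> \<in> \<Delta> \<Longrightarrow> Good x e \<Longrightarrow> Good (\<delta> x) e"
    and loc: "\<And>x. x \<in> H3 \<Longrightarrow> \<exists>e>0. \<exists>U. open U \<and> x \<in> U \<and> (\<forall>x'\<in>U \<inter> H3. Good x' e)"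
  shows "\<exists>e>(0::real). \<forall>x\<in>H3. Good x e"
proof -
  obtain K where K: "compact K" "K \<subseteq> H3" "\<forall>x\<in>H3. \<exists>\<delta>\<in>\<Delta>. \<exists>k\<in>K. x = \<delta> k" using H3_cocompact by (elim exE conjE)
  have "\<exists>p. x \<in> H3 \<longrightarrow> fst p > 0 \<and> open (snd p) \<and> x \<in> snd p \<and> (\<forall>x'\<in>snd p \<inter> H3. Good x' (fst p))" for x
  proof (cases "x \<in> H3")
    case True
    then obtain e U where "e > 0" "open U" "x \<in> U" "\<forall>x'\<in>U \<inter> H3. Good x' e" using loc by blast
    then show ?thesis by (intro exI[of _ "(e, U)"]) simp
  qed simp
  then obtain p where p: "\<And>x. x \<in> H3 \<Longrightarrow> fst (p x) > 0 \<and> open (snd (p x)) \<and> x \<in> snd (p x) \<and> (\<forall>x'\<in>snd (p x) \<inter> H3. Good x' (fst (p x)))"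
    using choice[of "\<lambda>x p. x \<in> H3 \<longrightarrow> fst p > 0 \<and> open (snd p) \<and> x \<in> snd p \<and> (\<forall>x'\<in>snd p \<inter> H3. Good x' (fst p))"] by auto
  have cov: "K \<subseteq> \<Union>((\<lambda>x. snd (p x)) ` K)" using p K(2) by blast
  have op: "open V" if "V \<in> (\<lambda>x. snd (p x)) ` K" for V using that p K(2) by blast
  obtain \<D> where D: "\<D> \<subseteq> (\<lambda>x. snd (p x)) ` K" "finite \<D>" "K \<subseteq> \<Union>\<D>"
    by (rule compactE[OF K(1) cov op])
  obtain F where F: "F \<subseteq> K" "finite F" "\<D> = (\<lambda>x. snd (p x)) ` F" using finite_subset_image[OF D(2,1)] by blast
  define e where "e = Min (insert 1 ((\<lambda>x. fst (p x)) ` F))"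
  have e: "e > 0" "\<And>x. x \<in> F \<Longrightarrow> e \<le> fst (p x)"
    using F p K(2) by (auto simp: e_def)
  have "Good x e" if x: "x \<in> H3" for x
  proof -
    obtain \<delta> k where k: "\<delta> \<in> \<Delta>" "k \<in> K" "x = \<delta> k" using K(3) x by blast
    then obtain y where y: "y \<in> F" "k \<in> snd (p y)" using D(3) F(3) by blast
    have "y \<in> H3" "k \<in> H3" using y F K k by auto
    then have "Good k (fst (p y))" using p y by blast
    then have "Good k e" using mono e y \<open>k \<in> H3\<close> by blast
    then show ?thesis using invt k \<open>k \<in> H3\<close> by blast
  qed
  then show ?thesis using e(1) by blast
qed

text \<open>A positive injectivity radius. Near a given point only finitely many
  \<open>\<delta>\<close> matter by proper discontinuity, and each of them that moves the point
  separates some neighbourhood from its image.\<close>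

lemma injectivity: "\<exists>e>0. \<forall>x\<in>H3. \<forall>y\<in>H3. \<forall>\<delta>\<in>\<Delta>. chC x y < e \<and> chC x (\<delta> y) < e \<longrightarrow> \<delta> y = y"
proof (rule uniformize[where Good = "\<lambda>x e. \<forall>y\<in>H3. \<forall>\<delta>\<in>\<Delta>. chC x y < e \<and> chC x (\<delta> y) < e \<longrightarrow> \<delta> y = y"])
  fix x e e' assume "\<forall>y\<in>H3. \<forall>\<delta>\<in>\<Delta>. chC x y < e \<and> chC x (\<delta> y) < e \<longrightarrow> \<delta> y = y" "0 < e'" "e' \<le> (e::real)"
  then show "\<forall>y\<in>H3. \<forall>\<delta>\<in>\<Delta>. chC x y < e' \<and> chC x (\<delta> y) < e' \<longrightarrow> \<delta> y = y" by (meson less_le_trans)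
next
  fix x \<epsilon> and e :: real assume x: "x \<in> H3" and ep: "\<epsilon> \<in> \<Delta>" and G: "\<forall>y\<in>H3. \<forall>\<delta>\<in>\<Delta>. chC x y < e \<and> chC x (\<delta> y) < e \<longrightarrow> \<delta> y = y"
  show "\<forall>y\<in>H3. \<forall>\<delta>\<in>\<Delta>. chC (\<epsilon> x) y < e \<and> chC (\<epsilon> x) (\<delta> y) < e \<longrightarrow> \<delta> y = y"
  proof (intro ballI impI)
    fix y \<delta> assume y: "y \<in> H3" "\<delta> \<in> \<Delta>" "chC (\<epsilon> x) y < e \<and> chC (\<epsilon> x) (\<delta> y) < e"
    obtain \<kappa> where k: "\<kappa> \<in> \<Delta>" "\<And>x. x \<in> H3 \<Longrightarrow> \<kappa> (\<epsilon> x) = x \<and> \<epsilon> (\<kappa> x) = x" using invD[OF ep] by blast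
    obtain \<mu> where m: "\<mu> \<in> \<Delta>" "\<And>x. x \<in> H3 \<Longrightarrow> \<mu> x = \<delta> (\<epsilon> x)" using comp[OF y(2) ep] by blast
    obtain \<nu> where n: "\<nu> \<in> \<Delta>" "\<And>x. x \<in> H3 \<Longrightarrow> \<nu> x = \<kappa> (\<mu> x)" using comp[OF k(1) m(1)] by blast
    have "chC x (\<kappa> y) = chC (\<epsilon> x) y" using chC_inv[OF ep x, of "\<kappa> y"] k y by simp
    moreover have "\<nu> (\<kappa> y) = \<kappa> (\<delta> y)" using n m k y by simp
    moreover have "chC x (\<kappa> (\<delta> y)) = chC (\<epsilon> x) (\<delta> y)" using chC_inv[OF ep x, of "\<kappa> (\<delta> y)"] k y by simp
    ultimately have "\<kappa> (\<delta> y) = \<kappa> y" using G n(1) k(1) y by (metis maps)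
    then show "\<delta> y = y" using k(2)[of "\<delta> y"] k(2)[of y] y by (metis maps)
  qed
next
  fix x assume x: "x \<in> H3"
  obtain r where r: "r > 0" "cball x r \<subseteq> H3" using open_H3 x open_contains_cball by blast
  let ?B = "cball x r"
  have fin: "finite {\<delta>\<in>\<Delta>. \<delta> ` ?B \<inter> ?B \<noteq> {}}" using properly_discontinuous r by simp
  let ?\<Phi> = "{\<delta>\<in>\<Delta>. \<delta> ` ?B \<inter> ?B \<noteq> {} \<and> \<delta> x \<noteq> x}"
  have fin': "finite ?\<Phi>" by (rule finite_subset[OF _ fin]) auto
  have "\<exists>N. \<delta> \<in> ?\<Phi> \<longrightarrow> open N \<and> x \<in> N \<and> (\<forall>y\<in>N \<inter> H3. \<delta> y \<notin> N)" for \<delta>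
  proof (cases "\<delta> \<in> ?\<Phi>")
    case True
    obtain A B where AB: "open A" "open B" "x \<in> A" "\<delta> x \<in> B" "A \<inter> B = {}"
      using hausdorff[of x "\<delta> x"] True by auto
    have "openin (top_of_set H3) (H3 \<inter> \<delta> -` B)" using True cont AB(2) continuous_openin_preimage_gen by blast
    then have "open (H3 \<inter> \<delta> -` B)" using open_H3 openin_open_trans by blast
    then show ?thesis using AB x by (intro exI[of _ "A \<inter> (H3 \<inter> \<delta> -` B)"]) auto
  next
    case False
    then show ?thesis by (intro exI[of _ UNIV]) blast
  qed
  then obtain N where N: "\<And>\<delta>. \<delta> \<in> ?\<Phi> \<Longrightarrow> open (N \<delta>) \<and> x \<in> N \<delta> \<and> (\<forall>y\<in>N \<delta> \<inter> H3. \<delta> y \<notin> N \<delta>)"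
    using choice[of "\<lambda>\<delta> N. \<delta> \<in> ?\<Phi> \<longrightarrow> open N \<and> x \<in> N \<and> (\<forall>y\<in>N \<inter> H3. \<delta> y \<notin> N)"] by auto
  define W where "W = ball x r \<inter> (\<Inter>\<delta>\<in>?\<Phi>. N \<delta>)"
  have "open (\<Inter>\<delta>\<in>?\<Phi>. N \<delta>)" using fin' N by (intro open_INT) auto
  then have W: "open W" "x \<in> W" using r N by (auto simp: W_def)
  obtain e U where e: "e > 0" "open U" "x \<in> U" "\<forall>x'\<in>U \<inter> H3. \<forall>y\<in>H3. chC x' y < e \<longrightarrow> y \<in> W"
    using chC_local_ball[OF W x] by blast
  have "\<delta> y = y" if x': "x' \<in> U \<inter> H3" and y: "y \<in> H3" "\<delta> \<in> \<Delta>" "chC x' y < e" "chC x' (\<delta> y) < e" for x' y \<delta>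
  proof (rule ccontr)
    assume ne: "\<delta> y \<noteq> y"
    have W2: "y \<in> W" "\<delta> y \<in> W" using e(4) x' y by auto
    then have "\<delta> y \<in> \<delta> ` ?B \<inter> ?B" by (auto simp: W_def)
    moreover have "\<delta> x \<noteq> x" using free[OF y(2) x _ y(1)] ne by blast
    ultimately have ph: "\<delta> \<in> ?\<Phi>" using y by blast
    then have "y \<in> N \<delta>" "\<delta> y \<in> N \<delta>" using W2 by (auto simp: W_def)
    then show False using N[OF ph] y(1) by blast
  qed
  then show "\<exists>e>0. \<exists>U. open U \<and> x \<in> U \<and> (\<forall>x'\<in>U \<inter> H3. \<forall>y\<in>H3. \<forall>\<delta>\<in>\<Delta>. chC x' y < e \<and> chC x' (\<delta> y) < e \<longrightarrow> \<delta> y = y)"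
    using e(1-3) by (intro exI[of _ e] conjI exI[of _ U]) auto
qed

text \<open>Proper discontinuity makes the family of translates locally finite, so even an infinite
  union of these compact sets is closed.\<close>

lemma closed_union_translates:
  assumes "compact L" "L \<subseteq> H3" "D \<subseteq> \<Delta>"
  shows "closedin (top_of_set H3) (\<Union>\<delta>\<in>D. \<delta> ` L)"
proof -
  have mapL: "\<delta> x \<in> H3" if "\<delta> \<in> D" "x \<in> L" for \<delta> x
    using maps[of \<delta> x] assms(2,3) that by blast
  have "locally_finite_in (top_of_set H3) ((\<lambda>\<delta>. \<delta> ` L) ` D)"
    unfolding locally_finite_in_def
  proof (intro conjI ballI)
    show "\<Union>((\<lambda>\<delta>. \<delta> ` L) ` D) \<subseteq> topspace (top_of_set H3)" using mapL by auto
    fix x assume "x \<in> topspace (top_of_set H3)"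
    then have x: "x \<in> H3" by simp
    obtain r where r: "r > 0" "cball x r \<subseteq> H3" using open_H3 x open_contains_cball by blast
    let ?K = "L \<union> cball x r"
    have fin: "finite {\<delta>\<in>\<Delta>. \<delta> ` ?K \<inter> ?K \<noteq> {}}" by (rule properly_discontinuous) (use assms r in \<open>auto intro!: compact_Un\<close>)
    have "{V \<in> (\<lambda>\<delta>. \<delta> ` L) ` D. V \<inter> ball x r \<noteq> {}} \<subseteq> (\<lambda>\<delta>. \<delta> ` L) ` {\<delta>\<in>\<Delta>. \<delta> ` ?K \<inter> ?K \<noteq> {}}"
    proof
      fix V assume "V \<in> {V \<in> (\<lambda>\<delta>. \<delta> ` L) ` D. V \<inter> ball x r \<noteq> {}}"
      then have V: "V \<in> (\<lambda>\<delta>. \<delta> ` L) ` D" "V \<inter> ball x r \<noteq> {}" by simp_all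
      from V(1) obtain \<delta> where d1: "V = \<delta> ` L" "\<delta> \<in> D" by (rule imageE)
      from V(2) obtain v where v: "v \<in> V" "v \<in> ball x r" by (meson disjoint_iff)
      from v(1)[unfolded d1(1)] obtain y where y: "v = \<delta> y" "y \<in> L" by (rule imageE)
      note d = d1(2) d1(1) y(2) v(2)[unfolded y(1)]
      have "\<delta> y \<in> \<delta> ` ?K" using d(3) by (intro imageI UnI1)
      moreover have "\<delta> y \<in> ?K" using d(4) by simp
      ultimately have "\<delta> y \<in> \<delta> ` ?K \<inter> ?K" by (rule IntI)
      then have "\<delta> \<in> {\<delta>\<in>\<Delta>. \<delta> ` ?K \<inter> ?K \<noteq> {}}" using d(1) assms(3) by blast
      then show "V \<in> (\<lambda>\<delta>. \<delta> ` L) ` {\<delta>\<in>\<Delta>. \<delta> ` ?K \<inter> ?K \<noteq> {}}" unfolding d(2) by (rule imageI)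
    qed
    then have "finite {V \<in> (\<lambda>\<delta>. \<delta> ` L) ` D. V \<inter> ball x r \<noteq> {}}" by (rule finite_subset) (rule finite_imageI[OF fin])
    moreover have "openin (top_of_set H3) (ball x r)" using r by (auto simp: openin_open_eq[OF open_H3])
    ultimately show "\<exists>V. openin (top_of_set H3) V \<and> x \<in> V \<and> finite {U \<in> (\<lambda>\<delta>. \<delta> ` L) ` D. U \<inter> V \<noteq> {}}"
      using r by (intro exI[of _ "ball x r"]) auto
  qed
  moreover have "closedin (top_of_set H3) (\<delta> ` L)" if "\<delta> \<in> D" for \<delta>
  proof -
    have "compact (\<delta> ` L)" using assms that by (meson compact_continuous_image cont continuous_on_subset subsetD)
    then have "closed (\<delta> ` L)" by (rule compact_imp_closed)
    moreover have "\<delta> ` L \<subseteq> H3" using mapL that by auto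
    ultimately show ?thesis by (simp add: closed_subset)
  qed
  ultimately show ?thesis by (intro closedin_locally_finite_Union) (simp_all add: image_iff, metis)
qed

end

section \<open>The fibre group is normal\<close>

lemma cis_eq_near:
  assumes "cis a = cis b" "\<bar>a - b\<bar> < 2 * pi"
  shows "a = b"
proof -
  have "sin a = sin b \<and> cos a = cos b" using assms(1) by (metis cis.simps)
  then obtain n :: int where "a = b + 2 * n * pi" unfolding sin_cos_eq_iff by auto
  moreover from this have "\<bar>real_of_int n\<bar> < 1" using assms(2) pi_gt_zero by (simp add: abs_mult)
  then have "n = 0" by linarith
  ultimately show ?thesis by simp
qed

text \<open>The values lie in one coset of the multiples of \<open>2 * pi\<close>, which is
  discrete.\<close>

lemma cis_constant:
  fixes v :: "'a::topological_space \<Rightarrow> real"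
  assumes "connected S" "continuous_on S v" "\<And>x. x \<in> S \<Longrightarrow> cis (v x) = w" "x \<in> S" "y \<in> S"
  shows "v x = v y"
proof -
  have "v constant_on S"
  proof (rule continuous_discrete_range_constant[OF assms(1,2)])
    fix x assume x: "x \<in> S"
    have "2 * pi \<le> norm (v y - v x)" if "y \<in> S" "v y \<noteq> v x" for y
      using cis_eq_near[of "v y" "v x"] assms(3)[OF x] assms(3)[OF that(1)] that(2) by force
    then show "\<exists>e>0. \<forall>y. y \<in> S \<and> v y \<noteq> v x \<longrightarrow> e \<le> norm (v y - v x)"
      by (intro exI[of _ "2 * pi"]) auto
  qed
  then show ?thesis using assms(4,5) by (metis constant_on_def)
qed

lemma dist_cis_le: "dist (cis a) (cis b) \<le> \<bar>a - b\<bar>"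
proof -
  have "(norm (cis (a - b) - 1))\<^sup>2 = 2 - 2 * cos (a - b)"
    by (simp add: cmod2 power2_diff sin_squared_eq)
  also have "\<dots> = 4 * (sin ((a - b) / 2))\<^sup>2"
  proof -
    have d: "2 * ((a - b) / 2) = a - b" by (simp add: field_simps)
    show ?thesis using cos_double_sin[of "(a - b) / 2"] unfolding d by simp
  qed
  also have "\<dots> \<le> 4 * ((a - b) / 2)\<^sup>2"
  proof -
    have "\<bar>sin ((a - b) / 2)\<bar> \<le> \<bar>(a - b) / 2\<bar>" by (rule abs_sin_x_le_abs_x)
    then show ?thesis by (simp add: abs_le_square_iff del: abs_divide)
  qed
  also have "\<dots> = \<bar>a - b\<bar>\<^sup>2" by (simp add: power_divide)
  finally have "norm (cis (a - b) - 1) \<le> \<bar>a - b\<bar>" by (rule power2_le_imp_le) simp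
  moreover have "cis a - cis b = cis b * (cis (a - b) - 1)" by (simp add: algebra_simps cis_mult)
  ultimately show ?thesis by (simp add: dist_norm norm_mult)
qed

lemma H2_Im: "z \<in> H2 \<longleftrightarrow> Im z > 0"
  by (simp add: H2_def)

locale fibred = hyp3 \<Delta> + lattice \<Gamma>
  for \<Delta> :: "(complex \<times> real \<Rightarrow> complex \<times> real) set" and \<Gamma> +
  fixes p :: "(complex \<times> real) set \<Rightarrow> complex" and S \<phi> F \<rho>
  assumes fib: "fibers_over_circle \<Delta> p S"
    and hom: "homeomorphic_map (H2_quotient \<Gamma>) (subtopology (H3_quotient \<Delta>) S) \<phi>"
    and lift: "is_lift \<Gamma> \<Delta> \<phi> F"
    and hol: "is_holonomy \<Gamma> \<Delta> F \<rho>"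
begin

abbreviation "orb \<equiv> orbit_of (act_H2 ` \<Gamma>)"

lemma F_H3 [simp]: "z \<in> H2 \<Longrightarrow> F z \<in> H3"
  using lift by (auto simp: is_lift_def continuous_map_def)

lemma F_cont: "continuous_on H2 F"
  using lift by (simp add: is_lift_def)

lemma F_orb: "z \<in> H2 \<Longrightarrow> pr (F z) = \<phi> (orb z)"
  using lift by (simp add: is_lift_def)

lemma F_act: "\<gamma> \<in> \<Gamma> \<Longrightarrow> z \<in> H2 \<Longrightarrow> F (act_H2 \<gamma> z) = act_H3 (\<rho> \<gamma>) (F z)"
  using hol by (simp add: is_holonomy_def)

lemma rho_Delta: "\<gamma> \<in> \<Gamma> \<Longrightarrow> \<exists>\<delta>\<in>\<Delta>. \<forall>x\<in>H3. \<delta> x = act_H3 (\<rho> \<gamma>) x"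
  using hol by (intro bexI[of _ "restrict (act_H3 (\<rho> \<gamma>)) H3"]) (simp_all add: is_holonomy_def)

lemma act_H2_H2 [simp]: "\<gamma> \<in> \<Gamma> \<Longrightarrow> z \<in> H2 \<Longrightarrow> act_H2 \<gamma> z \<in> H2"
  by (simp add: H2_Im act_H2_pos)

lemma topspace_H2_quotient: "topspace (H2_quotient \<Gamma>) = orb ` H2"
proof -
  have mem: "y \<in> orb z \<Longrightarrow> orb y = orb z" if "z \<in> H2" for y z
  proof -
    assume "y \<in> orb z"
    then obtain \<gamma> where g: "\<gamma> \<in> \<Gamma>" "y = act_H2 \<gamma> z" by (auto simp: orbit_of_def)
    have "act_H2 \<epsilon> y = act_H2 (\<epsilon> \<otimes>\<^bsub>PSL2\<^esub> \<gamma>) z" if "\<epsilon> \<in> \<Gamma>" for \<epsilon>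
      using g that \<open>z \<in> H2\<close> by (simp add: act_H2_mult H2_Im)
    then have 1: "orb y \<subseteq> orb z" using g by (auto simp: orbit_of_def)
    have Im: "Im z > 0" "Im y > 0" using g \<open>z \<in> H2\<close> by (simp_all add: H2_Im act_H2_pos)
    have "act_H2 \<epsilon> z = act_H2 (\<epsilon> \<otimes>\<^bsub>PSL2\<^esub> inv\<^bsub>PSL2\<^esub> \<gamma>) y" if "\<epsilon> \<in> \<Gamma>" for \<epsilon>
    proof -
      have "act_H2 (\<epsilon> \<otimes>\<^bsub>PSL2\<^esub> inv\<^bsub>PSL2\<^esub> \<gamma>) y = act_H2 \<epsilon> (act_H2 (inv\<^bsub>PSL2\<^esub> \<gamma>) y)"
        by (rule act_H2_mult) (use g that Im in auto)
      also have "act_H2 (inv\<^bsub>PSL2\<^esub> \<gamma>) y = z" unfolding g(2) by (rule act_H2_inv(1)) (use g Im in auto)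
      finally show ?thesis by simp
    qed
    moreover have "\<epsilon> \<otimes>\<^bsub>PSL2\<^esub> inv\<^bsub>PSL2\<^esub> \<gamma> \<in> \<Gamma>" if "\<epsilon> \<in> \<Gamma>" for \<epsilon> using g that by simp
    ultimately have "orb z \<subseteq> orb y" unfolding orbit_of_def by blast
    then show "orb y = orb z" using 1 by blast
  qed
  have dis: "disjoint (orb ` H2)"
  proof (rule pairwiseI)
    fix A B assume AB: "A \<in> orb ` H2" "B \<in> orb ` H2" "A \<noteq> B"
    then obtain z w where zw: "z \<in> H2" "w \<in> H2" "A = orb z" "B = orb w" by auto
    have "y \<notin> B" if "y \<in> A" for y using mem zw AB(3) that by metis
    then show "disjnt A B" by (auto simp: disjnt_def)
  qed
  have self: "z \<in> orb z" for z
  proof -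
    have "act_H2 \<one>\<^bsub>PSL2\<^esub> z \<in> (\<lambda>t. t z) ` (act_H2 ` \<Gamma>)" by (intro imageI one_in)
    then show ?thesis by (simp add: orbit_of_def act_one)
  qed
  have "\<Union>(orb ` H2) = H2" using self by (auto simp: orbit_of_def)
  then have "openin (H2_quotient \<Gamma>) (orb ` H2)"
    unfolding H2_quotient_def orbit_space_def using openin_quotient_topology[OF dis] by (simp add: openin_subtopology_self)
  moreover have "U \<subseteq> orb ` H2" if "openin (H2_quotient \<Gamma>) U" for U
    using that unfolding H2_quotient_def orbit_space_def using openin_quotient_topology[OF dis] by simp
  ultimately show ?thesis unfolding topspace_def by blast
qed

section \<open>The fibration lifted to the universal cover\<close>

definition "base \<equiv> (SOME b. b \<in> sphere (0::complex) 1 \<and> S = {x\<in>topspace (H3_quotient \<Delta>). p x = b})"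

lemma base: "norm base = 1" "S = {x\<in>pr ` H3. p x = base}"
proof -
  have "\<exists>b. b \<in> sphere (0::complex) 1 \<and> S = {x\<in>topspace (H3_quotient \<Delta>). p x = b}"
    using fib by (auto simp: fibers_over_circle_def)
  then have "base \<in> sphere (0::complex) 1 \<and> S = {x\<in>topspace (H3_quotient \<Delta>). p x = base}"
    unfolding base_def by (rule someI_ex)
  then show "norm base = 1" "S = {x\<in>pr ` H3. p x = base}" by (auto simp: topspace_M)
qed

lemma S_iff: "m \<in> S \<longleftrightarrow> m \<in> pr ` H3 \<and> p m = base"
  by (subst base(2)) simp

lemma orb_self: "z \<in> orb z"
proof -
  have "act_H2 \<one>\<^bsub>PSL2\<^esub> z \<in> (\<lambda>t. t z) ` (act_H2 ` \<Gamma>)" by (intro imageI one_in)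
  then show ?thesis by (simp add: orbit_of_def act_one)
qed

lemma phi_inj: "z \<in> H2 \<Longrightarrow> w \<in> H2 \<Longrightarrow> \<phi> (orb z) = \<phi> (orb w) \<Longrightarrow> orb z = orb w"
proof -
  have "inj_on \<phi> (orb ` H2)" using hom by (simp add: homeomorphic_eq_everything_map topspace_H2_quotient)
  then show "z \<in> H2 \<Longrightarrow> w \<in> H2 \<Longrightarrow> \<phi> (orb z) = \<phi> (orb w) \<Longrightarrow> orb z = orb w" by (auto dest: inj_onD)
qed

lemma phi_image: "\<phi> ` orb ` H2 = S"
proof -
  have "\<phi> ` topspace (H2_quotient \<Gamma>) = topspace (subtopology (H3_quotient \<Delta>) S)"
    using hom homeomorphic_imp_surjective_map by blast
  moreover have "S \<subseteq> pr ` H3" using S_iff by blast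
  ultimately show ?thesis by (simp add: topspace_H2_quotient topspace_M Int_absorb1)
qed

lemma p_cont: "continuous_map (H3_quotient \<Delta>) (top_of_set (sphere 0 1)) p"
  using fib by (simp add: fibers_over_circle_def fibre_bundle_def)

text \<open>\<open>H3\<close> is contractible, so a map to the circle has a continuous
  argument.\<close>

lemma ex_lift: "\<exists>u. continuous_on H3 u \<and> (\<forall>x\<in>H3. p (pr x) = cis (u x))"
proof -
  have "continuous_map (top_of_set H3) (top_of_set (sphere 0 1)) (p \<circ> pr)"
    using continuous_map_compose[OF continuous_pr p_cont] .
  then have c: "continuous_on H3 (p \<circ> pr)" and n: "\<And>x. x \<in> H3 \<Longrightarrow> norm (p (pr x)) = 1"
    by (auto simp: continuous_map_in_subtopology image_subset_iff)
  have nz: "(p \<circ> pr) z \<noteq> 0" if "z \<in> H3" for z using n[OF that] by auto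
  obtain g where g: "continuous_on H3 g" "\<And>x. x \<in> H3 \<Longrightarrow> (p \<circ> pr) x = exp (g x)"
    using continuous_logarithm_on_contractible[OF c convex_imp_contractible[OF convex_H3] nz] by metis
  have "p (pr x) = cis (Im (g x))" if "x \<in> H3" for x
  proof -
    have "exp (Re (g x)) = 1" using n[OF that] g(2)[OF that] by (simp add: norm_exp_eq_Re)
    then show ?thesis using g(2)[OF that] by (simp add: exp_eq_polar)
  qed
  moreover have "continuous_on H3 (\<lambda>x. Im (g x))" using g(1) by (intro continuous_intros)
  ultimately show ?thesis by blast
qed

definition "lev \<equiv> (SOME u. continuous_on H3 u \<and> (\<forall>x\<in>H3. p (pr x) = cis (u x)))"

lemma lev: "continuous_on H3 lev" "x \<in> H3 \<Longrightarrow> p (pr x) = cis (lev x)"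
proof -
  have *: "continuous_on H3 lev \<and> (\<forall>x\<in>H3. p (pr x) = cis (lev x))" unfolding lev_def by (rule someI_ex[OF ex_lift])
  show "continuous_on H3 lev" using * by (rule conjunct1)
  show "x \<in> H3 \<Longrightarrow> p (pr x) = cis (lev x)" using * by blast
qed

lemma lev_F: "z \<in> H2 \<Longrightarrow> w \<in> H2 \<Longrightarrow> lev (F z) = lev (F w)"
proof (rule cis_constant[of H2 "\<lambda>z. lev (F z)" base])
  have "convex H2" unfolding H2_def by (rule convex_halfspace_Im_gt)
  then show "connected H2" by (rule convex_connected)
  show "continuous_on H2 (\<lambda>z. lev (F z))"
    by (rule continuous_on_compose2[OF lev(1) F_cont]) auto
  show "cis (lev (F z)) = base" if "z \<in> H2" for z
  proof -
    have "pr (F z) \<in> S" using F_orb[OF that] phi_image that by auto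
    then show ?thesis using S_iff lev(2)[of "F z"] that by simp
  qed
qed

text \<open>\<open>\<delta>\<close> does not change the projection to the quotient, so it changes
  \<open>lev\<close> by a multiple of \<open>2 * pi\<close>, which is constant on the connected
  space \<open>H3\<close>.\<close>

lemma lev_shift:
  assumes "\<delta> \<in> \<Delta>" "x \<in> H3" "y \<in> H3"
  shows "lev (\<delta> x) - lev x = lev (\<delta> y) - lev y"
proof (rule cis_constant[of H3 "\<lambda>x. lev (\<delta> x) - lev x" 1])
  show "connected H3" by (rule convex_connected[OF convex_H3])
  show "continuous_on H3 (\<lambda>x. lev (\<delta> x) - lev x)"
    by (intro continuous_on_diff lev(1) continuous_on_compose2[OF lev(1) cont[OF assms(1)]]) (use assms in auto)
  show "cis (lev (\<delta> x) - lev x) = 1" if "x \<in> H3" for x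
  proof -
    have "cis (lev (\<delta> x)) = cis (lev x)" using lev(2)[of x] lev(2)[of "\<delta> x"] assms that by (simp add: pr_inv)
    then show ?thesis by (simp add: cis_divide[symmetric])
  qed
qed (use assms in auto)

abbreviation "\<Sigma> \<equiv> F ` H2"

text \<open>Two points of \<open>\<Sigma>\<close> with the same projection come from one orbit of
  \<open>\<Gamma>\<close>, because \<open>\<phi>\<close> is injective. So \<open>\<delta>\<close>
  agrees with some \<open>\<rho> \<gamma>\<close> at one point, and by freeness everywhere.\<close>

lemma stabilizer:
  assumes "\<delta> \<in> \<Delta>" "z \<in> H2" "w \<in> H2" "\<delta> (F z) = F w"
  shows "\<exists>\<gamma>\<in>\<Gamma>. \<forall>x\<in>H3. \<delta> x = act_H3 (\<rho> \<gamma>) x"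
proof -
  have "pr (F z) = pr (F w)" using pr_inv[OF assms(1), of "F z"] assms by simp
  then have "orb z = orb w" using F_orb phi_inj assms by metis
  moreover have "w \<in> orb w" by (rule orb_self)
  ultimately have "w \<in> orb z" by simp
  then obtain \<gamma> where g: "\<gamma> \<in> \<Gamma>" "w = act_H2 \<gamma> z" by (auto simp: orbit_of_def)
  obtain \<epsilon> where e: "\<epsilon> \<in> \<Delta>" "\<And>x. x \<in> H3 \<Longrightarrow> \<epsilon> x = act_H3 (\<rho> \<gamma>) x" using rho_Delta[OF g(1)] by blast
  have eq: "\<delta> (F z) = \<epsilon> (F z)" using assms g e F_act by simp
  have "\<delta> x = \<epsilon> x" if "x \<in> H3" for x by (rule free2[OF assms(1) e(1) F_H3[OF assms(2)] eq that])
  then show ?thesis using g e by auto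
qed

text \<open>The level set is covered by translates of a compact piece \<open>?L\<close> of
  \<open>\<Sigma>\<close>. By \<open>stabilizer\<close> each translate lies in
  \<open>\<Sigma>\<close> or misses it, and the translates of either kind have a closed union. A
  connected set meeting \<open>\<Sigma>\<close> therefore stays in it.\<close>

lemma level_connected:
  assumes "connected C" "C \<subseteq> {x\<in>H3. lev x = lev (F \<i>)}" "F \<i> \<in> C"
  shows "C \<subseteq> \<Sigma>"
proof -
  obtain K where K: "compact K" "K \<subseteq> H2" "\<forall>z\<in>H2. \<exists>\<gamma>\<in>\<Gamma>. \<exists>w\<in>K. z = act_H2 \<gamma> w"
    using H2_cocompact by (elim exE conjE)
  let ?L = "F ` K"
  have L: "compact ?L" "?L \<subseteq> H3" using K F_cont by (auto intro: compact_continuous_image continuous_on_subset)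
  define D1 where "D1 = {\<delta>\<in>\<Delta>. \<delta> ` ?L \<subseteq> \<Sigma>}"
  define D2 where "D2 = {\<delta>\<in>\<Delta>. \<not> \<delta> ` ?L \<subseteq> \<Sigma>}"
  let ?A = "\<Union>\<delta>\<in>D1. \<delta> ` ?L" and ?B = "\<Union>\<delta>\<in>D2. \<delta> ` ?L"
  have ii: "\<i> \<in> H2" by (simp add: H2_Im)
  have clA: "closedin (top_of_set H3) ?A" by (rule closed_union_translates[OF L]) (auto simp: D1_def)
  have clB: "closedin (top_of_set H3) ?B" by (rule closed_union_translates[OF L]) (auto simp: D2_def)
  have AS: "?A \<subseteq> \<Sigma>" unfolding D1_def by blast
  have BS: "F w \<notin> ?B" if w: "w \<in> H2" for w
  proof
    assume "F w \<in> ?B"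
    then obtain \<delta> where d1: "\<delta> \<in> D2" "F w \<in> \<delta> ` ?L" by (rule UN_E)
    from d1(2) obtain k where "k \<in> K" "F w = \<delta> (F k)" by (elim imageE) simp
    then have d: "\<delta> \<in> \<Delta>" "\<not> \<delta> ` ?L \<subseteq> \<Sigma>" "k \<in> K" "F w = \<delta> (F k)" using d1(1) by (simp_all add: D2_def)
    obtain \<gamma> where g: "\<gamma> \<in> \<Gamma>" "\<forall>x\<in>H3. \<delta> x = act_H3 (\<rho> \<gamma>) x"
      using stabilizer[OF d(1) _ w d(4)[symmetric]] d(3) K(2) by blast
    have "\<delta> (F k') \<in> \<Sigma>" if "k' \<in> K" for k'
    proof -
      have "k' \<in> H2" using that K(2) by blast
      then have "\<delta> (F k') = F (act_H2 \<gamma> k')" using g F_act by simp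
      then show ?thesis using \<open>k' \<in> H2\<close> g(1) by simp
    qed
    then show False using d(2) by auto
  qed
  have CAB: "C \<subseteq> ?A \<union> ?B"
  proof
    fix x assume "x \<in> C"
    then have x: "x \<in> H3" "lev x = lev (F \<i>)" using assms(2) by auto
    have "p (pr x) = p (pr (F \<i>))" using lev(2)[OF x(1)] lev(2)[of "F \<i>"] x(2) ii by simp
    moreover have "pr (F \<i>) \<in> S" using F_orb[OF ii] phi_image ii by auto
    ultimately have "pr x \<in> S" using S_iff x(1) by auto
    then obtain z where z: "z \<in> H2" "pr x = \<phi> (orb z)" using phi_image by auto
    then have "pr (F z) = pr x" using F_orb by simp
    then obtain \<delta> where d: "\<delta> \<in> \<Delta>" "x = \<delta> (F z)" using pr_eq_iff[of "F z" x] x z by auto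
    obtain \<gamma> k where g: "\<gamma> \<in> \<Gamma>" "k \<in> K" "z = act_H2 \<gamma> k" using K(3) z by blast
    have k: "k \<in> H2" using g K by auto
    obtain \<epsilon> where e: "\<epsilon> \<in> \<Delta>" "\<And>x. x \<in> H3 \<Longrightarrow> \<epsilon> x = act_H3 (\<rho> \<gamma>) x" using rho_Delta[OF g(1)] by blast
    obtain \<mu> where m: "\<mu> \<in> \<Delta>" "\<And>x. x \<in> H3 \<Longrightarrow> \<mu> x = \<delta> (\<epsilon> x)" using comp[OF d(1) e(1)] by blast
    have "x = \<mu> (F k)" using d m e k g F_act by simp
    moreover have "\<mu> \<in> D1 \<or> \<mu> \<in> D2" using m by (auto simp: D1_def D2_def)
    ultimately show "x \<in> ?A \<union> ?B" using g(2) by blast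
  qed
  have CH: "C \<subseteq> H3" using assms(2) by blast
  have restr: "closedin (top_of_set C) (C \<inter> A)" if A: "closedin (top_of_set H3) A" for A
  proof -
    obtain T where "closed T" "A = H3 \<inter> T" using A by (auto simp: closedin_closed)
    moreover from this have "C \<inter> A = C \<inter> T" using CH by blast
    ultimately show ?thesis by (auto simp: closedin_closed)
  qed
  obtain A B where AB: "closedin (top_of_set C) (C \<inter> A)" "closedin (top_of_set C) (C \<inter> B)"
    "C \<subseteq> A \<union> B" "A \<subseteq> \<Sigma>" "\<And>w. w \<in> H2 \<Longrightarrow> F w \<notin> B"
    by (rule that[OF restr[OF clA] restr[OF clB] CAB AS BS])
  have cover: "C \<subseteq> (C \<inter> A) \<union> (C \<inter> B)" using AB(3) by blast
  have disj: "(C \<inter> A) \<inter> (C \<inter> B) = {}" using AB(4,5) by blast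
  have "C \<inter> A \<noteq> {}" using assms(3) AB(3) AB(5)[OF ii] by blast
  then have "C \<inter> B = {}"
    using assms(1)[unfolded connected_closedin] AB(1,2) cover disj by metis
  then show ?thesis using AB(3,4) by blast
qed

text \<open>Used to single out the right value of \<open>lev\<close> among those with the same
  \<open>cis\<close>.\<close>

lemma lev_unif: "\<exists>e>0. \<forall>x\<in>H3. \<forall>y\<in>H3. chC x y < e \<longrightarrow> \<bar>lev x - lev y\<bar> < 1"
proof (rule uniformize[where Good = "\<lambda>x e. \<forall>y\<in>H3. chC x y < e \<longrightarrow> \<bar>lev x - lev y\<bar> < 1"])
  fix x \<delta> and e :: real assume x: "x \<in> H3" and d: "\<delta> \<in> \<Delta>" and G: "\<forall>y\<in>H3. chC x y < e \<longrightarrow> \<bar>lev x - lev y\<bar> < 1"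
  show "\<forall>y\<in>H3. chC (\<delta> x) y < e \<longrightarrow> \<bar>lev (\<delta> x) - lev y\<bar> < 1"
  proof (intro ballI impI)
    fix y assume y: "y \<in> H3" "chC (\<delta> x) y < e"
    obtain \<kappa> where k: "\<kappa> \<in> \<Delta>" "\<And>x. x \<in> H3 \<Longrightarrow> \<kappa> (\<delta> x) = x \<and> \<delta> (\<kappa> x) = x" using invD[OF d] by blast
    have ky: "\<kappa> y \<in> H3" "\<delta> (\<kappa> y) = y" using k y by auto
    have "chC x (\<kappa> y) < e" using chC_inv[OF d x ky(1)] ky y by simp
    then have "\<bar>lev x - lev (\<kappa> y)\<bar> < 1" using G ky by blast
    moreover have "lev (\<delta> x) - lev x = lev y - lev (\<kappa> y)" using lev_shift[OF d x ky(1)] ky by simp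
    ultimately show "\<bar>lev (\<delta> x) - lev y\<bar> < 1" by linarith
  qed
next
  fix x assume x: "x \<in> H3"
  obtain A where A: "open A" "x \<in> A" "\<forall>y\<in>H3. y \<in> A \<longrightarrow> lev y \<in> ball (lev x) (1/2)"
    using lev(1) x unfolding continuous_on_topological by (metis centre_in_ball half_gt_zero open_ball zero_less_one)
  obtain e U where e: "e > 0" "open U" "x \<in> U" "\<forall>x'\<in>U \<inter> H3. \<forall>y\<in>H3. chC x' y < e \<longrightarrow> y \<in> A"
    using chC_local_ball[OF A(1,2) x] by blast
  have "\<bar>lev x' - lev y\<bar> < 1" if "x' \<in> U \<inter> H3" "y \<in> H3" "chC x' y < e" for x' y
  proof -
    have "y \<in> A" using e(4) that by blast
    moreover have "x' \<in> A" using e(4)[rule_format, OF that(1), of x'] that e(1) by (simp add: chC_self)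
    ultimately have "lev y \<in> ball (lev x) (1/2)" "lev x' \<in> ball (lev x) (1/2)" using A(3) that by auto
    then show ?thesis unfolding mem_ball dist_real_def by linarith
  qed
  then show "\<exists>e>0. \<exists>U. open U \<and> x \<in> U \<and> (\<forall>x'\<in>U \<inter> H3. \<forall>y\<in>H3. chC x' y < e \<longrightarrow> \<bar>lev x' - lev y\<bar> < 1)"
    using e(1-3) by (intro exI[of _ e] conjI exI[of _ U]) auto
qed (meson less_le_trans)

text \<open>\<open>T s\<close> moves a point of a nearby fibre to the fibre over
  \<open>cis s\<close>, keeping its coordinate in a local trivialisation. The last clause is joint
  continuity in \<open>s\<close> and the point, written for points of \<open>H3\<close> since they
  are what will be lifted.\<close>

lemma local_transport:
  "\<exists>U T. open U \<and> cis c \<in> U \<and>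
    (\<forall>s x. x \<in> H3 \<and> cis (lev x) \<in> U \<and> cis s \<in> U \<longrightarrow> T s (pr x) \<in> pr ` H3 \<and> p (T s (pr x)) = cis s \<and> (cis (lev x) = cis s \<longrightarrow> T s (pr x) = pr x)) \<and>
    (\<forall>s0 x0 V. x0 \<in> H3 \<and> cis (lev x0) \<in> U \<and> cis s0 \<in> U \<and> openin (H3_quotient \<Delta>) V \<and> T s0 (pr x0) \<in> V \<longrightarrow>
       (\<exists>\<eta>>0. \<exists>W. open W \<and> x0 \<in> W \<and> (\<forall>s x. \<bar>s - s0\<bar> < \<eta> \<and> x \<in> W \<inter> H3 \<longrightarrow> cis (lev x) \<in> U \<and> cis s \<in> U \<and> T s (pr x) \<in> V)))"
proof -
  let ?M = "H3_quotient \<Delta>" and ?Y = "subtopology (H3_quotient \<Delta>) S" and ?C = "top_of_set (sphere (0::complex) 1)"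
  have "\<exists>U h. openin ?C U \<and> cis c \<in> U \<and>
        homeomorphic_map (subtopology ?M {x\<in>topspace ?M. p x \<in> U}) (prod_topology (subtopology ?C U) ?Y) h \<and>
        (\<forall>x\<in>topspace ?M. p x \<in> U \<longrightarrow> fst (h x) = p x)"
    using fib unfolding fibers_over_circle_def fibre_bundle_def by auto
  then obtain U0 h where U0: "openin ?C U0" "cis c \<in> U0"
    "homeomorphic_map (subtopology ?M {x\<in>topspace ?M. p x \<in> U0}) (prod_topology (subtopology ?C U0) ?Y) h"
    "\<And>x. x\<in>topspace ?M \<Longrightarrow> p x \<in> U0 \<Longrightarrow> fst (h x) = p x" by blast
  let ?X = "subtopology ?M {x\<in>topspace ?M. p x \<in> U0}" and ?P = "prod_topology (subtopology ?C U0) ?Y"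
  obtain k where hk: "homeomorphic_maps ?X ?P h k" using U0(3) homeomorphic_map_maps by blast
  have hc: "continuous_map ?X ?P h" and kc: "continuous_map ?P ?X k"
    and kh: "\<And>x. x \<in> topspace ?X \<Longrightarrow> k (h x) = x" and hkk: "\<And>y. y \<in> topspace ?P \<Longrightarrow> h (k y) = y"
    using hk by (auto simp: homeomorphic_maps_def)
  obtain U where U: "open U" "U0 = sphere 0 1 \<inter> U" using U0(1) by (auto simp: openin_open)
  have cU: "cis s \<in> U0 \<longleftrightarrow> cis s \<in> U" for s using U(2) by simp
  define T where "T s m = k (cis s, snd (h m))" for s m
  have tX: "topspace ?X = {m \<in> pr ` H3. p m \<in> U0}" by (auto simp: topspace_M)
  have prX: "pr x \<in> topspace ?X" if "x \<in> H3" "cis (lev x) \<in> U" for x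
    using that lev(2)[of x] cU unfolding tX by auto
  have tP: "topspace ?P = U0 \<times> (topspace ?M \<inter> S)" using U(2) by (auto simp: topspace_M)
  have hX: "snd (h m) \<in> topspace ?M \<inter> S" if "m \<in> topspace ?X" for m
    using continuous_map_image_subset_topspace[OF hc] that unfolding tP by (auto simp: mem_Times_iff)
  have Tin: "(cis s, snd (h m)) \<in> topspace ?P" if "m \<in> topspace ?X" "cis s \<in> U" for s m
    using hX[OF that(1)] that(2) cU by (simp add: tP)
  have T1: "T s m \<in> topspace ?X" if "m \<in> topspace ?X" "cis s \<in> U" for s m
    using continuous_map_image_subset_topspace[OF kc] Tin[OF that] unfolding T_def by blast
  have fsth: "fst (h m) = p m" if "m \<in> topspace ?X" for m
    using U0(4)[of m] that by (simp add: topspace_subtopology)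
  have A: "T s (pr x) \<in> pr ` H3 \<and> p (T s (pr x)) = cis s \<and> (cis (lev x) = cis s \<longrightarrow> T s (pr x) = pr x)"
    if "x \<in> H3" "cis (lev x) \<in> U" "cis s \<in> U" for s x
  proof (intro conjI impI)
    note px = prX[OF that(1,2)]
    show "T s (pr x) \<in> pr ` H3" using T1[OF px that(3)] unfolding tX by simp
    have "p (T s (pr x)) = fst (h (T s (pr x)))" using fsth[OF T1[OF px that(3)]] by simp
    also have "\<dots> = cis s" using hkk[OF Tin[OF px that(3)]] by (simp add: T_def)
    finally show "p (T s (pr x)) = cis s" .
    assume "cis (lev x) = cis s"
    then have "fst (h (pr x)) = cis s" using fsth[OF px] lev(2)[OF that(1)] by simp
    then have "(cis s, snd (h (pr x))) = h (pr x)" by (metis prod.collapse)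
    then show "T s (pr x) = pr x" using kh[OF px] by (simp add: T_def)
  qed
  have B: "\<exists>\<eta>>0. \<exists>W. open W \<and> x0 \<in> W \<and> (\<forall>s x. \<bar>s - s0\<bar> < \<eta> \<and> x \<in> W \<inter> H3 \<longrightarrow> cis (lev x) \<in> U \<and> cis s \<in> U \<and> T s (pr x) \<in> V)"
    if x0: "x0 \<in> H3" "cis (lev x0) \<in> U" and s0: "cis s0 \<in> U" and V: "openin ?M V" "T s0 (pr x0) \<in> V" for s0 x0 V
  proof -
    have "topspace ?X \<inter> V = V \<inter> {x\<in>topspace ?M. p x \<in> U0}" by auto
    then have "openin ?X (topspace ?X \<inter> V)" using openin_subtopology_Int[OF V(1)] by simp
    then have "openin ?P {y \<in> topspace ?P. k y \<in> topspace ?X \<inter> V}" using kc openin_continuous_map_preimage by blast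
    moreover have "(cis s0, snd (h (pr x0))) \<in> {y \<in> topspace ?P. k y \<in> topspace ?X \<inter> V}"
      using Tin[OF prX[OF x0] s0] T1[OF prX[OF x0] s0] V(2) by (simp add: T_def)
    ultimately obtain A B where AB: "openin (subtopology ?C U0) A" "openin ?Y B" "cis s0 \<in> A" "snd (h (pr x0)) \<in> B"
      "A \<times> B \<subseteq> {y \<in> topspace ?P. k y \<in> topspace ?X \<inter> V}"
      unfolding openin_prod_topology_alt by (elim allE impE) (assumption, elim exE conjE, rule that)
    have "openin ?C A" using AB(1) U0(1) openin_trans_full by blast
    then obtain A' where A': "open A'" "A = sphere 0 1 \<inter> A'" by (auto simp: openin_open)
    have "cis = (\<lambda>s. exp (\<i> * of_real s))" by (rule ext) (rule cis_conv_exp)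
    moreover have "isCont (\<lambda>s. exp (\<i> * complex_of_real s)) s0" by (intro continuous_intros)
    ultimately have "isCont cis s0" by simp
    then have "\<forall>\<^sub>F s in nhds s0. cis s \<in> A' \<inter> U"
      using A' AB(3) s0 U(1) unfolding continuous_at tendsto_at_iff_tendsto_nhds by (intro topological_tendstoD) auto
    then obtain \<eta> where eta: "\<eta> > 0" "\<And>s. dist s s0 < \<eta> \<Longrightarrow> cis s \<in> A' \<inter> U" unfolding eventually_nhds_metric by blast
    have snd: "continuous_map ?X ?Y (snd \<circ> h)" using continuous_map_compose[OF hc continuous_map_snd] .
    have oX: "openin ?X {m \<in> topspace ?X. (snd \<circ> h) m \<in> B}" using snd AB(2) openin_continuous_map_preimage by blast
    have "openin ?M {x\<in>topspace ?M. p x \<in> U0}" using p_cont U0(1) openin_continuous_map_preimage by blast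
    then have oM: "openin ?M {m \<in> topspace ?X. (snd \<circ> h) m \<in> B}" using oX openin_trans_full by blast
    let ?W = "{x \<in> H3. pr x \<in> {m \<in> topspace ?X. (snd \<circ> h) m \<in> B}}"
    have "openin (top_of_set H3) ?W" using openin_continuous_map_preimage[OF continuous_pr oM] by simp
    then have oW: "open ?W" using open_H3 openin_open_trans by blast
    have "cis (lev x) \<in> U \<and> cis s \<in> U \<and> T s (pr x) \<in> V" if s: "\<bar>s - s0\<bar> < \<eta>" and x: "x \<in> ?W" for s x
    proof -
      have 1: "cis s \<in> A' \<inter> U" using eta(2)[of s] s by (simp add: dist_real_def)
      have 2: "pr x \<in> topspace ?X" "snd (h (pr x)) \<in> B" using x by auto
      have "(cis s, snd (h (pr x))) \<in> A \<times> B" using 1 2 A' by simp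
      then have "k (cis s, snd (h (pr x))) \<in> V" using AB(5) by blast
      moreover have "cis (lev x) \<in> U" using 2(1) lev(2)[of x] x cU unfolding tX by simp
      ultimately show ?thesis using 1 by (simp add: T_def)
    qed
    moreover have "x0 \<in> ?W" using x0 prX[OF x0] AB(4) by simp
    ultimately show ?thesis using eta(1) oW by (intro exI[of _ \<eta>] conjI exI[of _ ?W]) auto
  qed
  show ?thesis
    by (rule exI[of _ U], rule exI[of _ T]) (use A B U(1) U0(2) cU in simp)
qed

text \<open>\<open>r x\<close> is the lift of \<open>T s (pr x)\<close> close to \<open>x\<close>;
  the injectivity radius makes it unique, and uniqueness makes it continuous. That one
  \<open>\<eta>\<close> serves a whole slab, which is not compact, comes from
  \<open>uniformize\<close>.\<close>

lemma local_retraction: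
  "\<exists>\<eta>>0. \<forall>s. \<bar>s - c\<bar> < \<eta> \<longrightarrow> (\<exists>r. continuous_on {x\<in>H3. \<bar>lev x - c\<bar> < \<eta>} r \<and>
        (\<forall>x\<in>H3. \<bar>lev x - c\<bar> < \<eta> \<longrightarrow> r x \<in> H3 \<and> lev (r x) = s \<and> (lev x = s \<longrightarrow> r x = x)))"
proof -
  note split_paired_All [simp del] split_paired_Ex [simp del] split_paired_all [simp del]
  obtain e1 where e1: "e1 > 0" "\<forall>x\<in>H3. \<forall>y\<in>H3. \<forall>\<delta>\<in>\<Delta>. chC x y < e1 \<and> chC x (\<delta> y) < e1 \<longrightarrow> \<delta> y = y"
    using injectivity by blast
  obtain e2 where e2: "e2 > 0" "\<forall>x\<in>H3. \<forall>y\<in>H3. chC x y < e2 \<longrightarrow> \<bar>lev x - lev y\<bar> < 1"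
    using lev_unif by blast
  define e where "e = min e1 e2"
  have e: "e > 0" "e \<le> e1" "e \<le> e2" using e1(1) e2(1) by (auto simp: e_def)
  from local_transport[of c] obtain U T where UT: "open U" "cis c \<in> U"
    "\<forall>s x. x \<in> H3 \<and> cis (lev x) \<in> U \<and> cis s \<in> U \<longrightarrow> T s (pr x) \<in> pr ` H3 \<and> p (T s (pr x)) = cis s \<and> (cis (lev x) = cis s \<longrightarrow> T s (pr x) = pr x)"
    "\<forall>s0 x0 V. x0 \<in> H3 \<and> cis (lev x0) \<in> U \<and> cis s0 \<in> U \<and> openin (H3_quotient \<Delta>) V \<and> T s0 (pr x0) \<in> V \<longrightarrow>
       (\<exists>\<eta>>0. \<exists>W. open W \<and> x0 \<in> W \<and> (\<forall>s x. \<bar>s - s0\<bar> < \<eta> \<and> x \<in> W \<inter> H3 \<longrightarrow> cis (lev x) \<in> U \<and> cis s \<in> U \<and> T s (pr x) \<in> V))"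
    by (elim exE conjE)
  have UT3: "p (T s (pr x)) = cis s" "cis (lev x) = cis s \<Longrightarrow> T s (pr x) = pr x"
    if "x \<in> H3" "cis (lev x) \<in> U" "cis s \<in> U" for s x
    using UT(3)[rule_format, of x s] that by auto
  \<comment> \<open>Expressed by \<open>p (pr x)\<close> and not by \<open>lev x\<close>, because
    \<open>uniformize\<close> needs invariance under \<open>\<Delta>\<close> and \<open>lev\<close>
    may be shifted.\<close>
  define Good where "Good x \<eta> \<longleftrightarrow> (\<forall>s. dist (p (pr x)) (cis c) < \<eta> \<and> \<bar>s - c\<bar> < \<eta> \<longrightarrow>
      p (pr x) \<in> U \<and> cis s \<in> U \<and> (\<exists>y\<in>H3. pr y = T s (pr x) \<and> chC x y < e))" for x \<eta>
  have "\<exists>\<eta>>(0::real). \<forall>x\<in>H3. Good x \<eta>"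
  proof (rule uniformize)
    show "Good x e'" if "x \<in> H3" "Good x e0" "0 < e'" "e' \<le> e0" for x e0 e'
      using that unfolding Good_def by (meson less_le_trans)
    show "Good (\<delta> x) e0" if x: "x \<in> H3" and d: "\<delta> \<in> \<Delta>" and G: "Good x e0" for x \<delta> e0
      unfolding Good_def pr_inv[OF d x]
    proof (intro allI impI)
      fix s assume "dist (p (pr x)) (cis c) < e0 \<and> \<bar>s - c\<bar> < e0"
      then obtain y where y: "p (pr x) \<in> U" "cis s \<in> U" "y \<in> H3" "pr y = T s (pr x)" "chC x y < e"
        using G unfolding Good_def by blast
      then show "p (pr x) \<in> U \<and> cis s \<in> U \<and> (\<exists>y\<in>H3. pr y = T s (pr x) \<and> chC (\<delta> x) y < e)"
        using d x by (intro conjI bexI[of _ "\<delta> y"]) (simp_all add: pr_inv)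
    qed
    show "\<exists>\<eta>>0. \<exists>W. open W \<and> x \<in> W \<and> (\<forall>x'\<in>W \<inter> H3. Good x' \<eta>)" if x: "x \<in> H3" for x
    proof (cases "p (pr x) = cis c")
      \<comment> \<open>Off the fibre over \<open>cis c\<close> the premise fails for small
        \<open>\<eta>\<close>, so the property holds vacuously.\<close>
      case False
      define d where "d = dist (p (pr x)) (cis c) / 2"
      have d: "d > 0" using False by (simp add: d_def)
      have "continuous_on H3 (\<lambda>x. cis (lev x))" by (intro continuous_intros lev(1))
      then obtain A where A: "open A" "x \<in> A" "\<forall>y\<in>H3. y \<in> A \<longrightarrow> cis (lev y) \<in> ball (cis (lev x)) d"
        using x d unfolding continuous_on_topological by (metis centre_in_ball open_ball)
      have "\<not> dist (p (pr y)) (cis c) < d" if "y \<in> A \<inter> H3" for y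
      proof
        assume "dist (p (pr y)) (cis c) < d"
        moreover have "dist (p (pr x)) (p (pr y)) < d" using A(3) that lev(2) x by simp
        ultimately have "dist (p (pr x)) (cis c) < 2 * d" using dist_triangle[of "p (pr x)" "cis c" "p (pr y)"] by linarith
        then show False by (simp add: d_def)
      qed
      then have "\<forall>x'\<in>A \<inter> H3. Good x' d" unfolding Good_def by blast
      then show ?thesis using d A by (intro exI[of _ d] conjI exI[of _ A]) auto
    next
      case True
      have lc: "cis (lev x) = cis c" using True lev(2)[OF x] by simp
      obtain N1 N2 where N: "open N1" "open N2" "x \<in> N1" "x \<in> N2" "\<forall>x'\<in>N1. \<forall>y'\<in>N2. chC x' y' < e"
        using chC_nbhd[OF x x, of e] e(1) by (auto simp: chC_self)
      have oV: "openin (H3_quotient \<Delta>) (pr ` (N2 \<inter> H3))" using N(2) open_H3 by (intro open_pr_image) auto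
      have "T c (pr x) = pr x" using UT3(2)[OF x _ UT(2) lc] UT(2) lc by simp
      then have "T c (pr x) \<in> pr ` (N2 \<inter> H3)" using N x by simp
      then obtain \<eta> W where W: "\<eta> > 0" "open W" "x \<in> W" "\<forall>s x. \<bar>s - c\<bar> < \<eta> \<and> x \<in> W \<inter> H3 \<longrightarrow> cis (lev x) \<in> U \<and> cis s \<in> U \<and> T s (pr x) \<in> pr ` (N2 \<inter> H3)"
        using UT(4)[rule_format, of x c "pr ` (N2 \<inter> H3)"] x lc UT(2) oV by auto
      have "Good x' \<eta>" if x': "x' \<in> (W \<inter> N1) \<inter> H3" for x'
        unfolding Good_def
      proof (intro allI impI)
        fix s assume "dist (p (pr x')) (cis c) < \<eta> \<and> \<bar>s - c\<bar> < \<eta>"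
        then have w: "cis (lev x') \<in> U" "cis s \<in> U" "T s (pr x') \<in> pr ` (N2 \<inter> H3)" using W(4) x' by auto
        then obtain y where "y \<in> N2 \<inter> H3" "T s (pr x') = pr y" by auto
        then show "p (pr x') \<in> U \<and> cis s \<in> U \<and> (\<exists>y\<in>H3. pr y = T s (pr x') \<and> chC x' y < e)"
          using w N(5) x' lev(2)[of x'] by auto
      qed
      then show ?thesis using W N by (intro exI[of _ \<eta>] conjI exI[of _ "W \<inter> N1"]) auto
    qed
  qed
  then obtain \<eta>0 where h0: "\<eta>0 > 0" "\<forall>x\<in>H3. Good x \<eta>0" by blast
  define \<eta> where "\<eta> = min \<eta>0 1"
  have h: "\<eta> > 0" "\<eta> \<le> \<eta>0" "\<eta> \<le> 1" using h0(1) by (auto simp: \<eta>_def)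
  have ex: "p (pr x) \<in> U \<and> cis s \<in> U \<and> (\<exists>y\<in>H3. pr y = T s (pr x) \<and> chC x y < e)"
    if "x \<in> H3" "\<bar>lev x - c\<bar> < \<eta>" "\<bar>s - c\<bar> < \<eta>" for x s
  proof -
    have "dist (p (pr x)) (cis c) < \<eta>0" using dist_cis_le[of "lev x" c] that h lev(2)[OF that(1)] by simp
    moreover have "\<bar>s - c\<bar> < \<eta>0" using that(3) h by linarith
    ultimately show ?thesis using h0(2)[rule_format, OF that(1), unfolded Good_def, rule_format, of s] by blast
  qed
  have uniq: "y = y'" if a: "x \<in> H3" "y \<in> H3" "y' \<in> H3" "pr y = pr y'" "chC x y < e" "chC x y' < e" for x y y'
  proof -
    obtain \<delta> where "\<delta> \<in> \<Delta>" "y' = \<delta> y" using pr_eq_iff[OF a(2,3)] a(4) by blast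
    moreover have "chC x y < e1" "chC x y' < e1" using a e by auto
    ultimately show ?thesis using e1(2)[rule_format, OF a(1,2)] by metis
  qed
  show ?thesis
  proof (intro exI[of _ \<eta>] conjI allI impI h(1))
    fix s assume s: "\<bar>s - c\<bar> < \<eta>"
    define r where "r x = (SOME y. y \<in> H3 \<and> pr y = T s (pr x) \<and> chC x y < e)" for x
    have r: "r x \<in> H3" "pr (r x) = T s (pr x)" "chC x (r x) < e" if "x \<in> H3" "\<bar>lev x - c\<bar> < \<eta>" for x
    proof -
      have "\<exists>y. y \<in> H3 \<and> pr y = T s (pr x) \<and> chC x y < e" using ex[OF that s] by blast
      then have "r x \<in> H3 \<and> pr (r x) = T s (pr x) \<and> chC x (r x) < e" unfolding r_def by (rule someI_ex)
      then show "r x \<in> H3" "pr (r x) = T s (pr x)" "chC x (r x) < e" by auto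
    qed
    have Us: "cis (lev x) \<in> U" "cis s \<in> U" if "x \<in> H3" "\<bar>lev x - c\<bar> < \<eta>" for x
      using ex[OF that s] lev(2)[OF that(1)] by auto
    \<comment> \<open>The levels agree modulo \<open>2 * pi\<close>; as \<open>r x\<close> is close
      to \<open>x\<close>, they differ by less than 3.\<close>
    have lr: "lev (r x) = s" if x: "x \<in> H3" "\<bar>lev x - c\<bar> < \<eta>" for x
    proof (rule cis_eq_near)
      have "cis (lev (r x)) = p (pr (r x))" using lev(2)[OF r(1)[OF x]] by simp
      also have "\<dots> = cis s" using UT3(1)[OF x(1) Us[OF x]] r(2)[OF x] by simp
      finally show "cis (lev (r x)) = cis s" .
      have "chC x (r x) < e2" using r(3)[OF x] e by simp
      then have "\<bar>lev x - lev (r x)\<bar> < 1" using e2(2) x r(1)[OF x] by blast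
      then have "\<bar>lev (r x) - s\<bar> < 3" using x s h by linarith
      then show "\<bar>lev (r x) - s\<bar> < 2 * pi" using pi_gt3 by linarith
    qed
    have rid: "r x = x" if x: "x \<in> H3" "\<bar>lev x - c\<bar> < \<eta>" "lev x = s" for x
    proof (rule uniq[of x])
      show "pr (r x) = pr x" using r(2)[OF x(1,2)] UT3(2)[OF x(1) Us[OF x(1,2)]] x(3) by simp
    qed (use r x e in \<open>auto simp: chC_self\<close>)
    have cont: "continuous_on {x\<in>H3. \<bar>lev x - c\<bar> < \<eta>} r"
      unfolding continuous_on_topological
    proof (intro ballI allI impI)
      fix x0 N assume x0: "x0 \<in> {x\<in>H3. \<bar>lev x - c\<bar> < \<eta>}" and N: "open N" "r x0 \<in> N"
      have x0': "x0 \<in> H3" "\<bar>lev x0 - c\<bar> < \<eta>" using x0 by auto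
      obtain N1 N2 where N12: "open N1" "open N2" "x0 \<in> N1" "r x0 \<in> N2" "\<forall>x'\<in>N1. \<forall>y'\<in>N2. chC x' y' < e"
        using chC_nbhd[OF x0'(1) r(1)[OF x0'] r(3)[OF x0']] by (elim exE conjE)
      have oV: "openin (H3_quotient \<Delta>) (pr ` (N \<inter> N2 \<inter> H3))" using N(1) N12(2) open_H3 by (intro open_pr_image) auto
      have "T s (pr x0) \<in> pr ` (N \<inter> N2 \<inter> H3)" unfolding r(2)[OF x0', symmetric] using N N12 r(1)[OF x0'] by simp
      then obtain \<eta>' W where W: "\<eta>' > 0" "open W" "x0 \<in> W" "\<forall>s' x. \<bar>s' - s\<bar> < \<eta>' \<and> x \<in> W \<inter> H3 \<longrightarrow> cis (lev x) \<in> U \<and> cis s' \<in> U \<and> T s' (pr x) \<in> pr ` (N \<inter> N2 \<inter> H3)"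
        using UT(4)[rule_format, of x0 s "pr ` (N \<inter> N2 \<inter> H3)"] x0'(1) Us[OF x0'] oV by auto
      have "r x \<in> N" if x: "x \<in> {x\<in>H3. \<bar>lev x - c\<bar> < \<eta>}" "x \<in> W \<inter> N1" for x
      proof -
        have x': "x \<in> H3" "\<bar>lev x - c\<bar> < \<eta>" using x by auto
        have "T s (pr x) \<in> pr ` (N \<inter> N2 \<inter> H3)" using W(4)[rule_format, of s x] W(1) x by simp
        then obtain y where y: "y \<in> N \<inter> N2 \<inter> H3" "T s (pr x) = pr y" by auto
        have "r x = y" by (rule uniq[of x]) (use r[OF x'] y x N12(5) in auto)
        then show ?thesis using y by simp
      qed
      then show "\<exists>A. open A \<and> x0 \<in> A \<and> (\<forall>y\<in>{x\<in>H3. \<bar>lev x - c\<bar> < \<eta>}. y \<in> A \<longrightarrow> r y \<in> N)"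
        using W N12 by (intro exI[of _ "W \<inter> N1"]) auto
    qed
    show "\<exists>r. continuous_on {x\<in>H3. \<bar>lev x - c\<bar> < \<eta>} r \<and>
        (\<forall>x\<in>H3. \<bar>lev x - c\<bar> < \<eta> \<longrightarrow> r x \<in> H3 \<and> lev (r x) = s \<and> (lev x = s \<longrightarrow> r x = x))"
      by (rule exI[of _ r]) (use cont r(1) lr rid in blast)
  qed
qed

text \<open>Join the points by a segment, push it down to the level, then push the result up by
  applying \<open>push_down\<close> to \<open>- lev\<close>. Points on the level, in particular the
  ends, are kept both times.\<close>

lemma connected_in_level:
  assumes x: "x \<in> H3" "y \<in> H3" "lev x = lev y"
  shows "\<exists>C. connected C \<and> C \<subseteq> {z\<in>H3. lev z = lev x} \<and> x \<in> C \<and> y \<in> C"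
proof -
  note split_paired_All [simp del] split_paired_Ex [simp del] split_paired_all [simp del]
  let ?c = "lev x" and ?C = "closed_segment x y"
  have CH: "?C \<subseteq> H3" using x convex_H3 by (simp add: closed_segment_subset)
  have "compact (lev ` ?C)" using lev(1) CH by (meson compact_continuous_image compact_segment continuous_on_subset)
  then obtain b where b: "\<And>z. z \<in> ?C \<Longrightarrow> \<bar>lev z\<bar> \<le> b" using compact_imp_bounded bounded_iff by (metis imageI real_norm_def)
  have "\<exists>C'. connected C' \<and> C' \<subseteq> H3 \<and> ?C \<inter> {z. lev z \<le> ?c} \<subseteq> C' \<and> (\<forall>z\<in>C'. lev z \<le> ?c \<and> (z \<in> ?C \<or> lev z = ?c))"
    by (rule push_down[OF lev(1) local_retraction, where b = b]) (use CH b in \<open>auto intro: connected_segment\<close>, smt (verit))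
  then obtain C' where C': "connected C'" "C' \<subseteq> H3" "?C \<inter> {z. lev z \<le> ?c} \<subseteq> C'" "\<forall>z\<in>C'. lev z \<le> ?c \<and> (z \<in> ?C \<or> lev z = ?c)"
    by (elim exE conjE)
  have cm: "continuous_on H3 (\<lambda>z. - lev z)" by (intro continuous_intros lev(1))
  have lm: "\<exists>\<eta>>0. \<forall>s. \<bar>s - c\<bar> < \<eta> \<longrightarrow> (\<exists>r. continuous_on {x\<in>H3. \<bar>- lev x - c\<bar> < \<eta>} r \<and>
        (\<forall>x\<in>H3. \<bar>- lev x - c\<bar> < \<eta> \<longrightarrow> r x \<in> H3 \<and> - lev (r x) = s \<and> (- lev x = s \<longrightarrow> r x = x)))" for c
  proof -
    obtain \<eta> where eta: "\<eta> > 0" "\<forall>s. \<bar>s - (- c)\<bar> < \<eta> \<longrightarrow> (\<exists>r. continuous_on {x\<in>H3. \<bar>lev x - (- c)\<bar> < \<eta>} r \<and>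
        (\<forall>x\<in>H3. \<bar>lev x - (- c)\<bar> < \<eta> \<longrightarrow> r x \<in> H3 \<and> lev (r x) = s \<and> (lev x = s \<longrightarrow> r x = x)))"
      using local_retraction[of "- c"] by (elim exE conjE)
    have a: "\<bar>- a - c\<bar> = \<bar>a - (- c)\<bar>" for a by linarith
    have "\<exists>r. continuous_on {x\<in>H3. \<bar>- lev x - c\<bar> < \<eta>} r \<and>
        (\<forall>x\<in>H3. \<bar>- lev x - c\<bar> < \<eta> \<longrightarrow> r x \<in> H3 \<and> - lev (r x) = s \<and> (- lev x = s \<longrightarrow> r x = x))" if "\<bar>s - c\<bar> < \<eta>" for s
    proof -
      have "\<bar>- s - (- c)\<bar> < \<eta>" using that by linarith
      from eta(2)[rule_format, OF this] show ?thesis unfolding a by (elim exE) (intro exI, auto)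
    qed
    then show ?thesis using eta(1) by blast
  qed
  have "\<exists>C''. connected C'' \<and> C'' \<subseteq> H3 \<and> C' \<inter> {z. - lev z \<le> - ?c} \<subseteq> C'' \<and> (\<forall>z\<in>C''. - lev z \<le> - ?c \<and> (z \<in> C' \<or> - lev z = - ?c))"
  proof (rule push_down[OF cm lm C'(1,2)])
    fix z assume "z \<in> C'"
    then have "lev z \<le> ?c" "z \<in> ?C \<or> lev z = ?c" using C'(4) by auto
    moreover have "\<bar>?c\<bar> \<le> b" by (rule b) simp
    ultimately show "- lev z \<le> b" using b[of z] by auto
  qed
  then obtain C'' where C'': "connected C''" "C'' \<subseteq> H3" "C' \<inter> {z. - lev z \<le> - ?c} \<subseteq> C''" "\<forall>z\<in>C''. - lev z \<le> - ?c \<and> (z \<in> C' \<or> - lev z = - ?c)"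
    by (elim exE conjE)
  have "lev z = ?c" if "z \<in> C''" for z using C''(4) C'(4) that by force
  moreover have "x \<in> C''" "y \<in> C''"
  proof -
    have 1: "x \<in> C'" by (rule subsetD[OF C'(3)]) simp
    have 2: "y \<in> C'" by (rule subsetD[OF C'(3)]) (simp add: x(3))
    show "x \<in> C''" by (rule subsetD[OF C''(3)]) (simp add: 1)
    show "y \<in> C''" by (rule subsetD[OF C''(3)]) (simp add: 2 x(3))
  qed
  ultimately show ?thesis using C''(1,2) by (intro exI[of _ C'']) blast
qed

text \<open>The function \<open>lev\<close>, a lift of the projection to the circle, is shifted by a constant by each element of \<open>\<Delta>\<close>, and its level set
  through \<open>F \<i>\<close> is \<open>F ` H2\<close> because it is connected. So conjugates of \<open>\<rho> \<gamma>\<close> by elements of \<open>\<Delta>\<close> preserve \<open>F ` H2\<close>.\<close>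

lemma normality:
  assumes "\<delta> \<in> \<Delta>" "\<gamma> \<in> \<Gamma>"
  shows "\<exists>\<gamma>'\<in>\<Gamma>. \<forall>x\<in>H3. act_H3 (\<rho> \<gamma>) (\<delta> x) = \<delta> (act_H3 (\<rho> \<gamma>') x)"
proof -
  note split_paired_All [simp del] split_paired_Ex [simp del] split_paired_all [simp del]
  have ii: "\<i> \<in> H2" by (simp add: H2_Im)
  obtain \<kappa> where k: "\<kappa> \<in> \<Delta>" "\<And>x. x \<in> H3 \<Longrightarrow> \<kappa> (\<delta> x) = x \<and> \<delta> (\<kappa> x) = x" using invD[OF assms(1)] by blast
  obtain \<epsilon> where e: "\<epsilon> \<in> \<Delta>" "\<And>x. x \<in> H3 \<Longrightarrow> \<epsilon> x = act_H3 (\<rho> \<gamma>) x" using rho_Delta[OF assms(2)] by blast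
  obtain \<mu> where m: "\<mu> \<in> \<Delta>" "\<And>x. x \<in> H3 \<Longrightarrow> \<mu> x = \<epsilon> (\<delta> x)" using comp[OF e(1) assms(1)] by blast
  \<comment> \<open>The conjugate of \<open>\<rho> \<gamma>\<close> by \<open>\<delta>\<close>. The
    shifts of \<open>lev\<close> by \<open>\<delta>\<close> and by its inverse cancel, and
    \<open>\<rho> \<gamma>\<close> shifts by 0 since it preserves \<open>\<Sigma>\<close>.\<close>
  obtain \<nu> where n: "\<nu> \<in> \<Delta>" "\<And>x. x \<in> H3 \<Longrightarrow> \<nu> x = \<kappa> (\<mu> x)" using comp[OF k(1) m(1)] by blast
  let ?x = "F \<i>"
  have x: "?x \<in> H3" using ii by simp
  have dx: "\<delta> ?x \<in> H3" "\<epsilon> (\<delta> ?x) \<in> H3" using maps[OF assms(1) x] maps[OF e(1) maps[OF assms(1) x]] by simp_all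
  have "lev (\<epsilon> (\<delta> ?x)) - lev (\<delta> ?x) = lev (\<epsilon> ?x) - lev ?x" by (rule lev_shift[OF e(1) dx(1) x])
  moreover have "\<epsilon> ?x = F (act_H2 \<gamma> \<i>)" by (rule trans[OF e(2)[OF x] F_act[OF assms(2) ii, symmetric]])
  moreover have "lev (F (act_H2 \<gamma> \<i>)) = lev ?x" by (rule lev_F[OF act_H2_H2[OF assms(2) ii] ii])
  ultimately have 1: "lev (\<epsilon> (\<delta> ?x)) = lev (\<delta> ?x)" by simp
  have "lev (\<kappa> (\<epsilon> (\<delta> ?x))) - lev (\<epsilon> (\<delta> ?x)) = lev (\<kappa> (\<delta> ?x)) - lev (\<delta> ?x)" by (rule lev_shift[OF k(1) dx(2,1)])
  moreover have "\<nu> ?x = \<kappa> (\<epsilon> (\<delta> ?x))" using n(2)[OF x] m(2)[OF x] by (simp only:)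
  moreover have "\<kappa> (\<delta> ?x) = ?x" using k(2)[OF x] by (rule conjunct1)
  ultimately have 2: "lev (\<nu> ?x) = lev ?x" using 1 by (simp only:)
  obtain C where C: "connected C" "C \<subseteq> {z\<in>H3. lev z = lev ?x}" "?x \<in> C" "\<nu> ?x \<in> C"
    using connected_in_level[OF x maps[OF n(1) x] 2[symmetric]] by (elim exE conjE)
  have "\<nu> ?x \<in> \<Sigma>" using level_connected[OF C(1-3)] C(4) by blast
  then obtain w where w: "\<nu> ?x = F w" "w \<in> H2" by (rule imageE)
  have "\<exists>\<gamma>'\<in>\<Gamma>. \<forall>x\<in>H3. \<nu> x = act_H3 (\<rho> \<gamma>') x"
    by (rule stabilizer[OF n(1) ii w(2,1)])
  then obtain \<gamma>' where g: "\<gamma>' \<in> \<Gamma>" "\<forall>x\<in>H3. \<nu> x = act_H3 (\<rho> \<gamma>') x" ..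
  have "act_H3 (\<rho> \<gamma>) (\<delta> y) = \<delta> (act_H3 (\<rho> \<gamma>') y)" if y: "y \<in> H3" for y
  proof -
    have "\<epsilon> (\<delta> y) \<in> H3" by (rule maps[OF e(1) maps[OF assms(1) y]])
    then have "\<delta> (\<kappa> (\<epsilon> (\<delta> y))) = \<epsilon> (\<delta> y)" using k(2) by blast
    then have "\<delta> (\<nu> y) = \<epsilon> (\<delta> y)" unfolding n(2)[OF y] m(2)[OF y] .
    then show ?thesis unfolding g(2)[rule_format, OF y] e(2)[OF maps[OF assms(1) y]] by (rule sym)
  qed
  then show ?thesis using g(1) by blast
qed

end

section \<open>Representations with a boundary extension\<close>

lemma hgt_pos: "snd x > 0 \<Longrightarrow> hgt x > 0"
  using hdenom_pos[of x] by (simp add: hgt_def)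

lemma hgt_le: "hgt x \<le> 1 / 2"
proof -
  have "2 * snd x \<le> 1 + (snd x)\<^sup>2" using sum_squares_bound[of 1 "snd x"] by simp
  then have "2 * snd x \<le> hdenom x" unfolding hdenom_def by (smt (verit) zero_le_power2)
  then show ?thesis using hdenom_pos[of x] by (simp add: hgt_def divide_simps)
qed

lemma norm_ballmap_le: "norm (ballmap x) \<le> 1"
proof -
  have "(norm (ballmap x))\<^sup>2 \<le> 1\<^sup>2" unfolding norm_ballmap by simp
  then show ?thesis by (rule power2_le_imp_le) simp
qed

lemma norm_ballmap_less: "snd x > 0 \<Longrightarrow> norm (ballmap x) < 1"
proof -
  assume "snd x > 0"
  then have "(norm (ballmap x))\<^sup>2 < 1\<^sup>2" unfolding norm_ballmap using hgt_pos[of x] by simp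
  then show ?thesis by (rule power2_less_imp_less) simp
qed

lemma dist_le_inner:
  fixes x y :: "'a::real_inner"
  assumes "norm x \<le> 1" "norm y \<le> 1"
  shows "(dist x y)\<^sup>2 \<le> 2 * (1 - x \<bullet> y)"
proof -
  have "(norm x)\<^sup>2 \<le> 1" "(norm y)\<^sup>2 \<le> 1" using assms by (simp_all add: power_le_one)
  moreover have "(dist x y)\<^sup>2 = (norm x)\<^sup>2 + (norm y)\<^sup>2 - 2 * (x \<bullet> y)"
    by (simp add: dist_norm power2_norm_eq_inner inner_diff inner_commute)
  ultimately show ?thesis by (simp add: right_diff_distrib)
qed

lemma inner_le_1:
  fixes x y :: "'a::real_inner"
  assumes "norm x \<le> 1" "norm y \<le> 1"
  shows "x \<bullet> y \<le> 1"
proof -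
  have "x \<bullet> y \<le> norm x * norm y" by (rule norm_cauchy_schwarz)
  also have "\<dots> \<le> 1 * 1" using assms by (intro mult_mono) auto
  finally show ?thesis by simp
qed

lemma tendsto_of_inner:
  fixes s :: "'b \<Rightarrow> 'a::real_inner"
  assumes "\<And>n. norm (s n) \<le> 1" "norm x \<le> 1" "((\<lambda>n. 1 - s n \<bullet> x) \<longlongrightarrow> 0) F"
  shows "(s \<longlongrightarrow> x) F"
proof -
  have "((\<lambda>n. 2 * (1 - s n \<bullet> x)) \<longlongrightarrow> 2 * 0) F" by (intro tendsto_intros assms(3))
  then have "((\<lambda>n. 2 * (1 - s n \<bullet> x)) \<longlongrightarrow> 0) F" by simp
  then have "((\<lambda>n. (dist (s n) x)\<^sup>2) \<longlongrightarrow> 0) F"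
    by (rule tendsto_sandwich[OF _ _ tendsto_const, rotated 2]) (use dist_le_inner[OF assms(1,2)] in auto)
  then have "((\<lambda>n. sqrt ((dist (s n) x)\<^sup>2)) \<longlongrightarrow> sqrt 0) F" by (rule tendsto_real_sqrt)
  then have "((\<lambda>n. dist (s n) x) \<longlongrightarrow> 0) F" by simp
  then show ?thesis by (rule tendsto_dist_iff[THEN iffD2])
qed

text \<open>By the cocycle identity the factor is the reciprocal of a factor of the inverse, which
  \<open>sg_le\<close> bounds from above.\<close>

lemma sgp_lower: "g \<in> carrier PSL2 \<Longrightarrow> \<exists>m>0. \<forall>\<xi>. sgp g \<xi> \<ge> m"
proof -
  assume g: "g \<in> carrier PSL2"
  let ?i = "inv\<^bsub>PSL2\<^esub> g"
  define C where "C = (cmod (rep ?i$1$1))\<^sup>2 + (cmod (rep ?i$1$2))\<^sup>2 + (cmod (rep ?i$2$1))\<^sup>2 + (cmod (rep ?i$2$2))\<^sup>2"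
  have i: "?i \<in> carrier PSL2" using g by simp
  have up: "sgp ?i \<eta> \<le> C" for \<eta> unfolding sgp_def C_def by (rule sg_le)
  have C: "C > 0" using up[of None] sgp_pos[OF i, of None] by linarith
  have "1 / C \<le> sgp g \<xi>" for \<xi>
  proof -
    have "sgp (?i \<otimes>\<^bsub>PSL2\<^esub> g) \<xi> = sgp ?i (act_bdry g \<xi>) * sgp g \<xi>" using sgp_mult[OF i g] .
    then have "1 = sgp ?i (act_bdry g \<xi>) * sgp g \<xi>" using g by (simp add: sgp_one PSL2.l_inv)
    also have "\<dots> \<le> C * sgp g \<xi>" using up sgp_pos[OF g] by (intro mult_right_mono) (auto intro: less_imp_le)
    finally show ?thesis using C by (simp add: divide_le_eq mult.commute)
  qed
  then show ?thesis using C by (intro exI[of _ "1 / C"]) simp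
qed

lemma limitin_act_bdry:
  fixes h :: "(real^2^2) set"
  assumes h: "h \<in> carrier PSL2" and s: "limitin bdry_top s \<xi> F"
  shows "limitin bdry_top (\<lambda>n. act_bdry h (s n)) (act_bdry h \<xi>) F"
proof -
  let ?g = "cpsl h"
  have g: "?g \<in> carrier PSL2" using h by (rule cpsl_carrier)
  obtain m where m: "m > 0" "\<And>\<xi>. sgp ?g \<xi> \<ge> m" using sgp_lower[OF g] by blast
  have lim: "((\<lambda>n. chord (inc_bd (s n)) (inc_bd \<xi>)) \<longlongrightarrow> 0) F"
    using s unfolding limitin_bdry_real tendsto_bdpt_iff_chord .
  then have lim2: "((\<lambda>n. chord (inc_bd (s n)) (inc_bd \<xi>) / (m * m)) \<longlongrightarrow> 0) F"
    by (rule tendsto_divide_zero)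
  have "chord (inc_bd (act_bdry h (s n))) (inc_bd (act_bdry h \<xi>)) \<le> chord (inc_bd (s n)) (inc_bd \<xi>) / (m * m)" for n
  proof -
    let ?c = "chord (act_bdry ?g (inc_bd (s n))) (act_bdry ?g (inc_bd \<xi>))"
    have "?c * (m * m) \<le> ?c * (sgp ?g (inc_bd (s n)) * sgp ?g (inc_bd \<xi>))"
      using m by (intro mult_left_mono mult_mono chord_nonneg) (auto intro: less_imp_le order_trans)
    also have "\<dots> = chord (inc_bd (s n)) (inc_bd \<xi>)" using chord_act[OF g, of "inc_bd (s n)" "inc_bd \<xi>"] by (simp add: mult.assoc)
    finally show ?thesis using m(1) h by (simp add: pos_le_divide_eq act_bdry_cpsl)
  qed
  then have "((\<lambda>n. chord (inc_bd (act_bdry h (s n))) (inc_bd (act_bdry h \<xi>))) \<longlongrightarrow> 0) F"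
    by (intro tendsto_sandwich[OF _ _ tendsto_const lim2]) (auto simp: chord_nonneg)
  then show ?thesis unfolding limitin_bdry_real tendsto_bdpt_iff_chord .
qed

lemma limitin_Some:
  fixes y :: "nat \<Rightarrow> real"
  assumes "y \<longlonglongrightarrow> \<eta>"
  shows "limitin bdry_top (\<lambda>n. Some (y n)) (Some \<eta>) sequentially"
proof -
  have "continuous_map euclidean bdry_top (Some :: real \<Rightarrow> _)" unfolding bdry_top_def by (rule continuous_map_Some)
  from continuous_map_limit[OF this] assms show ?thesis by (simp add: o_def)
qed

text \<open>What the inclusion of \<open>\<Gamma>\<close> and the representation
  \<open>\<rho>\<close> have in common; both are interpretations, so the limits of their cocycles
  are computed once.\<close>

locale bdry_rep = lattice \<Gamma> for \<Gamma> +
  fixes r :: "(real^2^2) set \<Rightarrow> (complex^2^2) set" and \<Phi> :: "complex \<Rightarrow> complex \<times> real" and \<psi> :: "real option \<Rightarrow> complex option"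
  assumes r_carrier [simp]: "\<gamma> \<in> \<Gamma> \<Longrightarrow> r \<gamma> \<in> carrier PSL2"
    and r_mult: "\<gamma> \<in> \<Gamma> \<Longrightarrow> \<delta> \<in> \<Gamma> \<Longrightarrow> r (\<gamma> \<otimes>\<^bsub>PSL2\<^esub> \<delta>) = r \<gamma> \<otimes>\<^bsub>PSL2\<^esub> r \<delta>"
    and Phi_pos: "z \<in> H2 \<Longrightarrow> snd (\<Phi> z) > 0"
    and Phi_act: "\<gamma> \<in> \<Gamma> \<Longrightarrow> z \<in> H2 \<Longrightarrow> \<Phi> (act_H2 \<gamma> z) = act_H3 (r \<gamma>) (\<Phi> z)"
    and psi_act: "\<gamma> \<in> \<Gamma> \<Longrightarrow> \<psi> (act_bdry \<gamma> \<xi>) = act_bdry (r \<gamma>) (\<psi> \<xi>)"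
    and psi_cont: "continuous_map bdry_top bdry_top \<psi>"
    and ext: "((\<lambda>z. ballmap (\<Phi> z)) \<longlongrightarrow> bdpt (\<psi> (Some x))) (at (of_real x) within H2)"
begin

definition sig :: "(real^2^2) set \<Rightarrow> real option \<Rightarrow> real" where
  "sig \<gamma> \<xi> = sgp (r \<gamma>) (\<psi> \<xi>)"

definition Q :: "real option \<Rightarrow> real option \<Rightarrow> real" where
  "Q \<xi> \<eta> = chord (\<psi> \<xi>) (\<psi> \<eta>)"

lemma sig_pos: "\<gamma> \<in> \<Gamma> \<Longrightarrow> sig \<gamma> \<xi> > 0"
  by (simp add: sig_def sgp_pos)

lemma sig_mult: "\<gamma> \<in> \<Gamma> \<Longrightarrow> \<delta> \<in> \<Gamma> \<Longrightarrow> sig (\<gamma> \<otimes>\<^bsub>PSL2\<^esub> \<delta>) \<xi> = sig \<gamma> (act_bdry \<delta> \<xi>) * sig \<delta> \<xi>"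
  by (simp add: sig_def r_mult sgp_mult psi_act)

lemma r_one: "r \<one>\<^bsub>PSL2\<^esub> = \<one>\<^bsub>PSL2\<^esub>"
  using r_mult[OF one_in one_in] r_carrier[OF one_in] by (metis PSL2.l_cancel_one' PSL2.l_one PSL2.one_closed)

lemma sig_one: "sig \<one>\<^bsub>PSL2\<^esub> \<xi> = 1"
  by (simp add: sig_def r_one sgp_one)

lemma sig_inv: "\<gamma> \<in> \<Gamma> \<Longrightarrow> sig (inv\<^bsub>PSL2\<^esub> \<gamma>) (act_bdry \<gamma> \<xi>) * sig \<gamma> \<xi> = 1"
  using sig_mult[of "inv\<^bsub>PSL2\<^esub> \<gamma>" \<gamma> \<xi>] by (simp add: PSL2.l_inv sig_one)

lemma Q_act: "\<gamma> \<in> \<Gamma> \<Longrightarrow> Q (act_bdry \<gamma> \<xi>) (act_bdry \<gamma> \<eta>) * sig \<gamma> \<xi> * sig \<gamma> \<eta> = Q \<xi> \<eta>"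
  by (simp add: Q_def sig_def psi_act chord_act)

lemma Q_nonneg: "Q \<xi> \<eta> \<ge> 0" and Q_pos: "Q \<xi> \<eta> > 0 \<longleftrightarrow> \<psi> \<xi> \<noteq> \<psi> \<eta>" and Q_commute: "Q \<xi> \<eta> = Q \<eta> \<xi>" and Q_le_1: "Q \<xi> \<eta> \<le> 1"
  unfolding Q_def by (rule chord_nonneg, rule chord_pos, rule chord_commute, rule chord_le_1)

lemma psi_lim: "limitin bdry_top s \<xi> F \<Longrightarrow> ((\<lambda>n. bdpt (\<psi> (s n))) \<longlongrightarrow> bdpt (\<psi> \<xi>)) F"
  using continuous_map_limit[OF psi_cont, of s \<xi> F] by (simp add: limitin_bdry_complex o_def)

lemma Q_lim1: "limitin bdry_top s \<xi> F \<Longrightarrow> ((\<lambda>n. Q (s n) \<eta>) \<longlongrightarrow> Q \<xi> \<eta>) F"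
  unfolding Q_def by (intro chord_tendsto psi_lim tendsto_const)

lemma i_H2 [simp]: "\<i> \<in> H2"
  by (simp add: H2_Im)

lemma act_H2_in [simp]: "\<gamma> \<in> \<Gamma> \<Longrightarrow> z \<in> H2 \<Longrightarrow> act_H2 \<gamma> z \<in> H2"
  by (simp add: H2_Im act_H2_pos)

lemma poisson_sig:
  assumes "\<gamma> \<in> \<Gamma>" "z \<in> H2"
  shows "poisson (\<Phi> (act_H2 \<gamma> z)) (\<psi> (act_bdry \<gamma> \<xi>)) * sig \<gamma> \<xi> = poisson (\<Phi> z) (\<psi> \<xi>)"
  using assms by (simp add: Phi_act psi_act sig_def poisson_act Phi_pos)

lemma poisson_lim:
  assumes "limitin bdry_top s \<xi> F"
  shows "((\<lambda>n. poisson x (\<psi> (s n))) \<longlongrightarrow> poisson x (\<psi> \<xi>)) F"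
  unfolding poisson_def
proof (cases "hgt x = 0")
  case False
  then show "((\<lambda>n. (1 - ballmap x \<bullet> bdpt (\<psi> (s n))) / (2 * hgt x)) \<longlongrightarrow> (1 - ballmap x \<bullet> bdpt (\<psi> \<xi>)) / (2 * hgt x)) F"
    by (intro tendsto_intros psi_lim assms) simp
qed simp

text \<open>\<open>poisson_sig\<close> writes \<open>sig\<close> as a quotient of positive
  continuous functions of the boundary point.\<close>

lemma sig_lim:
  assumes "\<gamma> \<in> \<Gamma>" "limitin bdry_top s \<xi> F"
  shows "((\<lambda>n. sig \<gamma> (s n)) \<longlongrightarrow> sig \<gamma> \<xi>) F"
proof -
  have eq: "sig \<gamma> \<eta> = poisson (\<Phi> \<i>) (\<psi> \<eta>) / poisson (\<Phi> (act_H2 \<gamma> \<i>)) (\<psi> (act_bdry \<gamma> \<eta>))" for \<eta>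
    using poisson_sig[OF assms(1) i_H2, of \<eta>] poisson_pos[of "\<Phi> (act_H2 \<gamma> \<i>)" "\<psi> (act_bdry \<gamma> \<eta>)"] Phi_pos assms(1)
    by (simp add: field_simps)
  have "poisson (\<Phi> (act_H2 \<gamma> \<i>)) (\<psi> (act_bdry \<gamma> \<xi>)) \<noteq> 0"
    using poisson_pos[of "\<Phi> (act_H2 \<gamma> \<i>)" "\<psi> (act_bdry \<gamma> \<xi>)"] Phi_pos assms(1) by simp
  then show ?thesis unfolding eq
    by (intro tendsto_intros poisson_lim assms(2) limitin_act_bdry) (use assms(1) in auto)
qed

text \<open>The height is a function of the norm in the ball by \<open>norm_ballmap\<close>, and the
  limit point lies on the unit sphere.\<close>

lemma hgt_tendsto_0:
  assumes "z \<longlonglongrightarrow> of_real \<zeta>" "\<And>n. z n \<in> H2"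
  shows "(\<lambda>n. ballmap (\<Phi> (z n))) \<longlonglongrightarrow> bdpt (\<psi> (Some \<zeta>))" "(\<lambda>n. hgt (\<Phi> (z n))) \<longlonglongrightarrow> 0"
proof -
  have ne: "of_real \<zeta> \<notin> H2" by (simp add: H2_Im)
  have "filterlim z (at (of_real \<zeta>) within H2) sequentially"
    unfolding filterlim_at using assms ne by (auto intro!: always_eventually) metis
  then show 1: "(\<lambda>n. ballmap (\<Phi> (z n))) \<longlonglongrightarrow> bdpt (\<psi> (Some \<zeta>))"
    by (rule filterlim_compose[OF ext])
  have "(\<lambda>n. sqrt ((1 - (norm (ballmap (\<Phi> (z n))))\<^sup>2) / 4)) \<longlonglongrightarrow> sqrt ((1 - (norm (bdpt (\<psi> (Some \<zeta>))))\<^sup>2) / 4)"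
    by (intro tendsto_intros 1) simp
  moreover have "sqrt ((1 - (norm (ballmap (\<Phi> (z n))))\<^sup>2) / 4) = hgt (\<Phi> (z n))" for n
  proof -
    have "hgt (\<Phi> (z n)) > 0" using Phi_pos[OF assms(2)] by (rule hgt_pos)
    then show ?thesis unfolding norm_ballmap by simp
  qed
  ultimately show "(\<lambda>n. hgt (\<Phi> (z n))) \<longlonglongrightarrow> 0" by (simp add: norm_bdpt)
qed

text \<open>The cocycle identity splits the factor of the conjugate into that of \<open>h\<close>
  and those of \<open>g n\<close> and its inverse. The latter are quotients of Poisson terms at the
  common point \<open>g n \<i>\<close>; its height cancels, and inner products tending to chords to
  \<open>\<psi> (Some \<zeta>)\<close> remain.\<close>

lemma sig_conj_lim:
  assumes g: "\<And>n. g n \<in> \<Gamma>" and h: "h \<in> \<Gamma>"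
    and x: "limitin bdry_top (\<lambda>n. act_bdry (g n) \<xi>) \<eta> sequentially"
    and z: "(\<lambda>n. act_H2 (g n) \<i>) \<longlonglongrightarrow> of_real \<zeta>"
    and fixed: "limitin bdry_top (\<lambda>n. act_bdry (inv\<^bsub>PSL2\<^esub> (g n) \<otimes>\<^bsub>PSL2\<^esub> h \<otimes>\<^bsub>PSL2\<^esub> g n) \<xi>) \<xi> sequentially"
    and ne: "Q \<eta> (Some \<zeta>) \<noteq> 0"
  shows "(\<lambda>n. sig (inv\<^bsub>PSL2\<^esub> (g n) \<otimes>\<^bsub>PSL2\<^esub> h \<otimes>\<^bsub>PSL2\<^esub> g n) \<xi>) \<longlonglongrightarrow> sig h \<eta> * Q (act_bdry h \<eta>) (Some \<zeta>) / Q \<eta> (Some \<zeta>)"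
proof -
  let ?x = "\<lambda>n. act_bdry (g n) \<xi>" and ?z = "\<lambda>n. \<Phi> (act_H2 (g n) \<i>)"
  let ?k = "\<lambda>n. inv\<^bsub>PSL2\<^esub> (g n) \<otimes>\<^bsub>PSL2\<^esub> h \<otimes>\<^bsub>PSL2\<^esub> g n"
  have zH: "act_H2 (g n) \<i> \<in> H2" for n using g by simp
  have X: "(\<lambda>n. ballmap (?z n)) \<longlonglongrightarrow> bdpt (\<psi> (Some \<zeta>))" by (rule hgt_tendsto_0(1)[OF z zH])
  have hx: "limitin bdry_top (\<lambda>n. act_bdry h (?x n)) (act_bdry h \<eta>) sequentially"
    by (rule limitin_act_bdry[OF _ x]) (use h in simp)
  have num: "(\<lambda>n. (1 - ballmap (?z n) \<bullet> bdpt (\<psi> (act_bdry h (?x n)))) / 2) \<longlonglongrightarrow> Q (act_bdry h \<eta>) (Some \<zeta>)"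
    unfolding Q_def chord_def by (subst inner_commute) (intro tendsto_intros X psi_lim[OF hx], simp)
  have den: "(\<lambda>n. (1 - ballmap (?z n) \<bullet> bdpt (\<psi> (?x n))) / 2) \<longlonglongrightarrow> Q \<eta> (Some \<zeta>)"
    unfolding Q_def chord_def by (subst inner_commute) (intro tendsto_intros X psi_lim[OF x], simp)
  have P0: "poisson (\<Phi> \<i>) (\<psi> \<xi>) \<noteq> 0" using poisson_pos[of "\<Phi> \<i>" "\<psi> \<xi>"] Phi_pos[OF i_H2] by simp
  have "(\<lambda>n. sig h (?x n) * (((1 - ballmap (?z n) \<bullet> bdpt (\<psi> (act_bdry h (?x n)))) / 2) / ((1 - ballmap (?z n) \<bullet> bdpt (\<psi> (?x n))) / 2))
       * (poisson (\<Phi> \<i>) (\<psi> \<xi>) / poisson (\<Phi> \<i>) (\<psi> (act_bdry (?k n) \<xi>))))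
     \<longlonglongrightarrow> sig h \<eta> * (Q (act_bdry h \<eta>) (Some \<zeta>) / Q \<eta> (Some \<zeta>)) * (poisson (\<Phi> \<i>) (\<psi> \<xi>) / poisson (\<Phi> \<i>) (\<psi> \<xi>))"
    by (intro tendsto_intros num den sig_lim[OF h x] ne poisson_lim[OF fixed] P0)
  moreover have "sig (?k n) \<xi> = sig h (?x n) * (((1 - ballmap (?z n) \<bullet> bdpt (\<psi> (act_bdry h (?x n)))) / 2) / ((1 - ballmap (?z n) \<bullet> bdpt (\<psi> (?x n))) / 2))
       * (poisson (\<Phi> \<i>) (\<psi> \<xi>) / poisson (\<Phi> \<i>) (\<psi> (act_bdry (?k n) \<xi>)))" for n
  proof -
    let ?gi = "inv\<^bsub>PSL2\<^esub> (g n)"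
    have gG: "g n \<in> \<Gamma>" "?gi \<in> \<Gamma>" using g by auto
    have k1: "act_bdry (?k n) \<xi> = act_bdry ?gi (act_bdry h (?x n))"
      using gG h by (simp add: act_bdry_mult)
    have "sig (?k n) \<xi> = sig (?gi \<otimes>\<^bsub>PSL2\<^esub> h) (?x n) * sig (g n) \<xi>" using gG h by (intro sig_mult) auto
    also have "sig (?gi \<otimes>\<^bsub>PSL2\<^esub> h) (?x n) = sig ?gi (act_bdry h (?x n)) * sig h (?x n)" using gG h by (intro sig_mult)
    finally have s: "sig (?k n) \<xi> = sig ?gi (act_bdry h (?x n)) * sig h (?x n) * sig (g n) \<xi>" .
    have a: "poisson (?z n) (\<psi> (?x n)) * sig (g n) \<xi> = poisson (\<Phi> \<i>) (\<psi> \<xi>)" by (rule poisson_sig[OF gG(1) i_H2])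
    have "act_H2 ?gi (act_H2 (g n) \<i>) = \<i>" using gG by (intro act_H2_inv(1)) auto
    then have b: "poisson (\<Phi> \<i>) (\<psi> (act_bdry (?k n) \<xi>)) * sig ?gi (act_bdry h (?x n)) = poisson (?z n) (\<psi> (act_bdry h (?x n)))"
      using poisson_sig[OF gG(2) zH, of n "act_bdry h (?x n)"] k1 by simp
    have zp: "snd (?z n) > 0" using Phi_pos zH by blast
    have p: "poisson (?z n) (\<psi> (?x n)) > 0" "poisson (\<Phi> \<i>) (\<psi> (act_bdry (?k n) \<xi>)) > 0"
      using poisson_pos zp Phi_pos[OF i_H2] by blast+
    have c: "sig (g n) \<xi> = poisson (\<Phi> \<i>) (\<psi> \<xi>) / poisson (?z n) (\<psi> (?x n))"
      "sig ?gi (act_bdry h (?x n)) = poisson (?z n) (\<psi> (act_bdry h (?x n))) / poisson (\<Phi> \<i>) (\<psi> (act_bdry (?k n) \<xi>))"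
      using a b p by (simp_all add: field_simps)
    have rat: "poisson (?z n) (\<psi> (act_bdry h (?x n))) / poisson (?z n) (\<psi> (?x n)) =
       ((1 - ballmap (?z n) \<bullet> bdpt (\<psi> (act_bdry h (?x n)))) / 2) / ((1 - ballmap (?z n) \<bullet> bdpt (\<psi> (?x n))) / 2)"
    proof -
      have "(a / (2 * h)) / (b / (2 * h)) = (a / 2) / (b / 2)" if "h > 0" for a b h :: real using that by simp
      from this[OF hgt_pos[OF zp]] show ?thesis unfolding poisson_def .
    qed
    show ?thesis unfolding s c rat[symmetric] by (simp add: mult_ac)
  qed
  ultimately show ?thesis using P0 by simp
qed

end

section \<open>The Cannon-Thurston map as boundary map of the representation\<close>

locale ct_setting = fibred \<Delta> \<Gamma> p S \<phi> F \<rho>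
  for \<Delta> :: "(complex \<times> real \<Rightarrow> complex \<times> real) set" and \<Gamma> p S \<phi> F \<rho> +
  fixes f :: "real option \<Rightarrow> complex option"
  assumes ct: "is_Cannon_Thurston_map \<Gamma> \<rho> F f"
begin

definition ext_map :: "complex option \<Rightarrow> complex \<times> real" where
  "ext_map x = ballmap_opt (extend_by F f x)"

lemma ext_map_cont: "continuous_map H2_bar euclidean ext_map"
  using continuous_map_compose[OF _ continuous_ballmap_opt, of H2_bar "extend_by F f"] ct
  by (simp add: is_Cannon_Thurston_map_def ext_map_def[abs_def] o_def)

lemma ext_map_H2: "z \<in> H2 \<Longrightarrow> ext_map (Some z) = ballmap (F z)"
  by (simp add: ext_map_def extend_by_def Let_def H2_Im ballmap_opt_def)

lemma ext_map_bd: "Im z \<le> 0 \<Longrightarrow> ext_map (Some z) = bdpt (f (Some (Re z)))" "ext_map None = bdpt (f None)"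
  by (simp_all add: ext_map_def extend_by_def Let_def bdpt_def)

sublocale R2: bdry_rep \<Gamma> \<rho> F f
proof unfold_locales
  have hom: "\<rho> \<in> hom (PSL2\<lparr>carrier := \<Gamma>\<rparr>) PSL2" using hol by (simp add: is_holonomy_def)
  show "\<rho> \<gamma> \<in> carrier PSL2" if "\<gamma> \<in> \<Gamma>" for \<gamma> using hom that by (auto simp: hom_def)
  show "\<rho> (\<gamma> \<otimes>\<^bsub>PSL2\<^esub> \<delta>) = \<rho> \<gamma> \<otimes>\<^bsub>PSL2\<^esub> \<rho> \<delta>" if "\<gamma> \<in> \<Gamma>" "\<delta> \<in> \<Gamma>" for \<gamma> \<delta> using hom that by (auto simp: hom_def)
  show "snd (F z) > 0" if "z \<in> H2" for z using F_H3[OF that] by (simp add: H3_snd)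
  show "F (act_H2 \<gamma> z) = act_H3 (\<rho> \<gamma>) (F z)" if "\<gamma> \<in> \<Gamma>" "z \<in> H2" for \<gamma> z using F_act that .
  show "f (act_bdry \<gamma> \<xi>) = act_bdry (\<rho> \<gamma>) (f \<xi>)" if "\<gamma> \<in> \<Gamma>" for \<gamma> \<xi> using ct that by (simp add: is_Cannon_Thurston_map_def)
  show "continuous_map bdry_top bdry_top f" using ct by (simp add: is_Cannon_Thurston_map_def)
  show "((\<lambda>z. ballmap (F z)) \<longlongrightarrow> bdpt (f (Some x))) (at (of_real x) within H2)" for x
  proof -
    have "continuous_map (top_of_set {z. 0 \<le> Im z}) euclidean (ext_map \<circ> Some)"
      by (rule continuous_map_compose[OF continuous_map_Some]) (use ext_map_cont in \<open>simp add: H2_bar_def\<close>)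
    then have "continuous_on {z. 0 \<le> Im z} (\<lambda>z. ext_map (Some z))" by (simp add: o_def)
    then have "((\<lambda>z. ext_map (Some z)) \<longlongrightarrow> ext_map (Some (of_real x))) (at (of_real x) within {z. 0 \<le> Im z})"
      by (simp add: continuous_on_def)
    then have "((\<lambda>z. ext_map (Some z)) \<longlongrightarrow> ext_map (Some (of_real x))) (at (of_real x) within H2)"
      by (rule tendsto_within_subset) (auto simp: H2_Im)
    then have "((\<lambda>z. ext_map (Some z)) \<longlongrightarrow> bdpt (f (Some x))) (at (of_real x) within H2)" by (simp add: ext_map_bd)
    moreover have "\<forall>\<^sub>F z in at (of_real x) within H2. ext_map (Some z) = ballmap (F z)"
      by (auto simp: eventually_at_filter ext_map_H2)
    ultimately show ?thesis by (rule Lim_transform_eventually)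
  qed
qed

text \<open>The image of the compactified half-plane in the closed ball. Being compact, and meeting
  the sphere only in the range of \<open>f\<close> by \<open>img_sphere\<close>, it shows that
  limits of \<open>F\<close> on the sphere are values of \<open>f\<close>.\<close>

definition "img \<equiv> ext_map ` topspace H2_bar"

lemma img_compact: "compact img"
proof -
  have "compactin H2_bar (topspace H2_bar)" using compact_space_def compact_space_Alexandroff_compactification unfolding H2_bar_def by blast
  then show ?thesis unfolding img_def using image_compactin[OF _ ext_map_cont] by simp
qed

lemma img_F: "z \<in> H2 \<Longrightarrow> ballmap (F z) \<in> img"
  unfolding img_def H2_bar_def by (rule image_eqI[of _ _ "Some z"]) (auto simp: ext_map_H2 H2_Im)

lemma img_cases: "X \<in> img \<Longrightarrow> (\<exists>z\<in>H2. X = ballmap (F z)) \<or> (\<exists>\<xi>. X = bdpt (f \<xi>))"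
proof -
  assume "X \<in> img"
  then obtain x where x: "X = ext_map x" "x \<in> topspace H2_bar" by (auto simp: img_def)
  show ?thesis
  proof (cases x)
    case None
    then show ?thesis using x ext_map_bd by auto
  next
    case (Some z)
    then show ?thesis using x ext_map_bd(1)[of z] ext_map_H2[of z] by (cases "Im z > 0") (auto simp: H2_Im)
  qed
qed

lemma img_sphere: "bdpt \<omega> \<in> img \<Longrightarrow> \<omega> \<in> range f"
proof -
  assume "bdpt \<omega> \<in> img"
  then consider z where "z \<in> H2" "bdpt \<omega> = ballmap (F z)" | \<xi> where "bdpt \<omega> = bdpt (f \<xi>)" using img_cases by blast
  then show ?thesis
  proof cases
    case 1
    then show ?thesis using norm_ballmap_less[OF R2.Phi_pos[OF 1(1)]] norm_bdpt[of \<omega>] by simp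
  next
    case 2
    then show ?thesis by (simp add: bdpt_inj)
  qed
qed

text \<open>Read off from the definition of \<open>generic\<close> at any generic point, with
  \<open>\<zeta> + 1\<close> as auxiliary first target.\<close>

lemma escape: "\<exists>g. (\<forall>n. g n \<in> \<Gamma>) \<and> (\<lambda>n. act_H2 (g n) \<i>) \<longlonglongrightarrow> complex_of_real \<zeta>"
proof -
  obtain x where x: "generic \<Gamma> x" using ex_generic[of 0 1] by auto
  have "\<exists>g\<in>\<Gamma>. act_H2 g \<i> \<in> ball (of_real \<zeta>) (1 / real (Suc n))" for n
  proof -
    have "x \<notin> bad_set \<Gamma> (\<zeta> + 1) \<zeta> (1 / real (Suc n))" using x unfolding generic_def by auto
    then show ?thesis unfolding bad_set_def by auto
  qed
  then obtain g where g: "\<And>n. g n \<in> \<Gamma> \<and> act_H2 (g n) \<i> \<in> ball (complex_of_real \<zeta>) (1 / real (Suc n))"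
    using choice[of "\<lambda>n g. g \<in> \<Gamma> \<and> act_H2 g \<i> \<in> ball (complex_of_real \<zeta>) (1 / real (Suc n))"] by blast
  have "(\<lambda>n. dist (act_H2 (g n) \<i>) (of_real \<zeta>)) \<longlonglongrightarrow> 0"
  proof (rule tendsto_sandwich[OF _ _ tendsto_const LIMSEQ_Suc[OF lim_1_over_n]])
    show "\<forall>\<^sub>F n in sequentially. dist (act_H2 (g n) \<i>) (of_real \<zeta>) \<le> 1 / of_nat (Suc n)"
      using g by (intro always_eventually) (auto simp: dist_commute less_imp_le)
  qed simp
  then have "(\<lambda>n. act_H2 (g n) \<i>) \<longlonglongrightarrow> of_real \<zeta>" by (rule tendsto_dist_iff[THEN iffD2])
  then show ?thesis using g by blast
qed

end

section \<open>The Cannon-Thurston map is not injective\<close>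

text \<open>A continuous bijection would be a homeomorphism from the circle to the sphere, but
  removing two points disconnects the circle and not the sphere.\<close>

lemma not_injective_onto_sphere:
  fixes f :: "real option \<Rightarrow> complex option"
  assumes "continuous_map bdry_top bdry_top f" "surj f"
  shows "\<not> inj f"
proof
  assume inj: "inj f"
  have Haus: "Hausdorff_space (bdry_top :: complex option topology)"
    by (rule Hausdorff_space_injective_preimage[OF _ continuous_bdpt]) (auto intro!: inj_onI simp: bdpt_inj)
  have hom: "homeomorphic_map bdry_top bdry_top f"
    by (rule continuous_imp_homeomorphic_map[OF assms(1) compact_space_bdry_top Haus])
       (use assms(2) inj in auto)
  define D where "D = UNIV - {f None, f (Some 0)}"
  define P where "P = {w. Some w \<in> {f None, f (Some 0)}}"
  have "P \<subseteq> the ` {f None, f (Some 0)}"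
  proof
    fix x assume "x \<in> P"
    then have "the (Some x) \<in> the ` {f None, f (Some 0)}" unfolding P_def by (intro imageI) simp
    then show "x \<in> the ` {f None, f (Some 0)}" by simp
  qed
  then have finP: "finite P" by (rule finite_subset) simp
  have conP: "connected (- P)"
    using path_connected_complement_countable[of P] finP by (simp add: countable_finite path_connected_imp_connected)
  have "continuous_map euclidean bdry_top (Some :: complex \<Rightarrow> _)" unfolding bdry_top_def by (rule continuous_map_Some)
  then have conS: "connectedin bdry_top (Some ` (- P))"
    by (rule connectedin_continuous_map_image) (simp add: conP)
  \<comment> \<open>Infinity may or may not belong to \<open>D\<close>. Placing \<open>D\<close>
    between a connected subset of the plane and its closure settles both cases.\<close>
  have conD: "connectedin bdry_top D"
  proof (rule connectedin_intermediate_closure_of[OF conS])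
    show "Some ` (- P) \<subseteq> D" by (auto simp: P_def D_def)
    show "D \<subseteq> bdry_top closure_of Some ` (- P)"
    proof
      fix x assume x: "x \<in> D"
      show "x \<in> bdry_top closure_of Some ` (- P)"
        unfolding in_closure_of
      proof (intro conjI allI impI)
        fix T assume T: "x \<in> T \<and> openin bdry_top T"
        show "\<exists>y. y \<in> Some ` (- P) \<and> y \<in> T"
        proof (cases x)
          case (Some w)
          then show ?thesis using x T by (intro exI[of _ x]) (auto simp: P_def D_def)
        next
          case None
          then obtain C where C: "compact C" "T = insert None (Some ` (UNIV - C))"
            using T unfolding bdry_top_def openin_Alexandroff_compactification by auto
          have "bounded (C \<union> P)" using C(1) finP by (simp add: compact_imp_bounded finite_imp_bounded)
          then have "C \<union> P \<noteq> UNIV" using not_bounded_UNIV by metis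
          then obtain w where "w \<notin> C \<union> P" by blast
          then show ?thesis using C(2) by (intro exI[of _ "Some w"]) auto
        qed
      qed simp
    qed
  qed
  have opmap: "openin bdry_top (f ` V)" if "openin bdry_top V" for V
    using homeomorphic_imp_open_map[OF hom] that by (simp add: open_map_def)
  have op: "openin bdry_top (f ` Some ` {0<..})" "openin bdry_top (f ` Some ` {..<0})"
    by (intro opmap; simp add: bdry_top_def)+
  have "D \<subseteq> f ` Some ` {0<..} \<union> f ` Some ` {..<0}"
  proof
    fix y assume y: "y \<in> D"
    obtain \<xi> where \<xi>: "y = f \<xi>" using assms(2) by blast
    obtain x where "\<xi> = Some x" "x \<noteq> 0" using y \<xi> by (cases \<xi>) (auto simp: D_def)
    then show "y \<in> f ` Some ` {0<..} \<union> f ` Some ` {..<0}" using \<xi> by (cases "x > 0") auto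
  qed
  moreover have "f ` Some ` {0<..} \<inter> f ` Some ` {..<0} \<inter> D = {}" using inj by (auto dest: injD)
  moreover have "f (Some 1) \<in> f ` Some ` {0<..} \<inter> D" "f (Some (-1)) \<in> f ` Some ` {..<0} \<inter> D"
    using inj by (auto simp: D_def dest: injD)
  ultimately show False using conD op unfolding connectedin by blast
qed

lemma inverse_square_tendsto_0: "(\<lambda>n. 1 / (1 + (real n)\<^sup>2)) \<longlonglongrightarrow> 0"
proof (rule tendsto_sandwich[OF _ _ tendsto_const LIMSEQ_Suc[OF lim_1_over_n]])
  have "1 / (1 + (real n)\<^sup>2) \<le> 1 / real (Suc n)" if "n \<ge> 1" for n
  proof -
    have "real n * 1 \<le> real n * real n" using that by (intro mult_left_mono) auto
    then show ?thesis by (intro frac_le) (simp_all add: power2_eq_square)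
  qed
  then show "\<forall>\<^sub>F n in sequentially. 1 / (1 + (real n)\<^sup>2) \<le> 1 / real (Suc n)"
    by (auto simp: eventually_sequentially intro!: exI[of _ 1])
qed simp

section \<open>Surjectivity of the Cannon-Thurston map\<close>

context ct_setting
begin

lemma f_const_reals: "(\<And>x. f (Some x) = c) \<Longrightarrow> f \<xi> = c"
proof (cases \<xi>)
  case None
  assume c: "\<And>x. f (Some x) = c"
  have "continuous_map bdry_top euclidean (\<lambda>\<xi>. bdpt (f \<xi>))"
    using continuous_map_compose[OF R2.psi_cont continuous_bdpt] by (simp add: o_def)
  moreover have "limitin bdry_top (\<lambda>n::nat. Some (real n)) None sequentially"
    unfolding limitin_bdry_real tendsto_bdpt_iff_chord
  proof -
    have "chord (inc_bd (Some (real n))) (inc_bd None) = 1 / (1 + (real n)\<^sup>2)" for n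
      by (simp add: chord_eq hn_def add.commute)
    moreover note inverse_square_tendsto_0
    ultimately show "(\<lambda>n. chord (inc_bd (Some (real n))) (inc_bd None)) \<longlonglongrightarrow> 0" by simp
  qed
  ultimately have "(\<lambda>n. bdpt (f (Some (real n)))) \<longlonglongrightarrow> bdpt (f None)"
    using continuous_map_limit[of bdry_top euclidean "\<lambda>\<xi>. bdpt (f \<xi>)"] by (simp add: o_def)
  then have "bdpt c = bdpt (f None)" using c by (simp add: LIMSEQ_const_iff)
  then show "f \<xi> = c" using None by (simp add: bdpt_inj)
qed simp

text \<open>Parabolic elements have arbitrarily small displacement, so \<open>\<Delta>\<close>, being cocompact, contains none.\<close>

lemma parabolic_small:
  fixes A :: "complex^2^2"
  assumes A: "det A = 1" "mobius_bdry A \<zeta> = \<zeta>" "sg A \<zeta> = 1" and e: "e > 0"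
  shows "\<exists>x\<in>H3. chC x (mobius_H3 A x) < e"
proof -
  define a b c d where s: "a = A$1$1" "b = A$1$2" "c = A$2$1" "d = A$2$2"
  have D: "a * d - b * c = 1" using A(1) by (simp add: det_2 s)
  obtain l where l: "l \<noteq> 0" "a * hx \<zeta> + b * hy \<zeta> = l * hx \<zeta>" "c * hx \<zeta> + d * hy \<zeta> = l * hy \<zeta>"
    using mobius_homog[OF A(1), of \<zeta>] A(2) unfolding s by metis
  have "sg A \<zeta> = (cmod l)\<^sup>2 * hn \<zeta> / hn \<zeta>" by (rule sg_homog) (use l in \<open>simp_all add: s\<close>)
  then have "(cmod l)\<^sup>2 = 1" using A(3) hn_pos[of \<zeta>] by simp
  then have nl: "cmod l = 1" by (simp add: power2_eq_1_iff) (smt (verit) norm_ge_zero)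
  show ?thesis
  proof (cases \<zeta>)
    case None
    then have c0: "c = 0" and al: "a = l" using l by simp_all
    have nd: "cmod d = 1" using D c0 al nl by (metis diff_zero mult_cancel_right1 mult_zero_right norm_mult norm_one mult_1)
    \<comment> \<open>A point high above the origin is moved horizontally by \<open>cmod b\<close>,
      so \<open>chC\<close> is \<open>(cmod b)^2 / (2 * t^2)\<close>. Adding 1 makes the inequality
      strict and \<open>t\<close> positive.\<close>
    define t where "t = sqrt ((cmod b)\<^sup>2 / (2 * e)) + 1"
    have t: "t > 0" unfolding t_def by (intro add_nonneg_pos) (use e in auto)
    have M: "mobius_H3 A (0, t) = (b * cnj d, t)"
      by (simp add: mobius_H3_def Let_def c0 nd flip: s)
    have "sqrt ((cmod b)\<^sup>2 / (2 * e)) < t" by (simp add: t_def)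
    then have "(sqrt ((cmod b)\<^sup>2 / (2 * e)))\<^sup>2 < t\<^sup>2" by (intro power_strict_mono) (use e in auto)
    then have "(cmod b)\<^sup>2 / (2 * e) < t\<^sup>2" using e by simp
    then have "(cmod b)\<^sup>2 < 2 * e * t\<^sup>2" using e by (simp add: divide_less_eq mult_ac)
    then have "chC (0, t) (mobius_H3 A (0, t)) < e"
      using t unfolding M by (simp add: chC_def norm_mult nd divide_less_eq power2_eq_square mult_ac)
    then show ?thesis using t by (intro bexI[of _ "(0, t)"]) (auto simp: H3_snd)
  next
    case (Some z)
    have w: "c * z + d = l" "a * z + b = l * z" using l Some by simp_all
    have "(a - c * z) * l = 1" using D w by algebra
    then have nac: "cmod (a - c * z) = 1" using nl by (metis mult.right_neutral norm_mult norm_one)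
    define k where "k = (cmod c)\<^sup>2"
    have k: "k \<ge> 0" by (simp add: k_def)
    \<comment> \<open>Close to the finite fixed point \<open>chC\<close> is at most
      \<open>(k * t^2 + (k * t^2)^2) / 2\<close>; the bound by 1 reduces the fourth power of
      \<open>t\<close> to the second.\<close>
    define t where "t = sqrt (min 1 (e / (1 + k\<^sup>2 + k)))"
    have kk: "1 + k\<^sup>2 + k > 0" using k by (simp add: add_pos_nonneg)
    have t: "t > 0" "t\<^sup>2 \<le> 1" "t\<^sup>2 \<le> e / (1 + k\<^sup>2 + k)" using e kk by (simp_all add: t_def)
    define q where "q = 1 + k * t\<^sup>2"
    have q: "q \<ge> 1" using k by (simp add: q_def)
    have M: "mobius_H3 A (z, t) = ((l * z * cnj l + a * cnj c * of_real (t\<^sup>2)) / of_real q, t / q)"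
      by (simp add: mobius_H3_def Let_def w nl q_def k_def del: complex_cnj_add complex_cnj_mult flip: s)
    have ll: "l * cnj l = 1" using nl by (simp add: complex_norm_square[symmetric])
    have qc: "of_real q = 1 + c * cnj c * of_real (t\<^sup>2)" unfolding q_def k_def of_real_add of_real_mult complex_norm_square by simp
    have q0: "of_real q \<noteq> (0::complex)" using q by auto
    have "z - fst (mobius_H3 A (z, t)) = (z * of_real q - (l * cnj l * z + a * cnj c * of_real (t\<^sup>2))) / of_real q"
      unfolding M using q0 by (simp add: diff_divide_distrib mult_ac)
    also have "z * of_real q - (l * cnj l * z + a * cnj c * of_real (t\<^sup>2)) = - (cnj c * of_real (t\<^sup>2) * (a - c * z))"
      unfolding ll qc by (simp add: algebra_simps)
    finally have "cmod (z - fst (mobius_H3 A (z, t))) = cmod c * t\<^sup>2 / q"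
      using nac q by (simp add: norm_divide norm_mult norm_power)
    then have n1: "(cmod (z - fst (mobius_H3 A (z, t))))\<^sup>2 = k * t\<^sup>2 * t\<^sup>2 / q\<^sup>2"
      by (simp add: power_divide power_mult_distrib k_def power2_eq_square)
    have n2: "(t - t / q)\<^sup>2 = t\<^sup>2 * (k * t\<^sup>2)\<^sup>2 / q\<^sup>2"
    proof -
      have "t - t / q = t * (k * t\<^sup>2) / q" using q by (simp add: q_def field_simps)
      then show ?thesis by (simp add: power_divide power_mult_distrib)
    qed
    have "chC (z, t) (mobius_H3 A (z, t)) = (k * t\<^sup>2 * t\<^sup>2 / q\<^sup>2 + t\<^sup>2 * (k * t\<^sup>2)\<^sup>2 / q\<^sup>2) / (2 * t * (t / q))"
      unfolding chC_def fst_conv snd_conv n1 using n2 by (simp add: M)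
    also have "\<dots> = (k * t\<^sup>2 + (k * t\<^sup>2)\<^sup>2) / (2 * q)"
      using t q by (simp add: field_simps power2_eq_square)
    also have "\<dots> \<le> (k * t\<^sup>2 + (k * t\<^sup>2)\<^sup>2) / 2"
      using k q by (intro divide_left_mono) auto
    also have "(k * t\<^sup>2)\<^sup>2 \<le> k\<^sup>2 * t\<^sup>2"
    proof -
      have "(k * t\<^sup>2)\<^sup>2 = k\<^sup>2 * t\<^sup>2 * t\<^sup>2" by (simp add: power2_eq_square)
      also have "\<dots> \<le> k\<^sup>2 * t\<^sup>2 * 1" using t by (intro mult_left_mono) auto
      finally show ?thesis by simp
    qed
    then have "(k * t\<^sup>2 + (k * t\<^sup>2)\<^sup>2) / 2 \<le> ((k + k\<^sup>2) * t\<^sup>2) / 2" by (simp add: algebra_simps)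
    also have "\<dots> \<le> ((1 + k\<^sup>2 + k) * t\<^sup>2) / 2" by (simp add: algebra_simps)
    also have "\<dots> \<le> e / 2" using t(3) kk by (simp add: pos_le_divide_eq mult.commute)
    finally have "chC (z, t) (mobius_H3 A (z, t)) < e" using e by simp
    then show ?thesis using t by (intro bexI[of _ "(z, t)"]) (auto simp: H3_snd)
  qed
qed

text \<open>A constant value would be fixed by all \<open>\<rho> \<gamma>\<close>. If all factors
  there are 1, each \<open>\<rho> \<gamma>\<close> has arbitrarily small displacement and is trivial
  on \<open>H3\<close>, although some \<open>\<gamma>\<close> moves \<open>F \<i>\<close>. Otherwise
  some element has a second fixed point, and its powers, or those of its inverse, carry
  \<open>F \<i>\<close> towards it, so it is another value of \<open>f\<close>.\<close>

lemma f_nonconstant: "\<exists>x y. f (Some x) \<noteq> f (Some y)"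
proof (rule ccontr)
  assume "\<not> ?thesis"
  then have "\<And>x. f (Some x) = f (Some 0)" by blast
  then have cst: "\<And>\<xi>. f \<xi> = f (Some 0)" using f_const_reals by blast
  define \<zeta> where "\<zeta> = f (Some 0)"
  have cst: "f \<xi> = \<zeta>" for \<xi> using cst \<zeta>_def by simp
  have fixed: "act_bdry (\<rho> \<gamma>) \<zeta> = \<zeta>" if "\<gamma> \<in> \<Gamma>" for \<gamma>
    using R2.psi_act[OF that, of None] cst by simp
  have rc: "\<rho> \<gamma> \<in> carrier PSL2" if "\<gamma> \<in> \<Gamma>" for \<gamma> using that by simp
  show False
  proof (cases "\<forall>\<gamma>\<in>\<Gamma>. sgp (\<rho> \<gamma>) \<zeta> = 1")
    case True
    obtain g where g: "\<And>n. g n \<in> \<Gamma>" "(\<lambda>n. act_H2 (g n) \<i>) \<longlonglongrightarrow> complex_of_real 0" using escape[of 0] by blast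
    have "(\<lambda>n. hgt (F (act_H2 (g n) \<i>))) \<longlonglongrightarrow> 0" by (rule R2.hgt_tendsto_0(2)[OF g(2)]) (use g(1) in simp)
    moreover have "hgt (F \<i>) > 0" using R2.Phi_pos[OF R2.i_H2] by (rule hgt_pos)
    ultimately have "\<forall>\<^sub>F n in sequentially. hgt (F (act_H2 (g n) \<i>)) < hgt (F \<i>)" by (rule order_tendstoD)
    then obtain n where n: "hgt (F (act_H2 (g n) \<i>)) < hgt (F \<i>)" by (meson eventually_sequentially order_refl)
    let ?\<gamma> = "g n"
    have ne: "F (act_H2 ?\<gamma> \<i>) \<noteq> F \<i>" using n by auto
    obtain \<delta> where d: "\<delta> \<in> \<Delta>" "\<forall>x\<in>H3. \<delta> x = act_H3 (\<rho> ?\<gamma>) x" using rho_Delta[OF g(1)[of n]] by (elim bexE)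
    obtain e where e: "e > 0" "\<forall>x\<in>H3. \<forall>y\<in>H3. \<forall>\<delta>\<in>\<Delta>. chC x y < e \<and> chC x (\<delta> y) < e \<longrightarrow> \<delta> y = y"
      using injectivity by (elim exE conjE)
    let ?A = "rep (\<rho> ?\<gamma>)"
    have A: "det ?A = 1" "mobius_bdry ?A \<zeta> = \<zeta>" "sg ?A \<zeta> = 1"
      using rep_spec(1)[OF rc[OF g(1)[of n]]] fixed[OF g(1)[of n]] True g(1)[of n] by (simp_all add: act_bdry_rep sgp_def)
    obtain x where x: "x \<in> H3" "chC x (mobius_H3 ?A x) < e" using parabolic_small[OF A e(1)] by blast
    have dx: "\<delta> x = mobius_H3 ?A x" using d(2)[rule_format, OF x(1)] act_H3_rep[OF rc[OF g(1)[of n]]] by simp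
    have "\<delta> x = x" using e(2)[rule_format, OF x(1) x(1) d(1)] x(2) e(1) dx by (simp add: chC_self)
    then have "\<delta> (F \<i>) = F \<i>" by (rule free[OF d(1) x(1) _ F_H3[OF R2.i_H2]])
    moreover have "\<delta> (F \<i>) = F (act_H2 ?\<gamma> \<i>)" using d(2)[rule_format, OF F_H3[OF R2.i_H2]] F_act[OF g(1)[of n] R2.i_H2] by simp
    ultimately show False using ne by simp
  next
    case False
    then obtain \<gamma> where g: "\<gamma> \<in> \<Gamma>" "sgp (\<rho> \<gamma>) \<zeta> \<noteq> 1" by blast
    let ?A = "rep (\<rho> \<gamma>)"
    have dA: "det ?A = 1" using rep_spec(1)[OF rc[OF g(1)]] .
    have fA: "mobius_bdry ?A \<zeta> = \<zeta>" using fixed[OF g(1)] rc[OF g(1)] by (simp add: act_bdry_rep)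
    obtain l where l: "l \<noteq> 0" "?A$1$1 * hx \<zeta> + ?A$1$2 * hy \<zeta> = l * hx \<zeta>" "?A$2$1 * hx \<zeta> + ?A$2$2 * hy \<zeta> = l * hy \<zeta>"
      using mobius_homog[OF dA, of \<zeta>] fA by metis
    have "sg ?A \<zeta> = (cmod l)\<^sup>2 * hn \<zeta> / hn \<zeta>" by (rule sg_homog) (use l in simp_all)
    then have "(cmod l)\<^sup>2 \<noteq> 1" using g(2) hn_pos[of \<zeta>] by (simp add: sgp_def)
    then have "l\<^sup>2 \<noteq> 1" by (metis norm_one norm_power)
    from second_fixed_point[OF dA l(2,3) this] obtain \<zeta>' where z': "\<zeta>' \<noteq> \<zeta>" "mobius_bdry ?A \<zeta>' = \<zeta>'" by blast
    have fx': "act_bdry (\<rho> \<gamma>) \<zeta>' = \<zeta>'" using z'(2) rc[OF g(1)] by (simp add: act_bdry_rep)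
    have "chord \<zeta> \<zeta>' * sgp (\<rho> \<gamma>) \<zeta> * sgp (\<rho> \<gamma>) \<zeta>' = chord \<zeta> \<zeta>'"
      using chord_act[OF rc[OF g(1)], of \<zeta> \<zeta>'] fixed[OF g(1)] fx' by simp
    moreover have "chord \<zeta> \<zeta>' \<noteq> 0" using z'(1) by (simp add: chord_eq_0)
    ultimately have "sgp (\<rho> \<gamma>) \<zeta> * sgp (\<rho> \<gamma>) \<zeta>' = 1" by (simp add: mult.assoc)
    then have ne1: "sgp (\<rho> \<gamma>) \<zeta>' \<noteq> 1" using g(2) by auto
    have "\<exists>\<kappa>\<in>\<Gamma>. act_bdry (\<rho> \<kappa>) \<zeta>' = \<zeta>' \<and> sgp (\<rho> \<kappa>) \<zeta>' > 1"
    proof (cases "sgp (\<rho> \<gamma>) \<zeta>' > 1")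
      case True
      then show ?thesis using g(1) fx' by blast
    next
      case False
      let ?i = "inv\<^bsub>PSL2\<^esub> \<gamma>"
      have i: "?i \<in> \<Gamma>" using g(1) by simp
      have one: "\<rho> ?i \<otimes>\<^bsub>PSL2\<^esub> \<rho> \<gamma> = \<one>\<^bsub>PSL2\<^esub>" using R2.r_mult[OF i g(1)] R2.r_one g(1) by (simp add: PSL2.l_inv)
      have "act_bdry (\<rho> ?i) (act_bdry (\<rho> \<gamma>) \<zeta>') = \<zeta>'"
        using act_bdry_mult[OF rc[OF i] rc[OF g(1)], of \<zeta>'] one by (simp add: act_one)
      then have "act_bdry (\<rho> ?i) \<zeta>' = \<zeta>'" using fx' by simp
      moreover have "sgp (\<rho> ?i) \<zeta>' * sgp (\<rho> \<gamma>) \<zeta>' = 1"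
        using sgp_mult[OF rc[OF i] rc[OF g(1)], of \<zeta>'] one fx' by (simp add: sgp_one)
      moreover have "0 < sgp (\<rho> \<gamma>) \<zeta>'" "sgp (\<rho> \<gamma>) \<zeta>' < 1" using False ne1 sgp_pos[OF rc[OF g(1)]] by auto
      ultimately show ?thesis using i
        by (intro bexI[of _ ?i] conjI) (auto simp: nonzero_eq_divide_eq[symmetric])
    qed
    then obtain \<kappa> where k: "\<kappa> \<in> \<Gamma>" "act_bdry (\<rho> \<kappa>) \<zeta>' = \<zeta>'" "sgp (\<rho> \<kappa>) \<zeta>' > 1" by blast
    \<comment> \<open>Iterating \<open>\<kappa>\<close> divides \<open>poisson\<close> at
      \<open>\<zeta>'\<close> by a number above 1 each time, which drives the points of
      \<open>F\<close> to \<open>\<zeta>'\<close>.\<close>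
    define z where "z n = (act_H2 \<kappa> ^^ n) \<i>" for n :: nat
    have zH: "z n \<in> H2" for n unfolding z_def by (induction n) (use k(1) in auto)
    let ?s = "sgp (\<rho> \<kappa>) \<zeta>'"
    have P: "poisson (F (z n)) \<zeta>' * ?s ^ n = poisson (F \<i>) \<zeta>'" for n
    proof (induction n)
      case (Suc n)
      have "poisson (F (z (Suc n))) \<zeta>' * ?s = poisson (F (z n)) \<zeta>'"
        using poisson_act[OF rc[OF k(1)] R2.Phi_pos[OF zH], of n \<zeta>'] F_act[OF k(1) zH] k(2) by (simp add: z_def)
      then have "poisson (F (z (Suc n))) \<zeta>' * ?s ^ Suc n = poisson (F (z n)) \<zeta>' * ?s ^ n"
        by (simp add: mult.assoc[symmetric])
      then show ?case using Suc by simp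
    qed (simp add: z_def)
    have "poisson (F (z n)) \<zeta>' = poisson (F \<i>) \<zeta>' * (1 / ?s) ^ n" for n
      using P[of n] k(3) by (simp add: field_simps)
    moreover have "(\<lambda>n. poisson (F \<i>) \<zeta>' * (1 / ?s) ^ n) \<longlonglongrightarrow> poisson (F \<i>) \<zeta>' * 0"
      using k(3) by (intro tendsto_intros LIMSEQ_power_zero) auto
    ultimately have pl: "(\<lambda>n. poisson (F (z n)) \<zeta>') \<longlonglongrightarrow> 0" by simp
    have nn: "0 \<le> 1 - ballmap (F (z n)) \<bullet> bdpt \<zeta>'" for n
      using inner_le_1[OF norm_ballmap_le[of "F (z n)"], of "bdpt \<zeta>'"] by (simp add: norm_bdpt)
    have "(\<lambda>n. 1 - ballmap (F (z n)) \<bullet> bdpt \<zeta>') \<longlonglongrightarrow> 0"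
      by (rule tendsto_sandwich[OF _ _ tendsto_const pl])
         (intro always_eventually allI nn poisson_tendsto_bound[OF R2.Phi_pos[OF zH]])+
    then have lim: "(\<lambda>n. ballmap (F (z n))) \<longlonglongrightarrow> bdpt \<zeta>'"
      by (rule tendsto_of_inner[rotated 2]) (simp_all add: norm_ballmap_le norm_bdpt)
    have "closed img" using img_compact by (rule compact_imp_closed)
    then have "bdpt \<zeta>' \<in> img" by (rule closed_sequentially[OF _ _ lim]) (use img_F zH in auto)
    then have "\<zeta>' \<in> range f" by (rule img_sphere)
    then show False using cst z'(1) by auto
  qed
qed

lemma chC_rho:
  assumes "\<gamma> \<in> \<Gamma>" "x \<in> H3" "y \<in> H3"
  shows "chC (act_H3 (\<rho> \<gamma>) x) (act_H3 (\<rho> \<gamma>) y) = chC x y" "act_H3 (\<rho> \<gamma>) x \<in> H3"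
proof -
  obtain \<delta> where d: "\<delta> \<in> \<Delta>" "\<forall>x\<in>H3. \<delta> x = act_H3 (\<rho> \<gamma>) x" using rho_Delta[OF assms(1)] by (elim bexE)
  show "chC (act_H3 (\<rho> \<gamma>) x) (act_H3 (\<rho> \<gamma>) y) = chC x y"
    using chC_inv[OF d(1) assms(2,3)] d(2) assms(2,3) by simp
  show "act_H3 (\<rho> \<gamma>) x \<in> H3" using maps[OF d(1) assms(2)] d(2) assms(2) by simp
qed

text \<open>The orbits of \<open>y\<close> and \<open>F \<i>\<close> stay at constant hyperbolic
  distance, while the heights along the second tend to 0; so their distance in the ball tends to
  0.\<close>

lemma orbit_converges:
  assumes g: "\<And>n. g n \<in> \<Gamma>" "(\<lambda>n. act_H2 (g n) \<i>) \<longlonglongrightarrow> complex_of_real x" and y: "y \<in> H3"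
  shows "(\<lambda>n. ballmap (act_H3 (\<rho> (g n)) y)) \<longlonglongrightarrow> bdpt (f (Some x))"
proof -
  let ?s = "\<lambda>n. act_H3 (\<rho> (g n)) y" and ?t = "\<lambda>n. F (act_H2 (g n) \<i>)"
  have H: "act_H2 (g n) \<i> \<in> H2" for n using g(1) by simp
  have X: "(\<lambda>n. ballmap (?t n)) \<longlonglongrightarrow> bdpt (f (Some x))" and h: "(\<lambda>n. hgt (?t n)) \<longlonglongrightarrow> 0"
    using R2.hgt_tendsto_0[OF g(2) H] by auto
  define B where "B = 1 + chC y (F \<i>)"
  have B: "B \<ge> 0" using chC_nonneg[OF y F_H3[OF R2.i_H2]] by (simp add: B_def)
  have eq: "1 - ballmap (?s n) \<bullet> ballmap (?t n) = 4 * hgt (?s n) * hgt (?t n) * B" for n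
  proof -
    have "?t n = act_H3 (\<rho> (g n)) (F \<i>)" using F_act[OF g(1) R2.i_H2] .
    moreover have "snd (?s n) > 0" using chC_rho(2)[OF g(1) y y] by (simp add: H3_snd)
    ultimately show ?thesis
      using inner_ballmap_chC[of "?s n" "?t n"] R2.Phi_pos[OF H, of n] chC_rho(1)[OF g(1) y F_H3[OF R2.i_H2]] by (simp add: B_def)
  qed
  have spos: "hgt (?s n) > 0" for n using chC_rho(2)[OF g(1) y y] by (intro hgt_pos) (simp add: H3_snd)
  have tpos: "hgt (?t n) > 0" for n using R2.Phi_pos[OF H] by (intro hgt_pos)
  have "1 - ballmap (?s n) \<bullet> ballmap (?t n) \<le> 2 * hgt (?t n) * B" for n
  proof -
    have "4 * hgt (?s n) * hgt (?t n) \<le> 4 * (1/2) * hgt (?t n)"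
      by (intro mult_right_mono mult_left_mono hgt_le less_imp_le[OF tpos]) simp
    then have "4 * hgt (?s n) * hgt (?t n) \<le> 2 * hgt (?t n)" by simp
    from mult_right_mono[OF this B] have "4 * hgt (?s n) * hgt (?t n) * B \<le> 2 * hgt (?t n) * B" .
    then show ?thesis unfolding eq .
  qed
  then have le: "(dist (ballmap (?s n)) (ballmap (?t n)))\<^sup>2 \<le> 2 * (2 * hgt (?t n) * B)" for n
    using dist_le_inner[OF norm_ballmap_le norm_ballmap_le, of "?s n" "?t n"] by (smt (verit))
  have "(\<lambda>n. 2 * (2 * hgt (?t n) * B)) \<longlonglongrightarrow> 2 * (2 * 0 * B)" by (intro tendsto_intros h)
  then have "(\<lambda>n. 2 * (2 * hgt (?t n) * B)) \<longlonglongrightarrow> 0" by simp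
  then have "(\<lambda>n. (dist (ballmap (?s n)) (ballmap (?t n)))\<^sup>2) \<longlonglongrightarrow> 0"
    by (rule tendsto_sandwich[OF _ _ tendsto_const, rotated 2]) (use le in auto)
  then have "(\<lambda>n. sqrt ((dist (ballmap (?s n)) (ballmap (?t n)))\<^sup>2)) \<longlonglongrightarrow> sqrt 0" by (rule tendsto_real_sqrt)
  then have "(\<lambda>n. dist (ballmap (?s n)) (ballmap (?t n))) \<longlonglongrightarrow> 0" by simp
  then have "(\<lambda>n. dist (ballmap (?s n)) (ballmap (?t n)) + dist (ballmap (?t n)) (bdpt (f (Some x)))) \<longlonglongrightarrow> 0 + 0"
    by (rule tendsto_add[OF _ iffD1[OF tendsto_dist_iff X]])
  then have z: "(\<lambda>n. dist (ballmap (?s n)) (ballmap (?t n)) + dist (ballmap (?t n)) (bdpt (f (Some x)))) \<longlonglongrightarrow> 0" by simp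
  show ?thesis
    by (rule iffD2[OF tendsto_dist_iff], rule tendsto_sandwich[OF _ _ tendsto_const z]) (simp_all add: dist_triangle)
qed

text \<open>If a point is missed by \<open>f\<close>, then it is seen from \<open>F ` H2\<close> at a positive chordal distance. Pulling points \<open>y\<close> above it
  into the compact set \<open>K\<close> by some \<open>\<epsilon>\<close> in \<open>\<Delta>\<close> shrinks \<open>F ` H2\<close> to a set of chordal diameter \<open>O(hgt y)\<close>,
  while by normality \<open>\<epsilon> (F ` H2)\<close> accumulates on the whole range of \<open>f\<close>.\<close>

lemma some_in_range: "Some w \<in> range f"
proof (rule ccontr)
  assume nr: "Some w \<notin> range f"
  let ?b = "bdpt (Some w)"
  have nimg: "?b \<notin> img" using img_sphere nr by blast
  have nle: "norm X \<le> 1" if "X \<in> img" for X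
    using img_cases[OF that] by (auto simp: norm_ballmap_le norm_bdpt)
  \<comment> \<open>The factor 2 leaves the margin \<open>c\<close> when \<open>?b\<close> is
    replaced by a point of the ball within \<open>c\<close> of it.\<close>
  have "\<exists>c>0. \<forall>X\<in>img. 2 * c \<le> 1 - X \<bullet> ?b"
  proof -
    have ne: "img \<noteq> {}" using img_F[OF R2.i_H2] by blast
    have "continuous_on img (\<lambda>X. 1 - X \<bullet> ?b)" by (intro continuous_intros)
    then obtain X0 where X0: "X0 \<in> img" "\<And>X. X \<in> img \<Longrightarrow> 1 - X0 \<bullet> ?b \<le> 1 - X \<bullet> ?b"
      using continuous_attains_inf[OF img_compact ne] by metis
    have "X0 \<noteq> ?b" using X0 nimg by auto
    then have "0 < (dist X0 ?b)\<^sup>2" by simp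
    then have "0 < 2 * (1 - X0 \<bullet> ?b)"
      by (rule less_le_trans) (rule dist_le_inner[OF nle[OF X0(1)] eq_refl[OF norm_bdpt]])
    then have "0 < 1 - X0 \<bullet> ?b" by simp
    then show ?thesis using X0(2) by (intro exI[of _ "(1 - X0 \<bullet> ?b) / 2"]) auto
  qed
  then obtain c where c: "c > 0" "\<And>X. X \<in> img \<Longrightarrow> 2 * c \<le> 1 - X \<bullet> ?b" by blast
  obtain x x' where xx: "f (Some x) \<noteq> f (Some x')" using f_nonconstant by blast
  define q where "q = chord (f (Some x)) (f (Some x'))"
  have q: "q > 0" using xx by (simp add: q_def chord_pos)
  obtain K where K: "compact K" "K \<subseteq> H3" "\<forall>x\<in>H3. \<exists>\<delta>\<in>\<Delta>. \<exists>k\<in>K. x = \<delta> k" using H3_cocompact by (elim exE conjE)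
  have "\<exists>k0>0. \<forall>k\<in>K. k0 \<le> hgt k"
  proof (cases "K = {}")
    case False
    obtain k where k: "k \<in> K" "\<And>y. y \<in> K \<Longrightarrow> hgt k \<le> hgt y"
      using continuous_attains_inf[OF K(1) False hgt_continuous] by metis
    moreover have "hgt k > 0" using k K(2) by (intro hgt_pos) (auto simp: H3_snd)
    ultimately show ?thesis by blast
  qed (auto intro: exI[of _ 1])
  then obtain k0 where k0: "k0 > 0" "\<And>k. k \<in> K \<Longrightarrow> k0 \<le> hgt k" by blast
  \<comment> \<open>The left side does not depend on \<open>t\<close>, whereas
    \<open>hgt (w, t)\<close> tends to 0 with \<open>t\<close>; this is the final
    contradiction.\<close>
  have bound: "2 * q * k0\<^sup>2 * c\<^sup>2 \<le> 8 * (hgt (w, t))\<^sup>2" if t: "t > 0" "norm (ballmap (w, t) - ?b) < c" for t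
  proof -
    let ?y = "(w, t)"
    have y: "?y \<in> H3" using t by (simp add: H3_snd)
    obtain \<delta> k where d: "\<delta> \<in> \<Delta>" "k \<in> K" "?y = \<delta> k" using K(3) y by blast
    have kH: "k \<in> H3" using d K by blast
    obtain \<epsilon> where e: "\<epsilon> \<in> \<Delta>" "\<And>x. x \<in> H3 \<Longrightarrow> \<epsilon> (\<delta> x) = x \<and> \<delta> (\<epsilon> x) = x" using invD[OF d(1)] by blast
    have ey: "\<epsilon> ?y = k" using e(2)[OF kH] d(3) by simp
    let ?o = "\<epsilon> (F \<i>)"
    have oH: "?o \<in> H3" using maps[OF e(1) F_H3[OF R2.i_H2]] .
    have orb: "\<exists>z\<in>H2. act_H3 (\<rho> \<gamma>) ?o = \<epsilon> (F z)" if g: "\<gamma> \<in> \<Gamma>" for \<gamma>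
    proof -
      obtain \<gamma>' where g': "\<gamma>' \<in> \<Gamma>" "\<forall>x\<in>H3. act_H3 (\<rho> \<gamma>) (\<epsilon> x) = \<epsilon> (act_H3 (\<rho> \<gamma>') x)" using normality[OF e(1) g] ..
      have "act_H3 (\<rho> \<gamma>) ?o = \<epsilon> (F (act_H2 \<gamma>' \<i>))"
        using g'(2)[rule_format, OF F_H3[OF R2.i_H2]] F_act[OF g'(1) R2.i_H2] by simp
      then show ?thesis using R2.act_H2_in[OF g'(1) R2.i_H2] by blast
    qed
    have Xb: "c \<le> 1 - ballmap (F z) \<bullet> ballmap ?y" if z: "z \<in> H2" for z
    proof -
      have "\<bar>ballmap (F z) \<bullet> (ballmap ?y - ?b)\<bar> \<le> norm (ballmap (F z)) * norm (ballmap ?y - ?b)" by (rule Cauchy_Schwarz_ineq2)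
      also have "\<dots> \<le> 1 * norm (ballmap ?y - ?b)" by (intro mult_right_mono norm_ballmap_le) simp
      finally have "ballmap (F z) \<bullet> ballmap ?y - ballmap (F z) \<bullet> ?b < c" using t(2) by (simp add: inner_diff_right)
      then show ?thesis using c(2)[OF img_F[OF z]] by linarith
    qed
    \<comment> \<open>\<open>\<epsilon>\<close> preserves \<open>chC\<close>, so by
      \<open>inner_ballmap_chC\<close> the inner products before and after it differ only in the
      heights. Comparing \<open>F z\<close> and \<open>F z'\<close> with \<open>?y\<close>, and
      their images with \<open>k\<close>, eliminates the heights of the images and leaves the square
      of \<open>hgt ?y\<close>.\<close>
    have main: "(1 - ballmap (\<epsilon> (F z)) \<bullet> ballmap (\<epsilon> (F z'))) * k0\<^sup>2 * c\<^sup>2 \<le> 8 * (hgt ?y)\<^sup>2" if z: "z \<in> H2" "z' \<in> H2" for z z'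
    proof -
      have Fz: "F z \<in> H3" "F z' \<in> H3" using z by auto
      have eF: "\<epsilon> (F z) \<in> H3" "\<epsilon> (F z') \<in> H3" using maps[OF e(1) Fz(1)] maps[OF e(1) Fz(2)] .
      define b0 b1 b2 where b: "b0 = 1 + chC (F z) (F z')" "b1 = 1 + chC (F z) ?y" "b2 = 1 + chC (F z') ?y"
      define h1 h2 h h1' h2' hk where h: "h1 = hgt (F z)" "h2 = hgt (F z')" "h = hgt ?y" "h1' = hgt (\<epsilon> (F z))" "h2' = hgt (\<epsilon> (F z'))" "hk = hgt k"
      have sn: "snd (F z) > 0" "snd (F z') > 0" "snd ?y > 0" "snd (\<epsilon> (F z)) > 0" "snd (\<epsilon> (F z')) > 0" "snd k > 0"
        using Fz eF y kH unfolding H3_snd by auto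
      have hp: "h1 > 0" "h2 > 0" "h > 0" "h1' > 0" "h2' > 0" "hk > 0"
        unfolding h by (rule hgt_pos, rule sn)+
      have c0: "chC (\<epsilon> (F z)) (\<epsilon> (F z')) = chC (F z) (F z')" by (rule chC_inv[OF e(1) Fz])
      have c1: "chC (\<epsilon> (F z)) k = chC (F z) ?y" using chC_inv[OF e(1) Fz(1) y] ey by simp
      have c2: "chC (\<epsilon> (F z')) k = chC (F z') ?y" using chC_inv[OF e(1) Fz(2) y] ey by simp
      have e0: "1 - ballmap (F z) \<bullet> ballmap (F z') = 4 * h1 * h2 * b0" unfolding h b by (rule inner_ballmap_chC[OF sn(1,2)])
      have e1: "1 - ballmap (F z) \<bullet> ballmap ?y = 4 * h1 * h * b1" unfolding h b by (rule inner_ballmap_chC[OF sn(1,3)])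
      have e2: "1 - ballmap (F z') \<bullet> ballmap ?y = 4 * h2 * h * b2" unfolding h b by (rule inner_ballmap_chC[OF sn(2,3)])
      have e0': "1 - ballmap (\<epsilon> (F z)) \<bullet> ballmap (\<epsilon> (F z')) = 4 * h1' * h2' * b0" unfolding h b c0[symmetric] by (rule inner_ballmap_chC[OF sn(4,5)])
      have e1': "1 - ballmap (\<epsilon> (F z)) \<bullet> ballmap k = 4 * h1' * hk * b1" unfolding h b c1[symmetric] by (rule inner_ballmap_chC[OF sn(4,6)])
      have e2': "1 - ballmap (\<epsilon> (F z')) \<bullet> ballmap k = 4 * h2' * hk * b2" unfolding h b c2[symmetric] by (rule inner_ballmap_chC[OF sn(5,6)])
      have bp: "b0 > 0" "b1 > 0" "b2 > 0" unfolding b using chC_nonneg[OF Fz] chC_nonneg[OF Fz(1) y] chC_nonneg[OF Fz(2) y] by linarith+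
      have up: "1 - ballmap u \<bullet> ballmap v \<le> 2" for u v
      proof -
        have "\<bar>ballmap u \<bullet> ballmap v\<bar> \<le> norm (ballmap u) * norm (ballmap v)" by (rule Cauchy_Schwarz_ineq2)
        also have "\<dots> \<le> 1 * 1" by (intro mult_mono norm_ballmap_le) auto
        finally show ?thesis by linarith
      qed
      have f0: "4 * h1 * h2 * b0 \<le> 2" using up[of "F z" "F z'"] e0 by simp
      have f1: "c \<le> 4 * h1 * h * b1" using Xb[OF z(1)] e1 by simp
      have f2: "c \<le> 4 * h2 * h * b2" using Xb[OF z(2)] e2 by simp
      have f1': "4 * h1' * hk * b1 \<le> 2" using up[of "\<epsilon> (F z)" k] e1' by simp
      have f2': "4 * h2' * hk * b2 \<le> 2" using up[of "\<epsilon> (F z')" k] e2' by simp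
      have m1: "(4 * h1' * hk * b1) * (4 * h2' * hk * b2) \<le> 2 * 2"
        by (rule mult_mono[OF f1' f2']) (simp_all add: hp bp less_imp_le)
      have m2: "c * c \<le> (4 * h1 * h * b1) * (4 * h2 * h * b2)"
        by (rule mult_mono[OF f1 f2]) (simp_all add: hp bp c(1) less_imp_le)
      have "((4 * h1' * hk * b1) * (4 * h2' * hk * b2)) * (c * c) \<le> (2 * 2) * ((4 * h1 * h * b1) * (4 * h2 * h * b2))"
        by (rule mult_mono[OF m1 m2]) (simp_all add: c(1) less_imp_le)
      then have "(16 * b1 * b2) * ((h1' * h2' * hk\<^sup>2) * c\<^sup>2) \<le> (16 * b1 * b2) * (4 * (h1 * h2 * h\<^sup>2))"
        by (simp add: power2_eq_square mult_ac)
      then have "(h1' * h2' * hk\<^sup>2) * c\<^sup>2 \<le> 4 * (h1 * h2 * h\<^sup>2)"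
        by (rule mult_left_le_imp_le) (simp add: bp)
      from mult_left_mono[OF this, of "4 * b0"] bp(1)
      have "(4 * b0) * ((h1' * h2' * hk\<^sup>2) * c\<^sup>2) \<le> (4 * b0) * (4 * (h1 * h2 * h\<^sup>2))" by simp
      then have "(4 * h1' * h2' * b0) * hk\<^sup>2 * c\<^sup>2 \<le> 4 * h\<^sup>2 * (4 * h1 * h2 * b0)" by (simp add: mult_ac)
      also have "\<dots> \<le> 4 * h\<^sup>2 * 2" using f0 by (intro mult_left_mono) auto
      finally have le: "(4 * h1' * h2' * b0) * hk\<^sup>2 * c\<^sup>2 \<le> 8 * h\<^sup>2" by simp
      have "k0\<^sup>2 \<le> hk\<^sup>2" unfolding h using k0 d(2) by (intro power_mono) auto
      then have "(4 * h1' * h2' * b0) * k0\<^sup>2 * c\<^sup>2 \<le> (4 * h1' * h2' * b0) * hk\<^sup>2 * c\<^sup>2"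
        by (intro mult_right_mono mult_left_mono) (simp_all add: hp bp less_imp_le)
      from order_trans[OF this le] show ?thesis unfolding e0' h(3) .
    qed
    obtain g where g: "\<And>n. g n \<in> \<Gamma>" "(\<lambda>n. act_H2 (g n) \<i>) \<longlonglongrightarrow> complex_of_real x" using escape[of x] by blast
    obtain g' where g': "\<And>n. g' n \<in> \<Gamma>" "(\<lambda>n. act_H2 (g' n) \<i>) \<longlonglongrightarrow> complex_of_real x'" using escape[of x'] by blast
    let ?s = "\<lambda>n. act_H3 (\<rho> (g n)) ?o" and ?s' = "\<lambda>n. act_H3 (\<rho> (g' n)) ?o"
    have le: "(1 - ballmap (?s n) \<bullet> ballmap (?s' n)) * k0\<^sup>2 * c\<^sup>2 \<le> 8 * (hgt ?y)\<^sup>2" for n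
    proof -
      obtain z where z: "z \<in> H2" "?s n = \<epsilon> (F z)" using orb[OF g(1)] ..
      obtain z' where z': "z' \<in> H2" "?s' n = \<epsilon> (F z')" using orb[OF g'(1)] ..
      show ?thesis unfolding z(2) z'(2) by (rule main[OF z(1) z'(1)])
    qed
    have "(\<lambda>n. (1 - ballmap (?s n) \<bullet> ballmap (?s' n)) * k0\<^sup>2 * c\<^sup>2) \<longlonglongrightarrow> (1 - bdpt (f (Some x)) \<bullet> bdpt (f (Some x'))) * k0\<^sup>2 * c\<^sup>2"
      by (intro tendsto_intros orbit_converges[OF g oH] orbit_converges[OF g' oH])
    then have "(1 - bdpt (f (Some x)) \<bullet> bdpt (f (Some x'))) * k0\<^sup>2 * c\<^sup>2 \<le> 8 * (hgt ?y)\<^sup>2"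
      by (rule LIMSEQ_le_const2) (use le in auto)
    moreover have "2 * q = 1 - bdpt (f (Some x)) \<bullet> bdpt (f (Some x'))" by (simp add: q_def chord_def)
    ultimately show ?thesis by simp
  qed
  have cb: "((\<lambda>t. ballmap (w, t)) \<longlongrightarrow> ballmap (w, 0)) (at_right 0)"
  proof -
    have "isCont ballmap (w, 0)" using ballmap_continuous[of UNIV] by (simp add: continuous_on_eq_continuous_at)
    then have "isCont (\<lambda>t. ballmap (w, t)) 0" by (rule isCont_o2[rotated]) (intro continuous_intros)
    then show ?thesis by (simp add: isCont_def filterlim_at_split)
  qed
  have ch: "((\<lambda>t. hgt (w, t)) \<longlongrightarrow> hgt (w, 0)) (at_right 0)"
  proof -
    have "isCont hgt (w, 0)" using hgt_continuous[of UNIV] by (simp add: continuous_on_eq_continuous_at)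
    then have "isCont (\<lambda>t. hgt (w, t)) 0" by (rule isCont_o2[rotated]) (intro continuous_intros)
    then show ?thesis by (simp add: isCont_def filterlim_at_split)
  qed
  have "\<forall>\<^sub>F t in at_right 0. ballmap (w, t) \<in> ball ?b c"
    using topological_tendstoD[OF cb open_ball, of ?b c] c(1) by (simp add: bdpt_Some)
  then have ev: "\<forall>\<^sub>F t in at_right 0. 2 * q * k0\<^sup>2 * c\<^sup>2 \<le> 8 * (hgt (w, t))\<^sup>2"
    using eventually_at_right_less[of 0]
  proof eventually_elim
    case (elim t)
    then show ?case by (intro bound) (auto simp: dist_norm norm_minus_commute)
  qed
  have "((\<lambda>t. 8 * (hgt (w, t))\<^sup>2) \<longlongrightarrow> 8 * (hgt (w, 0))\<^sup>2) (at_right 0)" by (intro tendsto_intros ch)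
  from tendsto_lowerbound[OF this ev] have "2 * q * k0\<^sup>2 * c\<^sup>2 \<le> 8 * (hgt (w, 0))\<^sup>2" by simp
  then have "2 * q * k0\<^sup>2 * c\<^sup>2 \<le> 0" by (simp add: hgt_def)
  moreover have "2 * q * k0\<^sup>2 * c\<^sup>2 > 0" using q k0 c by simp
  ultimately show False by linarith
qed

text \<open>Only infinity is left: the range is compact, hence closed, and infinity is the limit of
  the values \<open>Some (of_nat n)\<close>.\<close>

lemma f_surj: "surj f"
proof -
  have "None \<in> range f"
  proof -
    have "compactin bdry_top (range f)"
      using image_compactin[OF _ R2.psi_cont, of UNIV] compact_space_bdry_top by (simp add: compact_space_def)
    then have "compact (bdpt ` range f)" using image_compactin[OF _ continuous_bdpt] by simp
    then have cl: "closed (bdpt ` range f)" by (rule compact_imp_closed)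
    have lim: "(\<lambda>n. bdpt (Some (of_nat n))) \<longlonglongrightarrow> bdpt None"
      unfolding tendsto_bdpt_iff_chord
    proof -
      have "chord (Some (of_nat n)) None = 1 / (1 + (real n)\<^sup>2)" for n
        by (simp add: chord_eq hn_def add.commute)
    moreover note inverse_square_tendsto_0
      ultimately show "(\<lambda>n. chord (Some (of_nat n)) None) \<longlonglongrightarrow> 0" by simp
    qed
    have "bdpt None \<in> bdpt ` range f"
      by (rule closed_sequentially[OF cl _ lim]) (use some_in_range in blast)
    then show ?thesis using bdpt_inj by (auto simp: image_iff)
  qed
  then have "\<omega> \<in> range f" for \<omega> using some_in_range by (cases \<omega>) auto
  then show ?thesis by blast
qed

lemma f_not_inj: "\<exists>\<xi> \<eta>. \<xi> \<noteq> \<eta> \<and> f \<xi> = f \<eta>"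
  using not_injective_onto_sphere[OF R2.psi_cont f_surj] unfolding inj_def by blast

end

section \<open>Asymptotic values of the boundary cocycles\<close>

lemma continuous_inc_bd: "continuous_map bdry_top bdry_top inc_bd"
  using continuous_bdpt_inc unfolding continuous_map_atin limitin_bdry_complex by simp

lemma (in lattice) bdry_rep_inclusion: "bdry_rep \<Gamma> cpsl inc_H2 inc_bd"
proof unfold_locales
  fix \<gamma> \<delta> z \<xi> assume g: "\<gamma> \<in> \<Gamma>"
  show "cpsl \<gamma> \<in> carrier PSL2" using g by (simp add: cpsl_carrier)
  show "inc_bd (act_bdry \<gamma> \<xi>) = act_bdry (cpsl \<gamma>) (inc_bd \<xi>)" using g by (simp add: act_bdry_cpsl)
  show "cpsl (\<gamma> \<otimes>\<^bsub>PSL2\<^esub> \<delta>) = cpsl \<gamma> \<otimes>\<^bsub>PSL2\<^esub> cpsl \<delta>" if "\<delta> \<in> \<Gamma>"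
    using g that by (simp add: cpsl_mult)
  show "inc_H2 (act_H2 \<gamma> z) = act_H3 (cpsl \<gamma>) (inc_H2 z)" if "z \<in> H2"
    using g that by (simp add: act_H3_cpsl H2_Im)
next
  show "snd (inc_H2 z) > 0" if "z \<in> H2" for z using that by (simp add: inc_H2_def H2_Im)
  show "continuous_map bdry_top bdry_top inc_bd" by (rule continuous_inc_bd)
  show "((\<lambda>z. ballmap (inc_H2 z)) \<longlongrightarrow> bdpt (inc_bd (Some x))) (at (of_real x) within H2)" for x
  proof -
    have "continuous_on UNIV (\<lambda>z. ballmap (inc_H2 z))"
      unfolding inc_H2_def by (intro continuous_on_compose2[OF ballmap_continuous[of UNIV]] continuous_intros) auto
    then have "((\<lambda>z. ballmap (inc_H2 z)) \<longlongrightarrow> ballmap (inc_H2 (of_real x))) (at (of_real x) within UNIV)"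
      unfolding continuous_on_def by simp
    then have "((\<lambda>z. ballmap (inc_H2 z)) \<longlongrightarrow> ballmap (inc_H2 (of_real x))) (at (of_real x) within H2)"
      by (rule tendsto_within_subset) simp
    then show ?thesis by (simp add: inc_H2_def bdpt_Some)
  qed
qed

context bdry_rep
begin

text \<open>Applying the inverse of \<open>g n\<close> to two points whose distances to the limit of
  \<open>g n \<i>\<close> stay bounded below contracts their \<open>chord\<close> by a constant
  times the squared height of \<open>g n \<i>\<close>; this combines \<open>Q_act\<close> with
  \<open>poisson_sig\<close>.\<close>

lemma conj_chord_lim:
  assumes g: "\<And>n. g n \<in> \<Gamma>" and h: "h \<in> \<Gamma>"
    and x: "limitin bdry_top (\<lambda>n. act_bdry (g n) \<xi>) \<eta> sequentially"
    and z: "(\<lambda>n. act_H2 (g n) \<i>) \<longlonglongrightarrow> of_real \<zeta>"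
    and ne: "Q \<eta> (Some \<zeta>) \<noteq> 0" "Q (act_bdry h \<eta>) (Some \<zeta>) \<noteq> 0"
  shows "(\<lambda>n. Q (act_bdry (inv\<^bsub>PSL2\<^esub> (g n) \<otimes>\<^bsub>PSL2\<^esub> h \<otimes>\<^bsub>PSL2\<^esub> g n) \<xi>) \<xi>) \<longlonglongrightarrow> 0"
proof -
  let ?x = "\<lambda>n. act_bdry (g n) \<xi>" and ?z = "\<lambda>n. \<Phi> (act_H2 (g n) \<i>)"
  let ?k = "\<lambda>n. act_bdry (inv\<^bsub>PSL2\<^esub> (g n) \<otimes>\<^bsub>PSL2\<^esub> h \<otimes>\<^bsub>PSL2\<^esub> g n) \<xi>"
  let ?u = "\<lambda>n. (1 - ballmap (?z n) \<bullet> bdpt (\<psi> (?x n))) / 2"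
  let ?v = "\<lambda>n. (1 - ballmap (?z n) \<bullet> bdpt (\<psi> (act_bdry h (?x n)))) / 2"
  have zH: "act_H2 (g n) \<i> \<in> H2" for n using g by simp
  have zp: "snd (?z n) > 0" for n using Phi_pos zH by blast
  have X: "(\<lambda>n. ballmap (?z n)) \<longlonglongrightarrow> bdpt (\<psi> (Some \<zeta>))" and H: "(\<lambda>n. hgt (?z n)) \<longlonglongrightarrow> 0"
    by (rule hgt_tendsto_0[OF z zH])+
  have hx: "limitin bdry_top (\<lambda>n. act_bdry h (?x n)) (act_bdry h \<eta>) sequentially"
    by (rule limitin_act_bdry[OF _ x]) (use h in simp)
  have v: "?v \<longlonglongrightarrow> Q (act_bdry h \<eta>) (Some \<zeta>)"
    unfolding Q_def chord_def by (subst inner_commute) (intro tendsto_intros X psi_lim[OF hx], simp)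
  have u: "?u \<longlonglongrightarrow> Q \<eta> (Some \<zeta>)"
    unfolding Q_def chord_def by (subst inner_commute) (intro tendsto_intros X psi_lim[OF x], simp)
  define c where "c = 1 / hgt (\<Phi> \<i>)"
  have hi: "hgt (\<Phi> \<i>) > 0" using Phi_pos[OF i_H2] by (rule hgt_pos)
  have Pi: "0 < poisson (\<Phi> \<i>) \<omega>" "poisson (\<Phi> \<i>) \<omega> \<le> c" for \<omega>
  proof -
    show "0 < poisson (\<Phi> \<i>) \<omega>" by (rule poisson_pos[OF Phi_pos[OF i_H2]])
    have "- (ballmap (\<Phi> \<i>) \<bullet> bdpt \<omega>) \<le> 1"
      using inner_le_1[of "- ballmap (\<Phi> \<i>)" "bdpt \<omega>"] norm_ballmap_le[of "\<Phi> \<i>"] by (simp add: norm_bdpt)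
    then have "poisson (\<Phi> \<i>) \<omega> \<le> 2 / (2 * hgt (\<Phi> \<i>))" unfolding poisson_def using hi by (intro divide_right_mono) auto
    then show "poisson (\<Phi> \<i>) \<omega> \<le> c" by (simp add: c_def)
  qed
  have bound: "Q (?k n) \<xi> \<le> c * c * (hgt (?z n) * hgt (?z n)) / (?u n * ?v n)" for n
  proof -
    let ?gi = "inv\<^bsub>PSL2\<^esub> (g n)"
    have gG: "g n \<in> \<Gamma>" "?gi \<in> \<Gamma>" using g by auto
    have k1: "?k n = act_bdry ?gi (act_bdry h (?x n))" using gG h by (simp add: act_bdry_mult)
    have k2: "\<xi> = act_bdry ?gi (?x n)" using gG by simp
    have zi: "act_H2 ?gi (act_H2 (g n) \<i>) = \<i>" using gG by (intro act_H2_inv(1)) auto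
    let ?a = "poisson (\<Phi> \<i>) (\<psi> (?k n))" and ?b = "poisson (\<Phi> \<i>) (\<psi> \<xi>)"
    let ?s = "sig ?gi (act_bdry h (?x n))" and ?t = "sig ?gi (?x n)"
    have a: "?a * ?s = poisson (?z n) (\<psi> (act_bdry h (?x n)))"
      using poisson_sig[OF gG(2) zH, of n "act_bdry h (?x n)"] unfolding zi k1 .
    have b: "?b * ?t = poisson (?z n) (\<psi> (?x n))"
      using poisson_sig[OF gG(2) zH, of n "?x n"] unfolding zi k2[symmetric] .
    have hz: "hgt (?z n) > 0" using zp by (rule hgt_pos)
    have pu: "poisson (?z n) (\<psi> (?x n)) = ?u n / hgt (?z n)" and pv: "poisson (?z n) (\<psi> (act_bdry h (?x n))) = ?v n / hgt (?z n)"
      unfolding poisson_def by simp_all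
    have up: "?u n > 0" "?v n > 0"
      using poisson_pos[OF zp, of n "\<psi> (?x n)"] poisson_pos[OF zp, of n "\<psi> (act_bdry h (?x n))"] hz
      unfolding pu pv zero_less_divide_iff by linarith+
    have Qk: "Q (?k n) \<xi> * ?s * ?t = Q (act_bdry h (?x n)) (?x n)"
      using Q_act[OF gG(2), of "act_bdry h (?x n)" "?x n"] unfolding k1 k2[symmetric] .
    have "Q (?k n) \<xi> * ((?v n / hgt (?z n)) * (?u n / hgt (?z n))) = Q (act_bdry h (?x n)) (?x n) * (?a * ?b)"
      unfolding pu[symmetric] pv[symmetric] a[symmetric] b[symmetric] Qk[symmetric] by (simp add: mult_ac)
    also have "\<dots> \<le> 1 * (c * c)"
      using Pi by (intro mult_mono Q_le_1 Q_nonneg mult_nonneg_nonneg) (auto intro: less_imp_le order_trans[OF less_imp_le])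
    finally have le: "Q (?k n) \<xi> * ((?v n / hgt (?z n)) * (?u n / hgt (?z n))) \<le> c * c" by simp
    have "(?v n / hgt (?z n)) * (?u n / hgt (?z n)) = ?u n * ?v n / (hgt (?z n) * hgt (?z n))" by simp
    then have "Q (?k n) \<xi> * (?u n * ?v n) / (hgt (?z n) * hgt (?z n)) \<le> c * c" using le by (simp add: mult_ac)
    then have "Q (?k n) \<xi> * (?u n * ?v n) \<le> c * c * (hgt (?z n) * hgt (?z n))" using hz by (simp add: pos_divide_le_eq)
    then show ?thesis using mult_pos_pos[OF up] by (simp only: pos_le_divide_eq)
  qed
  have "(\<lambda>n. c * c * (hgt (?z n) * hgt (?z n)) / (?u n * ?v n)) \<longlonglongrightarrow> c * c * (0 * 0) / (Q \<eta> (Some \<zeta>) * Q (act_bdry h \<eta>) (Some \<zeta>))"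
    by (intro tendsto_divide tendsto_mult tendsto_const H u v) (use ne in simp)
  then have lim: "(\<lambda>n. c * c * (hgt (?z n) * hgt (?z n)) / (?u n * ?v n)) \<longlonglongrightarrow> 0" by simp
  show ?thesis
    by (rule tendsto_sandwich[OF _ _ tendsto_const lim]) (intro always_eventually allI Q_nonneg bound)+
qed

end

context ct_setting
begin

sublocale R1: bdry_rep \<Gamma> cpsl inc_H2 inc_bd
  by (rule bdry_rep_inclusion)

lemma R1_Q_0: "R1.Q \<xi> \<eta> = 0 \<longleftrightarrow> \<xi> = \<eta>"
  by (simp add: R1.Q_def chord_eq_0 inc_bd_inj)

lemma R2_Q_0: "R2.Q \<xi> \<eta> = 0 \<longleftrightarrow> f \<xi> = f \<eta>"
  by (simp add: R2.Q_def chord_eq_0)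

lemma limitin_iff_Q: "limitin bdry_top s \<xi> sequentially \<longleftrightarrow> (\<lambda>n. R1.Q (s n) \<xi>) \<longlonglongrightarrow> 0"
  unfolding limitin_bdry_real tendsto_bdpt_iff_chord R1.Q_def ..

text \<open>\<open>ess \<xi> \<eta> a b\<close>: the multiplicative analogue of the essential values of the pair of cocycles,
  recording the limits of \<open>\<gamma>\<^sub>n \<xi>\<close> and of the two conformal factors.\<close>

definition ess :: "real option \<Rightarrow> real option \<Rightarrow> real \<Rightarrow> real \<Rightarrow> bool" where
  "ess \<xi> \<eta> a b \<longleftrightarrow> (bdpt (inc_bd \<eta>), a, b) \<in>
     closure ((\<lambda>\<gamma>. (bdpt (inc_bd (act_bdry \<gamma> \<xi>)), R1.sig \<gamma> \<xi>, R2.sig \<gamma> \<xi>)) ` \<Gamma>)"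

lemma ess_iff_sequence:
  "ess \<xi> \<eta> a b \<longleftrightarrow> (\<exists>\<gamma>. (\<forall>n. \<gamma> n \<in> \<Gamma>) \<and> limitin bdry_top (\<lambda>n. act_bdry (\<gamma> n) \<xi>) \<eta> sequentially \<and>
     (\<lambda>n. R1.sig (\<gamma> n) \<xi>) \<longlonglongrightarrow> a \<and> (\<lambda>n. R2.sig (\<gamma> n) \<xi>) \<longlonglongrightarrow> b)" (is "_ \<longleftrightarrow> ?R")
proof
  let ?D = "\<lambda>\<gamma>. (bdpt (inc_bd (act_bdry \<gamma> \<xi>)), R1.sig \<gamma> \<xi>, R2.sig \<gamma> \<xi>)"
  assume "ess \<xi> \<eta> a b"
  then obtain s where s: "\<forall>n. s n \<in> ?D ` \<Gamma>" "s \<longlonglongrightarrow> (bdpt (inc_bd \<eta>), a, b)"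
    unfolding ess_def closure_sequential by (elim exE conjE)
  have "\<forall>n. \<exists>\<gamma>. \<gamma> \<in> \<Gamma> \<and> s n = ?D \<gamma>" using s(1) by (simp add: image_iff Bex_def)
  then obtain \<gamma> where g: "\<forall>n. \<gamma> n \<in> \<Gamma> \<and> s n = ?D (\<gamma> n)" by (rule choice[THEN exE])
  then have eq: "s = (\<lambda>n. ?D (\<gamma> n))" by (intro ext) simp
  have l: "(\<lambda>n. ?D (\<gamma> n)) \<longlonglongrightarrow> (bdpt (inc_bd \<eta>), a, b)" using s(2) unfolding eq .
  show ?R
  proof (intro exI[of _ \<gamma>] conjI)
    show "\<forall>n. \<gamma> n \<in> \<Gamma>" using g by simp
    show "limitin bdry_top (\<lambda>n. act_bdry (\<gamma> n) \<xi>) \<eta> sequentially"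
      unfolding limitin_bdry_real using tendsto_fst[OF l] by simp
    show "(\<lambda>n. R1.sig (\<gamma> n) \<xi>) \<longlonglongrightarrow> a" using tendsto_fst[OF tendsto_snd[OF l]] by simp
    show "(\<lambda>n. R2.sig (\<gamma> n) \<xi>) \<longlonglongrightarrow> b" using tendsto_snd[OF tendsto_snd[OF l]] by simp
  qed
next
  assume ?R
  then obtain \<gamma> where g: "\<forall>n. \<gamma> n \<in> \<Gamma>" "limitin bdry_top (\<lambda>n. act_bdry (\<gamma> n) \<xi>) \<eta> sequentially"
     "(\<lambda>n. R1.sig (\<gamma> n) \<xi>) \<longlonglongrightarrow> a" "(\<lambda>n. R2.sig (\<gamma> n) \<xi>) \<longlonglongrightarrow> b" by (elim exE conjE)
  show "ess \<xi> \<eta> a b" unfolding ess_def closure_sequential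
    by (intro exI[of _ "\<lambda>n. (bdpt (inc_bd (act_bdry (\<gamma> n) \<xi>)), R1.sig (\<gamma> n) \<xi>, R2.sig (\<gamma> n) \<xi>)"] conjI allI
        tendsto_Pair g(3,4) g(2)[unfolded limitin_bdry_real] imageI g(1)[rule_format])
qed

lemma ess_closed:
  assumes "\<forall>\<^sub>F n in sequentially. ess \<xi> (\<eta> n) (a n) (b n)" "limitin bdry_top \<eta> \<eta>' sequentially" "a \<longlonglongrightarrow> a'" "b \<longlonglongrightarrow> b'"
  shows "ess \<xi> \<eta>' a' b'"
  unfolding ess_def
  by (rule Lim_in_closed_set[OF closed_closure assms(1)[unfolded ess_def] trivial_limit_sequentially])
     (intro tendsto_Pair assms(3,4) assms(2)[unfolded limitin_bdry_real])

lemma limitin_bdry_const: "limitin bdry_top (\<lambda>n. \<xi>) (\<xi> :: real option) sequentially"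
  unfolding limitin_bdry_real by (rule tendsto_const)

lemma ess_orbit: "\<gamma> \<in> \<Gamma> \<Longrightarrow> ess \<xi> (act_bdry \<gamma> \<xi>) (R1.sig \<gamma> \<xi>) (R2.sig \<gamma> \<xi>)"
  unfolding ess_def by (rule closure_subset[THEN subsetD]) (rule imageI)

text \<open>For fixed \<open>m\<close>, apply \<open>\<kappa> m\<close> to the approximations of the
  first value and use continuity of its factors; then let \<open>m\<close> grow. Closedness of
  \<open>ess\<close> replaces a diagonal sequence.\<close>

lemma ess_mult:
  assumes "ess \<xi> \<eta> a b" "ess \<eta> \<omega> c d"
  shows "ess \<xi> \<omega> (c * a) (d * b)"
proof -
  obtain \<gamma> where g: "\<forall>n. \<gamma> n \<in> \<Gamma>" "limitin bdry_top (\<lambda>n. act_bdry (\<gamma> n) \<xi>) \<eta> sequentially"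
     "(\<lambda>n. R1.sig (\<gamma> n) \<xi>) \<longlonglongrightarrow> a" "(\<lambda>n. R2.sig (\<gamma> n) \<xi>) \<longlonglongrightarrow> b"
    using assms(1) unfolding ess_iff_sequence by (elim exE conjE)
  obtain \<kappa> where k: "\<forall>n. \<kappa> n \<in> \<Gamma>" "limitin bdry_top (\<lambda>n. act_bdry (\<kappa> n) \<eta>) \<omega> sequentially"
     "(\<lambda>n. R1.sig (\<kappa> n) \<eta>) \<longlonglongrightarrow> c" "(\<lambda>n. R2.sig (\<kappa> n) \<eta>) \<longlonglongrightarrow> d"
    using assms(2) unfolding ess_iff_sequence by (elim exE conjE)
  have "ess \<xi> (act_bdry (\<kappa> m) \<eta>) (R1.sig (\<kappa> m) \<eta> * a) (R2.sig (\<kappa> m) \<eta> * b)" for m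
  proof (rule ess_closed)
    show "\<forall>\<^sub>F n in sequentially. ess \<xi> (act_bdry (\<kappa> m) (act_bdry (\<gamma> n) \<xi>))
       (R1.sig (\<kappa> m) (act_bdry (\<gamma> n) \<xi>) * R1.sig (\<gamma> n) \<xi>) (R2.sig (\<kappa> m) (act_bdry (\<gamma> n) \<xi>) * R2.sig (\<gamma> n) \<xi>)"
    proof (intro always_eventually allI)
      fix n
      have m: "\<kappa> m \<in> \<Gamma>" "\<gamma> n \<in> \<Gamma>" using g(1) k(1) by auto
      show "ess \<xi> (act_bdry (\<kappa> m) (act_bdry (\<gamma> n) \<xi>))
       (R1.sig (\<kappa> m) (act_bdry (\<gamma> n) \<xi>) * R1.sig (\<gamma> n) \<xi>) (R2.sig (\<kappa> m) (act_bdry (\<gamma> n) \<xi>) * R2.sig (\<gamma> n) \<xi>)"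
        using ess_orbit[of "\<kappa> m \<otimes>\<^bsub>PSL2\<^esub> \<gamma> n" \<xi>] m
        by (simp add: R1.sig_mult R2.sig_mult act_bdry_mult)
    qed
    have km: "\<kappa> m \<in> \<Gamma>" using k(1) by simp
    show "limitin bdry_top (\<lambda>n. act_bdry (\<kappa> m) (act_bdry (\<gamma> n) \<xi>)) (act_bdry (\<kappa> m) \<eta>) sequentially"
      by (rule limitin_act_bdry[OF in_carrier[OF km] g(2)])
    show "(\<lambda>n. R1.sig (\<kappa> m) (act_bdry (\<gamma> n) \<xi>) * R1.sig (\<gamma> n) \<xi>) \<longlonglongrightarrow> R1.sig (\<kappa> m) \<eta> * a"
      by (intro tendsto_mult R1.sig_lim[OF km g(2)] g(3))
    show "(\<lambda>n. R2.sig (\<kappa> m) (act_bdry (\<gamma> n) \<xi>) * R2.sig (\<gamma> n) \<xi>) \<longlonglongrightarrow> R2.sig (\<kappa> m) \<eta> * b"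
      by (intro tendsto_mult R2.sig_lim[OF km g(2)] g(4))
  qed
  then show ?thesis
    by (intro ess_closed[OF always_eventually[OF allI] k(2) tendsto_mult[OF k(3) tendsto_const] tendsto_mult[OF k(4) tendsto_const]])
qed

lemma generic_sequence:
  assumes "generic \<Gamma> x" "\<eta> \<noteq> \<zeta>"
  shows "\<exists>g. (\<forall>n. g n \<in> \<Gamma>) \<and> limitin bdry_top (\<lambda>n. act_bdry (g n) (Some x)) (Some \<eta>) sequentially \<and>
     (\<lambda>n. act_H2 (g n) \<i>) \<longlonglongrightarrow> of_real \<zeta> \<and> (\<forall>n. \<exists>y. act_bdry (g n) (Some x) = Some y)"
proof -
  have "\<forall>n. \<exists>g y. g \<in> \<Gamma> \<and> act_bdry g (Some x) = Some y \<and> dist \<eta> y < inverse (real (Suc n)) \<and>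
    dist (of_real \<zeta>) (act_H2 g \<i>) < inverse (real (Suc n))"
  proof
    fix n
    have "x \<notin> bad_set \<Gamma> \<eta> \<zeta> (inverse (real (Suc n)))" using assms unfolding generic_def by simp
    then obtain g where g: "g \<in> \<Gamma>" "act_bdry g (Some x) \<in> Some ` ball \<eta> (inverse (real (Suc n)))"
      "act_H2 g \<i> \<in> ball (of_real \<zeta>) (inverse (real (Suc n)))" unfolding bad_set_def by auto
    then show "\<exists>g y. g \<in> \<Gamma> \<and> act_bdry g (Some x) = Some y \<and> dist \<eta> y < inverse (real (Suc n)) \<and>
      dist (of_real \<zeta>) (act_H2 g \<i>) < inverse (real (Suc n))" by (elim imageE) (intro exI[of _ g], auto)
  qed
  then obtain g where "\<forall>n. \<exists>y. g n \<in> \<Gamma> \<and> act_bdry (g n) (Some x) = Some y \<and> dist \<eta> y < inverse (real (Suc n)) \<and>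
    dist (of_real \<zeta>) (act_H2 (g n) \<i>) < inverse (real (Suc n))" by (rule choice[THEN exE])
  then obtain y where gy: "\<forall>n. g n \<in> \<Gamma> \<and> act_bdry (g n) (Some x) = Some (y n) \<and> dist \<eta> (y n) < inverse (real (Suc n)) \<and>
    dist (of_real \<zeta>) (act_H2 (g n) \<i>) < inverse (real (Suc n))" by (rule choice[THEN exE])
  have squeeze: "s \<longlonglongrightarrow> l" if "\<And>n. dist l (s n) < inverse (real (Suc n))" for s and l :: "'m::metric_space"
  proof (rule iffD2[OF tendsto_dist_iff])
    have le: "dist (s n) l \<le> inverse (real (Suc n))" for n using that[of n] by (simp add: dist_commute)
    show "(\<lambda>n. dist (s n) l) \<longlonglongrightarrow> 0"
      by (rule tendsto_sandwich[OF _ _ tendsto_const LIMSEQ_inverse_real_of_nat]) (intro always_eventually allI zero_le_dist le)+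
  qed
  have "y \<longlonglongrightarrow> \<eta>" by (rule squeeze) (use gy in blast)
  then have "limitin bdry_top (\<lambda>n. act_bdry (g n) (Some x)) (Some \<eta>) sequentially" using limitin_Some[of y \<eta>] gy by simp
  moreover have "(\<lambda>n. act_H2 (g n) \<i>) \<longlonglongrightarrow> of_real \<zeta>" by (rule squeeze) (use gy in blast)
  ultimately show ?thesis using gy by (intro exI[of _ g]) simp
qed

text \<open>For \<open>\<eta>\<close> at infinity, the real targets \<open>real n + 1\<close> are
  used. The last clause keeps the orbit on the real line, where \<open>ess_conj\<close> is
  stated.\<close>

lemma generic_orbit_dense:
  assumes "generic \<Gamma> x"
  shows "\<exists>g. (\<forall>n. g n \<in> \<Gamma>) \<and> limitin bdry_top (\<lambda>n. act_bdry (g n) (Some x)) \<eta> sequentially \<and>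
     (\<forall>n. \<exists>y. act_bdry (g n) (Some x) = Some y)"
proof (cases \<eta>)
  case (Some y)
  obtain g where "\<forall>n. g n \<in> \<Gamma>" "limitin bdry_top (\<lambda>n. act_bdry (g n) (Some x)) (Some y) sequentially"
    "\<forall>n. \<exists>y. act_bdry (g n) (Some x) = Some y"
    using generic_sequence[OF assms, of y "y + 1"] by auto
  then show ?thesis unfolding Some by (intro exI[of _ g] conjI)
next
  case None
  have "\<forall>n. \<exists>g. g \<in> \<Gamma> \<and> (\<exists>y. act_bdry g (Some x) = Some y \<and> real n < y)"
  proof
    fix n
    have "x \<notin> bad_set \<Gamma> (real n + 1) (real n) 1" using assms unfolding generic_def by simp
    then obtain g where "g \<in> \<Gamma>" "act_bdry g (Some x) \<in> Some ` ball (real n + 1) 1" unfolding bad_set_def by auto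
    then show "\<exists>g. g \<in> \<Gamma> \<and> (\<exists>y. act_bdry g (Some x) = Some y \<and> real n < y)"
      by (elim imageE) (intro exI[of _ g], auto simp: dist_real_def abs_less_iff)
  qed
  then obtain g where g: "\<forall>n. g n \<in> \<Gamma> \<and> (\<exists>y. act_bdry (g n) (Some x) = Some y \<and> real n < y)" by (rule choice[THEN exE])
  have "limitin bdry_top (\<lambda>n. act_bdry (g n) (Some x)) None sequentially"
    unfolding limitin_iff_Q
  proof (rule tendsto_sandwich[OF _ _ tendsto_const LIMSEQ_inverse_real_of_nat])
    have "R1.Q (act_bdry (g n) (Some x)) None \<le> inverse (real (Suc n))" for n
    proof -
      obtain y where y: "act_bdry (g n) (Some x) = Some y" "real n < y" using g by blast
      have "real n \<le> y\<^sup>2"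
      proof (cases n)
        case (Suc m)
        then have "1 * real n \<le> y * y" using y(2) by (intro mult_mono) auto
        then show ?thesis by (simp add: power2_eq_square)
      qed simp
      then have "1 + real n \<le> y\<^sup>2 + 1" by simp
      then have "inverse (y\<^sup>2 + 1) \<le> inverse (1 + real n)" by (intro le_imp_inverse_le) auto
      moreover have "R1.Q (act_bdry (g n) (Some x)) None = inverse (y\<^sup>2 + 1)"
        by (simp add: y(1) R1.Q_def chord_eq hn_def hx_def hy_def inverse_eq_divide)
      ultimately show ?thesis by simp
    qed
    then show "\<forall>\<^sub>F n in sequentially. R1.Q (act_bdry (g n) (Some x)) None \<le> inverse (real (Suc n))" by simp
  qed (simp add: R1.Q_nonneg)
  then show ?thesis unfolding None using g by (intro exI[of _ g]) auto
qed

lemma ess_conj: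
  assumes x: "generic \<Gamma> x" and h: "h \<in> \<Gamma>"
    and ne: "f (Some \<eta>) \<noteq> f (Some \<zeta>)" "f (act_bdry h (Some \<eta>)) \<noteq> f (Some \<zeta>)"
  shows "ess (Some x) (Some x)
     (R1.sig h (Some \<eta>) * R1.Q (act_bdry h (Some \<eta>)) (Some \<zeta>) / R1.Q (Some \<eta>) (Some \<zeta>))
     (R2.sig h (Some \<eta>) * R2.Q (act_bdry h (Some \<eta>)) (Some \<zeta>) / R2.Q (Some \<eta>) (Some \<zeta>))"
proof -
  have "\<eta> \<noteq> \<zeta>" using ne(1) by blast
  from generic_sequence[OF x this] obtain g where g: "\<forall>n. g n \<in> \<Gamma>" "limitin bdry_top (\<lambda>n. act_bdry (g n) (Some x)) (Some \<eta>) sequentially"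
     "(\<lambda>n. act_H2 (g n) \<i>) \<longlonglongrightarrow> of_real \<zeta>"
    by (elim exE conjE)
  have gG: "\<And>n. g n \<in> \<Gamma>" using g(1) by simp
  have Q1: "R1.Q (Some \<eta>) (Some \<zeta>) \<noteq> 0" "R1.Q (act_bdry h (Some \<eta>)) (Some \<zeta>) \<noteq> 0"
    using ne by (auto simp: R1_Q_0)
  have Q2: "R2.Q (Some \<eta>) (Some \<zeta>) \<noteq> 0" using ne by (simp add: R2_Q_0)
  let ?k = "\<lambda>n. inv\<^bsub>PSL2\<^esub> (g n) \<otimes>\<^bsub>PSL2\<^esub> h \<otimes>\<^bsub>PSL2\<^esub> g n"
  have fixed: "limitin bdry_top (\<lambda>n. act_bdry (?k n) (Some x)) (Some x) sequentially"
    unfolding limitin_iff_Q by (rule R1.conj_chord_lim[OF gG h g(2,3) Q1])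
  have kG: "?k n \<in> \<Gamma>" for n using gG h by simp
  show ?thesis unfolding ess_iff_sequence
    by (intro exI[of _ ?k] conjI allI kG fixed R1.sig_conj_lim[OF gG h g(2,3) fixed Q1(1)] R2.sig_conj_lim[OF gG h g(2,3) fixed Q2])
qed

text \<open>Let \<open>h n\<close> move \<open>b\<close> towards \<open>\<alpha>\<close>. Combine
  the value of \<open>ess_conj\<close> for \<open>h n\<close> at \<open>b\<close> with target
  \<open>\<zeta>\<close> and the one for the inverse of \<open>h n\<close> at the image of
  \<open>b\<close> with target \<open>\<zeta>'\<close>: the factors of \<open>h n\<close> cancel and
  only quotients of \<open>Q\<close> remain.\<close>

lemma ess_cross_ratio:
  assumes x: "generic \<Gamma> x" and b: "generic \<Gamma> b"
    and ne: "f (Some b) \<noteq> f (Some \<zeta>)" "f (Some b) \<noteq> f (Some \<zeta>')" "f \<alpha> \<noteq> f (Some \<zeta>)" "f \<alpha> \<noteq> f (Some \<zeta>')"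
  shows "ess (Some x) (Some x)
     ((R1.Q \<alpha> (Some \<zeta>) / R1.Q (Some b) (Some \<zeta>)) / (R1.Q \<alpha> (Some \<zeta>') / R1.Q (Some b) (Some \<zeta>')))
     ((R2.Q \<alpha> (Some \<zeta>) / R2.Q (Some b) (Some \<zeta>)) / (R2.Q \<alpha> (Some \<zeta>') / R2.Q (Some b) (Some \<zeta>')))"
proof -
  obtain h where h: "\<forall>n. h n \<in> \<Gamma>" "limitin bdry_top (\<lambda>n. act_bdry (h n) (Some b)) \<alpha> sequentially"
     "\<forall>n. \<exists>y. act_bdry (h n) (Some b) = Some y"
    using generic_orbit_dense[OF b, of \<alpha>] by (elim exE conjE)
  let ?a = "\<lambda>n. act_bdry (h n) (Some b)"
  have nz: "R1.Q (Some b) (Some \<zeta>) \<noteq> 0" "R1.Q (Some b) (Some \<zeta>') \<noteq> 0" "R1.Q \<alpha> (Some \<zeta>) \<noteq> 0" "R1.Q \<alpha> (Some \<zeta>') \<noteq> 0"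
    "R2.Q (Some b) (Some \<zeta>) \<noteq> 0" "R2.Q (Some b) (Some \<zeta>') \<noteq> 0" "R2.Q \<alpha> (Some \<zeta>) \<noteq> 0" "R2.Q \<alpha> (Some \<zeta>') \<noteq> 0"
    using ne by (auto simp: R1_Q_0 R2_Q_0)
  have ev: "\<forall>\<^sub>F n in sequentially. R2.Q (?a n) (Some \<zeta>) \<noteq> 0" "\<forall>\<^sub>F n in sequentially. R2.Q (?a n) (Some \<zeta>') \<noteq> 0"
    by (rule tendsto_imp_eventually_ne[OF R2.Q_lim1[OF h(2)] nz(7)], rule tendsto_imp_eventually_ne[OF R2.Q_lim1[OF h(2)] nz(8)])
  show ?thesis
  proof (rule ess_closed[OF _ limitin_bdry_const])
    show "\<forall>\<^sub>F n in sequentially. ess (Some x) (Some x)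
     ((R1.Q (?a n) (Some \<zeta>) / R1.Q (Some b) (Some \<zeta>)) / (R1.Q (?a n) (Some \<zeta>') / R1.Q (Some b) (Some \<zeta>')))
     ((R2.Q (?a n) (Some \<zeta>) / R2.Q (Some b) (Some \<zeta>)) / (R2.Q (?a n) (Some \<zeta>') / R2.Q (Some b) (Some \<zeta>')))"
      using ev
    proof eventually_elim
      case (elim n)
      obtain y where y: "?a n = Some y" using h(3) by blast
      have hn: "h n \<in> \<Gamma>" "inv\<^bsub>PSL2\<^esub> (h n) \<in> \<Gamma>" using h(1) by auto
      have bk: "act_bdry (inv\<^bsub>PSL2\<^esub> (h n)) (Some y) = Some b" using hn y by (metis act_bdry_inv(1) in_carrier)
      have fy: "f (Some y) \<noteq> f (Some \<zeta>)" "f (Some y) \<noteq> f (Some \<zeta>')" using elim by (simp_all add: y R2_Q_0)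
      have e1: "ess (Some x) (Some x)
         (R1.sig (h n) (Some b) * R1.Q (Some y) (Some \<zeta>) / R1.Q (Some b) (Some \<zeta>))
         (R2.sig (h n) (Some b) * R2.Q (Some y) (Some \<zeta>) / R2.Q (Some b) (Some \<zeta>))"
        using ess_conj[OF x hn(1) ne(1)] fy(1) by (simp add: y)
      have e2: "ess (Some x) (Some x)
         (R1.sig (inv\<^bsub>PSL2\<^esub> (h n)) (Some y) * R1.Q (Some b) (Some \<zeta>') / R1.Q (Some y) (Some \<zeta>'))
         (R2.sig (inv\<^bsub>PSL2\<^esub> (h n)) (Some y) * R2.Q (Some b) (Some \<zeta>') / R2.Q (Some y) (Some \<zeta>'))"
        using ess_conj[OF x hn(2) fy(2)] ne(2) by (simp add: bk)
      have s: "R1.sig (inv\<^bsub>PSL2\<^esub> (h n)) (Some y) * R1.sig (h n) (Some b) = 1"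
        "R2.sig (inv\<^bsub>PSL2\<^esub> (h n)) (Some y) * R2.sig (h n) (Some b) = 1"
        using R1.sig_inv[OF hn(1), of "Some b"] R2.sig_inv[OF hn(1), of "Some b"] y by simp_all
      have alg: "(s * q2 / q3) * (t * q0 / q1) = (q0 / q1) / (q3 / q2)" if "s * t = 1" for s t q0 q1 q2 q3 :: real
      proof -
        have "(s * q2 / q3) * (t * q0 / q1) = (s * t) * ((q2 / q3) * (q0 / q1))" by (simp add: mult_ac)
        then show ?thesis using that by (simp add: mult_ac)
      qed
      show ?case using ess_mult[OF e1 e2] unfolding alg[OF s(1)] alg[OF s(2)] y .
    qed
  qed (intro tendsto_divide tendsto_const R1.Q_lim1[OF h(2)] R2.Q_lim1[OF h(2)]; use nz in simp)+
qed

section \<open>All pairs of positive factors occur\<close>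

lemma ess_one: "ess \<xi> \<xi> 1 1"
  using ess_orbit[OF one_in, of \<xi>] by (simp add: R1.sig_one R2.sig_one act_one)

lemma ess_power: "ess \<xi> \<xi> a b \<Longrightarrow> ess \<xi> \<xi> (a ^ n) (b ^ n)"
  by (induction n) (auto simp: ess_one intro: ess_mult)

lemma R1_Q_Some:
  "R1.Q \<alpha> (Some z) = (hx \<alpha> - z * hy \<alpha>)\<^sup>2 / (((hx \<alpha>)\<^sup>2 + (hy \<alpha>)\<^sup>2) * (1 + z\<^sup>2))"
proof -
  have m: "hx (inc_bd \<alpha>) = of_real (hx \<alpha>)" "hy (inc_bd \<alpha>) = of_real (hy \<alpha>)" by (cases \<alpha>; simp add: hx_def hy_def)+
  have n: "cmod (of_real (hx \<alpha>) - of_real z * of_real (hy \<alpha>)) = \<bar>hx \<alpha> - z * hy \<alpha>\<bar>"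
    unfolding of_real_mult[symmetric] of_real_diff[symmetric] norm_of_real ..
  have n': "hn (inc_bd \<alpha>) = (hx \<alpha>)\<^sup>2 + (hy \<alpha>)\<^sup>2" "hn (inc_bd (Some z)) = 1 + z\<^sup>2"
    unfolding hn_def m by (simp_all add: hx_def hy_def)
  have "R1.Q \<alpha> (Some z) = (cmod (of_real (hx \<alpha>) - of_real z * of_real (hy \<alpha>)))\<^sup>2 / (hn (inc_bd \<alpha>) * hn (inc_bd (Some z)))"
    unfolding R1.Q_def chord_eq m by (simp add: hx_def hy_def)
  then show ?thesis unfolding n n' by simp
qed

text \<open>Up to factors independent of \<open>z\<close>, the quotient is
  \<open>(hx \<alpha> - z * hy \<alpha>)^2 / (b - z)^2\<close>. Quadratic polynomials that are
  proportional at three points are proportional everywhere, so \<open>\<alpha>\<close> would be the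
  double root \<open>Some b\<close>.\<close>

lemma cross_ratio_nonconstant:
  assumes b: "\<alpha> \<noteq> Some b" and z: "z1 \<noteq> z2" "z1 \<noteq> z3" "z2 \<noteq> z3" "b \<notin> {z1, z2, z3}"
    and eq: "R1.Q \<alpha> (Some z1) / R1.Q (Some b) (Some z1) = C" "R1.Q \<alpha> (Some z2) / R1.Q (Some b) (Some z2) = C"
      "R1.Q \<alpha> (Some z3) / R1.Q (Some b) (Some z3) = C"
  shows False
proof -
  define p q where pq: "p = hx \<alpha>" "q = hy \<alpha>"
  define D where "D = C * (p\<^sup>2 + q\<^sup>2) / (b\<^sup>2 + 1)"
  have pq0: "p\<^sup>2 + q\<^sup>2 > 0" unfolding pq by (cases \<alpha>) (auto simp: hx_def hy_def add_nonneg_pos)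
  have *: "(p - z * q)\<^sup>2 = D * (b - z)\<^sup>2" if "z \<noteq> b" "R1.Q \<alpha> (Some z) / R1.Q (Some b) (Some z) = C" for z
  proof -
    have zb: "(b - z)\<^sup>2 > 0" "b\<^sup>2 + 1 > 0" "1 + z\<^sup>2 > 0" using that by (simp_all add: add_nonneg_pos add_pos_nonneg)
    have "R1.Q \<alpha> (Some z) = C * R1.Q (Some b) (Some z)" using that zb by (simp add: R1_Q_0 nonzero_divide_eq_eq)
    then have "(p - z * q)\<^sup>2 / ((p\<^sup>2 + q\<^sup>2) * (1 + z\<^sup>2)) = C * ((b - z)\<^sup>2 / ((b\<^sup>2 + 1) * (1 + z\<^sup>2)))"
      unfolding R1_Q_Some pq by (simp add: hx_def hy_def)
    then have "((p - z * q)\<^sup>2 / (p\<^sup>2 + q\<^sup>2)) / (1 + z\<^sup>2) = (C * (b - z)\<^sup>2 / (b\<^sup>2 + 1)) / (1 + z\<^sup>2)"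
      unfolding divide_divide_eq_left times_divide_eq_right .
    then have "(p - z * q)\<^sup>2 / (p\<^sup>2 + q\<^sup>2) = C * (b - z)\<^sup>2 / (b\<^sup>2 + 1)"
      by (rule iffD1[OF divide_cancel_right, THEN disjE]) (use zb in simp_all)
    then have "(p - z * q)\<^sup>2 = (C * (b - z)\<^sup>2 / (b\<^sup>2 + 1)) * (p\<^sup>2 + q\<^sup>2)" by (rule iffD1[OF nonzero_divide_eq_eq[OF pq0[THEN less_imp_neq, symmetric]]])
    then show ?thesis by (simp add: D_def)
  qed
  have e: "(p - z1 * q)\<^sup>2 = D * (b - z1)\<^sup>2" "(p - z2 * q)\<^sup>2 = D * (b - z2)\<^sup>2" "(p - z3 * q)\<^sup>2 = D * (b - z3)\<^sup>2"
    using *[of z1] *[of z2] *[of z3] eq z(4) by auto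
  define A B where AB: "A = q\<^sup>2 - D" "B = 2 * D * b - 2 * p * q"
  have "(z1 - z2) * (A * (z1 + z2) + B) = 0" unfolding AB using e(1,2) by algebra
  then have 1: "A * (z1 + z2) + B = 0" using z by simp
  have "(z1 - z3) * (A * (z1 + z3) + B) = 0" unfolding AB using e(1,3) by algebra
  then have 2: "A * (z1 + z3) + B = 0" using z by simp
  have "A * (z2 - z3) = 0" using 1 2 by algebra
  then have A0: "A = 0" using z by simp
  then have B0: "B = 0" using 1 by simp
  have D: "D = q\<^sup>2" "D * b = p * q" using A0 B0 AB by auto
  have "p\<^sup>2 = D * b\<^sup>2" using e(1) D by algebra
  then show False using D b unfolding pq by (cases \<alpha>) (auto simp: hx_def hy_def)
qed

text \<open>As \<open>z s\<close> tends to \<open>e\<close>, where \<open>f\<close> takes the value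
  \<open>f \<alpha>\<close>, \<open>u1\<close> has a positive limit and \<open>u2\<close> tends to
  0. Ratios at two small parameters therefore yield all pairs \<open>(1, r)\<close>. Multiplying by
  these isolates the first coordinate, which fills an interval and, by powers and inverses,
  everything.\<close>

lemma ess_all:
  assumes x: "generic \<Gamma> x" and ab: "a > 0" "b > 0"
  shows "ess (Some x) (Some x) a b"
proof -
  obtain \<xi>0 \<eta>0 where ne: "\<xi>0 \<noteq> \<eta>0" "f \<xi>0 = f \<eta>0" using f_not_inj by (elim exE conjE)
  define c where "c = f \<xi>0"
  obtain t0 where t0: "f (Some t0) \<noteq> c" using f_nonconstant by metis
  define Z where "Z = {y. f (Some y) = c}"
  have cont: "limitin bdry_top (\<lambda>n. Some (s n)) (Some l) sequentially" if "s \<longlonglongrightarrow> l" for s and l :: real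
    using limitin_Some[OF that] .
  have Zc: "closed Z" unfolding closed_sequential_limits
  proof (intro allI impI)
    fix s l assume s: "(\<forall>n. s n \<in> Z) \<and> s \<longlonglongrightarrow> l"
    have "(\<lambda>n. bdpt (f (Some (s n)))) \<longlonglongrightarrow> bdpt (f (Some l))" by (rule R2.psi_lim[OF cont]) (use s in simp)
    then have "(\<lambda>n::nat. bdpt c) \<longlonglongrightarrow> bdpt (f (Some l))" using s by (simp add: Z_def)
    then show "l \<in> Z" by (simp add: Z_def LIMSEQ_const_iff bdpt_inj)
  qed
  have "\<exists>y. y \<in> Z"
  proof (cases \<xi>0)
    case None
    then show ?thesis using ne c_def by (cases \<eta>0) (auto simp: Z_def)
  qed (auto simp: Z_def c_def)
  then have Zne: "Z \<noteq> {}" by blast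
  \<comment> \<open>A point of \<open>Z\<close> nearest to \<open>t0\<close>: between
    \<open>e\<close> and \<open>t0\<close> the segment then avoids \<open>Z\<close>.\<close>
  obtain e where e: "e \<in> Z" "\<And>y. y \<in> Z \<Longrightarrow> dist t0 e \<le> dist t0 y"
    using distance_attains_inf[OF Zc Zne, of t0] by metis
  obtain \<alpha> where al: "f \<alpha> = c" "\<alpha> \<noteq> Some e" using ne c_def by (cases "\<xi>0 = Some e") auto
  define z where "z s = e + s * (t0 - e)" for s
  have te: "t0 \<noteq> e" using t0 e(1) by (auto simp: Z_def)
  have zZ: "f (Some (z s)) \<noteq> c" if "0 < s" "s \<le> 1" for s
  proof
    assume "f (Some (z s)) = c"
    then have "z s \<in> Z" by (simp add: Z_def)
    then have "dist t0 e \<le> dist t0 (z s)" by (rule e(2))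
    also have "t0 - z s = (1 - s) * (t0 - e)" by (simp add: z_def algebra_simps)
    then have "dist t0 (z s) = (1 - s) * dist t0 e" using that by (simp add: dist_real_def abs_mult)
    finally have "s * dist t0 e \<le> 0" by (simp add: algebra_simps)
    moreover have "s * dist t0 e > 0" using that te by simp
    ultimately show False by linarith
  qed
  have zc: "isCont z s" for s unfolding z_def by (intro continuous_intros)
  have zlim: "limitin bdry_top (\<lambda>s. Some (z s)) (Some (z s0)) (at s0)" for s0
  proof -
    have "continuous_map euclidean bdry_top (Some :: real \<Rightarrow> _)" unfolding bdry_top_def by (rule continuous_map_Some)
    from continuous_map_limit[OF this, of z "z s0" "at s0"] zc show ?thesis by (simp add: o_def isCont_def)
  qed
  have Q1c: "isCont (\<lambda>s. R1.Q \<beta> (Some (z s))) s" and Q2c: "isCont (\<lambda>s. R2.Q \<beta> (Some (z s))) s" for \<beta> s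
    unfolding isCont_def using R1.Q_lim1[OF zlim] R2.Q_lim1[OF zlim] by (simp_all add: R1.Q_commute R2.Q_commute)
  have "\<exists>b0. generic \<Gamma> b0 \<and> f (Some b0) \<noteq> c"
  proof -
    have "open (- Z)" using Zc by (rule open_Compl)
    then obtain d where d: "d > 0" "ball t0 d \<subseteq> - Z" using t0 unfolding open_contains_ball Z_def by auto
    obtain b0 where b0: "b0 \<in> {t0<..<t0 + d}" "generic \<Gamma> b0" using ex_generic[of t0 "t0 + d"] d by auto
    then have "b0 \<in> ball t0 d" by (auto simp: dist_real_def)
    then show ?thesis using b0 d by (auto simp: Z_def)
  qed
  then obtain b0 where b0: "generic \<Gamma> b0" "f (Some b0) \<noteq> c" by (elim exE conjE)
  have z0: "z 0 = e" by (simp add: z_def)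
  have Qe: "R2.Q (Some b0) (Some e) \<noteq> 0" using b0 e(1) by (simp add: R2_Q_0 Z_def)
  have "\<forall>\<^sub>F s in at 0. R2.Q (Some b0) (Some (z s)) \<noteq> 0"
    using tendsto_imp_eventually_ne[OF Q2c[where \<beta> = "Some b0" and s = 0, unfolded isCont_def], of 0] Qe by (simp add: z0)
  then obtain d where d: "d > 0" "\<And>s. s \<noteq> 0 \<Longrightarrow> dist s 0 < d \<Longrightarrow> R2.Q (Some b0) (Some (z s)) \<noteq> 0"
    unfolding eventually_at by auto
  \<comment> \<open>The bound 1 keeps \<open>z s\<close> off \<open>Z\<close>, the bound
    \<open>d / 2\<close> keeps \<open>f (Some (z s))\<close> different from
    \<open>f (Some b0)\<close>.\<close>
  define s0 where "s0 = min 1 (d / 2)"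
  have s0: "s0 > 0" "s0 \<le> 1" "s0 < d" using d(1) by (auto simp: s0_def)
  define u1 where "u1 s = R1.Q \<alpha> (Some (z s)) / R1.Q (Some b0) (Some (z s))" for s
  define u2 where "u2 s = R2.Q \<alpha> (Some (z s)) / R2.Q (Some b0) (Some (z s))" for s
  have good: "f (Some b0) \<noteq> f (Some (z s))" "f \<alpha> \<noteq> f (Some (z s))" if "0 < s" "s \<le> s0" for s
  proof -
    show "f (Some b0) \<noteq> f (Some (z s))" using d(2)[of s] that s0 by (simp add: R2_Q_0)
    show "f \<alpha> \<noteq> f (Some (z s))" using zZ[of s] that s0 al by (metis order_trans)
  qed
  have b0z: "b0 \<noteq> z s" if "0 \<le> s" "s \<le> s0" for s
    using good(1)[of s] that Qe z0 R2_Q_0 by (cases "s = 0") auto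
  have alz: "\<alpha> \<noteq> Some (z s)" if "0 \<le> s" "s \<le> s0" for s
    using good(2)[of s] that al(2) z0 by (cases "s = 0") auto
  have pos1: "u1 s > 0" if "0 \<le> s" "s \<le> s0" for s
  proof -
    have "R1.Q \<alpha> (Some (z s)) > 0" "R1.Q (Some b0) (Some (z s)) > 0"
      using alz[OF that] b0z[OF that] R1_Q_0 R1.Q_nonneg by (metis option.inject order_le_less)+
    then show ?thesis by (simp add: u1_def)
  qed
  have pos2: "u2 s > 0" if "0 < s" "s \<le> s0" for s
    unfolding u2_def using good[OF that] R2.Q_pos by simp
  have u2_0: "u2 0 = 0" using al(1) e(1) z0 R2_Q_0[of \<alpha> "Some e"] by (simp add: u2_def Z_def)
  have c1: "isCont u1 s" if "0 \<le> s" "s \<le> s0" for s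
    unfolding u1_def[abs_def] using b0z[OF that] by (intro isCont_divide Q1c) (simp add: R1_Q_0)
  have c2: "isCont u2 s" if "0 \<le> s" "s \<le> s0" for s
  proof -
    have "R2.Q (Some b0) (Some (z s)) \<noteq> 0"
      using that good(1)[of s] Qe z0 R2_Q_0 by (cases "s = 0") auto
    then show ?thesis unfolding u2_def[abs_def] by (intro isCont_divide Q2c)
  qed
  have W: "ess (Some x) (Some x) (u1 s / u1 s') (u2 s / u2 s')" if "0 < s" "s \<le> s0" "0 < s'" "s' \<le> s0" for s s'
    unfolding u1_def u2_def
    by (rule ess_cross_ratio[OF x b0(1) good(1)[OF that(1,2)] good(1)[OF that(3,4)] good(2)[OF that(1,2)] good(2)[OF that(3,4)]])
  have vert: "ess (Some x) (Some x) 1 r \<and> ess (Some x) (Some x) 1 (1 / r)" if r: "0 < r" "r \<le> 1" for r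
  proof -
    define t where "t n = s0 * inverse (real (Suc n))" for n
    have t: "0 < t n" "t n \<le> s0" for n
    proof -
      show "0 < t n" using s0 by (simp add: t_def)
      have "inverse (real (Suc n)) \<le> inverse 1" by (rule le_imp_inverse_le) auto
      then show "t n \<le> s0" unfolding t_def using s0 by (intro mult_left_le) auto
    qed
    have "(\<lambda>n. s0 * inverse (real (Suc n))) \<longlonglongrightarrow> s0 * 0" by (intro tendsto_mult tendsto_const LIMSEQ_inverse_real_of_nat)
    then have t0: "t \<longlonglongrightarrow> 0" by (simp add: t_def[abs_def])
    \<comment> \<open>Intermediate values of \<open>u2\<close>, which vanishes at 0 and is positive
      at \<open>t n\<close>.\<close>
    have "\<forall>n. \<exists>s. 0 < s \<and> s \<le> t n \<and> u2 s = r * u2 (t n)"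
    proof
      fix n
      have p: "u2 (t n) > 0" by (rule pos2[OF t])
      have "\<exists>s\<ge>0. s \<le> t n \<and> u2 s = r * u2 (t n)"
      proof (rule IVT)
        show "u2 0 \<le> r * u2 (t n)" using r p by (simp add: u2_0)
        show "r * u2 (t n) \<le> u2 (t n)" using r p by (simp add: mult_le_cancel_right1)
        show "0 \<le> t n" using t[of n] by simp
        show "\<forall>s. 0 \<le> s \<and> s \<le> t n \<longrightarrow> isCont u2 s" using c2 t(2)[of n] order_trans by blast
      qed
      then obtain s where s: "s \<ge> 0" "s \<le> t n" "u2 s = r * u2 (t n)" by (elim exE conjE)
      moreover have "s \<noteq> 0" using s(3) r p u2_0 by (metis less_irrefl mult_pos_pos)
      ultimately show "\<exists>s. 0 < s \<and> s \<le> t n \<and> u2 s = r * u2 (t n)" by (intro exI[of _ s]) auto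
    qed
    then obtain s where s: "\<forall>n. 0 < s n \<and> s n \<le> t n \<and> u2 (s n) = r * u2 (t n)" by (rule choice[THEN exE])
    have ss: "0 < s n" "s n \<le> s0" for n using s t(2)[of n] order_trans by blast+
    have s_lim: "s \<longlonglongrightarrow> 0"
      by (rule tendsto_sandwich[OF _ _ tendsto_const t0]) (intro always_eventually allI; use s in \<open>simp add: less_imp_le\<close>)+
    have u10: "u1 0 > 0" using pos1[of 0] s0 by simp
    have c0: "isCont u1 0" using c1[of 0] s0 by simp
    have lims: "(\<lambda>n. u1 (s n)) \<longlonglongrightarrow> u1 0" "(\<lambda>n. u1 (t n)) \<longlonglongrightarrow> u1 0"
      by (rule isCont_tendsto_compose[OF c0 s_lim], rule isCont_tendsto_compose[OF c0 t0])
    have l1: "(\<lambda>n. u1 (s n) / u1 (t n)) \<longlonglongrightarrow> u1 0 / u1 0" "(\<lambda>n. u1 (t n) / u1 (s n)) \<longlonglongrightarrow> u1 0 / u1 0"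
      by (intro tendsto_divide lims; use u10 in simp)+
    have rat: "u2 (s n) / u2 (t n) = r" "u2 (t n) / u2 (s n) = 1 / r" for n
      using s pos2[OF t, of n] r by (simp_all add: field_simps)
    have e1: "ess (Some x) (Some x) (u1 (s n) / u1 (t n)) r" for n
      using W[OF ss t, of n n] unfolding rat .
    have e2: "ess (Some x) (Some x) (u1 (t n) / u1 (s n)) (1 / r)" for n
      using W[OF t ss, of n n] unfolding rat .
    have "ess (Some x) (Some x) (u1 0 / u1 0) r" "ess (Some x) (Some x) (u1 0 / u1 0) (1 / r)"
      by (rule ess_closed[OF always_eventually[OF allI[OF e1]] limitin_bdry_const l1(1) tendsto_const],
          rule ess_closed[OF always_eventually[OF allI[OF e2]] limitin_bdry_const l1(2) tendsto_const])
    then show ?thesis using u10 by simp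
  qed
  have vert: "ess (Some x) (Some x) 1 r" if "r > 0" for r
    using vert[of r] vert[of "1 / r"] that by (cases "r \<le> 1") auto
  have hor: "ess (Some x) (Some x) (u1 s / u1 s') 1" if "0 < s" "s \<le> s0" "0 < s'" "s' \<le> s0" for s s'
  proof -
    have "u2 s' / u2 s > 0" using pos2 that by simp
    from ess_mult[OF W[OF that] vert[OF this]] show ?thesis using pos2[of s] pos2[of s'] that by simp
  qed
  have "\<exists>s1 s2. 0 < s1 \<and> s1 \<le> s0 \<and> 0 < s2 \<and> s2 \<le> s0 \<and> u1 s1 < u1 s2"
  proof (rule ccontr)
    assume "\<not> ?thesis"
    then have cst: "u1 s = u1 s'" if "0 < s" "s \<le> s0" "0 < s'" "s' \<le> s0" for s s'
      using that by (meson linorder_neqE)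
    \<comment> \<open>Three different parameters are enough to contradict
      \<open>cross_ratio_nonconstant\<close>.\<close>
    define s1 s2 where s12: "s1 = s0 / 2" "s2 = s0 / 4"
    have zi: "z s = z s' \<longleftrightarrow> s = s'" for s s' using te by (simp add: z_def)
    show False
    proof (rule cross_ratio_nonconstant)
      show "\<alpha> \<noteq> Some b0" using al(1) b0(2) by auto
      show "z s0 \<noteq> z s1" "z s0 \<noteq> z s2" "z s1 \<noteq> z s2" using s0 by (simp_all add: zi s12)
      show "b0 \<notin> {z s0, z s1, z s2}" using b0z[of s0] b0z[of s1] b0z[of s2] s0 by (simp add: s12)
      show "R1.Q \<alpha> (Some (z s0)) / R1.Q (Some b0) (Some (z s0)) = u1 s0" by (simp add: u1_def)
      show "R1.Q \<alpha> (Some (z s1)) / R1.Q (Some b0) (Some (z s1)) = u1 s0"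
        using cst[of s1 s0] s0 unfolding u1_def[symmetric] by (simp add: s12)
      show "R1.Q \<alpha> (Some (z s2)) / R1.Q (Some b0) (Some (z s2)) = u1 s0"
        using cst[of s2 s0] s0 unfolding u1_def[symmetric] by (simp add: s12)
    qed
  qed
  then obtain s1 s2 where s12: "0 < s1" "s1 \<le> s0" "0 < s2" "s2 \<le> s0" "u1 s1 < u1 s2" by (elim exE conjE)
  have p12: "u1 s1 > 0" "u1 s2 > 0" using pos1 s12 by auto
  define R where "R = u1 s2 / u1 s1"
  have R: "R > 1" using s12 p12 by (simp add: R_def)
  have small: "ess (Some x) (Some x) r 1 \<and> ess (Some x) (Some x) (1 / r) 1" if r: "1 \<le> r" "r \<le> R" for r
  proof -
    have ul: "u1 s1 \<le> r * u1 s1" "r * u1 s1 \<le> u1 s2" using r p12 by (simp_all add: R_def pos_le_divide_eq)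
    have "\<exists>s. 0 < s \<and> s \<le> s0 \<and> u1 s = r * u1 s1"
    proof (cases "s1 \<le> s2")
      case True
      have "\<exists>s\<ge>s1. s \<le> s2 \<and> u1 s = r * u1 s1"
        by (rule IVT[where f = u1, OF ul True]) (use c1 s12 in auto)
      then show ?thesis using s12 by (elim exE conjE) (intro exI conjI, auto)
    next
      case False
      have "\<exists>s\<ge>s2. s \<le> s1 \<and> u1 s = r * u1 s1"
        by (rule IVT2[where f = u1, OF ul]) (use c1 s12 False in auto)
      then show ?thesis using s12 by (elim exE conjE) (intro exI conjI, auto)
    qed
    then obtain s where s: "0 < s" "s \<le> s0" "u1 s = r * u1 s1" by (elim exE conjE)
    have "u1 s / u1 s1 = r" "u1 s1 / u1 s = 1 / r" using s(3) p12 r by (simp_all add: field_simps)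
    then show ?thesis using hor[OF s(1,2) s12(1,2)] hor[OF s12(1,2) s(1,2)] by simp
  qed
  \<comment> \<open>\<open>small\<close> covers \<open>[1, R]\<close>. A larger \<open>r\<close> is
    the \<open>n\<close>-th power of its \<open>n\<close>-th root, which lies in that interval once
    \<open>R ^ n\<close> exceeds \<open>r\<close>.\<close>
  have hor_all: "ess (Some x) (Some x) r 1 \<and> ess (Some x) (Some x) (1 / r) 1" if r: "1 \<le> r" for r
  proof -
    obtain n where n: "r < R ^ n" using real_arch_pow[OF R] by blast
    have n0: "n > 0" using n r by (cases n) auto
    have rn: "root n r ^ n = r" using n0 r by (simp add: real_root_pow_pos2)
    have "root n r \<le> root n (R ^ n)" using n n0 by simp
    then have le: "root n r \<le> R" using n0 R by (simp add: real_root_power_cancel)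
    have ge: "1 \<le> root n r" using n0 r by simp
    from small[OF ge le] have "ess (Some x) (Some x) (root n r ^ n) (1 ^ n)" "ess (Some x) (Some x) ((1 / root n r) ^ n) (1 ^ n)"
      by (intro ess_power; simp)+
    then show ?thesis by (simp add: rn power_divide)
  qed
  have "ess (Some x) (Some x) a 1" using hor_all[of a] hor_all[of "1 / a"] ab by (cases "1 \<le> a") auto
  from ess_mult[OF this vert[OF ab(2)]] show ?thesis by simp
qed

text \<open>An orbit element brings \<open>Some x\<close> close to \<open>\<eta>\<close>; the
  factors this costs are compensated beforehand by \<open>ess_all\<close>.\<close>

lemma ess_everything:
  assumes x: "generic \<Gamma> x" and ab: "a > 0" "b > 0"
  shows "ess (Some x) \<eta> a b"
proof -
  obtain g where g: "\<forall>n. g n \<in> \<Gamma>" "limitin bdry_top (\<lambda>n. act_bdry (g n) (Some x)) \<eta> sequentially"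
    using generic_orbit_dense[OF x, of \<eta>] by (elim exE conjE)
  have "ess (Some x) (act_bdry (g n) (Some x)) a b" for n
  proof -
    have gn: "g n \<in> \<Gamma>" using g by simp
    have p: "R1.sig (g n) (Some x) > 0" "R2.sig (g n) (Some x) > 0" using R1.sig_pos[OF gn] R2.sig_pos[OF gn] by blast+
    from ess_mult[OF ess_all[OF x divide_pos_pos[OF ab(1) p(1)] divide_pos_pos[OF ab(2) p(2)]] ess_orbit[OF gn]] p
    show ?thesis by simp
  qed
  then show ?thesis by (intro ess_closed[OF always_eventually[OF allI] g(2) tendsto_const tendsto_const])
qed

end

section \<open>Convergence in the group\<close>

lemma matrix_mul_2:
  fixes A B :: "'a::field^2^2"
  shows "(A ** B)$i$j = A$i$1 * B$1$j + A$i$2 * B$2$j"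
  by (simp add: matrix_matrix_mult_def sum_2)

lemma lagrange_identity:
  "(cmod (w1 * m2 - w2 * m1))\<^sup>2 + (cmod (cnj w1 * m1 + cnj w2 * m2))\<^sup>2 =
   ((cmod w1)\<^sup>2 + (cmod w2)\<^sup>2) * ((cmod m1)\<^sup>2 + (cmod m2)\<^sup>2)"
proof -
  have "complex_of_real ((cmod (w1 * m2 - w2 * m1))\<^sup>2 + (cmod (cnj w1 * m1 + cnj w2 * m2))\<^sup>2) =
    complex_of_real (((cmod w1)\<^sup>2 + (cmod w2)\<^sup>2) * ((cmod m1)\<^sup>2 + (cmod m2)\<^sup>2))"
    unfolding of_real_add of_real_mult complex_norm_square by (simp add: algebra_simps)
  then show ?thesis unfolding of_real_eq_iff .
qed

lemma sg_None: "sg A None = (cmod (A$1$1))\<^sup>2 + (cmod (A$2$1))\<^sup>2"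
  by (simp add: sg_def hx_def hy_def hn_def)

text \<open>The entries in question are the first column of \<open>inv B ** M k\<close>.\<close>

lemma first_column_limit:
  fixes B :: "complex^2^2" and M :: "nat \<Rightarrow> complex^2^2"
  assumes det: "det B = 1" "\<And>k. det (M k) = 1"
    and lim: "(\<lambda>k. chord (mobius_bdry (M k) None) (mobius_bdry B None)) \<longlonglongrightarrow> 0" "(\<lambda>k. sg (M k) None) \<longlonglongrightarrow> sg B None"
  shows "(\<lambda>k. B$1$1 * M k$2$1 - B$2$1 * M k$1$1) \<longlonglongrightarrow> 0"
    and "(\<lambda>k. cmod (B$2$2 * M k$1$1 - B$1$2 * M k$2$1)) \<longlonglongrightarrow> 1"
proof -
  let ?c = "\<lambda>k. B$1$1 * M k$2$1 - B$2$1 * M k$1$1" and ?a = "\<lambda>k. B$2$2 * M k$1$1 - B$1$2 * M k$2$1"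
  define s where "s = sg B None"
  have s: "s > 0" unfolding s_def by (rule sg_pos[OF det(1)])
  \<comment> \<open>\<open>?c k\<close> is the determinant of the first columns of \<open>B\<close>
    and \<open>M k\<close>, so its squared modulus is \<open>chord\<close> times their squared
    lengths.\<close>
  have cn: "(cmod (?c k))\<^sup>2 = chord (mobius_bdry (M k) None) (mobius_bdry B None) * sg (M k) None * sg B None" for k
  proof -
    let ?\<alpha> = "mobius_bdry (M k) None" and ?\<beta> = "mobius_bdry B None"
    obtain l where l: "M k$1$1 = l * hx ?\<alpha>" "M k$2$1 = l * hy ?\<alpha>"
      using mobius_homog[OF det(2), of k None] by (auto simp: hx_def hy_def)
    obtain l' where l': "B$1$1 = l' * hx ?\<beta>" "B$2$1 = l' * hy ?\<beta>"
      using mobius_homog[OF det(1), of None] by (auto simp: hx_def hy_def)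
    have n: "sg (M k) None = (cmod l)\<^sup>2 * hn ?\<alpha>" "sg B None = (cmod l')\<^sup>2 * hn ?\<beta>"
      unfolding sg_None l l' hn_def by (simp_all add: norm_mult power_mult_distrib distrib_left)
    have "?c k = - (l * l') * (hx ?\<alpha> * hy ?\<beta> - hx ?\<beta> * hy ?\<alpha>)" unfolding l l' by (simp add: algebra_simps)
    then have "(cmod (?c k))\<^sup>2 = (cmod l)\<^sup>2 * (cmod l')\<^sup>2 * (cmod (hx ?\<alpha> * hy ?\<beta> - hx ?\<beta> * hy ?\<alpha>))\<^sup>2"
      by (simp add: norm_mult power_mult_distrib)
    then show ?thesis unfolding n chord_eq using hn_pos[of ?\<alpha>] hn_pos[of ?\<beta>] by simp
  qed
  have "(\<lambda>k. (cmod (?c k))\<^sup>2) \<longlonglongrightarrow> 0 * sg B None * sg B None" unfolding cn by (intro tendsto_mult lim tendsto_const)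
  then have c2: "(\<lambda>k. (cmod (?c k))\<^sup>2) \<longlonglongrightarrow> 0" by simp
  then have "(\<lambda>k. sqrt ((cmod (?c k))\<^sup>2)) \<longlonglongrightarrow> sqrt 0" by (rule tendsto_real_sqrt)
  then have "(\<lambda>k. norm (?c k)) \<longlonglongrightarrow> 0" by simp
  then show c: "?c \<longlonglongrightarrow> 0" by (rule tendsto_norm_zero_cancel)
  let ?h = "\<lambda>k. cnj (B$1$1) * M k$1$1 + cnj (B$2$1) * M k$2$1"
  have "(\<lambda>k. s * sg (M k) None - (cmod (?c k))\<^sup>2) \<longlonglongrightarrow> s * s - 0"
    by (intro tendsto_intros c2 lim(2)[folded s_def])
  moreover have "s * sg (M k) None - (cmod (?c k))\<^sup>2 = (cmod (?h k))\<^sup>2" for k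
    using lagrange_identity[of "B$1$1" "M k$2$1" "B$2$1" "M k$1$1"] unfolding s_def sg_None by (simp add: add_ac)
  ultimately have "(\<lambda>k. (cmod (?h k))\<^sup>2) \<longlonglongrightarrow> s * s" by simp
  then have "(\<lambda>k. sqrt ((cmod (?h k))\<^sup>2)) \<longlonglongrightarrow> sqrt (s * s)" by (rule tendsto_real_sqrt)
  then have h: "(\<lambda>k. cmod (?h k)) \<longlonglongrightarrow> s" using s by simp
  \<comment> \<open>The Hermitian product of the columns of \<open>B\<close>. Expanding the first
    column of \<open>M k\<close> in these columns gives
    \<open>?h k = s * ?a k + \<kappa> * ?c k\<close>.\<close>
  define \<kappa> where "\<kappa> = cnj (B$1$1) * B$1$2 + cnj (B$2$1) * B$2$2"
  have a: "cmod (?h k - \<kappa> * ?c k) = s * cmod (?a k)" for k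
  proof -
    have D: "B$1$1 * B$2$2 - B$1$2 * B$2$1 = 1" using det(1) by (simp add: det_2)
    have "?h k - \<kappa> * ?c k = (B$1$1 * cnj (B$1$1) + B$2$1 * cnj (B$2$1)) * ?a k"
      unfolding \<kappa>_def using D by algebra
    also have "B$1$1 * cnj (B$1$1) + B$2$1 * cnj (B$2$1) = complex_of_real s"
      unfolding s_def sg_None of_real_add complex_norm_square by simp
    finally show ?thesis using s by (simp add: norm_mult)
  qed
  have "(\<lambda>k. cmod (\<kappa> * ?c k)) \<longlonglongrightarrow> 0"
    using tendsto_norm[OF tendsto_mult[OF tendsto_const[of \<kappa>] c]] by simp
  then have "(\<lambda>k. cmod (?h k - \<kappa> * ?c k) - cmod (?h k)) \<longlonglongrightarrow> 0"
  proof (rule Lim_null_comparison[rotated])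
    show "\<forall>\<^sub>F k in sequentially. norm (cmod (?h k - \<kappa> * ?c k) - cmod (?h k)) \<le> cmod (\<kappa> * ?c k)"
    proof (intro always_eventually allI)
      fix k
      have "\<bar>cmod (?h k - \<kappa> * ?c k) - cmod (?h k)\<bar> \<le> cmod ((?h k - \<kappa> * ?c k) - ?h k)" by (rule norm_triangle_ineq3)
      then show "norm (cmod (?h k - \<kappa> * ?c k) - cmod (?h k)) \<le> cmod (\<kappa> * ?c k)" by simp
    qed
  qed
  from tendsto_add[OF this h] have "(\<lambda>k. s * cmod (?a k)) \<longlonglongrightarrow> s" unfolding a by simp
  then have "(\<lambda>k. s * cmod (?a k) / s) \<longlonglongrightarrow> s / s" by (rule tendsto_divide[OF _ tendsto_const]) (use s in simp)
  then show "(\<lambda>k. cmod (?a k)) \<longlonglongrightarrow> 1" using s by simp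
qed

text \<open>\<open>inv B ** M\<close> has first row \<open>a\<close>, \<open>b\<close> and lower
  left entry \<open>c\<close>. The unipotent factor clears \<open>b\<close>, the determinant then
  forces \<open>1 / a\<close> in the corner, and the diagonal factor rescales the columns.\<close>

lemma unipotent_diagonal_factorization:
  fixes B M :: "'a::field^2^2"
  defines "a \<equiv> B$2$2 * M$1$1 - B$1$2 * M$2$1" and "c \<equiv> B$1$1 * M$2$1 - B$2$1 * M$1$1"
    and "b \<equiv> B$2$2 * M$1$2 - B$1$2 * M$2$2"
  assumes det: "det B = 1" "det M = 1" and nz: "a \<noteq> 0" "\<mu> \<noteq> 0"
  shows "M ** mat2 1 (- b / a) 0 1 ** mat2 \<mu> 0 0 (1 / \<mu>) = B ** mat2 (\<mu> * a) 0 (\<mu> * c) (1 / (\<mu> * a))"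
proof -
  define t where "t = - b / a"
  define u where "u = 1 / a"
  define v where "v = 1 / \<mu>"
  have h: "a * t = - b" "a * u = 1" using nz by (simp_all add: t_def u_def)
  have w: "1 / (\<mu> * a) = v * u" by (simp add: u_def v_def)
  have D: "B$1$1 * B$2$2 - B$1$2 * B$2$1 = 1" "M$1$1 * M$2$2 - M$1$2 * M$2$1 = 1" using det by (simp_all add: det_2)
  have 1: "M$1$1 * t + M$1$2 = B$1$2 * u" "M$2$1 * t + M$2$2 = B$2$2 * u"
  proof -
    have "a * (M$1$1 * t + M$1$2) = B$1$2" "a * (M$2$1 * t + M$2$2) = B$2$2"
      using h(1) D unfolding a_def b_def by algebra+
    moreover have "X = Y * u" if "a * X = Y" for X Y
    proof -
      have "Y * u = (a * u) * X" unfolding that[symmetric] by (simp only: mult_ac)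
      then show ?thesis using h(2) by simp
    qed
    ultimately show "M$1$1 * t + M$1$2 = B$1$2 * u" "M$2$1 * t + M$2$2 = B$2$2 * u" by blast+
  qed
  have 2: "M$1$1 = B$1$1 * a + B$1$2 * c" "M$2$1 = B$2$1 * a + B$2$2 * c"
    using D unfolding a_def c_def by algebra+
  show ?thesis
    unfolding t_def[symmetric] w v_def[symmetric] vec_eq_iff forall_2 matrix_mul_2 mat2_nth
  proof (intro conjI)
    show "(M$1$1 * 1 + M$1$2 * 0) * \<mu> + (M$1$1 * t + M$1$2 * 1) * 0 = B$1$1 * (\<mu> * a) + B$1$2 * (\<mu> * c)"
      "(M$2$1 * 1 + M$2$2 * 0) * \<mu> + (M$2$1 * t + M$2$2 * 1) * 0 = B$2$1 * (\<mu> * a) + B$2$2 * (\<mu> * c)"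
      using 2 by algebra+
    show "(M$1$1 * 1 + M$1$2 * 0) * 0 + (M$1$1 * t + M$1$2 * 1) * v = B$1$1 * 0 + B$1$2 * (v * u)"
      "(M$2$1 * 1 + M$2$2 * 0) * 0 + (M$2$1 * t + M$2$2 * 1) * v = B$2$1 * 0 + B$2$2 * (v * u)"
      using 1 by algebra+
  qed
qed

lemma eventually_psl_in_open:
  fixes U :: "('a::real_normed_field^2^2) set set" and B :: "'a^2^2"
  assumes U: "openin PSL2_top U" "psl B \<in> U" and B: "det B = 1"
    and lim: "p \<longlonglongrightarrow> 1" "r \<longlonglongrightarrow> 0" "s \<longlonglongrightarrow> 1" and ev: "\<forall>\<^sub>F k in sequentially. p k * s k = 1"
  shows "\<forall>\<^sub>F k in sequentially. psl (B ** mat2 (p k) 0 (r k) (s k)) \<in> U"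
proof -
  have sub: "U \<subseteq> carrier PSL2" and op: "openin (top_of_set {A. det A = 1}) (\<Union>U)" using U(1) by (simp_all add: openin_PSL2_top)
  obtain T where T: "open T" "\<Union>U = {A. det A = 1} \<inter> T" using op unfolding openin_open by blast
  have "B \<in> \<Union>U" using U(2) by (auto simp: psl_eq)
  then have BT: "B \<in> T" using T by blast
  have "(\<lambda>k. B ** mat2 (p k) 0 (r k) (s k)) \<longlonglongrightarrow> B"
  proof (rule vec_tendstoI, rule vec_tendstoI)
    fix i j :: 2
    have "(\<lambda>k. B$i$1 * p k + B$i$2 * r k) \<longlonglongrightarrow> B$i$1 * 1 + B$i$2 * 0" "(\<lambda>k. B$i$1 * 0 + B$i$2 * s k) \<longlonglongrightarrow> B$i$1 * 0 + B$i$2 * 1"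
      by (intro tendsto_intros lim)+
    then show "(\<lambda>k. (B ** mat2 (p k) 0 (r k) (s k)) $ i $ j) \<longlonglongrightarrow> B $ i $ j"
      using exhaust_2[of j] unfolding matrix_mul_2 by auto
  qed
  then have "\<forall>\<^sub>F k in sequentially. B ** mat2 (p k) 0 (r k) (s k) \<in> T" by (rule topological_tendstoD[OF _ T(1) BT])
  then show ?thesis using ev
  proof eventually_elim
    case (elim k)
    have "det (mat2 (p k) 0 (r k) (s k)) = 1" using elim(2) by (simp add: det_2)
    then have "det (B ** mat2 (p k) 0 (r k) (s k)) = 1" using B by (simp add: det_mul)
    then have "B ** mat2 (p k) 0 (r k) (s k) \<in> \<Union>U" using elim(1) T(2) by blast
    from Union_PSL2[OF this sub] show ?case by simp
  qed
qed

text \<open>Only the absolute value of \<open>a\<close> is known to tend to 1. Correcting its sign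
  costs a diagonal matrix equal to plus or minus the identity, which is trivial in
  \<open>PSL2\<close>; so \<open>MM\<close> can be trivial in the real factor.\<close>

lemma eventually_unipotent_real:
  fixes B :: "real^2^2" and M :: "nat \<Rightarrow> real^2^2"
  assumes det: "det B = 1" "\<And>k. det (M k) = 1" and U: "openin PSL2_top U" "psl B \<in> U"
    and lim: "(\<lambda>k. chord (inc_bd (mobius_bdry (M k) None)) (inc_bd (mobius_bdry B None))) \<longlonglongrightarrow> 0"
      "(\<lambda>k. sg (cmat (M k)) None) \<longlonglongrightarrow> sg (cmat B) None"
  shows "\<forall>\<^sub>F k in sequentially. \<exists>n\<in>unipotent_PSL2. psl (M k) \<otimes>\<^bsub>PSL2\<^esub> n \<in> U"
proof -
  let ?c = "\<lambda>k. B$1$1 * M k$2$1 - B$2$1 * M k$1$1" and ?a = "\<lambda>k. B$2$2 * M k$1$1 - B$1$2 * M k$2$1"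
  have inN: "inc_bd None = None" by simp
  have mb: "mobius_bdry (cmat C) None = inc_bd (mobius_bdry C None)" if "det C = 1" for C
    using mobius_bdry_cmat[of C None] that by simp
  have l1: "(\<lambda>k. chord (mobius_bdry (cmat (M k)) None) (mobius_bdry (cmat B) None)) \<longlonglongrightarrow> 0"
    using lim(1) by (simp add: mb det)
  have dc: "det (cmat B) = 1" "\<And>k. det (cmat (M k)) = 1" by (simp_all add: det_cmat det)
  note fc = first_column_limit[OF dc l1 lim(2)]
  have cc: "(\<lambda>k. complex_of_real (?c k)) \<longlonglongrightarrow> of_real 0"
    using fc(1) by (simp add: cmat_def)
  have c: "?c \<longlonglongrightarrow> 0" by (rule tendsto_of_real_iff[THEN iffD1, OF cc])
  have "(\<lambda>k. cmod (of_real (?a k))) \<longlonglongrightarrow> 1" using fc(2) by (simp add: cmat_def)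
  then have a: "(\<lambda>k. \<bar>?a k\<bar>) \<longlonglongrightarrow> 1" unfolding norm_of_real .
  have a0: "\<forall>\<^sub>F k in sequentially. \<bar>?a k\<bar> \<noteq> 0" by (rule tendsto_imp_eventually_ne[OF a]) simp
  have sc: "(\<lambda>k. sgn (?a k) * ?c k) \<longlonglongrightarrow> 0"
  proof (rule Lim_null_comparison[OF _ tendsto_norm_zero[OF c]])
    show "\<forall>\<^sub>F k in sequentially. norm (sgn (?a k) * ?c k) \<le> norm (?c k)"
      by (intro always_eventually allI) (simp add: abs_mult sgn_if)
  qed
  have inv: "(\<lambda>k. 1 / \<bar>?a k\<bar>) \<longlonglongrightarrow> 1" using tendsto_divide[OF tendsto_const a, of 1] by simp
  have ps: "\<forall>\<^sub>F k in sequentially. \<bar>?a k\<bar> * (1 / \<bar>?a k\<bar>) = 1" using a0 by eventually_elim simp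
  have "\<forall>\<^sub>F k in sequentially. psl (B ** mat2 \<bar>?a k\<bar> 0 (sgn (?a k) * ?c k) (1 / \<bar>?a k\<bar>)) \<in> U"
    by (rule eventually_psl_in_open[OF U det(1) a sc inv ps])
  then show ?thesis using a0
  proof eventually_elim
    case (elim k)
    let ?\<mu> = "sgn (?a k)" and ?b = "B$2$2 * M k$1$2 - B$1$2 * M k$2$2"
    let ?N = "mat2 1 (- ?b / ?a k) 0 1"
    have mu: "?\<mu> \<noteq> 0" "?\<mu> * ?a k = \<bar>?a k\<bar>" using elim(2) by (auto simp: sgn_if)
    have "M k ** ?N ** mat2 ?\<mu> 0 0 (1 / ?\<mu>) = B ** mat2 (?\<mu> * ?a k) 0 (?\<mu> * ?c k) (1 / (?\<mu> * ?a k))"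
      by (rule unipotent_diagonal_factorization[OF det(1) det(2)]) (use elim(2) mu in auto)
    then have "psl (M k ** ?N ** mat2 ?\<mu> 0 0 (1 / ?\<mu>)) \<in> U" using elim(1) unfolding mu(2) by simp
    moreover have "psl (M k ** ?N ** mat2 ?\<mu> 0 0 (1 / ?\<mu>)) = psl (M k ** ?N)"
    proof -
      have "mat2 ?\<mu> 0 0 (1 / ?\<mu>) = mat 1 \<or> mat2 ?\<mu> 0 0 (1 / ?\<mu>) = - mat 1"
        using elim(2) by (auto simp: vec_eq_iff forall_2 mat_def sgn_if)
      then show ?thesis by (auto simp: matrix_mul_uminus_one psl_eq)
    qed
    moreover have "psl (M k) \<otimes>\<^bsub>PSL2\<^esub> psl ?N = psl (M k ** ?N)" by (rule mult_psl[OF det(2)]) (simp add: det_2)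
    ultimately show ?case by (intro bexI[of _ "psl ?N"]) (auto simp: unipotent_PSL2_def)
  qed
qed

lemma cis_minus_Arg_mult: "cis (- Arg z) * z = of_real (cmod z)"
proof -
  have "cis (- Arg z) * (of_real (cmod z) * cis (Arg z)) = of_real (cmod z) * (cis (- Arg z) * cis (Arg z))"
    by (simp only: mult_ac)
  also have "\<dots> = of_real (cmod z)" by (simp add: cis_mult)
  finally show ?thesis unfolding rcis_cmod_Arg[of z, unfolded rcis_def] .
qed

text \<open>The argument of \<open>a\<close> is not controlled by the conformal factors. It is
  removed by the rotation through \<open>- Arg a\<close>, which is where \<open>MM\<close>
  enters.\<close>

lemma eventually_unipotent_complex:
  fixes B :: "complex^2^2" and M :: "nat \<Rightarrow> complex^2^2"
  assumes det: "det B = 1" "\<And>k. det (M k) = 1" and U: "openin PSL2_top U" "psl B \<in> U"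
    and lim: "(\<lambda>k. chord (mobius_bdry (M k) None) (mobius_bdry B None)) \<longlonglongrightarrow> 0" "(\<lambda>k. sg (M k) None) \<longlonglongrightarrow> sg B None"
  shows "\<forall>\<^sub>F k in sequentially. \<exists>n\<in>unipotent_PSL2. \<exists>\<theta>. psl (M k) \<otimes>\<^bsub>PSL2\<^esub> n \<otimes>\<^bsub>PSL2\<^esub> psl (mat2 (cis \<theta>) 0 0 (cis (- \<theta>))) \<in> U"
proof -
  let ?c = "\<lambda>k. B$1$1 * M k$2$1 - B$2$1 * M k$1$1" and ?a = "\<lambda>k. B$2$2 * M k$1$1 - B$1$2 * M k$2$1"
  note fc = first_column_limit[OF det lim]
  have a0: "\<forall>\<^sub>F k in sequentially. cmod (?a k) \<noteq> 0" by (rule tendsto_imp_eventually_ne[OF fc(2)]) simp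
  have ac: "(\<lambda>k. complex_of_real (cmod (?a k))) \<longlonglongrightarrow> 1" using tendsto_of_real[OF fc(2)] by simp
  have sc: "(\<lambda>k. cis (- Arg (?a k)) * ?c k) \<longlonglongrightarrow> 0"
    by (rule Lim_null_comparison[OF _ tendsto_norm_zero[OF fc(1)]]) (simp add: norm_mult)
  have inv: "(\<lambda>k. 1 / complex_of_real (cmod (?a k))) \<longlonglongrightarrow> 1" using tendsto_divide[OF tendsto_const ac, of 1] by simp
  have ps: "\<forall>\<^sub>F k in sequentially. complex_of_real (cmod (?a k)) * (1 / complex_of_real (cmod (?a k))) = 1"
    using a0 by eventually_elim simp
  have "\<forall>\<^sub>F k in sequentially. psl (B ** mat2 (of_real (cmod (?a k))) 0 (cis (- Arg (?a k)) * ?c k) (1 / of_real (cmod (?a k)))) \<in> U"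
    by (rule eventually_psl_in_open[OF U det(1) ac sc inv ps])
  then show ?thesis using a0
  proof eventually_elim
    case (elim k)
    let ?\<mu> = "cis (- Arg (?a k))" and ?b = "B$2$2 * M k$1$2 - B$1$2 * M k$2$2"
    let ?N = "mat2 1 (- ?b / ?a k) 0 1" and ?D = "mat2 (cis (- Arg (?a k))) 0 0 (cis (- (- Arg (?a k))))"
    have mu: "?\<mu> * ?a k = of_real (cmod (?a k))" by (rule cis_minus_Arg_mult)
    have D: "?D = mat2 ?\<mu> 0 0 (1 / ?\<mu>)" by (simp add: vec_eq_iff forall_2 divide_inverse)
    have "M k ** ?N ** ?D = B ** mat2 (?\<mu> * ?a k) 0 (?\<mu> * ?c k) (1 / (?\<mu> * ?a k))"
      unfolding D by (rule unipotent_diagonal_factorization[OF det(1) det(2)]) (use elim(2) in auto)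
    then have "psl (M k ** ?N ** ?D) \<in> U" using elim(1) unfolding mu by simp
    moreover have "psl (M k) \<otimes>\<^bsub>PSL2\<^esub> psl ?N \<otimes>\<^bsub>PSL2\<^esub> psl ?D = psl (M k ** ?N ** ?D)"
    proof -
      have dN: "det ?N = 1" and dD: "det ?D = 1" by (simp_all add: det_2 cis_mult)
      have dMN: "det (M k ** ?N) = 1" unfolding det_mul det(2) dN by simp
      show ?thesis unfolding mult_psl[OF det(2) dN] mult_psl[OF dMN dD] ..
    qed
    moreover have "psl ?N \<in> unipotent_PSL2" by (auto simp: unipotent_PSL2_def)
    ultimately show ?case by (intro bexI[of _ "psl ?N"] exI[of _ "- Arg (?a k)"]) simp_all
  qed
qed

section \<open>Density of the orbits\<close>

lemma group_GG: "group GG"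
  unfolding GG_def by (rule DirProd_group) (rule group_PSL2)+

lemma carrier_GG: "carrier GG = carrier PSL2 \<times> carrier PSL2"
  by (simp add: GG_def)

lemma mult_GG: "(a, b) \<otimes>\<^bsub>GG\<^esub> (c, d) = (a \<otimes>\<^bsub>PSL2\<^esub> c, b \<otimes>\<^bsub>PSL2\<^esub> d)"
  by (simp add: GG_def)

lemma topspace_GG_top: "topspace GG_top = carrier GG"
  by (simp add: GG_top_def carrier_GG topspace_PSL2_top)

lemma unipotent_carrier: "unipotent_PSL2 \<subseteq> (carrier PSL2 :: ('a::field^2^2) set set)"
  by (auto simp: unipotent_PSL2_def det_2)

lemma unipotent_upper: "unipotent_PSL2 \<subseteq> (upper_PSL2 :: ('a::field^2^2) set set)"
proof
  fix g :: "('a^2^2) set" assume "g \<in> unipotent_PSL2"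
  then obtain b where "g = psl (mat2 1 b 0 1)" by (auto simp: unipotent_PSL2_def)
  then show "g \<in> upper_PSL2" unfolding upper_PSL2_def by (intro CollectI exI[of _ 1] exI[of _ b]) simp
qed

lemma MM_cases:
  assumes "m \<in> MM"
  obtains d where "m = (\<one>\<^bsub>PSL2\<^esub>, d)" "d \<in> carrier PSL2" "d \<in> upper_PSL2"
proof -
  obtain \<theta> where "m = (\<one>\<^bsub>PSL2\<^esub>, psl (mat2 (cis \<theta>) 0 0 (cis (- \<theta>))))" using assms by (auto simp: MM_def)
  moreover have "psl (mat2 (cis \<theta>) 0 0 (cis (- \<theta>))) \<in> carrier PSL2" by (simp add: det_2 cis_mult)
  moreover have "psl (mat2 (cis \<theta>) 0 0 (cis (- \<theta>))) \<in> upper_PSL2"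
    unfolding upper_PSL2_def by (intro CollectI exI[of _ "cis \<theta>"] exI[of _ 0] exI[of _ "cis (- \<theta>)"]) (simp add: cis_mult)
  ultimately show thesis by (rule that)
qed

text \<open>\<open>NN\<close> and \<open>MM\<close> consist of classes of upper triangular matrices,
  which fix infinity.\<close>

lemma NM_in:
  assumes g: "g \<in> carrier GG" and n: "n \<in> NN" and m: "m \<in> MM"
  shows "g \<otimes>\<^bsub>GG\<^esub> n \<otimes>\<^bsub>GG\<^esub> m \<in> carrier GG"
    and "GP_point (g \<otimes>\<^bsub>GG\<^esub> n \<otimes>\<^bsub>GG\<^esub> m <#\<^bsub>GG\<^esub> PP) = GP_point (g <#\<^bsub>GG\<^esub> PP)"
proof -
  obtain g1 g2 where g12: "g = (g1, g2)" "g1 \<in> carrier PSL2" "g2 \<in> carrier PSL2" using g by (auto simp: carrier_GG)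
  obtain n1 n2 where n12: "n = (n1, n2)" "n1 \<in> unipotent_PSL2" "n2 \<in> unipotent_PSL2" using n by (auto simp: NN_def)
  obtain d where d: "m = (\<one>\<^bsub>PSL2\<^esub>, d)" "d \<in> carrier PSL2" "d \<in> upper_PSL2" using m by (rule MM_cases)
  have nc: "n1 \<in> carrier PSL2" "n2 \<in> carrier PSL2" "n1 \<in> upper_PSL2" "n2 \<in> upper_PSL2"
    using n12 unipotent_carrier unipotent_upper by blast+
  have eq: "g \<otimes>\<^bsub>GG\<^esub> n \<otimes>\<^bsub>GG\<^esub> m = (g1 \<otimes>\<^bsub>PSL2\<^esub> n1, g2 \<otimes>\<^bsub>PSL2\<^esub> n2 \<otimes>\<^bsub>PSL2\<^esub> d)"
    unfolding g12 n12 d mult_GG using g12 nc by simp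
  have c: "g1 \<otimes>\<^bsub>PSL2\<^esub> n1 \<in> carrier PSL2" "g2 \<otimes>\<^bsub>PSL2\<^esub> n2 \<in> carrier PSL2" "g2 \<otimes>\<^bsub>PSL2\<^esub> n2 \<otimes>\<^bsub>PSL2\<^esub> d \<in> carrier PSL2"
    using g12 nc d by simp_all
  show "g \<otimes>\<^bsub>GG\<^esub> n \<otimes>\<^bsub>GG\<^esub> m \<in> carrier GG" unfolding eq carrier_GG using c by simp
  show "GP_point (g \<otimes>\<^bsub>GG\<^esub> n \<otimes>\<^bsub>GG\<^esub> m <#\<^bsub>GG\<^esub> PP) = GP_point (g <#\<^bsub>GG\<^esub> PP)"
    unfolding eq GP_point_coset[OF c(1,3)] unfolding g12(1) GP_point_coset[OF g12(2,3)]
    using act_bdry_upper[OF g12(2) nc(3)] act_bdry_upper[OF g12(3) nc(4)] act_bdry_upper[OF c(2) d(3)] by simp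
qed

context ct_setting
begin

lemma subgroup_Gamma_graph: "subgroup (Gamma_graph \<Gamma> \<rho>) GG"
proof -
  interpret GG: group GG by (rule group_GG)
  have mult: "(\<gamma>, \<rho> \<gamma>) \<otimes>\<^bsub>GG\<^esub> (\<delta>, \<rho> \<delta>) = (\<gamma> \<otimes>\<^bsub>PSL2\<^esub> \<delta>, \<rho> (\<gamma> \<otimes>\<^bsub>PSL2\<^esub> \<delta>))" if "\<gamma> \<in> \<Gamma>" "\<delta> \<in> \<Gamma>" for \<gamma> \<delta>
    using R2.r_mult[OF that] by (simp add: mult_GG)
  have one: "(\<one>\<^bsub>PSL2\<^esub>, \<rho> \<one>\<^bsub>PSL2\<^esub>) = \<one>\<^bsub>GG\<^esub>" by (simp add: GG_def R2.r_one)
  have car: "(\<gamma>, \<rho> \<gamma>) \<in> carrier GG" if "\<gamma> \<in> \<Gamma>" for \<gamma> using that by (simp add: carrier_GG)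
  show ?thesis
  proof (rule GG.subgroupI)
    show "Gamma_graph \<Gamma> \<rho> \<subseteq> carrier GG" using car by (auto simp: Gamma_graph_def)
    show "Gamma_graph \<Gamma> \<rho> \<noteq> {}" using one_in unfolding Gamma_graph_def by blast
    fix a assume "a \<in> Gamma_graph \<Gamma> \<rho>"
    then obtain \<gamma> where a: "a = (\<gamma>, \<rho> \<gamma>)" "\<gamma> \<in> \<Gamma>" by (auto simp: Gamma_graph_def)
    let ?i = "inv\<^bsub>PSL2\<^esub> \<gamma>"
    have i: "?i \<in> \<Gamma>" using a by simp
    have "(?i, \<rho> ?i) \<otimes>\<^bsub>GG\<^esub> a = \<one>\<^bsub>GG\<^esub>" unfolding a(1) mult[OF i a(2)] using a(2) one by (simp add: PSL2.l_inv)
    then have "inv\<^bsub>GG\<^esub> a = (?i, \<rho> ?i)" by (rule GG.inv_equality) (use car a i in simp_all)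
    then show "inv\<^bsub>GG\<^esub> a \<in> Gamma_graph \<Gamma> \<rho>" using i by (auto simp: Gamma_graph_def)
    fix b assume "b \<in> Gamma_graph \<Gamma> \<rho>"
    then obtain \<delta> where b: "b = (\<delta>, \<rho> \<delta>)" "\<delta> \<in> \<Gamma>" by (auto simp: Gamma_graph_def)
    show "a \<otimes>\<^bsub>GG\<^esub> b \<in> Gamma_graph \<Gamma> \<rho>"
      unfolding a(1) b(1) mult[OF a(2) b(2)] using mult_in[OF a(2) b(2)] by (auto simp: Gamma_graph_def)
  qed
qed

lemma orbit_approximation:
  assumes x: "generic \<Gamma> x" and g: "g1 \<in> carrier PSL2" "g2 \<in> carrier PSL2" "act_bdry g1 None = Some x" "act_bdry g2 None = f (Some x)"
    and h: "h1 \<in> carrier PSL2" "h2 \<in> carrier PSL2" "act_bdry h2 None = f (act_bdry h1 None)"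
    and W: "openin GG_top W" "(h1, h2) \<in> W"
  shows "\<exists>\<gamma>\<in>\<Gamma>. \<exists>n\<in>NN. \<exists>m\<in>MM. (\<gamma>, \<rho> \<gamma>) \<otimes>\<^bsub>GG\<^esub> ((g1, g2) \<otimes>\<^bsub>GG\<^esub> n \<otimes>\<^bsub>GG\<^esub> m) \<in> W"
proof -
  obtain U V where UV: "openin PSL2_top U" "openin PSL2_top V" "h1 \<in> U" "h2 \<in> V" "U \<times> V \<subseteq> W"
    using W unfolding GG_top_def openin_prod_topology_alt by metis
  define A1 where "A1 = rep g1"
  define A2 where "A2 = rep g2"
  define B1 where "B1 = rep h1"
  define B2 where "B2 = rep h2"
  have AB: "det A1 = 1" "det A2 = 1" "det B1 = 1" "det B2 = 1" "psl A1 = g1" "psl A2 = g2" "psl B1 = h1" "psl B2 = h2"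
    unfolding A1_def A2_def B1_def B2_def using rep_spec g(1,2) h(1,2) by auto
  define \<eta> where "\<eta> = act_bdry h1 None"
  have bd: "mobius_bdry A1 None = Some x" "mobius_bdry A2 None = f (Some x)" "mobius_bdry B1 None = \<eta>" "mobius_bdry B2 None = f \<eta>"
    using g h by (simp_all add: A1_def A2_def B1_def B2_def \<eta>_def act_bdry_rep)
  let ?sA1 = "sg (cmat A1) None" and ?sA2 = "sg A2 None" and ?sB1 = "sg (cmat B1) None" and ?sB2 = "sg B2 None"
  have sp: "?sA1 > 0" "?sA2 > 0" "?sB1 > 0" "?sB2 > 0" by (rule sg_pos; simp add: det_cmat AB)+
  \<comment> \<open>\<open>sg\<close> at infinity is the squared length of the first column. The
    prescribed limits make these lengths for \<open>\<gamma> k\<close> times \<open>g1\<close> and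
    \<open>\<rho> (\<gamma> k)\<close> times \<open>g2\<close> tend to those for \<open>h1\<close>
    and \<open>h2\<close>.\<close>
  obtain \<gamma> where \<gamma>: "\<forall>n. \<gamma> n \<in> \<Gamma>" and lim: "limitin bdry_top (\<lambda>n. act_bdry (\<gamma> n) (Some x)) \<eta> sequentially"
     "(\<lambda>n. R1.sig (\<gamma> n) (Some x)) \<longlonglongrightarrow> ?sB1 / ?sA1" "(\<lambda>n. R2.sig (\<gamma> n) (Some x)) \<longlonglongrightarrow> ?sB2 / ?sA2"
    using ess_everything[OF x divide_pos_pos[OF sp(3,1)] divide_pos_pos[OF sp(4,2)], of \<eta>]
    unfolding ess_iff_sequence by (elim exE conjE)
  have gG: "\<gamma> k \<in> \<Gamma>" for k using \<gamma> by simp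
  define C1 where "C1 k = rep (\<gamma> k)" for k
  define C2 where "C2 k = rep (\<rho> (\<gamma> k))" for k
  have C: "det (C1 k) = 1" "det (C2 k) = 1" "psl (C1 k) = \<gamma> k" "psl (C2 k) = \<rho> (\<gamma> k)" for k
    unfolding C1_def C2_def using rep_spec[OF in_carrier[OF gG]] rep_spec[OF R2.r_carrier[OF gG]] by auto
  define M1 where "M1 k = C1 k ** A1" for k
  define M2 where "M2 k = C2 k ** A2" for k
  have dM: "det (M1 k) = 1" "det (M2 k) = 1" for k unfolding M1_def M2_def by (simp_all add: det_mul C AB)
  have m1: "mobius_bdry (M1 k) None = act_bdry (\<gamma> k) (Some x)" for k
    unfolding M1_def mobius_bdry_mult[OF C(1) AB(1)] bd C(3)[symmetric] act_psl ..
  have m2: "mobius_bdry (M2 k) None = f (act_bdry (\<gamma> k) (Some x))" for k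
    unfolding M2_def mobius_bdry_mult[OF C(2) AB(2)] bd R2.psi_act[OF gG] C(4)[symmetric] act_psl ..
  have s1: "sg (cmat (M1 k)) None = R1.sig (\<gamma> k) (Some x) * ?sA1" for k
  proof -
    have d: "det (cmat (C1 k)) = 1" "det (cmat A1) = 1" by (simp_all add: det_cmat C AB)
    have mA: "mobius_bdry (cmat A1) None = inc_bd (Some x)" using mobius_bdry_cmat[of A1 None] bd(1) by simp
    have "R1.sig (\<gamma> k) (Some x) = sg (cmat (C1 k)) (inc_bd (Some x))"
      unfolding R1.sig_def C(3)[of k, symmetric] cpsl_psl[OF C(1)] sgp_psl[OF d(1)] ..
    then show ?thesis unfolding M1_def cmat_mult sg_mult[OF d] mA by simp
  qed
  have s2: "sg (M2 k) None = R2.sig (\<gamma> k) (Some x) * ?sA2" for k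
    unfolding M2_def sg_mult[OF C(2) AB(2)] bd R2.sig_def C(4)[of k, symmetric] sgp_psl[OF C(2)] ..
  have "(\<lambda>k. chord (inc_bd (act_bdry (\<gamma> k) (Some x))) (inc_bd \<eta>)) \<longlonglongrightarrow> 0"
    using lim(1) unfolding limitin_bdry_real tendsto_bdpt_iff_chord .
  then have l1: "(\<lambda>k. chord (inc_bd (mobius_bdry (M1 k) None)) (inc_bd (mobius_bdry B1 None))) \<longlonglongrightarrow> 0" unfolding m1 bd .
  have "(\<lambda>k. chord (f (act_bdry (\<gamma> k) (Some x))) (f \<eta>)) \<longlonglongrightarrow> 0"
    using R2.psi_lim[OF lim(1)] unfolding tendsto_bdpt_iff_chord .
  then have l2: "(\<lambda>k. chord (mobius_bdry (M2 k) None) (mobius_bdry B2 None)) \<longlonglongrightarrow> 0" unfolding m2 bd .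
  have n1: "(\<lambda>k. sg (cmat (M1 k)) None) \<longlonglongrightarrow> ?sB1"
    unfolding s1 using tendsto_mult[OF lim(2) tendsto_const[of ?sA1]] sp by simp
  have n2: "(\<lambda>k. sg (M2 k) None) \<longlonglongrightarrow> ?sB2"
    unfolding s2 using tendsto_mult[OF lim(3) tendsto_const[of ?sA2]] sp by simp
  have "\<forall>\<^sub>F k in sequentially. \<exists>n\<in>unipotent_PSL2. psl (M1 k) \<otimes>\<^bsub>PSL2\<^esub> n \<in> U"
    by (rule eventually_unipotent_real[OF AB(3) dM(1) UV(1) _ l1 n1]) (simp add: AB UV)
  moreover have "\<forall>\<^sub>F k in sequentially. \<exists>n\<in>unipotent_PSL2. \<exists>\<theta>. psl (M2 k) \<otimes>\<^bsub>PSL2\<^esub> n \<otimes>\<^bsub>PSL2\<^esub> psl (mat2 (cis \<theta>) 0 0 (cis (- \<theta>))) \<in> V"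
    by (rule eventually_unipotent_complex[OF AB(4) dM(2) UV(2) _ l2 n2]) (simp add: AB UV)
  ultimately have "\<forall>\<^sub>F k in sequentially. (\<exists>n\<in>unipotent_PSL2. psl (M1 k) \<otimes>\<^bsub>PSL2\<^esub> n \<in> U) \<and>
      (\<exists>n\<in>unipotent_PSL2. \<exists>\<theta>. psl (M2 k) \<otimes>\<^bsub>PSL2\<^esub> n \<otimes>\<^bsub>PSL2\<^esub> psl (mat2 (cis \<theta>) 0 0 (cis (- \<theta>))) \<in> V)"
    by (rule eventually_conj)
  then have "\<exists>k. (\<exists>n\<in>unipotent_PSL2. psl (M1 k) \<otimes>\<^bsub>PSL2\<^esub> n \<in> U) \<and>
      (\<exists>n\<in>unipotent_PSL2. \<exists>\<theta>. psl (M2 k) \<otimes>\<^bsub>PSL2\<^esub> n \<otimes>\<^bsub>PSL2\<^esub> psl (mat2 (cis \<theta>) 0 0 (cis (- \<theta>))) \<in> V)"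
    by (rule eventually_happens'[OF sequentially_bot])
  then obtain k n1 n2 \<theta> where k: "n1 \<in> unipotent_PSL2" "psl (M1 k) \<otimes>\<^bsub>PSL2\<^esub> n1 \<in> U"
    "n2 \<in> unipotent_PSL2" "psl (M2 k) \<otimes>\<^bsub>PSL2\<^esub> n2 \<otimes>\<^bsub>PSL2\<^esub> psl (mat2 (cis \<theta>) 0 0 (cis (- \<theta>))) \<in> V"
    by (elim exE conjE bexE)
  let ?d = "psl (mat2 (cis \<theta>) 0 0 (cis (- \<theta>)))"
  have dc: "?d \<in> carrier PSL2" by (simp add: det_2 cis_mult)
  have nc: "n1 \<in> carrier PSL2" "n2 \<in> carrier PSL2" using k unipotent_carrier by blast+
  have rc: "\<gamma> k \<in> carrier PSL2" "\<rho> (\<gamma> k) \<in> carrier PSL2" using gG[of k] by simp_all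
  have pM: "psl (M1 k) = \<gamma> k \<otimes>\<^bsub>PSL2\<^esub> g1" "psl (M2 k) = \<rho> (\<gamma> k) \<otimes>\<^bsub>PSL2\<^esub> g2"
    unfolding M1_def M2_def using mult_psl[OF C(1) AB(1), of k] mult_psl[OF C(2) AB(2), of k] by (simp_all add: C AB)
  have "(\<gamma> k, \<rho> (\<gamma> k)) \<otimes>\<^bsub>GG\<^esub> ((g1, g2) \<otimes>\<^bsub>GG\<^esub> (n1, n2) \<otimes>\<^bsub>GG\<^esub> (\<one>\<^bsub>PSL2\<^esub>, ?d)) =
     (psl (M1 k) \<otimes>\<^bsub>PSL2\<^esub> n1, psl (M2 k) \<otimes>\<^bsub>PSL2\<^esub> n2 \<otimes>\<^bsub>PSL2\<^esub> ?d)"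
    unfolding mult_GG pM using g(1,2) nc rc dc by (simp add: PSL2.m_assoc)
  also have "\<dots> \<in> W" using k UV(5) by blast
  finally have "(\<gamma> k, \<rho> (\<gamma> k)) \<otimes>\<^bsub>GG\<^esub> ((g1, g2) \<otimes>\<^bsub>GG\<^esub> (n1, n2) \<otimes>\<^bsub>GG\<^esub> (\<one>\<^bsub>PSL2\<^esub>, ?d)) \<in> W" .
  moreover have "(n1, n2) \<in> NN" using k by (simp add: NN_def)
  moreover have "(\<one>\<^bsub>PSL2\<^esub>, ?d) \<in> MM" unfolding MM_def by (intro SigmaI singletonI CollectI exI[of _ \<theta>]) simp
  ultimately show ?thesis using gG[of k] by (intro bexI)
qed

lemma orbit_dense_in:
  assumes x: "generic \<Gamma> x" and g: "g \<in> carrier GG" "GP_point (g <#\<^bsub>GG\<^esub> PP) = (Some x, f (Some x))"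
  shows "dense_in (subtopology (GG_quotient \<Gamma> \<rho>) (E_space \<Gamma> \<rho> f)) (NM_orbit \<Gamma> \<rho> g)"
proof -
  interpret GG: group GG by (rule group_GG)
  let ?L = "Gamma_graph \<Gamma> \<rho>" and ?E = "E_space \<Gamma> \<rho> f"
  note L = subgroup_Gamma_graph
  have disj: "disjoint (rcosets\<^bsub>GG\<^esub> ?L)" using GG.rcos_disjoint[OF L] by (simp add: disjoint_def pairwise_def disjnt_def)
  have op: "openin (GG_quotient \<Gamma> \<rho>) U \<longleftrightarrow> U \<subseteq> rcosets\<^bsub>GG\<^esub> ?L \<and> openin GG_top (\<Union>U)" for U
    unfolding GG_quotient_def by (rule openin_quotient_topology[OF disj])
  have "openin (GG_quotient \<Gamma> \<rho>) (rcosets\<^bsub>GG\<^esub> ?L)"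
    unfolding op GG.rcosets_part_G[OF L] topspace_GG_top[symmetric] by simp
  then have "rcosets\<^bsub>GG\<^esub> ?L \<subseteq> topspace (GG_quotient \<Gamma> \<rho>)" by (rule openin_subset)
  moreover have "?E \<subseteq> rcosets\<^bsub>GG\<^esub> ?L" unfolding E_space_def RCOSETS_def by blast
  ultimately have top: "topspace (subtopology (GG_quotient \<Gamma> \<rho>) ?E) = ?E" by (auto simp: topspace_subtopology)
  have sub: "NM_orbit \<Gamma> \<rho> g \<subseteq> ?E"
  proof
    fix C assume "C \<in> NM_orbit \<Gamma> \<rho> g"
    then obtain n m where C: "C = ?L #>\<^bsub>GG\<^esub> (g \<otimes>\<^bsub>GG\<^esub> n \<otimes>\<^bsub>GG\<^esub> m)" "n \<in> NN" "m \<in> MM" unfolding NM_orbit_def by blast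
    have "GP_point (g \<otimes>\<^bsub>GG\<^esub> n \<otimes>\<^bsub>GG\<^esub> m <#\<^bsub>GG\<^esub> PP) \<in> Lambda_graph f"
      unfolding NM_in(2)[OF g(1) C(2,3)] g(2) Lambda_graph_def by simp
    then show "C \<in> ?E" unfolding C(1) E_space_def using NM_in(1)[OF g(1) C(2,3)] by blast
  qed
  have "?E \<subseteq> subtopology (GG_quotient \<Gamma> \<rho>) ?E closure_of NM_orbit \<Gamma> \<rho> g"
  proof
    fix C assume CE: "C \<in> ?E"
    then obtain h where h: "C = ?L #>\<^bsub>GG\<^esub> h" "h \<in> carrier GG" "GP_point (h <#\<^bsub>GG\<^esub> PP) \<in> Lambda_graph f" unfolding E_space_def by blast
    show "C \<in> subtopology (GG_quotient \<Gamma> \<rho>) ?E closure_of NM_orbit \<Gamma> \<rho> g"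
      unfolding in_closure_of top
    proof (intro conjI allI impI CE)
      fix T assume T: "C \<in> T \<and> openin (subtopology (GG_quotient \<Gamma> \<rho>) ?E) T"
      then obtain V where V: "openin (GG_quotient \<Gamma> \<rho>) V" "T = V \<inter> ?E" unfolding openin_subtopology by blast
      have VL: "V \<subseteq> rcosets\<^bsub>GG\<^esub> ?L" "openin GG_top (\<Union>V)" using V(1) unfolding op by auto
      \<comment> \<open>The union of \<open>V\<close> is the open set of group elements over
        \<open>V\<close>, to which \<open>orbit_approximation\<close> applies.\<close>
      have hV: "h \<in> \<Union>V" using T V(2) h(1) GG.rcos_self[OF h(2) L] by blast
      obtain g1 g2 where g12: "g = (g1, g2)" "g1 \<in> carrier PSL2" "g2 \<in> carrier PSL2" using g(1) by (auto simp: carrier_GG)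
      obtain h1 h2 where h12: "h = (h1, h2)" "h1 \<in> carrier PSL2" "h2 \<in> carrier PSL2" using h(2) by (auto simp: carrier_GG)
      have gp: "act_bdry g1 None = Some x" "act_bdry g2 None = f (Some x)"
        using g(2) unfolding g12(1) GP_point_coset[OF g12(2,3)] by simp_all
      have hp: "act_bdry h2 None = f (act_bdry h1 None)"
        using h(3) unfolding h12(1) GP_point_coset[OF h12(2,3)] Lambda_graph_def by auto
      obtain \<gamma> n m where y: "\<gamma> \<in> \<Gamma>" "n \<in> NN" "m \<in> MM" "(\<gamma>, \<rho> \<gamma>) \<otimes>\<^bsub>GG\<^esub> (g \<otimes>\<^bsub>GG\<^esub> n \<otimes>\<^bsub>GG\<^esub> m) \<in> \<Union>V"
        using orbit_approximation[OF x g12(2,3) gp h12(2,3) hp VL(2)] hV unfolding g12(1) h12(1) by blast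
      let ?z = "g \<otimes>\<^bsub>GG\<^esub> n \<otimes>\<^bsub>GG\<^esub> m" and ?y = "(\<gamma>, \<rho> \<gamma>) \<otimes>\<^bsub>GG\<^esub> (g \<otimes>\<^bsub>GG\<^esub> n \<otimes>\<^bsub>GG\<^esub> m)"
      have z: "?z \<in> carrier GG" by (rule NM_in(1)[OF g(1) y(2,3)])
      have "(\<gamma>, \<rho> \<gamma>) \<in> ?L" using y(1) by (auto simp: Gamma_graph_def)
      then have yz: "?y \<in> ?L #>\<^bsub>GG\<^esub> ?z" by (auto simp: r_coset_def)
      have zo: "?L #>\<^bsub>GG\<^esub> ?z \<in> NM_orbit \<Gamma> \<rho> g" unfolding NM_orbit_def using y(2,3) by blast
      obtain D where D: "D \<in> V" "?y \<in> D" using y(4) by blast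
      have "?L #>\<^bsub>GG\<^esub> ?z \<in> rcosets\<^bsub>GG\<^esub> ?L" unfolding RCOSETS_def using z by blast
      then have "D = ?L #>\<^bsub>GG\<^esub> ?z" using disj D yz VL(1) unfolding disjoint_def by blast
      then have "?L #>\<^bsub>GG\<^esub> ?z \<in> T" using D(1) V(2) sub zo by blast
      then show "\<exists>y. y \<in> NM_orbit \<Gamma> \<rho> g \<and> y \<in> T" using zo by blast
    qed
  qed
  moreover have "subtopology (GG_quotient \<Gamma> \<rho>) ?E closure_of NM_orbit \<Gamma> \<rho> g \<subseteq> ?E"
    using closure_of_subset_topspace[of "subtopology (GG_quotient \<Gamma> \<rho>) ?E"] unfolding top .
  ultimately show ?thesis unfolding dense_in_def top using sub by blast
qed

end

theorem corollary1p10: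
  fixes \<Delta> :: "(complex \<times> real \<Rightarrow> complex \<times> real) set"
    and p :: "(complex \<times> real) set \<Rightarrow> complex"
    and S :: "(complex \<times> real) set set"
    and \<Gamma> :: "(real^2^2) set set"
    and \<phi> :: "complex set \<Rightarrow> (complex \<times> real) set"
    and F :: "complex \<Rightarrow> complex \<times> real"
    and \<rho> :: "(real^2^2) set \<Rightarrow> (complex^2^2) set"
    and f :: "real option \<Rightarrow> complex option"
  assumes "closed_hyperbolic_3_manifold \<Delta>"
    and "fibers_over_circle \<Delta> p S"
    and "torsion_free_uniform_lattice \<Gamma>"
    and "homeomorphic_map (H2_quotient \<Gamma>) (subtopology (H3_quotient \<Delta>) S) \<phi>"
    and "is_lift \<Gamma> \<Delta> \<phi> F"
    and "is_holonomy \<Gamma> \<Delta> F \<rho>"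
    and "is_Cannon_Thurston_map \<Gamma> \<rho> F f"
  shows "AE \<theta> in lebesgue_on {0..2 * pi}.
           let \<xi> = circle_to_bdry (cis \<theta>) in
             \<forall>g \<in> carrier GG. GP_point (g <#\<^bsub>GG\<^esub> PP) = (\<xi>, f \<xi>) \<longrightarrow>
               dense_in (subtopology (GG_quotient \<Gamma> \<rho>) (E_space \<Gamma> \<rho> f)) (NM_orbit \<Gamma> \<rho> g)"
proof -
  interpret ct_setting \<Delta> \<Gamma> p S \<phi> F \<rho> f
    by unfold_locales (rule assms)+
  show ?thesis
    by (rule AE_mp[OF AE_generic], rule AE_I2) (auto simp: Let_def intro: orbit_dense_in)
qed

end
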